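(* Let $G$ be a Fuchsian group of the first kind and let $\rho: G\to \mathrm{GL}_m(\mathbb{C})$ be a representation such that, for each parabolic element $\gamma\in G$, all eigenvalues of $\rho(\gamma)$ are unitary (i.e. have modulus one). Let $\mathfrak{c}$ be any cusp of $G$. Then there exists a constant $\alpha$, depending on $G$ (and, by the order of quantification, possibly on $\rho$), with the following properties. (a) If $\mathbb{X}$ is a holomorphic vector-valued automorphic form of even integer weight $k$ with respect to $\rho$, then the sequence of Fourier coefficients of $\mathbb{X}$ at the cusp $\mathfrak{c}$ is $O(n^{k+2\alpha})$. (b) If $\mathbb{X}$ is a vector-valued cusp form of even integer weight $k$ with respect to $\rho$, then the sequence of Fourier coefficients of $\mathbb{X}$ at the cusp $\mathfrak{c}$ is $O(n^{k/2+\alpha})$. (c) If $\mathbb{X}$ is a holomorphic vector-valued automorphic form of even integer weight $k$ with respect to $\rho$ and $k+2\alpha<0$, then $\mathbb{X}\equiv 0$.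
   Context: $\mathbb{H}$ is the upper half plane, $\tau=x+iy$. A Fuchsian group is a discrete subgroup $G$ of $\mathrm{PSL}_2(\mathbb{R})$ such that $G\backslash\mathbb{H}$ is topologically a Riemann surface with finitely many punctures; it is of the first kind if a fundamental domain has finite hyperbolic area. An element is parabolic if its trace has absolute value $2$ and it is nontrivial; a cusp of $G$ is a point $\mathfrak{c}\in\mathbb{R}\cup\{\infty\}$ fixed by a nontrivial parabolic element of $G$. For $\gamma=\pm\begin{pmatrix}a&b\\c&d\end{pmatrix}$, $j(\gamma,\tau)=c\tau+d$, and for even $k$ and $\mathbb{X}:\mathbb{H}\to\mathbb{C}^m$ put $\mathbb{X}|_k\gamma(\tau)=j(\gamma,\tau)^{-k}\mathbb{X}(\gamma\tau)$. For a cusp $\mathfrak{c}\in\mathbb{R}$ let $A_{\mathfrak{c}}=\pm\begin{pmatrix}\mathfrak{c}&-1\\1&0\end{pmatrix}$, and let $A_\infty$ be the identity. The stabilizer $G_{\mathfrak{c}}$ is infinite cyclic, generated by $t_{\mathfrak{c}}=A_{\mathfrak{c}}\begin{pmatrix}1&h_{\mathfrak{c}}\\0&1\end{pmatrix}A_{\mathfrak{c}}^{-1}$ with $h_{\mathfrak{c}}>0$ (the cusp width). For an eigenvalue $\lambda$ of $\rho(t_{\mathfrak{c}})$, $\mu(\lambda)\in[0,1)$ is defined by $\lambda=\exp(2\pi i\mu(\lambda))$, and $m(\lambda)$ is its multiplicity. Write $\tilde q=\exp(2\pi i\tau/h_{\mathfrak{c}})$, $\log\tilde q=2\pi i\tau/h_{\mathfrak{c}}$,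 and $\tilde q^{s}=\exp(2\pi i s\tau/h_{\mathfrak c})$. A holomorphic function $\mathbb{X}:\mathbb{H}\to\mathbb{C}^m$ with $\mathbb{X}|_k\gamma=\rho(\gamma)\mathbb{X}$ for all $\gamma\in G$ is a holomorphic vector-valued automorphic form of weight $k$ with respect to $\rho$ if at every cusp $\mathfrak{c}$ of $G$ there is an expansion $$\mathbb{X}|_kA_{\mathfrak{c}}(\tau)=\sum_{\lambda}\sum_{j=0}^{m(\lambda)-1}(\log\tilde q)^j\,h_{\lambda,j}(\tau),\qquad h_{\lambda,j}(\tau)=\sum_{n=0}^\infty \mathbb{X}_{[\lambda,j,n]}\tilde q^{\,n+\mu(\lambda)},$$ where $\lambda$ runs over the distinct eigenvalues of $\rho(t_{\mathfrak{c}})$ and $\mathbb{X}_{[\lambda,j,n]}\in\mathbb{C}^m$. The vectors $\mathbb{X}_{[\lambda,j,n]}$ are the Fourier coefficients of $\mathbb{X}$ at $\mathfrak{c}$. It is a cusp form if moreover, at every cusp, all the series $h_{\lambda,j}(\tau)$ decay exponentially as $\mathrm{Im}\,\tau\to\infty$. If $\rho$ is admissible ($\rho(\gamma)$ diagonalizable for every parabolic $\gamma\in G$), only the $j=0$ terms occur; the holomorphy condition is equivalent to $\mathbb{X}|_kA_{\mathfrak{c}}$ being bounded in some half-plane $\{\mathrm{Im}\,\tau>Y\}$ for every cusp, and being a cusp form to $\mathbb{X}|_kA_{\mathfrak c}(\tau)\to0$ as $\mathrm{Im}\,\tau\to\infty$ for every cusp. In that case, writing $\rho(t_{\mathfrak{c}})=P\,\mathrm{diag}(\lambda_1,\dots,\lambda_m)P^{-1}$,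 the Fourier coefficients are the vectors $\mathbb{X}_{[n]}\in\mathbb{C}^m$ with $\mathbb{X}|_kA_{\mathfrak{c}}(\tau)=P\,\mathrm{diag}(\tilde q^{\mu(\lambda_1)},\dots,\tilde q^{\mu(\lambda_m)})P^{-1}\sum_{n\ge0}\mathbb{X}_{[n]}\tilde q^n$. (For cusp forms one may equivalently use $0<\mu\le1$.) The statement that the Fourier coefficients are $O(n^{s})$ means that the norms of $\mathbb{X}_{[\lambda,j,n]}$ for every $\lambda,j$ (resp. of $\mathbb{X}_{[n]}$) are $O(n^s)$ as $n\to\infty$, with implied constant allowed to depend on $\mathbb{X}$. *)

theory Defs
  imports "HOL-Complex_Analysis.Complex_Analysis" "HOL-Algebra.Generated_Groups"
    "HOL-Library.Landau_Symbols"
begin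

section \<open>The group \<open>PSL\<^sub>2(\<real>)\<close> and its actions\<close>

definition mat2 :: "real \<Rightarrow> real \<Rightarrow> real \<Rightarrow> real \<Rightarrow> real^2^2" where
  "mat2 a b c d = vector [vector [a, b], vector [c, d]]"

definition SL2R :: "(real^2^2) monoid" where
  "SL2R = \<lparr>carrier = {A. det A = 1}, mult = (**), one = mat 1\<rparr>"

text \<open>Elements of \<open>PSL2R\<close> are cosets, i.e. two-element sets of matrices \<open>{A, -A}\<close>.\<close>

definition PSL2R :: "(real^2^2) set monoid" where
  "PSL2R = SL2R Mod {mat 1, - mat 1}"

definition psl :: "real^2^2 \<Rightarrow> (real^2^2) set" where
  "psl A = {mat 1, - mat 1} #>\<^bsub>SL2R\<^esub> A"

definition upper_half_plane :: "complex set" where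
  "upper_half_plane = {\<tau>. Im \<tau> > 0}"

definition automorphy :: "real^2^2 \<Rightarrow> complex \<Rightarrow> complex" where
  "automorphy A \<tau> = of_real (A$2$1) * \<tau> + of_real (A$2$2)"

definition mobius :: "real^2^2 \<Rightarrow> complex \<Rightarrow> complex" where
  "mobius A \<tau> = (of_real (A$1$1) * \<tau> + of_real (A$1$2)) / automorphy A \<tau>"

datatype boundary_point = Infty | Fin real

fun mobius_boundary :: "real^2^2 \<Rightarrow> boundary_point \<Rightarrow> boundary_point" where
  "mobius_boundary A Infty = (if A$2$1 = 0 then Infty else Fin (A$1$1 / A$2$1))"
| "mobius_boundary A (Fin x) =
     (if A$2$1 * x + A$2$2 = 0 then Infty
      else Fin ((A$1$1 * x + A$1$2) / (A$2$1 * x + A$2$2)))"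


section \<open>Fuchsian groups of the first kind\<close>

definition quotient_topology :: "'a topology \<Rightarrow> ('a \<Rightarrow> 'b) \<Rightarrow> 'b topology" where
  "quotient_topology X f =
     topology (\<lambda>U. U \<subseteq> f ` topspace X \<and> openin X {x \<in> topspace X. f x \<in> U})"

lemma openin_quotient_topology:
  "openin (quotient_topology X f) U \<longleftrightarrow>
     U \<subseteq> f ` topspace X \<and> openin X {x \<in> topspace X. f x \<in> U}"
proof -
  have "istopology (\<lambda>U. U \<subseteq> f ` topspace X \<and> openin X {x \<in> topspace X. f x \<in> U})"
    unfolding istopology_def
  proof (intro conjI allI impI)
    fix S T
    assume "S \<subseteq> f ` topspace X \<and> openin X {x \<in> topspace X. f x \<in> S}"
      and "T \<subseteq> f ` topspace X \<and> openin X {x \<in> topspace X. f x \<in> T}"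
    moreover have "{x \<in> topspace X. f x \<in> S \<inter> T} =
        {x \<in> topspace X. f x \<in> S} \<inter> {x \<in> topspace X. f x \<in> T}" by auto
    ultimately show "S \<inter> T \<subseteq> f ` topspace X" "openin X {x \<in> topspace X. f x \<in> S \<inter> T}"
      by auto
  next
    fix \<K>
    assume *: "\<forall>K\<in>\<K>. K \<subseteq> f ` topspace X \<and> openin X {x \<in> topspace X. f x \<in> K}"
    have "{x \<in> topspace X. f x \<in> \<Union>\<K>} = (\<Union>K\<in>\<K>. {x \<in> topspace X. f x \<in> K})" by auto
    then show "openin X {x \<in> topspace X. f x \<in> \<Union>\<K>}" using * by auto
    show "\<Union>\<K> \<subseteq> f ` topspace X" using * by auto
  qed
  then show ?thesis
    by (simp add: quotient_topology_def topology_inverse')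
qed

lemma quotient_map_quotient_topology: "quotient_map X (quotient_topology X f) f"
proof -
  have "topspace (quotient_topology X f) \<subseteq> f ` topspace X"
    using openin_topspace[of "quotient_topology X f"] openin_quotient_topology by metis
  moreover have "{x \<in> topspace X. f x \<in> f ` topspace X} = topspace X" by auto
  then have "openin (quotient_topology X f) (f ` topspace X)"
    by (simp add: openin_quotient_topology)
  then have "f ` topspace X \<subseteq> topspace (quotient_topology X f)"
    by (rule openin_subset)
  ultimately have eq: "f ` topspace X = topspace (quotient_topology X f)" by auto
  show ?thesis
    unfolding quotient_map_def using eq by (auto simp: openin_quotient_topology)
qed

definition PSL2R_topology :: "(real^2^2) set topology" where
  "PSL2R_topology = quotient_topology (top_of_set (carrier SL2R)) psl"

definition discrete_subgroup_PSL2R :: "(real^2^2) set set \<Rightarrow> bool" where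
  "discrete_subgroup_PSL2R G \<longleftrightarrow>
     subgroup G PSL2R \<and> subtopology PSL2R_topology G = discrete_topology G"

definition orbit :: "(real^2^2) set set \<Rightarrow> complex \<Rightarrow> complex set" where
  "orbit G \<tau> = {mobius A \<tau> | A. \<exists>\<gamma>\<in>G. A \<in> \<gamma>}"

definition orbit_space :: "(real^2^2) set set \<Rightarrow> complex set topology" where
  "orbit_space G = quotient_topology (top_of_set upper_half_plane) (orbit G)"

text \<open>A Riemann surface with a holomorphic atlas \<open>\<A>\<close>, given as a set of pairs
  of a coordinate domain and a chart.\<close>

definition riemann_surface :: "'a topology \<Rightarrow> ('a set \<times> ('a \<Rightarrow> complex)) set \<Rightarrow> bool" where
  "riemann_surface X \<A> \<longleftrightarrow>
     topspace X \<noteq> {} \<and> connected_space X \<and> Hausdorff_space X \<and>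
     (\<Union>(U,\<phi>)\<in>\<A>. U) = topspace X \<and>
     (\<forall>(U,\<phi>)\<in>\<A>. openin X U \<and> open (\<phi> ` U) \<and>
        homeomorphic_map (subtopology X U) (top_of_set (\<phi> ` U)) \<phi>) \<and>
     (\<forall>(U,\<phi>)\<in>\<A>. \<forall>(V,\<psi>)\<in>\<A>. (\<psi> \<circ> inv_into U \<phi>) holomorphic_on (\<phi> ` (U \<inter> V)))"

text \<open>Being topologically a Riemann surface with finitely many punctures means being
  homeomorphic to a compact Riemann surface minus a finite set. The compact surface is
  sought on the type \<^typ>\<open>complex set\<close>, which is large enough to carry a copy
  of every Riemann surface, since these have the cardinality of the continuum.\<close>

definition finitely_punctured_surface :: "'a topology \<Rightarrow> bool" where
  "finitely_punctured_surface X \<longleftrightarrow>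
     (\<exists>(K :: complex set topology) \<A> P.
        riemann_surface K \<A> \<and> compact_space K \<and> finite P \<and> P \<subseteq> topspace K \<and>
        X homeomorphic_space subtopology K (topspace K - P))"

definition fuchsian_group :: "(real^2^2) set set \<Rightarrow> bool" where
  "fuchsian_group G \<longleftrightarrow>
     discrete_subgroup_PSL2R G \<and> finitely_punctured_surface (orbit_space G)"

text \<open>A fundamental domain is a closed region (the closure in the upper half plane of its
  interior) whose translates cover the upper half plane without overlapping
  interiors. Requiring the closed region to be covering ensures that finiteness of its
  area is the usual finite covolume condition, without regularity assumptions on its boundary.\<close>

definition fundamental_domain :: "(real^2^2) set set \<Rightarrow> complex set \<Rightarrow> bool" where
  "fundamental_domain G F \<longleftrightarrow>
     F \<subseteq> upper_half_plane \<and> F = upper_half_plane \<inter> closure (interior F) \<and>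
     (\<Union>\<gamma>\<in>G. \<Union>A\<in>\<gamma>. mobius A ` F) = upper_half_plane \<and>
     (\<forall>\<gamma>\<in>G. \<gamma> \<noteq> \<one>\<^bsub>PSL2R\<^esub> \<longrightarrow> (\<forall>A\<in>\<gamma>. interior F \<inter> mobius A ` interior F = {}))"

definition hyperbolic_area :: "complex set \<Rightarrow> ennreal" where
  "hyperbolic_area F = (\<integral>\<^sup>+ \<tau>\<in>F. ennreal (1 / (Im \<tau>)\<^sup>2) \<partial>lborel)"

definition fuchsian_first_kind :: "(real^2^2) set set \<Rightarrow> bool" where
  "fuchsian_first_kind G \<longleftrightarrow>
     fuchsian_group G \<and> (\<exists>F. fundamental_domain G F \<and> hyperbolic_area F < \<infinity>)"


section \<open>Cusps\<close>

definition parabolic :: "(real^2^2) set \<Rightarrow> bool" where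
  "parabolic \<gamma> \<longleftrightarrow> \<gamma> \<in> carrier PSL2R \<and> \<gamma> \<noteq> \<one>\<^bsub>PSL2R\<^esub> \<and> (\<forall>A\<in>\<gamma>. \<bar>trace A\<bar> = 2)"

definition boundary_stabilizer ::
    "(real^2^2) set set \<Rightarrow> boundary_point \<Rightarrow> (real^2^2) set set" where
  "boundary_stabilizer G c = {\<gamma>\<in>G. \<forall>A\<in>\<gamma>. mobius_boundary A c = c}"

definition is_cusp :: "(real^2^2) set set \<Rightarrow> boundary_point \<Rightarrow> bool" where
  "is_cusp G c \<longleftrightarrow> (\<exists>\<gamma>\<in>boundary_stabilizer G c. parabolic \<gamma>)"

fun cusp_matrix :: "boundary_point \<Rightarrow> real^2^2" where
  "cusp_matrix Infty = mat 1"
| "cusp_matrix (Fin x) = mat2 x (-1) 1 0"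

definition cusp_translation :: "boundary_point \<Rightarrow> real \<Rightarrow> (real^2^2) set" where
  "cusp_translation c h =
     psl (cusp_matrix c ** mat2 1 h 0 1 ** matrix_inv (cusp_matrix c))"

definition cusp_width :: "(real^2^2) set set \<Rightarrow> boundary_point \<Rightarrow> real" where
  "cusp_width G c =
     (THE h. h > 0 \<and> boundary_stabilizer G c = generate PSL2R {cusp_translation c h})"

definition cusp_generator :: "(real^2^2) set set \<Rightarrow> boundary_point \<Rightarrow> (real^2^2) set" where
  "cusp_generator G c = cusp_translation c (cusp_width G c)"


section \<open>Representations and eigenvalues\<close>

definition GL_complex :: "(complex^'m^'m) monoid" where
  "GL_complex = \<lparr>carrier = {A. invertible A}, mult = (**), one = mat 1\<rparr>"

definition group_representation ::
    "(real^2^2) set set \<Rightarrow> ((real^2^2) set \<Rightarrow> complex^'m^'m) \<Rightarrow> bool" where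
  "group_representation G \<rho> \<longleftrightarrow> \<rho> \<in> hom (PSL2R\<lparr>carrier := G\<rparr>) GL_complex"

definition eigenvalue :: "complex^'m^'m \<Rightarrow> complex \<Rightarrow> bool" where
  "eigenvalue A l \<longleftrightarrow> (\<exists>v. v \<noteq> 0 \<and> A *v v = l *s v)"

definition charpoly :: "complex^'m^'m \<Rightarrow> complex poly" where
  "charpoly A = det (\<chi> i j. (if i = j then [:0, 1:] else 0) - [:A$i$j:])"

definition eigenvalue_multiplicity :: "complex^'m^'m \<Rightarrow> complex \<Rightarrow> nat" where
  "eigenvalue_multiplicity A l = Polynomial.order l (charpoly A)"

definition eigenvalue_exponent :: "complex \<Rightarrow> real" where
  "eigenvalue_exponent l =
     (THE \<mu>. 0 \<le> \<mu> \<and> \<mu> < 1 \<and> l = exp (2 * of_real pi * \<i> * of_real \<mu>))"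

definition diag_matrix :: "('m \<Rightarrow> complex) \<Rightarrow> complex^'m^'m" where
  "diag_matrix l = (\<chi> i j. if i = j then l i else 0)"

definition diagonalized_by :: "complex^'m^'m \<Rightarrow> complex^'m^'m \<Rightarrow> ('m \<Rightarrow> complex) \<Rightarrow> bool" where
  "diagonalized_by A P l \<longleftrightarrow> invertible P \<and> A = P ** diag_matrix l ** matrix_inv P"

definition admissible ::
    "(real^2^2) set set \<Rightarrow> ((real^2^2) set \<Rightarrow> complex^'m^'m) \<Rightarrow> bool" where
  "admissible G \<rho> \<longleftrightarrow> (\<forall>\<gamma>\<in>G. parabolic \<gamma> \<longrightarrow> (\<exists>P l. diagonalized_by (\<rho> \<gamma>) P l))"


section \<open>Vector-valued automorphic forms\<close>

text \<open>For even \<open>k\<close> the value of \<open>slash\<close> does not change when \<open>A\<close> is replaced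
  by \<open>-A\<close>.\<close>

definition slash ::
    "int \<Rightarrow> real^2^2 \<Rightarrow> (complex \<Rightarrow> complex^'m) \<Rightarrow> complex \<Rightarrow> complex^'m" where
  "slash k A X \<tau> = automorphy A \<tau> powi (-k) *s X (mobius A \<tau>)"

text \<open>The functions \<open>log q\<close> and \<open>q\<^sup>s\<close> for the local parameter
  \<open>q = exp (2\<pi>i\<tau>/h)\<close>.\<close>

definition log_q :: "real \<Rightarrow> complex \<Rightarrow> complex" where
  "log_q h \<tau> = 2 * of_real pi * \<i> * \<tau> / of_real h"

definition q_power :: "real \<Rightarrow> real \<Rightarrow> complex \<Rightarrow> complex" where
  "q_power h s \<tau> = exp (2 * of_real pi * \<i> * of_real s * \<tau> / of_real h)"

definition q_series :: "real \<Rightarrow> real \<Rightarrow> (nat \<Rightarrow> complex^'m) \<Rightarrow> complex \<Rightarrow> complex^'m" where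
  "q_series h \<mu> a \<tau> = (\<Sum>n. q_power h (real n + \<mu>) \<tau> *s a n)"

text \<open>\<open>C l j n\<close> is the Fourier coefficient with index \<open>[l, j, n]\<close>; it is meaningful only for
  eigenvalues \<open>l\<close> of the image of the cusp generator and \<open>j\<close> below the multiplicity of \<open>l\<close>.\<close>

definition fourier_expansion ::
    "(real^2^2) set set \<Rightarrow> ((real^2^2) set \<Rightarrow> complex^'m^'m) \<Rightarrow> int \<Rightarrow> boundary_point \<Rightarrow>
     (complex \<Rightarrow> complex^'m) \<Rightarrow> (complex \<Rightarrow> nat \<Rightarrow> nat \<Rightarrow> complex^'m) \<Rightarrow> bool" where
  "fourier_expansion G \<rho> k c X C \<longleftrightarrow>
     (let h = cusp_width G c; T = \<rho> (cusp_generator G c) in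
      \<forall>\<tau>\<in>upper_half_plane.
        (\<forall>l j. eigenvalue T l \<and> j < eigenvalue_multiplicity T l \<longrightarrow>
           summable (\<lambda>n. q_power h (real n + eigenvalue_exponent l) \<tau> *s C l j n)) \<and>
        slash k (cusp_matrix c) X \<tau> =
          (\<Sum>l | eigenvalue T l. \<Sum>j<eigenvalue_multiplicity T l.
             log_q h \<tau> ^ j *s q_series h (eigenvalue_exponent l) (C l j) \<tau>))"

definition exponential_decay :: "(complex \<Rightarrow> complex^'m) \<Rightarrow> bool" where
  "exponential_decay f \<longleftrightarrow>
     (\<exists>\<epsilon>>0. \<exists>K Y. \<forall>\<tau>. Im \<tau> > Y \<longrightarrow> norm (f \<tau>) \<le> K * exp (- \<epsilon> * Im \<tau>))"

definition cuspidal_expansion ::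
    "(real^2^2) set set \<Rightarrow> ((real^2^2) set \<Rightarrow> complex^'m^'m) \<Rightarrow> boundary_point \<Rightarrow>
     (complex \<Rightarrow> nat \<Rightarrow> nat \<Rightarrow> complex^'m) \<Rightarrow> bool" where
  "cuspidal_expansion G \<rho> c C \<longleftrightarrow>
     (let h = cusp_width G c; T = \<rho> (cusp_generator G c) in
      \<forall>l j. eigenvalue T l \<and> j < eigenvalue_multiplicity T l \<longrightarrow>
        exponential_decay (q_series h (eigenvalue_exponent l) (C l j)))"

definition weakly_automorphic ::
    "(real^2^2) set set \<Rightarrow> ((real^2^2) set \<Rightarrow> complex^'m^'m) \<Rightarrow> int \<Rightarrow>
     (complex \<Rightarrow> complex^'m) \<Rightarrow> bool" where
  "weakly_automorphic G \<rho> k X \<longleftrightarrow>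
     (\<forall>i. (\<lambda>\<tau>. X \<tau> $ i) holomorphic_on upper_half_plane) \<and>
     (\<forall>\<gamma>\<in>G. \<forall>A\<in>\<gamma>. \<forall>\<tau>\<in>upper_half_plane. slash k A X \<tau> = \<rho> \<gamma> *v X \<tau>)"

definition automorphic_form ::
    "(real^2^2) set set \<Rightarrow> ((real^2^2) set \<Rightarrow> complex^'m^'m) \<Rightarrow> int \<Rightarrow>
     (complex \<Rightarrow> complex^'m) \<Rightarrow> bool" where
  "automorphic_form G \<rho> k X \<longleftrightarrow>
     weakly_automorphic G \<rho> k X \<and>
     (\<forall>c. is_cusp G c \<longrightarrow> (\<exists>C. fourier_expansion G \<rho> k c X C))"

definition cusp_form ::
    "(real^2^2) set set \<Rightarrow> ((real^2^2) set \<Rightarrow> complex^'m^'m) \<Rightarrow> int \<Rightarrow>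
     (complex \<Rightarrow> complex^'m) \<Rightarrow> bool" where
  "cusp_form G \<rho> k X \<longleftrightarrow>
     automorphic_form G \<rho> k X \<and>
     (\<forall>c. is_cusp G c \<longrightarrow>
        (\<exists>C. fourier_expansion G \<rho> k c X C \<and> cuspidal_expansion G \<rho> c C))"

text \<open>For admissible \<open>\<rho>\<close> there is a second normalisation of the Fourier coefficients,
  indexed by \<open>n\<close> only: \<open>D n\<close> is the coefficient \<open>X\<^bsub>[n]\<^esub>\<close> with respect to a given diagonalization.\<close>

definition admissible_fourier_expansion ::
    "(real^2^2) set set \<Rightarrow> ((real^2^2) set \<Rightarrow> complex^'m^'m) \<Rightarrow> int \<Rightarrow> boundary_point \<Rightarrow>
     (complex \<Rightarrow> complex^'m) \<Rightarrow> complex^'m^'m \<Rightarrow> ('m \<Rightarrow> complex) \<Rightarrow> (nat \<Rightarrow> complex^'m) \<Rightarrow> bool" where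
  "admissible_fourier_expansion G \<rho> k c X P l D \<longleftrightarrow>
     diagonalized_by (\<rho> (cusp_generator G c)) P l \<and>
     (let h = cusp_width G c in
      \<forall>\<tau>\<in>upper_half_plane.
        summable (\<lambda>n. q_power h (real n) \<tau> *s D n) \<and>
        slash k (cusp_matrix c) X \<tau> =
          (P ** diag_matrix (\<lambda>i. q_power h (eigenvalue_exponent (l i)) \<tau>) ** matrix_inv P)
            *v q_series h 0 D \<tau>)"

text \<open>Quantifying over all expansions is harmless, as the relevant coefficients are uniquely determined
  by \<open>X\<close>.\<close>

definition fourier_coefficients_bigo ::
    "(real^2^2) set set \<Rightarrow> ((real^2^2) set \<Rightarrow> complex^'m^'m) \<Rightarrow> int \<Rightarrow> boundary_point \<Rightarrow>
     (complex \<Rightarrow> complex^'m) \<Rightarrow> real \<Rightarrow> bool" where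
  "fourier_coefficients_bigo G \<rho> k c X s \<longleftrightarrow>
     (\<forall>C. fourier_expansion G \<rho> k c X C \<longrightarrow>
        (let T = \<rho> (cusp_generator G c) in
         \<forall>l j. eigenvalue T l \<and> j < eigenvalue_multiplicity T l \<longrightarrow>
           (\<lambda>n. norm (C l j n)) \<in> O(\<lambda>n. real n powr s))) \<and>
     (admissible G \<rho> \<longrightarrow>
        (\<forall>P l D. admissible_fourier_expansion G \<rho> k c X P l D \<longrightarrow>
           (\<lambda>n. norm (D n)) \<in> O(\<lambda>n. real n powr s)))"

end

theory Submission
  imports Defs "HOL-Computational_Algebra.Fundamental_Theorem_Algebra"
begin

text \<open>Points of the upper half plane are written as \<open>g i\<close> with \<open>g \<in> SL\<^sub>2(\<real>)\<close>. By the Margulis lemma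
  and finiteness of the area, \<open>SL\<^sub>2(\<real>)\<close> is covered by the translates of a compact set and of finitely
  many cusp sectors. Since the eigenvalues of parabolic elements are unitary, the powers of
  \<open>\<rho>(t\<^sub>c)\<close> grow polynomially, so \<open>\<complex>\<^sup>m\<close> carries, over each cusp sector, a norm depending on the height
  that is at most polynomially larger than the fixed norm and changes only by a bounded factor under moves
  of bounded hyperbolic length, compatibly with \<open>\<rho>\<close>. Going down from height \<open>1\<close> to height \<open>y\<close> takes
  about \<open>log (1/y)\<close> such moves, whence \<open>\<parallel>v\<parallel>\<close> is at most \<open>O(y\<^sup>-\<^sup>\<beta>)\<close> times the adapted norm of
  \<open>\<rho>(\<gamma>) v\<close> when \<open>\<gamma>\<close> moves the point into the fundamental set. Applied to \<open>v = X(\<tau>)\<close>, together with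
  the Fourier expansions at the cusps of the fundamental set, this bounds \<open>X\<close> slashed to any cusp by a power of \<open>1/y\<close> as
  \<open>y \<rightarrow> 0\<close>. The terms belonging to the different powers of \<open>log q\<close> and different eigenvalues inherit
  the bound, and Cauchy's estimate with \<open>y = 1/n\<close> bounds the coefficients; if the power is
  negative, \<open>y \<rightarrow> 0\<close> shows that they vanish.\<close>

section \<open>Matrices of determinant one and the upper half plane\<close>

no_notation fps_nth (infixl "$" 75)

text \<open>Distances are read off matrix norms: \<open>(norm (adj2 g ** h))\<^sup>2\<close> is 2
  cosh of the hyperbolic distance of \<open>g i\<close> and \<open>h i\<close>, so geometry becomes
  submultiplicativity. The fundamental domain comes without regularity of its boundary, so cusps
  cannot be read off its sides; they arise from the thin part, where small elements commute, and the
  area enters through a packing count. The obstacle to the growth estimate is horizontal drift: two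
  points at height y in a cusp sector at bounded distance may differ by about y translations, and
  then powers of the cusp generator can cost a factor y^M in the fixed norm. Damping the n-th
  translate by (1 + |n|/y)^M removes this dependence on y. The final constant is \<alpha> = \<beta>
  + M + L, where 2^\<beta> is the cost of halving the height, M the exponent of growth of the
  powers, and L bounds the multiplicities, hence the powers of the logarithm. For automorphic forms
  the exponent obtained is k/2 + \<beta> + max 0 (k/2 + M + L); a form for which it is negative
  vanishes, and otherwise it is at most k + 2\<alpha>.\<close>

lemma mat2_nth [simp]:
  "mat2 a b c d $ 1 $ 1 = a" "mat2 a b c d $ 1 $ 2 = b"
  "mat2 a b c d $ 2 $ 1 = c" "mat2 a b c d $ 2 $ 2 = d"
  by (simp_all add: mat2_def)

lemma mat_nth_2 [simp]:
  "(mat k :: 'a::zero^2^2) $ 1 $ 1 = k" "(mat k :: 'a::zero^2^2) $ 1 $ 2 = 0"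
  "(mat k :: 'a::zero^2^2) $ 2 $ 1 = 0" "(mat k :: 'a::zero^2^2) $ 2 $ 2 = k"
  by (simp_all add: mat_def)

lemma matrix_eq_2: "A = B \<longleftrightarrow> A$1$1 = B$1$1 \<and> A$1$2 = B$1$2 \<and> A$2$1 = B$2$1 \<and> A$2$2 = B$2$2"
  for A B :: "'a^2^2"
  by (simp only: vec_eq_iff forall_2 conj_assoc)

lemma matrix_mult_nth_2: "(A ** B) $ i $ j = A$i$1 * B$1$j + A$i$2 * B$2$j"
  for A B :: "'a::semiring_1^2^2"
  by (simp add: matrix_matrix_mult_def sum_2)

lemma norm_matrix_2: "(norm A)\<^sup>2 = (A$1$1)\<^sup>2 + (A$1$2)\<^sup>2 + (A$2$1)\<^sup>2 + (A$2$2)\<^sup>2"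
  for A :: "real^2^2"
  by (simp add: norm_vec_def L2_set_def sum_2 real_norm_def)

lemma norm_matrix_2_le:
  fixes A :: "real^2^2"
  shows "(A$1$1)\<^sup>2 + (A$1$2)\<^sup>2 + (A$2$1)\<^sup>2 + (A$2$2)\<^sup>2 \<le> r\<^sup>2 \<Longrightarrow> 0 \<le> r \<Longrightarrow> norm A \<le> r"
  by (metis norm_matrix_2 power2_le_imp_le)

lemma entry_le_norm: "\<bar>A $ i $ j\<bar> \<le> norm A" for A :: "real^2^2"
  by (metis Finite_Cartesian_Product.norm_nth_le order_trans real_norm_def)

text \<open>The norm on \<open>real^2^2\<close> is the Frobenius norm; submultiplicativity is
  Cauchy-Schwarz for each entry, with Lagrange's square \<open>(a*z - b*x)\<^sup>2\<close> as the
  defect.\<close>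

lemma norm_matrix_mult_le: "norm (A ** B) \<le> norm A * norm B" for A B :: "real^2^2"
proof (rule power2_le_imp_le)
  have cs: "(a*x + b*z)\<^sup>2 \<le> (a\<^sup>2 + b\<^sup>2) * (x\<^sup>2 + z\<^sup>2)" for a b x z :: real
    using zero_le_power2[of "a*z - b*x"] by (simp add: power2_eq_square algebra_simps)
  show "(norm (A ** B))\<^sup>2 \<le> (norm A * norm B)\<^sup>2"
    unfolding power_mult_distrib norm_matrix_2 matrix_mult_nth_2
    using cs[of "A$1$1" "B$1$1" "A$1$2" "B$2$1"] cs[of "A$1$1" "B$1$2" "A$1$2" "B$2$2"]
      cs[of "A$2$1" "B$1$1" "A$2$2" "B$2$1"] cs[of "A$2$1" "B$1$2" "A$2$2" "B$2$2"]
    by (simp add: algebra_simps)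
qed simp

lemma norm_mult_le3: "norm (A ** B ** C) \<le> norm A * norm B * norm C" for A B C :: "real^2^2"
  by (meson mult_right_mono norm_ge_zero norm_matrix_mult_le order_trans)

text \<open>The adjugate, which is the inverse on \<open>SL2\<close>. Being linear in the entries it
  keeps all identities polynomial, and it preserves the norm.\<close>

definition adj2 :: "real^2^2 \<Rightarrow> real^2^2" where
  "adj2 A = mat2 (A$2$2) (- A$1$2) (- A$2$1) (A$1$1)"

lemma adj2_nth [simp]:
  "adj2 A $ 1 $ 1 = A$2$2" "adj2 A $ 1 $ 2 = - A$1$2" "adj2 A $ 2 $ 1 = - A$2$1" "adj2 A $ 2 $ 2 = A$1$1"
  by (simp_all add: adj2_def)

definition SL2 :: "(real^2^2) set" where "SL2 = {A. det A = 1}"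

lemma SL2_iff: "A \<in> SL2 \<longleftrightarrow> A$1$1 * A$2$2 - A$1$2 * A$2$1 = 1"
  by (simp add: SL2_def det_2)

lemma adj2_mult: "A \<in> SL2 \<Longrightarrow> adj2 A ** A = mat 1" "A \<in> SL2 \<Longrightarrow> A ** adj2 A = mat 1"
  by (simp_all add: matrix_eq_2 matrix_mult_nth_2 SL2_iff algebra_simps)

lemma adj2_mult_cancel [simp]:
  "A \<in> SL2 \<Longrightarrow> adj2 A ** (A ** B) = B" "A \<in> SL2 \<Longrightarrow> A ** (adj2 A ** B) = B"
  by (simp_all add: matrix_mul_assoc adj2_mult)

lemma SL2_mult [intro, simp]: "A \<in> SL2 \<Longrightarrow> B \<in> SL2 \<Longrightarrow> A ** B \<in> SL2"
  by (simp add: SL2_def det_mul)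

lemma SL2_one [intro, simp]: "mat 1 \<in> SL2"
  by (simp add: SL2_def)

lemma SL2_uminus [simp]: "- A \<in> SL2 \<longleftrightarrow> A \<in> SL2"
  by (simp add: SL2_iff)

lemma SL2_adj2 [simp]: "adj2 A \<in> SL2 \<longleftrightarrow> A \<in> SL2"
  by (auto simp add: SL2_iff algebra_simps)

lemma adj2_adj2 [simp]: "adj2 (adj2 A) = A"
  by (simp add: matrix_eq_2)

lemma adj2_mult_distrib: "adj2 (A ** B) = adj2 B ** adj2 A"
  by (simp add: matrix_eq_2 matrix_mult_nth_2 algebra_simps)

lemma adj2_uminus [simp]: "adj2 (- A) = - adj2 A"
  by (simp add: matrix_eq_2)

lemma adj2_one [simp]: "adj2 (mat 1) = mat 1"
  by (simp add: matrix_eq_2)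

lemma norm_adj2 [simp]: "norm (adj2 A) = norm A"
proof -
  have "(norm (adj2 A))\<^sup>2 = (norm A)\<^sup>2" by (simp add: norm_matrix_2)
  then show ?thesis by simp
qed

lemma matrix_inv_SL2: "A \<in> SL2 \<Longrightarrow> matrix_inv A = adj2 A"
proof -
  assume A: "A \<in> SL2"
  then have "invertible A" unfolding invertible_def using adj2_mult by blast
  then have "matrix_inv A ** A = mat 1"
    unfolding matrix_inv_def invertible_def by (rule someI2_ex) auto
  then have "matrix_inv A ** (A ** adj2 A) = adj2 A" by (simp add: matrix_mul_assoc)
  then show ?thesis using A by (simp add: adj2_mult)
qed

lemma norm_SL2_ge: assumes "A \<in> SL2" shows "(norm A)\<^sup>2 \<ge> 2"
proof -
  have "A$1$1 * A$2$2 - A$1$2 * A$2$1 = 1" using assms by (simp add: SL2_iff)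
  moreover have "(A$1$1 - A$2$2)\<^sup>2 + (A$1$2 + A$2$1)\<^sup>2 \<ge> 0" by simp
  ultimately show ?thesis unfolding norm_matrix_2 by (simp add: power2_eq_square algebra_simps)
qed

lemma norm_mat1: "norm (mat 1 :: real^2^2) = sqrt 2"
proof -
  have "(norm (mat 1 :: real^2^2))\<^sup>2 = 2" by (simp add: norm_matrix_2)
  then show ?thesis by (metis norm_ge_zero real_sqrt_unique)
qed

lemma matrix_mult_algebra:
  fixes A B C :: "real^2^2"
  shows "(A + B) ** C = A ** C + B ** C" "C ** (A + B) = C ** A + C ** B"
    "(A - B) ** C = A ** C - B ** C" "C ** (A - B) = C ** A - C ** B"
    "(- A) ** C = - (A ** C)" "C ** (- A) = - (C ** A)"
    "(r *\<^sub>R A) ** C = r *\<^sub>R (A ** C)" "C ** (r *\<^sub>R A) = r *\<^sub>R (C ** A)"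
  by (simp_all add: matrix_eq_2 matrix_mult_nth_2 algebra_simps)

lemma upper_half_plane_iff [simp]: "\<tau> \<in> upper_half_plane \<longleftrightarrow> Im \<tau> > 0"
  by (simp add: upper_half_plane_def)

lemma automorphy_nonzero: assumes "A \<in> SL2" "Im \<tau> > 0" shows "automorphy A \<tau> \<noteq> 0"
proof
  assume *: "automorphy A \<tau> = 0"
  then have "A$2$1 * Im \<tau> = 0" by (simp add: automorphy_def complex_eq_iff)
  then have "A$2$1 = 0" using assms by simp
  with * have "A$2$2 = 0" by (simp add: automorphy_def)
  with \<open>A$2$1 = 0\<close> show False using assms by (simp add: SL2_iff)
qed

lemma Im_mobius: assumes "A \<in> SL2" "Im \<tau> > 0"
  shows "Im (mobius A \<tau>) = Im \<tau> / (cmod (automorphy A \<tau>))\<^sup>2"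
proof -
  have d: "A$1$1 * A$2$2 - A$1$2 * A$2$1 = 1" using assms by (simp add: SL2_iff)
  have "Im (mobius A \<tau>) = Im ((A$1$1 * \<tau> + A$1$2) * cnj (automorphy A \<tau>)) / (cmod (automorphy A \<tau>))\<^sup>2"
    unfolding mobius_def
    by (simp add: complex_div_cnj[of _ "automorphy A \<tau>"] Im_divide_of_real del: Im_divide complex_cnj)
  also have "Im ((A$1$1 * \<tau> + A$1$2) * cnj (automorphy A \<tau>)) = (A$1$1 * A$2$2 - A$1$2 * A$2$1) * Im \<tau>"
    by (simp add: automorphy_def algebra_simps)
  finally show ?thesis using d by simp
qed

lemma Im_mobius_pos: assumes "A \<in> SL2" "Im \<tau> > 0" shows "Im (mobius A \<tau>) > 0"
  using Im_mobius[OF assms] automorphy_nonzero[OF assms] assms by simp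

lemma automorphy_mult: assumes "B \<in> SL2" "Im \<tau> > 0"
  shows "automorphy (A ** B) \<tau> = automorphy A (mobius B \<tau>) * automorphy B \<tau>"
  using automorphy_nonzero[OF assms]
  by (simp add: automorphy_def[of A] automorphy_def[of "A ** B"] mobius_def matrix_mult_nth_2 field_simps)
     (simp add: automorphy_def algebra_simps)

lemma mobius_mult: assumes "A \<in> SL2" "B \<in> SL2" "Im \<tau> > 0"
  shows "mobius (A ** B) \<tau> = mobius A (mobius B \<tau>)"
proof -
  have nz: "automorphy B \<tau> \<noteq> 0" "automorphy A (mobius B \<tau>) \<noteq> 0"
    using automorphy_nonzero[OF assms(2,3)] automorphy_nonzero[OF assms(1) Im_mobius_pos[OF assms(2,3)]] by auto
  have "(A$1$1 * mobius B \<tau> + A$1$2) * automorphy B \<tau> = (A ** B)$1$1 * \<tau> + (A ** B)$1$2"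
    using nz by (simp add: mobius_def matrix_mult_nth_2 field_simps) (simp add: automorphy_def algebra_simps)
  then show ?thesis
    using nz unfolding mobius_def[of "A ** B"] mobius_def[of A] automorphy_mult[OF assms(2,3)]
    by (metis (no_types, lifting) mult_divide_mult_cancel_right)
qed

lemma automorphy_uminus [simp]: "automorphy (- A) \<tau> = - automorphy A \<tau>"
  by (simp add: automorphy_def)

lemma mobius_one [simp]: "mobius (mat 1) \<tau> = \<tau>"
  by (simp add: mobius_def automorphy_def)

text \<open>The points of the upper half plane are represented by matrices through \<open>g \<mapsto> g i\<close>.\<close>

definition pt :: "real^2^2 \<Rightarrow> complex" where "pt g = mobius g \<i>"

lemma pt_mult: "A \<in> SL2 \<Longrightarrow> g \<in> SL2 \<Longrightarrow> pt (A ** g) = mobius A (pt g)"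
  by (simp add: pt_def mobius_mult)

lemma Im_pt: "g \<in> SL2 \<Longrightarrow> Im (pt g) = 1 / ((g$2$1)\<^sup>2 + (g$2$2)\<^sup>2)"
  unfolding pt_def by (subst Im_mobius) (auto simp: automorphy_def cmod_power2 algebra_simps)

lemma Im_pt_pos: "g \<in> SL2 \<Longrightarrow> Im (pt g) > 0"
  unfolding pt_def by (rule Im_mobius_pos) auto

lemma Re_pt: "g \<in> SL2 \<Longrightarrow> Re (pt g) = (g$1$1 * g$2$1 + g$1$2 * g$2$2) * Im (pt g)"
proof -
  assume g: "g \<in> SL2"
  have "pt g = Complex (g$1$2) (g$1$1) / Complex (g$2$2) (g$2$1)"
  proof -
    have "of_real a * \<i> + of_real b = Complex b a" for a b by (simp add: complex_eq_iff)
    then show ?thesis by (simp only: pt_def mobius_def automorphy_def)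
  qed
  then have "Re (pt g) = (g$1$2 * g$2$2 + g$1$1 * g$2$1) / ((g$2$2)\<^sup>2 + (g$2$1)\<^sup>2)"
    by (simp only: Re_divide complex.sel)
  then show ?thesis unfolding Im_pt[OF g] by (simp add: add.commute)
qed

text \<open>The left sides are the entries of g times its transpose, which depends only on the point
  \<open>g i\<close> because the stabilizer of i is the rotation group. Lagrange's identity with
  determinant 1 gives the third from the other two.\<close>

lemma gram_pt:
  assumes "g \<in> SL2"
  shows "(g$2$1)\<^sup>2 + (g$2$2)\<^sup>2 = 1 / Im (pt g)"
    "g$1$1 * g$2$1 + g$1$2 * g$2$2 = Re (pt g) / Im (pt g)"
    "(g$1$1)\<^sup>2 + (g$1$2)\<^sup>2 = ((Re (pt g))\<^sup>2 + (Im (pt g))\<^sup>2) / Im (pt g)"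
proof -
  define y where "y = Im (pt g)"
  have y: "y > 0" "(g$2$1)\<^sup>2 + (g$2$2)\<^sup>2 = 1 / y" using Im_pt[OF assms] Im_pt_pos[OF assms] by (auto simp: y_def)
  then show "(g$2$1)\<^sup>2 + (g$2$2)\<^sup>2 = 1 / Im (pt g)" by (simp add: y_def)
  have x: "g$1$1 * g$2$1 + g$1$2 * g$2$2 = Re (pt g) / y" using Re_pt[OF assms] y by (simp add: y_def)
  then show "g$1$1 * g$2$1 + g$1$2 * g$2$2 = Re (pt g) / Im (pt g)" by (simp add: y_def)
  have d: "g$1$1 * g$2$2 - g$1$2 * g$2$1 = 1" using assms by (simp add: SL2_iff)
  have "((g$1$1)\<^sup>2 + (g$1$2)\<^sup>2) * ((g$2$1)\<^sup>2 + (g$2$2)\<^sup>2) =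
      (g$1$1 * g$2$1 + g$1$2 * g$2$2)\<^sup>2 + (g$1$1 * g$2$2 - g$1$2 * g$2$1)\<^sup>2"
    by (simp add: power2_eq_square algebra_simps)
  then have "((g$1$1)\<^sup>2 + (g$1$2)\<^sup>2) / y = (Re (pt g) / y)\<^sup>2 + 1"
    using x y d by (simp add: divide_inverse)
  then have "(g$1$1)\<^sup>2 + (g$1$2)\<^sup>2 = ((Re (pt g) / y)\<^sup>2 + 1) * y"
    using y(1) by (simp add: divide_eq_eq)
  also have "\<dots> = ((Re (pt g))\<^sup>2 + y\<^sup>2) / y"
    using y(1) by (simp add: power_divide power2_eq_square add_divide_distrib distrib_right)
  finally show "(g$1$1)\<^sup>2 + (g$1$2)\<^sup>2 = ((Re (pt g))\<^sup>2 + (Im (pt g))\<^sup>2) / Im (pt g)"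
    by (simp add: y_def)
qed

lemma norm_pt: assumes "g \<in> SL2"
  shows "(norm g)\<^sup>2 = ((Re (pt g))\<^sup>2 + (Im (pt g))\<^sup>2 + 1) / Im (pt g)"
  unfolding norm_matrix_2 using gram_pt[OF assms] by (simp add: add_divide_distrib algebra_simps)

text \<open>Both sides are 2 cosh of the hyperbolic distance between the two points; the left side
  expands into the entries of the two Gram matrices.\<close>

lemma norm_rel_pt:
  assumes "g \<in> SL2" "h \<in> SL2"
  shows "(norm (adj2 g ** h))\<^sup>2 =
    ((Re (pt g) - Re (pt h))\<^sup>2 + (Im (pt g))\<^sup>2 + (Im (pt h))\<^sup>2) / (Im (pt g) * Im (pt h))"
proof -
  have poly: "(t1 * p2 + - q1 * r2)\<^sup>2 + (t1 * q2 + - q1 * t2)\<^sup>2 + (- r1 * p2 + p1 * r2)\<^sup>2 + (- r1 * q2 + p1 * t2)\<^sup>2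
    = (r1\<^sup>2 + t1\<^sup>2) * (p2\<^sup>2 + q2\<^sup>2) - 2 * (p1 * r1 + q1 * t1) * (p2 * r2 + q2 * t2)
      + (p1\<^sup>2 + q1\<^sup>2) * (r2\<^sup>2 + t2\<^sup>2)" for p1 q1 r1 t1 p2 q2 r2 t2 :: real
    by (simp add: power2_eq_square algebra_simps)
  have frac: "1 / y1 * ((x2\<^sup>2 + y2\<^sup>2) / y2) - 2 * (x1 / y1) * (x2 / y2) + (x1\<^sup>2 + y1\<^sup>2) / y1 * (1 / y2) =
      ((x1 - x2)\<^sup>2 + y1\<^sup>2 + y2\<^sup>2) / (y1 * y2)" for x1 y1 x2 y2 :: real
    by (simp add: add_divide_distrib diff_divide_distrib power2_diff mult.commute)
  show ?thesis
    unfolding norm_matrix_2 matrix_mult_nth_2 adj2_nth poly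
      gram_pt[OF assms(1)] gram_pt[OF assms(2)] frac ..
qed

section \<open>Discrete subgroups and the thick-thin decomposition\<close>

definition hf :: "real^2^2 \<Rightarrow> real" where "hf A = (A$1$1 + A$2$2) / 2"

text \<open>The trace-free part; up to scaling it determines the centralizer of a matrix.\<close>

definition tl2 :: "real^2^2 \<Rightarrow> real^2^2" where "tl2 A = A - hf A *\<^sub>R mat 1"

lemma tl2_nth [simp]:
  "tl2 A $ 1 $ 1 = (A$1$1 - A$2$2) / 2" "tl2 A $ 1 $ 2 = A$1$2"
  "tl2 A $ 2 $ 1 = A$2$1" "tl2 A $ 2 $ 2 = - ((A$1$1 - A$2$2) / 2)"
  by (simp_all add: tl2_def hf_def field_simps)

lemma tl2_decomp: "hf A *\<^sub>R mat 1 + tl2 A = A"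
  by (simp add: tl2_def)

lemma hf_conj: assumes "g \<in> SL2" shows "hf (adj2 g ** A ** g) = hf A"
proof -
  have "(d * w + - b * y) * a + (d * x + - b * z) * c + ((- c * w + a * y) * b + (- c * x + a * z) * d)
      = (a * d - b * c) * (w + z)" for a b c d w x y z :: real
    by (simp add: algebra_simps)
  then show ?thesis using assms unfolding hf_def matrix_mult_nth_2 adj2_nth SL2_iff by simp
qed

lemma tl2_conj: assumes "g \<in> SL2" shows "tl2 (adj2 g ** A ** g) = adj2 g ** tl2 A ** g"
  using assms unfolding tl2_def hf_conj[OF assms]
  by (simp add: matrix_mult_algebra adj2_mult)

lemma mult_zero_2 [simp]: "0 ** A = (0::real^2^2)" "A ** 0 = (0::real^2^2)"
  by (simp_all add: matrix_eq_2 matrix_mult_nth_2)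

lemma tl2_conj_eq_0: assumes "g \<in> SL2" shows "tl2 (adj2 g ** A ** g) = 0 \<longleftrightarrow> tl2 A = 0"
proof -
  have "tl2 A = g ** (adj2 g ** tl2 A ** g) ** adj2 g"
    using assms by (simp add: matrix_mul_assoc[symmetric] adj2_mult)
  then show ?thesis unfolding tl2_conj[OF assms] by (metis mult_zero_2)
qed

text \<open>On \<open>SL2\<close> this reads \<open>det (tl2 A) = 1 - (hf A)\<^sup>2\<close>, so for
  non-scalar A the determinant of the trace-free part is positive, zero or negative according as A
  is elliptic, parabolic or hyperbolic. Later case distinctions are made on this sign.\<close>

lemma det_decomp: "det A = (hf A)\<^sup>2 + det (tl2 A)"
proof -
  have "a * d - b * c = ((a + d) / 2)\<^sup>2 + ((a - d) / 2 * - ((a - d) / 2) - b * c)" for a b c d :: real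
    by (simp add: power2_eq_square field_simps)
  then show ?thesis unfolding det_2 hf_def tl2_nth .
qed

lemma norm_decomp: "(norm A)\<^sup>2 = 2 * (hf A)\<^sup>2 + (norm (tl2 A))\<^sup>2"
proof -
  have "a\<^sup>2 + b\<^sup>2 + c\<^sup>2 + d\<^sup>2 = 2 * ((a + d) / 2)\<^sup>2 + (((a - d) / 2)\<^sup>2 + b\<^sup>2 + c\<^sup>2 + (- ((a - d) / 2))\<^sup>2)"
    for a b c d :: real
    by (simp add: power2_eq_square field_simps)
  then show ?thesis unfolding norm_matrix_2 hf_def tl2_nth .
qed

lemma norm_tl2_le: "norm (tl2 A) \<le> norm (A - p *\<^sub>R mat 1)"
proof (rule power2_le_imp_le)
  have "tl2 (A - p *\<^sub>R mat 1) = tl2 A" by (simp add: matrix_eq_2)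
  then show "(norm (tl2 A))\<^sup>2 \<le> (norm (A - p *\<^sub>R mat 1))\<^sup>2"
    using norm_decomp[of "A - p *\<^sub>R mat 1"] by simp
qed simp

lemma hf_near: "norm (A - mat 1) \<le> e \<Longrightarrow> \<bar>hf A - 1\<bar> \<le> e"
  using entry_le_norm[of "A - mat 1" 1 1] entry_le_norm[of "A - mat 1" 2 2]
  by (simp add: hf_def field_simps abs_le_iff)

text \<open>Scalars drop out of the commutator, and the commutator of two trace-free matrices is, up
  to nonzero factors in the entries, the cross product of their coordinate vectors; it vanishes only
  for parallel vectors.\<close>

lemma commute_imp_parallel:
  assumes "A ** B = B ** A" "tl2 A \<noteq> 0"
  shows "\<exists>q. tl2 B = q *\<^sub>R tl2 A"
proof -
  have *: "\<exists>q. (a' - d') / 2 = q * ((a - d) / 2) \<and> b' = q * b \<and> c' = q * c"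
    if e: "a * a' + b * c' = a' * a + b' * c" "a * b' + b * d' = a' * b + b' * d" "c * a' + d * c' = c' * a + d' * c"
    and n: "\<not> ((a - d) / 2 = 0 \<and> b = 0 \<and> c = 0)" for a b c d a' b' c' d' :: real
  proof -
    have e': "b * c' = c * b'" "(a - d) * b' = b * (a' - d')" "(a - d) * c' = c * (a' - d')"
      using e by (simp_all add: algebra_simps)
    consider "b \<noteq> 0" | "c \<noteq> 0" | "a - d \<noteq> 0" using n by auto
    then show ?thesis
    proof cases
      case 1 then show ?thesis using e' by (intro exI[of _ "b' / b"]) (simp add: field_simps)
    next
      case 2 then show ?thesis using e' by (intro exI[of _ "c' / c"]) (simp add: field_simps)
    next
      case 3 then show ?thesis using e' by (intro exI[of _ "(a' - d') / (a - d)"]) (simp add: field_simps)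
    qed
  qed
  have "\<exists>q. (B$1$1 - B$2$2) / 2 = q * ((A$1$1 - A$2$2) / 2) \<and> B$1$2 = q * A$1$2 \<and> B$2$1 = q * A$2$1"
    by (rule *) (use assms in \<open>auto simp: matrix_eq_2 matrix_mult_nth_2\<close>)
  then show ?thesis by (auto simp: matrix_eq_2)
qed

lemma parallel_imp_commute: assumes "tl2 B = q *\<^sub>R tl2 A" shows "A ** B = B ** A"
proof -
  define N where "N = tl2 A"
  have "(a *\<^sub>R mat 1 + N) ** (b *\<^sub>R mat 1 + q *\<^sub>R N) = (b *\<^sub>R mat 1 + q *\<^sub>R N) ** (a *\<^sub>R mat 1 + N)" for a b
    by (simp add: matrix_mult_algebra algebra_simps)
  then show ?thesis using tl2_decomp[of A] tl2_decomp[of B] assms by (metis N_def)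
qed

text \<open>For non-scalar matrices commuting means having proportional trace-free parts, which is
  transitive. This spreads the commutation of small elements to a whole centralizer.\<close>

lemma commute_trans:
  assumes "A ** B = B ** A" "A ** C = C ** A" "tl2 A \<noteq> 0" "tl2 B \<noteq> 0"
  shows "B ** C = C ** B"
proof -
  obtain q where q: "tl2 B = q *\<^sub>R tl2 A" using commute_imp_parallel assms by blast
  obtain p where p: "tl2 C = p *\<^sub>R tl2 A" using commute_imp_parallel assms by blast
  have "q \<noteq> 0" using q assms by auto
  then have "tl2 C = (p / q) *\<^sub>R tl2 B" using p q by simp
  then show ?thesis by (rule parallel_imp_commute)
qed

section \<open>Discrete subgroups of SL2(R) and commuting small elements\<close>

lemma finite_positive_lower_bound:
  assumes "finite S" "\<And>x. x \<in> S \<Longrightarrow> f x > (0::real)"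
  shows "\<exists>m>0. \<forall>x\<in>S. m \<le> f x"
proof (cases "S = {}")
  case False
  then have "Min (f ` S) > 0" "\<forall>x\<in>S. Min (f ` S) \<le> f x" using assms by auto
  then show ?thesis by blast
qed (auto intro: exI[of _ 1])

text \<open>Discreteness is stated as finiteness in every ball, the form in which the compactness
  arguments use it. Closure under negation reflects that the group will be a full preimage of a
  subgroup of \<open>PSL2R\<close>.\<close>

locale discrete_SL2 =
  fixes \<Gamma> :: "(real^2^2) set"
  assumes sub: "A \<in> \<Gamma> \<Longrightarrow> A \<in> SL2"
    and one [simp]: "mat 1 \<in> \<Gamma>"
    and neg: "A \<in> \<Gamma> \<Longrightarrow> - A \<in> \<Gamma>"
    and mult: "A \<in> \<Gamma> \<Longrightarrow> B \<in> \<Gamma> \<Longrightarrow> A ** B \<in> \<Gamma>"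
    and inv: "A \<in> \<Gamma> \<Longrightarrow> adj2 A \<in> \<Gamma>"
    and fin: "finite {A \<in> \<Gamma>. norm A \<le> r}"
begin

text \<open>Conjugation by g moves the base point from \<open>g i\<close> to i, so that the
  commutation of small elements has to be shown only at i.\<close>

lemma conj_discrete: assumes "g \<in> SL2" shows "discrete_SL2 ((\<lambda>A. adj2 g ** A ** g) ` \<Gamma>)" (is "discrete_SL2 (?c ` \<Gamma>)")
proof
  have c1: "?c (mat 1) = mat 1" using assms by (simp add: adj2_mult)
  have cm: "?c A ** ?c B = ?c (A ** B)" for A B
    using assms by (simp add: matrix_mul_assoc[symmetric])
  show "mat 1 \<in> ?c ` \<Gamma>" using c1 one by (metis image_eqI)
  show "A ** B \<in> ?c ` \<Gamma>" if "A \<in> ?c ` \<Gamma>" "B \<in> ?c ` \<Gamma>" for A B using that cm mult by blast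
  show "A \<in> SL2" if "A \<in> ?c ` \<Gamma>" for A using that assms sub by auto
  show "- A \<in> ?c ` \<Gamma>" if "A \<in> ?c ` \<Gamma>" for A
  proof -
    obtain B where "B \<in> \<Gamma>" "A = ?c B" using \<open>A \<in> ?c ` \<Gamma>\<close> by blast
    then have "- A = ?c (- B)" "- B \<in> \<Gamma>" by (simp_all add: matrix_mult_algebra neg)
    then show ?thesis by blast
  qed
  show "adj2 A \<in> ?c ` \<Gamma>" if "A \<in> ?c ` \<Gamma>" for A
  proof -
    obtain B where "B \<in> \<Gamma>" "A = ?c B" using \<open>A \<in> ?c ` \<Gamma>\<close> by blast
    then have "adj2 A = ?c (adj2 B)" "adj2 B \<in> \<Gamma>"
      by (simp_all add: adj2_mult_distrib matrix_mul_assoc inv)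
    then show ?thesis by blast
  qed
  fix r
  have "{A \<in> ?c ` \<Gamma>. norm A \<le> r} \<subseteq> ?c ` {A \<in> \<Gamma>. norm A \<le> norm g * r * norm g}"
  proof
    fix A assume "A \<in> {A \<in> ?c ` \<Gamma>. norm A \<le> r}"
    then obtain B where B: "B \<in> \<Gamma>" "A = ?c B" "norm A \<le> r" by blast
    have "B = g ** A ** adj2 g" using assms B(2) by (simp add: matrix_mul_assoc[symmetric] adj2_mult)
    then have "norm B \<le> norm g * norm A * norm g" using norm_mult_le3[of g A "adj2 g"] by simp
    also have "\<dots> \<le> norm g * r * norm g" using B(3) by (intro mult_right_mono mult_left_mono) auto
    finally show "A \<in> ?c ` {A \<in> \<Gamma>. norm A \<le> norm g * r * norm g}" using B by blast
  qed
  then show "finite {A \<in> ?c ` \<Gamma>. norm A \<le> r}" using fin finite_subset by blast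
qed

text \<open>Here \<open>x ** N ** adj2 x = q *\<^sub>R N\<close>, so conjugating
  \<open>mat 1 + N\<close> by powers of x produces the group elements
  \<open>mat 1 + q ^ n *\<^sub>R N\<close>. For |q| < 1 these would be infinitely many in a bounded
  set. This is the reason that no hyperbolic element fixes the fixed point of a parabolic
  one.\<close>

lemma no_contraction:
  assumes "x \<in> \<Gamma>" "N \<noteq> 0" "x ** N = q *\<^sub>R (N ** x)" "mat 1 + N \<in> \<Gamma>"
  shows "\<bar>q\<bar> \<ge> 1"
proof (rule ccontr)
  assume "\<not> \<bar>q\<bar> \<ge> 1"
  then have q: "\<bar>q\<bar> < 1" by simp
  have x: "x \<in> SL2" using assms sub by blast
  have q0: "q \<noteq> 0"
  proof
    assume "q = 0"
    then have "adj2 x ** (x ** N) = 0" using assms(3) by (simp add: matrix_eq_2 matrix_mult_nth_2)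
    then show False using x assms(2) by simp
  qed
  define a where "a n = mat 1 + q ^ n *\<^sub>R N" for n
  have conj: "x ** N ** adj2 x = q *\<^sub>R N"
    using x by (simp add: assms(3) matrix_mult_algebra matrix_mul_assoc[symmetric] adj2_mult)
  have "a n \<in> \<Gamma>" for n
  proof (induction n)
    case (Suc n)
    have "x ** a n ** adj2 x = mat 1 + q ^ n *\<^sub>R (x ** N ** adj2 x)"
      using x by (simp add: a_def matrix_mult_algebra adj2_mult)
    also have "\<dots> = a (Suc n)" by (simp add: conj a_def mult.commute)
    finally show ?case using Suc assms(1) mult inv by metis
  qed (simp add: a_def assms(4))
  moreover have "norm (a n) \<le> sqrt 2 + norm N" for n
  proof -
    have "\<bar>q\<bar> ^ n \<le> 1" using q by (simp add: power_le_one)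
    then have "norm (q ^ n *\<^sub>R N) \<le> norm N" by (simp add: power_abs mult_left_le_one_le)
    then show ?thesis unfolding a_def using norm_triangle_ineq[of "mat 1" "q ^ n *\<^sub>R N"] norm_mat1 by linarith
  qed
  ultimately have "range a \<subseteq> {A \<in> \<Gamma>. norm A \<le> sqrt 2 + norm N}" by blast
  then have "finite (range a)" using fin finite_subset by blast
  moreover have "inj a"
  proof (rule injI)
    fix m n assume "a m = a n"
    then have "q ^ m = q ^ n" using assms(2) by (simp add: a_def)
    then have "\<bar>q\<bar> ^ m = \<bar>q\<bar> ^ n" by (metis power_abs)
    then show "m = n" using q q0 power_inject_exp' by (metis abs_ge_zero less_irrefl linorder_neqE_nat power_strict_decreasing zero_less_abs_iff)
  qed
  ultimately show False using finite_imageD by blast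
qed

text \<open>If a commutes with its conjugate by c, then conjugation by c multiplies
  \<open>N = tl2 a\<close> by a scalar q, and the claim is q = 1. Determinants give q^2 = 1 unless a
  is parabolic, where contraction is excluded for c and for its inverse; q = -1 is impossible for c
  close to the identity.\<close>

lemma conj_commute_descent:
  assumes "a \<in> \<Gamma>" "c \<in> \<Gamma>" "norm (a - mat 1) \<le> 1/10" "norm (c - mat 1) \<le> 3/10"
    and "(c ** a ** adj2 c) ** a = a ** (c ** a ** adj2 c)"
  shows "c ** a = a ** c"
proof (cases "tl2 a = 0")
  case True
  then show ?thesis using parallel_imp_commute[of a 0 c] by (simp add: True)
next
  case False
  have c: "c \<in> SL2" and a: "a \<in> SL2" using assms sub by auto
  define N where "N = tl2 a"
  have "tl2 (c ** a ** adj2 c) = c ** N ** adj2 c"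
    using tl2_conj[of "adj2 c" a] c by (simp add: N_def)
  moreover obtain q where "tl2 (c ** a ** adj2 c) = q *\<^sub>R N"
    using commute_imp_parallel[OF assms(5)[symmetric] False] by (auto simp: N_def)
  ultimately have "c ** N ** adj2 c ** c = (q *\<^sub>R N) ** c" by simp
  then have q: "c ** N = q *\<^sub>R (N ** c)"
    using c by (simp add: matrix_mul_assoc[symmetric] adj2_mult matrix_mult_algebra)
  have "\<bar>q\<bar> = 1"
  proof (cases "det N = 0")
    case False
    have "det (c ** N) = q\<^sup>2 * det (N ** c)" unfolding q by (simp add: det_2 power2_eq_square algebra_simps)
    then have "q\<^sup>2 = 1" using False c by (simp add: det_mul SL2_def)
    then show ?thesis by (auto simp: power2_eq_1_iff)
  next
    case True
    then have "(hf a)\<^sup>2 = 1" using det_decomp[of a] a by (simp add: SL2_def N_def)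
    moreover have "hf a > 0" using hf_near[OF assms(3)] by linarith
    ultimately have "hf a = 1" by (simp add: power2_eq_1_iff)
    then have "mat 1 + N = a" using tl2_decomp[of a] by (simp add: N_def)
    then have aN: "mat 1 + N \<in> \<Gamma>" using assms(1) by simp
    have N0: "N \<noteq> 0" using False by (simp add: N_def)
    have ge: "\<bar>q\<bar> \<ge> 1" using no_contraction[OF assms(2) N0 q aN] .
    have "adj2 c ** (c ** N) ** adj2 c = adj2 c ** (q *\<^sub>R (N ** c)) ** adj2 c" by (simp only: q)
    then have "N ** adj2 c = q *\<^sub>R (adj2 c ** N)"
      using c by (simp add: matrix_mult_algebra matrix_mul_assoc[symmetric] adj2_mult)
    then have "adj2 c ** N = inverse q *\<^sub>R (N ** adj2 c)" using ge by auto
    then have "\<bar>inverse q\<bar> \<ge> 1" using no_contraction[OF inv[OF assms(2)] N0 _ aN] by blast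
    then show ?thesis using ge by (simp add: abs_inverse) (smt (verit) one_le_inverse_iff)
  qed
  \<comment> \<open>If c and N anticommute, the identity below bounds \<open>2 * norm N\<close> by
    \<open>6/10 * norm N\<close>.\<close>
  moreover have "q \<noteq> -1"
  proof
    assume "q = -1"
    then have eq: "c ** N = - (N ** c)" using q by simp
    have "2 *\<^sub>R N = - ((c - mat 1) ** N + N ** (c - mat 1))"
      by (simp add: matrix_mult_algebra eq scaleR_2)
    then have "norm (2 *\<^sub>R N) = norm (- ((c - mat 1) ** N + N ** (c - mat 1)))" by (simp only:)
    then have "2 * norm N = norm ((c - mat 1) ** N + N ** (c - mat 1))"
      by (simp only: norm_minus_cancel norm_scaleR abs_numeral)
    also have "\<dots> \<le> norm (c - mat 1) * norm N + norm N * norm (c - mat 1)"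
      by (meson add_mono norm_matrix_mult_le norm_triangle_le)
    also have "\<dots> \<le> 3/10 * norm N + norm N * (3/10)"
      using assms(4) by (intro add_mono mult_right_mono mult_left_mono) auto
    finally show False using False by (simp add: N_def)
  qed
  ultimately have "q = 1" by linarith
  then have "c ** N = N ** c" using q by simp
  then show ?thesis
  proof -
    have "c ** (hf a *\<^sub>R mat 1 + N) = (hf a *\<^sub>R mat 1 + N) ** c"
      using \<open>c ** N = N ** c\<close> by (simp add: matrix_mult_algebra)
    then show ?thesis by (simp only: N_def tl2_decomp)
  qed
qed

text \<open>The Margulis lemma. The iterates \<open>b\<^sub>n\<^sub>+\<^sub>1 = b\<^sub>n a b\<^sub>n\<inverse>\<close> converge to \<open>a\<close>, hence reach \<open>a\<close> by
  discreteness, and commuting with \<open>a\<close> descends along the sequence.\<close>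

lemma small_commute_1:
  assumes "a \<in> \<Gamma>" "b \<in> \<Gamma>" "norm (a - mat 1) \<le> 1/10" "norm (b - mat 1) \<le> 1/10"
  shows "a ** b = b ** a"
proof -
  define B where "B n = ((\<lambda>x. x ** a ** adj2 x) ^^ n) b" for n
  have B0: "B 0 = b" and BS: "B (Suc n) = B n ** a ** adj2 (B n)" for n by (simp_all add: B_def)
  have BG: "B n \<in> \<Gamma>" for n
    by (induction n) (use assms BS B0 in \<open>auto intro: mult inv\<close>)
  have sq: "sqrt 2 \<le> 3/2" by (rule real_le_lsqrt) (auto simp: power2_eq_square)
  have Bn: "norm (B n - a) \<le> 1/5 * (1/2) ^ n" for n
  proof (induction n)
    case 0
    have "norm (b - a) \<le> norm (b - mat 1) + norm (a - mat 1)"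
      by (metis norm_triangle_sub norm_minus_commute diff_diff_eq2 diff_add_cancel norm_triangle_ineq4)
    then show ?case using assms B0 by simp
  next
    case (Suc n)
    have SL: "B n \<in> SL2" using BG sub by blast
    have "B (Suc n) - a = (B n ** a - a ** B n) ** adj2 (B n)"
      using SL by (simp add: BS matrix_mult_algebra matrix_mul_assoc[symmetric] adj2_mult)
    \<comment> \<open>The commutator is bilinear, and \<open>mat 1\<close> commutes with everything
      and \<open>a\<close> with itself, so it is built from products of two small factors. With
      \<open>norm (B n) \<le> 2\<close> the error is multiplied by at most 2/5, below the claimed
      1/2.\<close>
    also have "B n ** a - a ** B n = (B n - a) ** (a - mat 1) - (a - mat 1) ** (B n - a)"
      by (simp add: matrix_mult_algebra)
    finally have "norm (B (Suc n) - a) \<le>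
        norm ((B n - a) ** (a - mat 1) - (a - mat 1) ** (B n - a)) * norm (B n)"
      using norm_matrix_mult_le by (metis norm_adj2)
    also have "\<dots> \<le> (norm (B n - a) * (1/10) + (1/10) * norm (B n - a)) * norm (B n)"
    proof (intro mult_right_mono)
      have "norm ((B n - a) ** (a - mat 1)) \<le> norm (B n - a) * (1/10)"
        using norm_matrix_mult_le[of "B n - a" "a - mat 1"] assms(3) mult_left_mono[of "norm (a - mat 1)" "1/10" "norm (B n - a)"]
        by auto
      moreover have "norm ((a - mat 1) ** (B n - a)) \<le> (1/10) * norm (B n - a)"
        using norm_matrix_mult_le[of "a - mat 1" "B n - a"] assms(3) mult_right_mono[of "norm (a - mat 1)" "1/10" "norm (B n - a)"]
        by auto
      ultimately show "norm ((B n - a) ** (a - mat 1) - (a - mat 1) ** (B n - a)) \<le> norm (B n - a) * (1/10) + (1/10) * norm (B n - a)"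
        by (smt (verit) norm_triangle_ineq4)
    qed simp
    also have "\<dots> \<le> (norm (B n - a) * (1/10) + (1/10) * norm (B n - a)) * 2"
    proof (intro mult_left_mono)
      have "norm (B n) \<le> norm (B n - a) + norm (a - mat 1) + norm (mat 1 :: real^2^2)"
        by (smt (verit) norm_triangle_sub)
      moreover have "(1/2::real) ^ n \<le> 1" by (simp add: power_le_one)
      ultimately show "norm (B n) \<le> 2" using Suc assms(3) norm_mat1 sq by linarith
    qed simp
    also have "\<dots> \<le> 1/5 * (1/2) ^ Suc n"
    proof -
      have "(x * (1/10) + 1/10 * x) * 2 \<le> 1/5 * (1/2 * p)" if "x \<le> 1/5 * p" "0 \<le> x" for x p :: real
        using that by (simp add: algebra_simps)
      then show ?thesis unfolding power_Suc using Suc norm_ge_zero by blast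
    qed
    finally show ?case .
  qed
  \<comment> \<open>The sum of 1/5 and 1/10, which is the distance from the identity that the
    descent lemma allows for the conjugating element.\<close>
  have near: "norm (B n - mat 1) \<le> 3/10" for n
  proof -
    have "norm (B n - mat 1) \<le> norm (B n - a) + norm (a - mat 1)"
      by (metis diff_add_cancel add_diff_eq norm_triangle_ineq)
    moreover have "(1/2::real) ^ n \<le> 1" by (simp add: power_le_one)
    ultimately show ?thesis using Bn[of n] assms(3) by linarith
  qed
  have "\<exists>n. B n = a"
  proof (rule ccontr)
    assume "\<not> (\<exists>n. B n = a)"
    then have ne: "B n \<noteq> a" for n by blast
    have "finite ({A \<in> \<Gamma>. norm A \<le> 2} - {a})" using fin by blast
    then obtain m where m: "m > 0" "\<And>A. A \<in> {A \<in> \<Gamma>. norm A \<le> 2} - {a} \<Longrightarrow> m \<le> norm (A - a)"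
      using finite_positive_lower_bound[of "{A \<in> \<Gamma>. norm A \<le> 2} - {a}" "\<lambda>A. norm (A - a)"] by auto
    obtain n where n: "(1/2::real) ^ n < m" using m(1) real_arch_pow_inv[of m "1/2"] by auto
    have "norm (B n) \<le> 2" using near[of n] norm_mat1 sq norm_triangle_sub[of "B n" "mat 1"] by linarith
    then have "m \<le> norm (B n - a)" using m(2) BG ne by blast
    then show False using Bn[of n] n m(1) by linarith
  qed
  then obtain n where n: "B n = a" by blast
  have "B n ** a = a ** B n \<Longrightarrow> B 0 ** a = a ** B 0" for n
  proof (induction n)
    case (Suc n)
    have "B n ** a = a ** B n"
      by (rule conj_commute_descent[OF assms(1) BG assms(3) near]) (rule Suc.prems[unfolded BS])
    then show ?case by (rule Suc.IH)
  qed
  from this[of n] show ?thesis unfolding n B0 by (rule sym) (rule refl)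
qed

lemma small_commute:
  assumes "a \<in> \<Gamma>" "b \<in> \<Gamma>" "g \<in> SL2"
    and "norm (adj2 g ** a ** g - mat 1) \<le> 1/10" "norm (adj2 g ** b ** g - mat 1) \<le> 1/10"
  shows "a ** b = b ** a"
proof -
  interpret c: discrete_SL2 "(\<lambda>A. adj2 g ** A ** g) ` \<Gamma>" by (rule conj_discrete[OF assms(3)])
  have eq: "(adj2 g ** a ** g) ** (adj2 g ** b ** g) = (adj2 g ** b ** g) ** (adj2 g ** a ** g)"
    by (rule c.small_commute_1) (use assms in auto)
  have c1: "(adj2 g ** x ** g) ** (adj2 g ** y ** g) = adj2 g ** (x ** y) ** g" for x y
    using assms(3) by (simp only: matrix_mul_assoc[symmetric] adj2_mult_cancel)
  have c2: "g ** (adj2 g ** x ** g) ** adj2 g = x" for x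
    using assms(3) by (simp only: matrix_mul_assoc[symmetric] adj2_mult_cancel adj2_mult matrix_mul_rid)
  have "a ** b = g ** (adj2 g ** (a ** b) ** g) ** adj2 g" by (rule c2[symmetric])
  also have "\<dots> = g ** (adj2 g ** (b ** a) ** g) ** adj2 g" by (simp only: c1[symmetric] eq)
  also have "\<dots> = b ** a" by (rule c2)
  finally show ?thesis .
qed

end

section \<open>Leaving the thin part along a path\<close>

lemma continuous_on_mat2 [continuous_intros]:
  assumes "continuous_on S a" "continuous_on S b" "continuous_on S c" "continuous_on S d"
  shows "continuous_on S (\<lambda>t. mat2 (a t) (b t) (c t) (d t))"
proof -
  have "mat2 x y z w = x *\<^sub>R mat2 1 0 0 0 + y *\<^sub>R mat2 0 1 0 0 + z *\<^sub>R mat2 0 0 1 0 + w *\<^sub>R mat2 0 0 0 1"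
    for x y z w by (simp add: matrix_eq_2)
  then have eq: "(\<lambda>t. mat2 (a t) (b t) (c t) (d t)) = (\<lambda>t. a t *\<^sub>R mat2 1 0 0 0 + b t *\<^sub>R mat2 0 1 0 0 +
      c t *\<^sub>R mat2 0 0 1 0 + d t *\<^sub>R mat2 0 0 0 1)" by blast
  show ?thesis unfolding eq by (intro continuous_intros assms)
qed

lemma continuous_on_matrix_mult [continuous_intros]:
  fixes A B :: "'a::topological_space \<Rightarrow> real^2^2"
  assumes "continuous_on S A" "continuous_on S B"
  shows "continuous_on S (\<lambda>t. A t ** B t)"
proof -
  have "M ** N = mat2 (M$1$1 * N$1$1 + M$1$2 * N$2$1) (M$1$1 * N$1$2 + M$1$2 * N$2$2)
     (M$2$1 * N$1$1 + M$2$2 * N$2$1) (M$2$1 * N$1$2 + M$2$2 * N$2$2)" for M N :: "real^2^2"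
    by (simp add: matrix_eq_2 matrix_mult_nth_2)
  then show ?thesis by (simp only:) (intro continuous_intros assms)
qed

lemma continuous_on_adj2 [continuous_intros]:
  assumes "continuous_on S A" shows "continuous_on S (\<lambda>t. adj2 (A t))"
  unfolding adj2_def by (intro continuous_intros assms)

text \<open>Diagonal matrices stretch an off-diagonal entry by (1 + t)^2, and if N is diagonal,
  translations create an off-diagonal entry of size 2t |N11|. The linear lower bound is common to
  all three cases.\<close>

lemma escape:
  fixes N :: "real^2^2"
  assumes "N$2$2 = - N$1$1" "N \<noteq> 0"
  shows "\<exists>u k. continuous_on {0..} u \<and> u 0 = mat 1 \<and> (\<forall>t\<ge>0. u t \<in> SL2) \<and>
     k > (0::real) \<and> (\<forall>t\<ge>0. k * t \<le> norm (adj2 (u t) ** N ** u t))"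
proof -
  have sq: "k * t \<le> k * ((1 + t) * (1 + t))" if "k > 0" "t \<ge> 0" for k t :: real
    using that by (intro mult_left_mono) (auto simp: algebra_simps)
  consider "N$2$1 \<noteq> 0" | "N$1$2 \<noteq> 0" | "N$2$1 = 0" "N$1$2 = 0" "N$1$1 \<noteq> 0"
    using assms by (auto simp: matrix_eq_2)
  then show ?thesis
  proof cases
    case 1
    define u where "u t = mat2 (1 + t) 0 0 (inverse (1 + t))" for t
    have "\<bar>N$2$1\<bar> * t \<le> norm (adj2 (u t) ** N ** u t)" if "t \<ge> 0" for t
    proof -
      have "(adj2 (u t) ** N ** u t)$2$1 = N$2$1 * ((1 + t) * (1 + t))"
        by (simp add: u_def matrix_mult_nth_2)
      then have "\<bar>N$2$1\<bar> * ((1 + t) * (1 + t)) \<le> norm (adj2 (u t) ** N ** u t)"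
        using entry_le_norm[of "adj2 (u t) ** N ** u t" 2 1] that by (simp add: abs_mult)
      then show ?thesis using sq[of "\<bar>N$2$1\<bar>" t] 1 that by linarith
    qed
    moreover have "continuous_on {0..} u" unfolding u_def by (intro continuous_intros) auto
    moreover have "u 0 = mat 1" by (simp add: u_def matrix_eq_2)
    moreover have "u t \<in> SL2" if "t \<ge> 0" for t using that by (simp add: u_def SL2_iff)
    ultimately show ?thesis using 1 by (intro exI[of _ u] exI[of _ "\<bar>N$2$1\<bar>"]) auto
  next
    case 2
    define u where "u t = mat2 (inverse (1 + t)) 0 0 (1 + t)" for t
    have "\<bar>N$1$2\<bar> * t \<le> norm (adj2 (u t) ** N ** u t)" if "t \<ge> 0" for t
    proof -
      have "(adj2 (u t) ** N ** u t)$1$2 = N$1$2 * ((1 + t) * (1 + t))"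
        by (simp add: u_def matrix_mult_nth_2)
      then have "\<bar>N$1$2\<bar> * ((1 + t) * (1 + t)) \<le> norm (adj2 (u t) ** N ** u t)"
        using entry_le_norm[of "adj2 (u t) ** N ** u t" 1 2] that by (simp add: abs_mult)
      then show ?thesis using sq[of "\<bar>N$1$2\<bar>" t] 2 that by linarith
    qed
    moreover have "continuous_on {0..} u" unfolding u_def by (intro continuous_intros) auto
    moreover have "u 0 = mat 1" by (simp add: u_def matrix_eq_2)
    moreover have "u t \<in> SL2" if "t \<ge> 0" for t using that by (simp add: u_def SL2_iff)
    ultimately show ?thesis using 2 by (intro exI[of _ u] exI[of _ "\<bar>N$1$2\<bar>"]) auto
  next
    case 3
    define u where "u t = mat2 1 t 0 1" for t :: real
    have "(2 * \<bar>N$1$1\<bar>) * t \<le> norm (adj2 (u t) ** N ** u t)" if "t \<ge> 0" for t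
    proof -
      have "(adj2 (u t) ** N ** u t)$1$2 = 2 * N$1$1 * t"
        using 3 assms(1) by (simp add: u_def matrix_mult_nth_2)
      then show ?thesis
        using entry_le_norm[of "adj2 (u t) ** N ** u t" 1 2] that by (simp add: abs_mult)
    qed
    moreover have "continuous_on {0..} u" unfolding u_def by (intro continuous_intros)
    moreover have "u 0 = mat 1" by (simp add: u_def matrix_eq_2)
    moreover have "u t \<in> SL2" for t by (simp add: u_def SL2_iff)
    ultimately show ?thesis using 3 by (intro exI[of _ u] exI[of _ "2 * \<bar>N$1$1\<bar>"]) auto
  qed
qed

lemma norm_le_conj:
  assumes "g \<in> SL2" "norm (adj2 g ** A ** g - mat 1) \<le> 1/10"
  shows "norm A \<le> norm g * 2 * norm g"
proof -
  have "sqrt 2 \<le> 3/2" by (rule real_le_lsqrt) (auto simp: power2_eq_square)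
  then have *: "norm (adj2 g ** A ** g) \<le> 2"
    using norm_triangle_sub[of "adj2 g ** A ** g" "mat 1"] norm_mat1 assms(2) by linarith
  have "A = g ** (adj2 g ** A ** g) ** adj2 g"
    using assms(1) by (simp only: matrix_mul_assoc[symmetric] adj2_mult_cancel adj2_mult matrix_mul_rid)
  then have "norm A \<le> norm g * norm (adj2 g ** A ** g) * norm g"
    using norm_mult_le3[of g "adj2 g ** A ** g" "adj2 g"] by simp
  also have "\<dots> \<le> norm g * 2 * norm g" using * by (intro mult_right_mono mult_left_mono) auto
  finally show ?thesis .
qed

lemma conj_mult: "adj2 (s ** g) ** (A::real^2^2) ** (s ** g) = adj2 g ** (adj2 s ** A ** s) ** g"
  by (simp only: adj2_mult_distrib matrix_mul_assoc)

context discrete_SL2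
begin

text \<open>The constant 1/10 is that of \<open>small_commute\<close>. Elements with
  \<open>tl2 \<gamma> = 0\<close> are plus or minus the identity; they fix every point and say
  nothing about g.\<close>

definition thick :: "real^2^2 \<Rightarrow> bool" where
  "thick g \<longleftrightarrow> (\<forall>\<gamma>\<in>\<Gamma>. tl2 \<gamma> \<noteq> 0 \<longrightarrow> 1/10 \<le> norm (adj2 g ** \<gamma> ** g - mat 1))"

text \<open>If \<open>norm (tl2 \<delta>) < 1\<close>, the determinant gives
  \<open>(hf \<delta>)\<^sup>2 \<le> 2\<close> and hence
  \<open>(norm \<delta>)\<^sup>2 \<le> 5\<close>, which leaves finitely many elements; for all
  others 1 is a lower bound.\<close>

lemma norm_tl2_lower_bound: "\<exists>m>0. \<forall>\<delta>\<in>\<Gamma>. tl2 \<delta> \<noteq> 0 \<longrightarrow> m \<le> norm (tl2 \<delta>)"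
proof -
  have "finite {\<delta> \<in> {A \<in> \<Gamma>. norm A \<le> 3}. tl2 \<delta> \<noteq> 0}"
    by (rule finite_subset[OF _ fin[of 3]]) blast
  from finite_positive_lower_bound[OF this, of "\<lambda>\<delta>. norm (tl2 \<delta>)"]
  obtain m where m: "m > 0" "\<And>\<delta>. \<delta> \<in> \<Gamma> \<Longrightarrow> norm \<delta> \<le> 3 \<Longrightarrow> tl2 \<delta> \<noteq> 0 \<Longrightarrow> m \<le> norm (tl2 \<delta>)" by auto
  have "min m 1 \<le> norm (tl2 \<delta>)" if d: "\<delta> \<in> \<Gamma>" "tl2 \<delta> \<noteq> 0" for \<delta>
  proof (cases "norm (tl2 \<delta>) < 1")
    case True
    define N where "N = tl2 \<delta>"
    have "1 = (hf \<delta>)\<^sup>2 + det N" using det_decomp[of \<delta>] sub[OF d(1)] by (simp add: SL2_def N_def)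
    moreover have "- det N \<le> (norm N)\<^sup>2"
    proof -
      have "- (a * - a - b * c) \<le> a\<^sup>2 + b\<^sup>2 + c\<^sup>2 + (- a)\<^sup>2" for a b c :: real
      proof -
        have "(b - c)\<^sup>2 + b\<^sup>2 + c\<^sup>2 + 2 * a\<^sup>2 \<ge> 0" by simp
        then show ?thesis by (simp add: power2_eq_square algebra_simps)
      qed
      then show ?thesis unfolding N_def det_2 norm_matrix_2 tl2_nth .
    qed
    moreover have n1: "(norm N)\<^sup>2 \<le> 1" using True by (simp add: N_def power_le_one)
    ultimately have "(norm \<delta>)\<^sup>2 \<le> 5" using norm_decomp[of \<delta>] by (simp add: N_def)
    also have "(5::real) \<le> 3\<^sup>2" by simp
    finally have "norm \<delta> \<le> 3" by (rule power2_le_imp_le) simp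
    then show ?thesis using m(2)[OF d(1) _ d(2)] by simp
  qed auto
  then show ?thesis using m(1) by (intro exI[of _ "min m 1"]) auto
qed

text \<open>Moving a thin point in a direction in which all elements commuting with \<open>\<gamma>\<close> become large, one
  leaves the thin part at a point where some element commuting with \<open>\<gamma>\<close> is still small.\<close>

lemma exit_thin:
  assumes "\<gamma> \<in> \<Gamma>" "tl2 \<gamma> \<noteq> 0" "g \<in> SL2" "norm (adj2 g ** \<gamma> ** g - mat 1) < 1/10"
  shows "\<exists>w\<in>SL2. thick w \<and> (\<exists>\<delta>\<in>\<Gamma>. tl2 \<delta> \<noteq> 0 \<and> \<delta> ** \<gamma> = \<gamma> ** \<delta> \<and> norm (adj2 w ** \<delta> ** w - mat 1) \<le> 1/10)"
proof -
  define N where "N = adj2 g ** tl2 \<gamma> ** g"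
  have N: "N = tl2 (adj2 g ** \<gamma> ** g)" using tl2_conj[OF assms(3)] by (simp add: N_def)
  have "N$2$2 = - N$1$1" "N \<noteq> 0"
    unfolding N using tl2_conj_eq_0[OF assms(3)] assms(2) by auto
  from escape[OF this] obtain u k where u: "continuous_on {0..} u" "u 0 = mat 1" "\<And>t. t \<ge> 0 \<Longrightarrow> u t \<in> SL2"
    "k > 0" "\<And>t. t \<ge> 0 \<Longrightarrow> k * t \<le> norm (adj2 (u t) ** N ** u t)" by blast
  define \<phi> where "\<phi> t = g ** u t" for t
  define small where "small \<delta> t = norm (adj2 (\<phi> t) ** \<delta> ** \<phi> t - mat 1)" for \<delta> t
  define C where "C = {\<delta> \<in> \<Gamma>. tl2 \<delta> \<noteq> 0 \<and> \<delta> ** \<gamma> = \<gamma> ** \<delta>}"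
  \<comment> \<open>The times at which some non-scalar element of the centralizer of
    \<open>\<gamma>\<close> is still small. The supremum T of S does not belong to S, which is
    relatively open, yet at T some element of C has size at most 1/10.\<close>
  define S where "S = {t. t \<ge> 0 \<and> (\<exists>\<delta>\<in>C. small \<delta> t < 1/10)}"
  have phiSL: "\<phi> t \<in> SL2" if "t \<ge> 0" for t using u(3) that assms(3) by (simp add: \<phi>_def)
  have cphi: "continuous_on {0..} \<phi>" unfolding \<phi>_def by (intro continuous_intros u(1))
  have csmall: "continuous_on {0..} (small \<delta>)" for \<delta>
    unfolding small_def by (intro continuous_intros cphi)
  have S0: "0 \<in> S"
    using assms by (auto simp: S_def C_def small_def \<phi>_def u(2) intro!: bexI[of _ \<gamma>])
  obtain m where m: "m > 0" "\<And>\<delta>. \<delta> \<in> \<Gamma> \<Longrightarrow> tl2 \<delta> \<noteq> 0 \<Longrightarrow> m \<le> norm (tl2 \<delta>)"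
    using norm_tl2_lower_bound by blast
  define G where "G = norm (tl2 \<gamma>)"
  have G: "G > 0" using assms(2) by (simp add: G_def)
  \<comment> \<open>Every \<open>\<delta>\<close> in C has trace-free part
    \<open>q *\<^sub>R tl2 \<gamma>\<close> with |q| at least \<open>m / G\<close>, so all of C
    grows along the path at a common linear rate.\<close>
  have bound: "t \<le> G / (10 * m * k)" if tS: "t \<in> S" for t
  proof -
    obtain \<delta> where d: "\<delta> \<in> C" "small \<delta> t < 1/10" and t: "t \<ge> 0" using tS unfolding S_def by blast
    obtain q where q: "tl2 \<delta> = q *\<^sub>R tl2 \<gamma>"
      using commute_imp_parallel[of \<gamma> \<delta>] d assms(2) by (auto simp: C_def)
    have mq: "m \<le> \<bar>q\<bar> * G" using m(2)[of \<delta>] d q by (auto simp: C_def G_def)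
    have "tl2 (adj2 (\<phi> t) ** \<delta> ** \<phi> t) = q *\<^sub>R (adj2 (u t) ** N ** u t)"
      unfolding tl2_conj[OF phiSL[OF t]] q by (simp add: \<phi>_def conj_mult N_def matrix_mult_algebra)
    then have "\<bar>q\<bar> * norm (adj2 (u t) ** N ** u t) \<le> small \<delta> t"
      using norm_tl2_le[of "adj2 (\<phi> t) ** \<delta> ** \<phi> t" 1] by (simp add: small_def)
    moreover have "\<bar>q\<bar> * (k * t) \<le> \<bar>q\<bar> * norm (adj2 (u t) ** N ** u t)"
      using u(5)[OF t] by (intro mult_left_mono) auto
    ultimately have "\<bar>q\<bar> * (k * t) \<le> 1/10" using d(2) by linarith
    then have "G * (\<bar>q\<bar> * (k * t)) \<le> G * (1/10)" using G by (intro mult_left_mono) auto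
    moreover have "m * (k * t) \<le> \<bar>q\<bar> * G * (k * t)" using mq u(4) t by (intro mult_right_mono) auto
    ultimately have "m * (k * t) \<le> G / 10" by (simp add: algebra_simps)
    then show ?thesis using m(1) u(4) by (simp add: field_simps)
  qed
  then have bdd: "bdd_above S" by (auto simp: bdd_above_def)
  define T where "T = Sup S"
  have T0: "T \<ge> 0" unfolding T_def using S0 bdd by (rule cSup_upper)
  have near: "\<exists>d>0. \<forall>t\<ge>0. \<bar>t - T\<bar> < d \<longrightarrow> \<bar>small \<delta> t - small \<delta> T\<bar> < e" if "e > 0" for \<delta> e
  proof -
    have "T \<in> {0..}" using T0 by simp
    then obtain d where "d > 0" "\<forall>t\<in>{0..}. dist t T < d \<longrightarrow> dist (small \<delta> t) (small \<delta> T) < e"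
      using csmall[of \<delta>, unfolded continuous_on_iff] \<open>e > 0\<close> by blast
    then show ?thesis by (intro exI[of _ d]) (auto simp: dist_real_def)
  qed
  have TS: "T \<notin> S"
  proof
    assume "T \<in> S"
    then obtain \<delta> where d: "\<delta> \<in> C" "small \<delta> T < 1/10" unfolding S_def by blast
    obtain d where d': "d > 0" "\<And>t. t \<ge> 0 \<Longrightarrow> \<bar>t - T\<bar> < d \<Longrightarrow> \<bar>small \<delta> t - small \<delta> T\<bar> < 1/10 - small \<delta> T"
      using near[of "1/10 - small \<delta> T" \<delta>] d(2) by auto
    have "small \<delta> (T + d/2) < 1/10" using d'(2)[of "T + d/2"] d'(1) T0 by (simp add: abs_less_iff)
    moreover have "T + d/2 \<ge> 0" using T0 d'(1) by simp
    ultimately have "T + d/2 \<in> S" using d(1) unfolding S_def by blast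
    then have "T + d/2 \<le> T" unfolding T_def using bdd by (rule cSup_upper)
    then show False using d'(1) by simp
  qed
  \<comment> \<open>Only finitely many elements can be small somewhere on the compact path, so if
    all exceeded 1/10 at T they would still do so shortly before T, against the choice of the
    supremum.\<close>
  have "\<exists>\<delta>\<in>C. small \<delta> T \<le> 1/10"
  proof (rule ccontr)
    assume "\<not> ?thesis"
    then have no: "\<And>\<delta>. \<delta> \<in> C \<Longrightarrow> small \<delta> T > 1/10" by force
    have "compact (\<phi> ` {0..T})"
      by (intro compact_continuous_image continuous_on_subset[OF cphi]) auto
    from compact_imp_bounded[OF this]
    obtain B where B: "B > 0" "\<And>t. t \<in> {0..T} \<Longrightarrow> norm (\<phi> t) \<le> B"
      unfolding bounded_pos by blast
    define F where "F = {\<delta> \<in> C. norm \<delta> \<le> B * 2 * B}"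
    have "F \<subseteq> {A \<in> \<Gamma>. norm A \<le> B * 2 * B}" by (auto simp: F_def C_def)
    then have finF: "finite F" using fin finite_subset by blast
    have "\<exists>d>0. \<forall>t\<ge>0. \<bar>t - T\<bar> < d \<longrightarrow> \<bar>small \<delta> t - small \<delta> T\<bar> < small \<delta> T - 1/10" if "\<delta> \<in> F" for \<delta>
      using near no that by (auto simp: F_def)
    then obtain d where d: "\<And>\<delta>. \<delta> \<in> F \<Longrightarrow> d \<delta> > 0"
      "\<And>\<delta> t. \<delta> \<in> F \<Longrightarrow> t \<ge> 0 \<Longrightarrow> \<bar>t - T\<bar> < d \<delta> \<Longrightarrow> \<bar>small \<delta> t - small \<delta> T\<bar> < small \<delta> T - 1/10" by metis
    obtain e where e: "e > 0" "\<And>\<delta>. \<delta> \<in> F \<Longrightarrow> e \<le> d \<delta>"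
      using finite_positive_lower_bound[OF finF, of d] d(1) by auto
    obtain t where t: "t \<in> S" "T - e < t" using less_cSupE[of "T - e" S] S0 e(1) by (auto simp: T_def)
    have tT: "t \<le> T" unfolding T_def using t(1) bdd by (rule cSup_upper)
    have t0: "t \<ge> 0" using t(1) by (simp add: S_def)
    obtain \<delta> where \<delta>: "\<delta> \<in> C" "small \<delta> t < 1/10" using t(1) unfolding S_def by blast
    have "norm \<delta> \<le> norm (\<phi> t) * 2 * norm (\<phi> t)"
      using norm_le_conj[OF phiSL[OF t0]] \<delta>(2) by (simp add: small_def)
    also have "\<dots> \<le> B * 2 * B" using B(1) B(2)[of t] tT t0 by (intro mult_mono) auto
    finally have F: "\<delta> \<in> F" using \<delta>(1) by (simp add: F_def)
    have "\<bar>t - T\<bar> < d \<delta>" using e(2)[OF F] t(2) tT by linarith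
    from d(2)[OF F t0 this] show False using \<delta>(2) by linarith
  qed
  then obtain \<delta> where \<delta>: "\<delta> \<in> C" "small \<delta> T \<le> 1/10" by blast
  \<comment> \<open>An element \<open>\<delta>2\<close> violating thickness commutes with the small
    \<open>\<delta>\<close>, hence with \<open>\<gamma>\<close>, and so would put T into S.\<close>
  have "thick (\<phi> T)"
    unfolding thick_def
  proof (intro ballI impI, rule ccontr)
    fix \<delta>2 assume d2: "\<delta>2 \<in> \<Gamma>" "tl2 \<delta>2 \<noteq> 0" "\<not> 1/10 \<le> norm (adj2 (\<phi> T) ** \<delta>2 ** \<phi> T - mat 1)"
    have "\<delta> ** \<delta>2 = \<delta>2 ** \<delta>"
      by (rule small_commute[OF _ d2(1) phiSL[OF T0]]) (use \<delta> d2 in \<open>auto simp: small_def C_def\<close>)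
    then have "\<delta>2 ** \<gamma> = \<gamma> ** \<delta>2"
      by (rule commute_trans) (use \<delta> d2 in \<open>auto simp: C_def\<close>)
    then have "\<delta>2 \<in> C" using d2 by (simp add: C_def)
    moreover have "small \<delta>2 T < 1/10" using d2(3) by (simp add: small_def)
    ultimately have "T \<in> S" using T0 unfolding S_def by blast
    then show False using TS by blast
  qed
  then show ?thesis using phiSL[OF T0] \<delta> by (auto simp: C_def small_def)
qed

text \<open>The exit point belonging to a thin g is moved by \<open>\<sigma>\<close> into the ball
  of radius R, so the conjugate of the element \<open>\<delta>\<close> small there lies in a finite
  set E. The element \<open>\<gamma>\<close> that is small at g has trace-free part q times that of
  \<open>\<delta>\<close>, and discreteness bounds |q| from below; smallness of
  \<open>\<gamma>\<close> at g thus becomes boundedness of \<open>\<delta>\<close> at g.\<close>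

lemma thin_reduce:
  assumes R: "R > 0" "\<And>w. w \<in> SL2 \<Longrightarrow> thick w \<Longrightarrow> \<exists>\<sigma>\<in>\<Gamma>. norm (\<sigma> ** w) \<le> R"
  shows "\<exists>E R2. finite E \<and> E \<subseteq> {\<delta> \<in> \<Gamma>. tl2 \<delta> \<noteq> 0} \<and> R2 > 0 \<and>
    (\<forall>g\<in>SL2. \<not> thick g \<longrightarrow> (\<exists>\<sigma>\<in>\<Gamma>. \<exists>\<delta>\<in>E. norm (adj2 (\<sigma> ** g) ** tl2 \<delta> ** (\<sigma> ** g)) \<le> R2))"
proof -
  obtain m where m: "m > 0" "\<And>\<delta>. \<delta> \<in> \<Gamma> \<Longrightarrow> tl2 \<delta> \<noteq> 0 \<Longrightarrow> m \<le> norm (tl2 \<delta>)"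
    using norm_tl2_lower_bound by blast
  define E where "E = {\<delta> \<in> {A \<in> \<Gamma>. norm A \<le> R * 2 * R}. tl2 \<delta> \<noteq> 0}"
  define R2 where "R2 = R * 2 * R / (10 * m)"
  have "\<exists>\<sigma>\<in>\<Gamma>. \<exists>\<delta>\<in>E. norm (adj2 (\<sigma> ** g) ** tl2 \<delta> ** (\<sigma> ** g)) \<le> R2"
    if g: "g \<in> SL2" "\<not> thick g" for g
  proof -
    obtain \<gamma> where \<gamma>: "\<gamma> \<in> \<Gamma>" "tl2 \<gamma> \<noteq> 0" "norm (adj2 g ** \<gamma> ** g - mat 1) < 1/10"
      using g(2) by (auto simp: thick_def not_le)
    obtain w \<delta> where w: "w \<in> SL2" "thick w" and d: "\<delta> \<in> \<Gamma>" "tl2 \<delta> \<noteq> 0" "\<delta> ** \<gamma> = \<gamma> ** \<delta>"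
      "norm (adj2 w ** \<delta> ** w - mat 1) \<le> 1/10" using exit_thin[OF \<gamma>(1,2) g(1) \<gamma>(3)] by blast
    obtain \<sigma> where s: "\<sigma> \<in> \<Gamma>" "norm (\<sigma> ** w) \<le> R" using R(2)[OF w] by blast
    have S: "\<sigma> \<in> SL2" using s sub by blast
    define \<delta>' where "\<delta>' = adj2 (adj2 \<sigma>) ** \<delta> ** adj2 \<sigma>"
    define \<gamma>' where "\<gamma>' = adj2 (adj2 \<sigma>) ** \<gamma> ** adj2 \<sigma>"
    have bk: "adj2 (\<sigma> ** h) ** (adj2 (adj2 \<sigma>) ** A ** adj2 \<sigma>) ** (\<sigma> ** h) = adj2 h ** A ** h" for h A
      using S by (simp only: adj2_mult_distrib adj2_adj2 matrix_mul_assoc[symmetric] adj2_mult_cancel)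
    have "\<delta>' \<in> \<Gamma>" "\<gamma>' \<in> \<Gamma>" unfolding \<delta>'_def \<gamma>'_def using s d \<gamma> by (auto intro!: mult inv)
    have ntl: "tl2 \<delta>' \<noteq> 0" "tl2 \<gamma>' \<noteq> 0"
      unfolding \<delta>'_def \<gamma>'_def using tl2_conj_eq_0[of "adj2 \<sigma>"] S d \<gamma> by auto
    have "norm \<delta>' \<le> norm (\<sigma> ** w) * 2 * norm (\<sigma> ** w)"
      by (rule norm_le_conj) (use S w d in \<open>auto simp: \<delta>'_def bk simp del: adj2_adj2\<close>)
    also have "\<dots> \<le> R * 2 * R" using s(2) R(1) by (intro mult_mono) auto
    finally have nd: "norm \<delta>' \<le> R * 2 * R" .
    then have E: "\<delta>' \<in> E" using \<open>\<delta>' \<in> \<Gamma>\<close> ntl by (simp add: E_def)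
    obtain q where q: "tl2 \<gamma> = q *\<^sub>R tl2 \<delta>" using commute_imp_parallel[OF d(3,2)] by blast
    have "tl2 \<gamma>' = q *\<^sub>R tl2 \<delta>'"
      unfolding \<delta>'_def \<gamma>'_def using S by (subst (1 2) tl2_conj) (auto simp: q matrix_mult_algebra)
    then have mq: "m \<le> \<bar>q\<bar> * norm (tl2 \<delta>')" using m(2)[OF \<open>\<gamma>' \<in> \<Gamma>\<close> ntl(2)] by simp
    define X where "X = adj2 g ** tl2 \<delta> ** g"
    have "q *\<^sub>R X = tl2 (adj2 g ** \<gamma> ** g)"
      unfolding tl2_conj[OF g(1)] q X_def by (simp add: matrix_mult_algebra)
    then have "norm (q *\<^sub>R X) \<le> norm (adj2 g ** \<gamma> ** g - 1 *\<^sub>R mat 1)"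
      using norm_tl2_le by metis
    then have "\<bar>q\<bar> * norm X \<le> 1/10" using \<gamma>(3) by simp
    then have "norm (tl2 \<delta>') * (\<bar>q\<bar> * norm X) \<le> norm (tl2 \<delta>') * (1/10)" by (intro mult_left_mono) auto
    moreover have "m * norm X \<le> \<bar>q\<bar> * norm (tl2 \<delta>') * norm X" using mq by (intro mult_right_mono) auto
    moreover have "norm (tl2 \<delta>') \<le> R * 2 * R" using norm_tl2_le[of \<delta>' 0] nd by simp
    ultimately have "m * norm X \<le> R * 2 * R / 10" by (simp add: algebra_simps)
    then have "norm X \<le> R2" using m(1) by (simp add: R2_def field_simps)
    moreover have "adj2 (\<sigma> ** g) ** tl2 \<delta>' ** (\<sigma> ** g) = X"
      unfolding \<delta>'_def using S tl2_conj[of "adj2 \<sigma>" \<delta>] bk X_def by (simp del: adj2_adj2)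
    ultimately show ?thesis using s(1) E by auto
  qed
  moreover have "finite E" unfolding E_def by (rule finite_subset[OF _ fin[of "R * 2 * R"]]) blast
  moreover have "E \<subseteq> {\<delta> \<in> \<Gamma>. tl2 \<delta> \<noteq> 0}" by (auto simp: E_def)
  moreover have "R2 > 0" using R m by (simp add: R2_def)
  ultimately show ?thesis by blast
qed

end

text \<open>The off-diagonal entries of the conjugate are, up to sign, the values at the columns of
  g of a quadratic form of discriminant -4 det N. For det N > 0 the form is definite, so a bound on
  its values bounds the columns.\<close>

lemma elliptic_bounded:
  assumes "N$2$2 = - N$1$1" "det N > 0" "norm (adj2 g ** N ** g) \<le> r"
  shows "(norm g)\<^sup>2 \<le> 2 * ((\<bar>N$1$2\<bar> + \<bar>N$2$1\<bar>) * r / det N)"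
proof -
  have form: "D * (x\<^sup>2 + y\<^sup>2) \<le> (\<bar>b\<bar> + \<bar>c\<bar>) * \<bar>c * x\<^sup>2 - 2 * a * x * y - b * y\<^sup>2\<bar>"
    if "D = - a * a - b * c" for a b c x y D :: real
  proof -
    define Q where "Q = c * x\<^sup>2 - 2 * a * x * y - b * y\<^sup>2"
    have "c * Q = (c * x - a * y)\<^sup>2 + D * y\<^sup>2" "- (b * Q) = (b * y + a * x)\<^sup>2 + D * x\<^sup>2"
      unfolding Q_def that by (simp_all add: power2_eq_square algebra_simps)
    then have "D * y\<^sup>2 \<le> c * Q" "D * x\<^sup>2 \<le> - (b * Q)" by simp_all
    then have "D * y\<^sup>2 \<le> \<bar>c * Q\<bar>" "D * x\<^sup>2 \<le> \<bar>b * Q\<bar>" by linarith+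
    then show ?thesis unfolding Q_def[symmetric] by (simp only: abs_mult distrib_left distrib_right)
  qed
  define D where "D = det N"
  have D: "D = - N$1$1 * N$1$1 - N$1$2 * N$2$1" by (simp add: D_def det_2 assms(1))
  have "(adj2 g ** N ** g)$2$1 = N$2$1 * (g$1$1)\<^sup>2 - 2 * N$1$1 * g$1$1 * g$2$1 - N$1$2 * (g$2$1)\<^sup>2"
    "(adj2 g ** N ** g)$1$2 = - (N$2$1 * (g$1$2)\<^sup>2 - 2 * N$1$1 * g$1$2 * g$2$2 - N$1$2 * (g$2$2)\<^sup>2)"
    by (simp_all add: matrix_mult_nth_2 assms(1) power2_eq_square algebra_simps)
  then have *: "\<bar>N$2$1 * (g$1$1)\<^sup>2 - 2 * N$1$1 * g$1$1 * g$2$1 - N$1$2 * (g$2$1)\<^sup>2\<bar> \<le> r"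
    "\<bar>N$2$1 * (g$1$2)\<^sup>2 - 2 * N$1$1 * g$1$2 * g$2$2 - N$1$2 * (g$2$2)\<^sup>2\<bar> \<le> r"
    using entry_le_norm[of "adj2 g ** N ** g" 2 1] entry_le_norm[of "adj2 g ** N ** g" 1 2] assms(3) by auto
  have "D * ((g$1$1)\<^sup>2 + (g$2$1)\<^sup>2) \<le> (\<bar>N$1$2\<bar> + \<bar>N$2$1\<bar>) * r"
    by (rule order_trans[OF form[OF D] mult_left_mono[OF *(1)]]) auto
  moreover have "D * ((g$1$2)\<^sup>2 + (g$2$2)\<^sup>2) \<le> (\<bar>N$1$2\<bar> + \<bar>N$2$1\<bar>) * r"
    by (rule order_trans[OF form[OF D] mult_left_mono[OF *(2)]]) auto
  ultimately have "D * (norm g)\<^sup>2 \<le> 2 * ((\<bar>N$1$2\<bar> + \<bar>N$2$1\<bar>) * r)"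
    unfolding norm_matrix_2 by (simp add: algebra_simps)
  then show ?thesis using assms(2) by (simp add: D_def field_simps)
qed

lemma hyperbolic_diagonalize:
  fixes N :: "real^2^2"
  assumes "N$2$2 = - N$1$1" "det N < 0"
  shows "\<exists>L\<in>SL2. \<exists>l. l \<noteq> 0 \<and> N = L ** mat2 l 0 0 (- l) ** adj2 L"
proof -
  define a b c where "a = N$1$1" and "b = N$1$2" and "c = N$2$1"
  have pos: "a * a + b * c > 0" using assms by (simp add: det_2 a_def b_def c_def)
  have fromL: "N = L ** M ** adj2 L" if "L \<in> SL2" "N ** L = L ** M" for L M
    by (simp only: that(2)[symmetric] matrix_mul_assoc[symmetric] adj2_mult(2)[OF that(1)] matrix_mul_rid)
  show ?thesis
  proof (cases "c = 0")
    case True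
    then have a: "a \<noteq> 0" using pos by auto
    define L where "L = mat2 1 (- b / (2 * a)) 0 1"
    have "L \<in> SL2" by (simp add: L_def SL2_iff)
    moreover have "N ** L = L ** mat2 a 0 0 (- a)"
      using True a assms(1) by (simp add: matrix_eq_2 matrix_mult_nth_2 L_def a_def b_def c_def)
    ultimately show ?thesis using a fromL by blast
  next
    case False
    define l where "l = sqrt (a * a + b * c)"
    have l: "l > 0" "l * l = a * a + b * c" using pos by (auto simp: l_def)
    \<comment> \<open>The columns of L are eigenvectors for l and -l; dividing the second one by
      \<open>2 * l * c\<close> gives determinant 1.\<close>
    define k where "k = 2 * l * c"
    have k: "k \<noteq> 0" using l(1) False by (simp add: k_def)
    define L where "L = mat2 (a + l) ((a - l) / k) c (c / k)"
    have "(a + l) * (c / k) - (a - l) / k * c = 1" using k unfolding k_def by (simp add: field_simps)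
    then have "L \<in> SL2" by (simp add: L_def SL2_iff)
    moreover have "N ** L = L ** mat2 l 0 0 (- l)"
    proof -
      have "a * (a + l) + b * c = (a + l) * l" using l(2) by (simp add: algebra_simps)
      moreover have "a * ((a - l) / k) + b * (c / k) = - ((a - l) / k * l)"
      proof -
        have "a * (a - l) + b * c = - ((a - l) * l)" using l(2) by (simp add: algebra_simps)
        then have "(a * (a - l) + b * c) / k = - ((a - l) * l) / k" by simp
        then show ?thesis by (simp add: add_divide_distrib)
      qed
      moreover have "c * (a + l) - a * c = c * l" by (simp add: algebra_simps)
      moreover have "c * ((a - l) / k) - a * (c / k) = - (c / k * l)"
        by (simp add: diff_divide_distrib algebra_simps)
      ultimately show ?thesis using assms(1)
        by (simp add: matrix_eq_2 matrix_mult_nth_2 L_def a_def[symmetric] b_def[symmetric] c_def[symmetric])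
    qed
    ultimately show ?thesis using l(1) fromL by (metis less_irrefl)
  qed
qed

lemma power_int_normalize:
  fixes \<nu> A :: real
  assumes "\<nu> > 0" "\<nu> \<noteq> 1" "A > 0"
  shows "\<exists>n::int. 1 \<le> \<nu> powi n * A \<and> \<nu> powi n * A \<le> max \<nu> (1 / \<nu>)"
proof -
  have gt: "\<exists>n::int. 1 \<le> v powi n * A \<and> v powi n * A \<le> v" if v: "v > 1" for v :: real
  proof -
    define n where "n = \<lceil>- ln A / ln v\<rceil>"
    have lv: "ln v > 0" using v by simp
    have "- ln A / ln v \<le> n" "n < - ln A / ln v + 1" unfolding n_def by linarith+
    then have "- ln A \<le> n * ln v" "n * ln v \<le> - ln A + ln v" using lv by (auto simp: field_simps)
    moreover have "ln (v powi n * A) = n * ln v + ln A" using v assms(3)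
      by (simp add: ln_mult powr_real_of_int'[symmetric])
    ultimately have "ln (v powi n * A) \<ge> 0" "ln (v powi n * A) \<le> ln v" by auto
    moreover have "v powi n * A > 0" using v assms(3) by simp
    ultimately show ?thesis using v by (metis ln_ge_zero_iff ln_le_cancel_iff less_trans zero_less_one)
  qed
  show ?thesis
  proof (cases "\<nu> > 1")
    case True
    then show ?thesis using gt[OF True] by (meson max.coboundedI1)
  next
    case False
    then have "1 / \<nu> > 1" using assms by simp
    then obtain n where "1 \<le> (1/\<nu>) powi n * A" "(1/\<nu>) powi n * A \<le> 1/\<nu>" using gt by blast
    moreover have "(1/\<nu>) powi n = \<nu> powi (- n)"
      by (simp add: power_int_minus power_int_divide_distrib field_simps)
    ultimately show ?thesis by (metis max.coboundedI2)
  qed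
qed

text \<open>The bound on the conjugate keeps \<open>g i\<close> within bounded distance of the axis
  of \<open>\<delta>\<close>, and a power of \<open>\<delta>\<close> translates it along the axis
  into a compact region.\<close>

lemma (in discrete_SL2) hyperbolic_bounded:
  assumes "\<delta> \<in> \<Gamma>" "det (tl2 \<delta>) < 0"
  shows "\<exists>B. \<forall>g\<in>SL2. norm (adj2 g ** tl2 \<delta> ** g) \<le> r \<longrightarrow> (\<exists>\<sigma>\<in>\<Gamma>. norm (\<sigma> ** g) \<le> B)"
proof -
  obtain L l where L: "L \<in> SL2" "l \<noteq> 0" "tl2 \<delta> = L ** mat2 l 0 0 (- l) ** adj2 L"
    using hyperbolic_diagonalize[of "tl2 \<delta>"] assms by auto
  define h where "h = hf \<delta>"
  define \<mu> where "\<mu> = h + l"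
  \<comment> \<open>\<open>D \<mu>\<close> is \<open>\<delta>\<close> written in its eigenbasis L,
    and D is multiplicative, so the integral powers of \<open>\<mu>\<close> give group
    elements.\<close>
  define D where "D x = L ** mat2 x 0 0 (inverse x) ** adj2 L" for x
  have dL: "det L = 1" "det (adj2 L) = 1" using L(1) SL2_adj2[of L] by (simp_all add: SL2_def del: SL2_adj2)
  have "det (mat2 l 0 0 (- l)) = - (l * l)" by (simp add: det_2)
  then have "det (tl2 \<delta>) = - (l * l)" unfolding L(3) det_mul dL by simp
  then have "(h + l) * (h - l) = 1" using det_decomp[of \<delta>] sub[OF assms(1)]
    by (simp add: SL2_def h_def power2_eq_square algebra_simps)
  then have inv\<mu>: "h - l = inverse \<mu>" and \<mu>0: "\<mu> \<noteq> 0"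
    unfolding \<mu>_def by (auto simp: inverse_unique)
  have "L ** adj2 L = mat 1" using L(1) by (rule adj2_mult)
  then have "\<delta> = L ** (h *\<^sub>R mat 1 + mat2 l 0 0 (- l)) ** adj2 L"
    using tl2_decomp[of \<delta>] by (simp add: h_def L(3) matrix_mult_algebra)
  also have "h *\<^sub>R mat 1 + mat2 l 0 0 (- l) = mat2 \<mu> 0 0 (inverse \<mu>)"
    unfolding inv\<mu>[symmetric] by (simp add: matrix_eq_2 \<mu>_def)
  finally have \<delta>D: "\<delta> = D \<mu>" by (simp add: D_def)
  have DD: "D x ** D y = D (x * y)" for x y
  proof -
    have "mat2 x 0 0 (inverse x) ** mat2 y 0 0 (inverse y) = mat2 (x * y) 0 0 (inverse (x * y))"
      by (simp add: matrix_eq_2 matrix_mult_nth_2)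
    then show ?thesis unfolding D_def
      by (simp only: matrix_mul_assoc[symmetric] adj2_mult_cancel(1)[OF L(1)]) (simp only: matrix_mul_assoc)
  qed
  have Dnat: "D (\<mu> ^ n) \<in> \<Gamma>" for n
  proof (induction n)
    case 0
    have "mat2 1 0 0 1 = mat 1" by (simp add: matrix_eq_2)
    then show ?case using adj2_mult(2)[OF L(1)] by (simp add: D_def)
  next
    case (Suc n)
    have "\<delta> ** D (\<mu> ^ n) \<in> \<Gamma>" using assms(1) Suc by (rule mult)
    then show ?case unfolding \<delta>D DD power_Suc .
  qed
  have adjD: "adj2 (D x) = D (inverse x)" for x
  proof -
    have "adj2 (mat2 x 0 0 (inverse x)) = mat2 (inverse x) 0 0 (inverse (inverse x))" by (simp add: matrix_eq_2)
    then show ?thesis unfolding D_def by (simp add: adj2_mult_distrib matrix_mul_assoc)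
  qed
  have Dint: "D (\<mu> powi n) \<in> \<Gamma>" for n
  proof (cases "n \<ge> 0")
    case True
    then show ?thesis using Dnat[of "nat n"] by (simp add: power_int_def)
  next
    case False
    then have "\<mu> powi n = inverse (\<mu> ^ nat (- n))" by (simp add: power_int_def power_inverse)
    then show ?thesis using inv[OF Dnat[of "nat (- n)"]] adjD by simp
  qed
  define \<nu> where "\<nu> = \<mu>\<^sup>2"
  have \<nu>: "\<nu> > 0" "\<nu> \<noteq> 1"
  proof -
    show "\<nu> > 0" using \<mu>0 by (simp add: \<nu>_def)
    show "\<nu> \<noteq> 1"
    proof
      assume "\<nu> = 1"
      then have "inverse \<mu> = \<mu>" by (simp add: \<nu>_def power2_eq_square inverse_unique)
      then show False using inv\<mu> L(2) by (simp add: \<mu>_def)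
    qed
  qed
  define B where "B = norm L * sqrt (max \<nu> (1 / \<nu>) + (1 + (r / \<bar>l\<bar>)\<^sup>2))"
  have "\<exists>\<sigma>\<in>\<Gamma>. norm (\<sigma> ** g) \<le> B" if g: "g \<in> SL2" "norm (adj2 g ** tl2 \<delta> ** g) \<le> r" for g
  proof -
    define f where "f = adj2 L ** g"
    have f: "f \<in> SL2" using g L by (simp add: f_def)
    have "adj2 g ** tl2 \<delta> ** g = adj2 f ** mat2 l 0 0 (- l) ** f"
      by (simp add: f_def L(3) adj2_mult_distrib matrix_mul_assoc)
    then have fr: "norm (adj2 f ** mat2 l 0 0 (- l) ** f) \<le> r" using g(2) by simp
    \<comment> \<open>Squared lengths of the rows of f. Their product measures the distance from the
      axis and is kept by \<open>mat2 x 0 0 (inverse x)\<close>, which multiplies A by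
      \<open>x\<^sup>2\<close> and divides C by it.\<close>
    define A C where "A = (f$1$1)\<^sup>2 + (f$1$2)\<^sup>2" and "C = (f$2$1)\<^sup>2 + (f$2$2)\<^sup>2"
    have "f$1$1 * f$2$2 - f$1$2 * f$2$1 = 1" using f by (simp add: SL2_iff)
    moreover have "A * C = (f$1$1 * f$2$1 + f$1$2 * f$2$2)\<^sup>2 + (f$1$1 * f$2$2 - f$1$2 * f$2$1)\<^sup>2"
      by (simp add: A_def C_def power2_eq_square algebra_simps)
    ultimately have AC: "A * C = (f$1$1 * f$2$1 + f$1$2 * f$2$2)\<^sup>2 + 1" by simp
    have "(adj2 f ** mat2 l 0 0 (- l) ** f)$2$1 = - (2 * l * (f$1$1 * f$2$1))"
      "(adj2 f ** mat2 l 0 0 (- l) ** f)$1$2 = 2 * l * (f$1$2 * f$2$2)"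
      by (simp_all add: matrix_mult_nth_2)
    then have "2 * \<bar>l\<bar> * \<bar>f$1$1 * f$2$1\<bar> \<le> r" "2 * \<bar>l\<bar> * \<bar>f$1$2 * f$2$2\<bar> \<le> r"
      using fr entry_le_norm[of "adj2 f ** mat2 l 0 0 (- l) ** f" 2 1]
        entry_le_norm[of "adj2 f ** mat2 l 0 0 (- l) ** f" 1 2] by (auto simp: abs_mult)
    then have "\<bar>f$1$1 * f$2$1\<bar> + \<bar>f$1$2 * f$2$2\<bar> \<le> r / \<bar>l\<bar>" using L(2) by (simp add: field_simps)
    then have "\<bar>f$1$1 * f$2$1 + f$1$2 * f$2$2\<bar> \<le> r / \<bar>l\<bar>" by linarith
    then have "(f$1$1 * f$2$1 + f$1$2 * f$2$2)\<^sup>2 \<le> (r / \<bar>l\<bar>)\<^sup>2" by (metis abs_ge_zero power2_abs power_mono)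
    then have AC': "A * C \<le> 1 + (r / \<bar>l\<bar>)\<^sup>2" using AC by simp
    have "A * C > 0" using AC by (simp add: add_nonneg_pos)
    moreover have "A \<ge> 0" "C \<ge> 0" by (simp_all add: A_def C_def)
    ultimately have A: "A > 0" "C > 0" by (auto simp: zero_less_mult_iff)
    obtain n where n: "1 \<le> \<nu> powi n * A" "\<nu> powi n * A \<le> max \<nu> (1 / \<nu>)"
      using power_int_normalize[OF \<nu> A(1)] by blast
    define x where "x = \<mu> powi n"
    have x: "x\<^sup>2 = \<nu> powi n" "x \<noteq> 0"
      unfolding x_def \<nu>_def power2_eq_square using \<mu>0 by (simp_all only: power_int_mult_distrib power_int_eq_0_iff) simp
    define M where "M = mat2 x 0 0 (inverse x) ** f"
    have "D x ** g = L ** M" by (simp add: D_def M_def f_def matrix_mul_assoc)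
    moreover have "norm M \<le> sqrt (max \<nu> (1 / \<nu>) + (1 + (r / \<bar>l\<bar>)\<^sup>2))"
    proof (rule real_le_rsqrt)
      have "(norm M)\<^sup>2 = x\<^sup>2 * A + (inverse x)\<^sup>2 * C"
        by (simp add: norm_matrix_2 M_def matrix_mult_nth_2 A_def C_def power_mult_distrib algebra_simps)
      moreover have "(inverse x)\<^sup>2 * C = A * C / (x\<^sup>2 * A)" using A x(2) by (simp add: field_simps)
      moreover have "A * C / (x\<^sup>2 * A) \<le> A * C / 1"
        using n(1) x(1) A by (intro divide_left_mono) auto
      ultimately show "(norm M)\<^sup>2 \<le> max \<nu> (1 / \<nu>) + (1 + (r / \<bar>l\<bar>)\<^sup>2)" using n(2) x(1) AC' by simp
    qed
    ultimately have "norm (D x ** g) \<le> B"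
      unfolding B_def using order_trans[OF norm_matrix_mult_le[of L M] mult_left_mono[OF _ norm_ge_zero]] by simp
    then show ?thesis using Dint[of n] unfolding x_def by blast
  qed
  then show ?thesis by blast
qed

section \<open>Compactness of the thick part\<close>

definition to_R2 :: "complex \<Rightarrow> real^2" where "to_R2 z = vector [Re z, Im z]"
definition from_R2 :: "real^2 \<Rightarrow> complex" where "from_R2 x = Complex (x$1) (x$2)"

lemma to_R2_nth [simp]: "to_R2 z $ 1 = Re z" "to_R2 z $ 2 = Im z"
  by (simp_all add: to_R2_def)

lemma from_to_R2 [simp]: "from_R2 (to_R2 z) = z" "to_R2 (from_R2 x) = x"
  by (simp_all add: from_R2_def complex_eq_iff vec_eq_iff forall_2)

lemma Re_Im_from_R2 [simp]: "Re (from_R2 x) = x$1" "Im (from_R2 x) = x$2"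
  by (simp_all add: from_R2_def)

lemma bounded_linear_from_R2: "bounded_linear from_R2"
  by (intro linear_conv_bounded_linear[THEN iffD1] linearI) (simp_all add: complex_eq_iff)

lemma bounded_linear_to_R2: "bounded_linear to_R2"
  by (intro linear_conv_bounded_linear[THEN iffD1] linearI) (simp_all add: vec_eq_iff forall_2)

lemma from_R2_measurable [measurable]: "from_R2 \<in> borel_measurable borel"
  by (intro borel_measurable_continuous_onI linear_continuous_on bounded_linear_from_R2)

lemma prod_Basis_R2: "(\<Prod>b\<in>(Basis :: (real^2) set). x \<bullet> b) = x$1 * x$2" for x :: "real^2"
proof -
  have B: "(Basis :: (real^2) set) = {axis 1 1, axis 2 1}"
    by (auto simp: Basis_vec_def UNIV_2)
  have "axis 1 1 \<noteq> (axis 2 1 :: real^2)" by (simp add: axis_eq_axis)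
  then show ?thesis unfolding B by (simp add: inner_axis)
qed

text \<open>Equality is checked on boxes, where both sides are products of side lengths. It moves
  integrals to \<open>real^2\<close>, where the change of variables has a Jacobian
  determinant.\<close>

lemma lborel_complex_R2: "(lborel :: complex measure) = distr lborel borel from_R2"
proof (rule lborel_eqI)
  fix l u :: complex
  assume lu: "\<And>b. b \<in> Basis \<Longrightarrow> l \<bullet> b \<le> u \<bullet> b"
  have le: "Re l \<le> Re u" "Im l \<le> Im u" using lu[of 1] lu[of \<i>] by (simp_all add: Basis_complex_def inner_complex_def)
  have "from_R2 -` box l u = box (to_R2 l) (to_R2 u)"
    by (auto simp: in_box_complex_iff mem_box_cart forall_2)
  then have "emeasure (distr lborel borel from_R2) (box l u) = emeasure lborel (box (to_R2 l) (to_R2 u))"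
    by (subst emeasure_distr) auto
  also have "\<dots> = (\<Prod>b\<in>Basis. (to_R2 u - to_R2 l) \<bullet> b)"
    by (rule emeasure_lborel_box)
       (use le in \<open>auto simp: Basis_vec_def inner_axis forall_2 split: if_splits\<close>, metis exhaust_2 to_R2_nth)
  also have "(\<Prod>b\<in>Basis. (to_R2 u - to_R2 l) \<bullet> b) = (\<Prod>b\<in>Basis. (u - l) \<bullet> b)"
    unfolding prod_Basis_R2 by (simp add: Basis_complex_def inner_complex_def)
  finally show "emeasure (distr lborel borel from_R2) (box l u) = (\<Prod>b\<in>Basis. (u - l) \<bullet> b)" .
qed simp

lemma hyperbolic_area_R2:
  assumes "S \<in> sets borel"
  shows "hyperbolic_area S = (\<integral>\<^sup>+ x. ennreal (1 / (x$2)\<^sup>2) * indicator (from_R2 -` S) x \<partial>lborel)"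
proof -
  have [measurable]: "S \<in> sets borel" by fact
  have "hyperbolic_area S = (\<integral>\<^sup>+ \<tau>. ennreal (1 / (Im \<tau>)\<^sup>2) * indicator S \<tau> \<partial>distr lborel borel from_R2)"
    unfolding hyperbolic_area_def lborel_complex_R2[symmetric] ..
  also have "\<dots> = (\<integral>\<^sup>+ x. ennreal (1 / (Im (from_R2 x))\<^sup>2) * indicator S (from_R2 x) \<partial>lborel)"
    by (rule nn_integral_distr) measurable
  finally show ?thesis by (simp add: indicator_def)
qed

lemma mobius_inverse: assumes "g \<in> SL2" "Im z > 0"
  shows "mobius (adj2 g) (mobius g z) = z" "mobius g (mobius (adj2 g) z) = z"
  using mobius_mult[of "adj2 g" g z] mobius_mult[of g "adj2 g" z] assms by (simp_all add: adj2_mult)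

lemma mobius_has_field_derivative:
  assumes "g \<in> SL2" "Im z > 0"
  shows "(mobius g has_field_derivative 1 / (automorphy g z)\<^sup>2) (at z)"
proof -
  have nz: "of_real (g$2$1) * z + of_real (g$2$2) \<noteq> 0"
    using automorphy_nonzero[OF assms] by (simp add: automorphy_def)
  have d: "complex_of_real (g$1$1) * of_real (g$2$2) - of_real (g$1$2) * of_real (g$2$1) = 1"
    using assms(1) unfolding SL2_iff by (metis of_real_1 of_real_diff of_real_mult)
  have "((\<lambda>z. (of_real (g$1$1) * z + of_real (g$1$2)) / (of_real (g$2$1) * z + of_real (g$2$2)))
     has_field_derivative (of_real (g$1$1) * (of_real (g$2$1) * z + of_real (g$2$2)) -
       (of_real (g$1$1) * z + of_real (g$1$2)) * of_real (g$2$1)) /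
       ((of_real (g$2$1) * z + of_real (g$2$2)) * (of_real (g$2$1) * z + of_real (g$2$2)))) (at z)"
    using nz by (auto intro!: derivative_eq_intros)
  also have "of_real (g$1$1) * (of_real (g$2$1) * z + of_real (g$2$2)) -
       (of_real (g$1$1) * z + of_real (g$1$2)) * of_real (g$2$1) = (1::complex)"
    using d by (simp add: algebra_simps)
  finally show ?thesis
    unfolding mobius_def[abs_def] automorphy_def[abs_def] by (simp add: power2_eq_square)
qed

lemma mobius_image_measurable:
  assumes "g \<in> SL2" "S \<in> sets borel" "S \<subseteq> upper_half_plane"
  shows "mobius g ` S \<in> sets borel"
proof -
  have H: "open upper_half_plane" unfolding upper_half_plane_def by (rule open_halfspace_Im_gt)
  have eq: "mobius g ` S = mobius (adj2 g) -` S \<inter> upper_half_plane"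
  proof (intro equalityI subsetI)
    fix w assume "w \<in> mobius g ` S"
    then obtain z where z: "z \<in> S" "w = mobius g z" by blast
    have "Im z > 0" using z(1) assms(3) by auto
    then show "w \<in> mobius (adj2 g) -` S \<inter> upper_half_plane"
      using z mobius_inverse(1)[OF assms(1)] Im_mobius_pos[OF assms(1)] by simp
  next
    fix w assume w: "w \<in> mobius (adj2 g) -` S \<inter> upper_half_plane"
    then have "w = mobius g (mobius (adj2 g) w)" using mobius_inverse(2)[OF assms(1)] by simp
    then show "w \<in> mobius g ` S" using w by blast
  qed
  have "continuous_on upper_half_plane (mobius (adj2 g))"
    using mobius_has_field_derivative[of "adj2 g"] assms(1)
    by (intro continuous_at_imp_continuous_on ballI DERIV_isCont) auto
  then have "mobius (adj2 g) \<in> borel_measurable (restrict_space borel upper_half_plane)"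
    by (rule borel_measurable_continuous_on_restrict)
  from measurable_sets[OF this assms(2)]
  have "mobius (adj2 g) -` S \<inter> upper_half_plane \<in> sets (restrict_space borel upper_half_plane)"
    by (simp add: space_restrict_space)
  then show ?thesis unfolding eq using H by (subst (asm) sets_restrict_space_iff) auto
qed

text \<open>The Jacobian of a holomorphic map is the square of the modulus of its derivative, here
  |cz + d|^(-4), while the height is divided by |cz + d|^2; so dx dy / y^2 is preserved. Finite area
  makes the density absolutely integrable, as the change of variables demands.\<close>

lemma hyperbolic_area_mobius:
  assumes g: "g \<in> SL2" and S: "S \<in> sets borel" "S \<subseteq> upper_half_plane" and fin: "hyperbolic_area S < \<infinity>"
  shows "hyperbolic_area (mobius g ` S) = hyperbolic_area S"
proof -
  define A where "A = from_R2 -` S"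
  have [measurable]: "A \<in> sets borel"
    unfolding A_def using S(1) by (metis from_R2_measurable measurable_sets_borel)
  have Apos: "x$2 > 0" if "x \<in> A" for x using that S(2) by (auto simp: A_def subset_iff)
  define \<phi> where "\<phi> x = 1 / (x$2)\<^sup>2" for x :: "real^2"
  define w where "w x = (if x \<in> A then \<phi> x else 0)" for x
  obtain r where r: "r \<ge> 0" "hyperbolic_area S = ennreal r"
    using fin by (cases "hyperbolic_area S") auto
  have [measurable]: "(\<lambda>x :: real^2. x$2) \<in> borel_measurable borel"
    by (intro borel_measurable_continuous_onI continuous_intros)
  have "w \<in> borel_measurable borel" unfolding w_def \<phi>_def by measurable
  moreover have "(\<integral>\<^sup>+ x. ennreal (w x) \<partial>lborel) = ennreal r"
    unfolding r(2)[symmetric] hyperbolic_area_R2[OF S(1)]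
    by (intro nn_integral_cong) (auto simp: w_def \<phi>_def A_def)
  ultimately have "(w has_integral r) UNIV"
    using r(1) by (intro nn_integral_has_integral) (auto simp: w_def \<phi>_def)
  then have int: "(\<phi> has_integral r) A" unfolding w_def by (simp add: has_integral_restrict_UNIV)
  then have "\<phi> absolutely_integrable_on A"
    by (intro nonnegative_absolutely_integrable_1) (auto simp: \<phi>_def)
  \<comment> \<open>The change of variables is for vector-valued integrands, whence the passage
    through \<open>real^1\<close>.\<close>
  then have vec1: "(\<lambda>x. vec (\<phi> x) :: real^1) absolutely_integrable_on A \<and>
      integral A (\<lambda>x. vec (\<phi> x) :: real^1) = vec r"
    using int by (simp add: absolutely_integrable_on_1_iff integral_on_1_eq integral_unique)
  define m where "m x = 1 / (automorphy g (from_R2 x))\<^sup>2" for x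
  define G where "G x = to_R2 (mobius g (from_R2 x))" for x
  define G' where "G' x h = to_R2 (m x * from_R2 h)" for x h
  have der: "(G has_derivative G' x) (at x within A)" if "x \<in> A" for x
  proof -
    have "(mobius g has_derivative (\<lambda>h. m x * h)) (at (from_R2 x))"
    proof -
      have "Im (from_R2 x) > 0" using Apos[OF that] by simp
      from mobius_has_field_derivative[OF g this] show ?thesis unfolding m_def has_field_derivative_def .
    qed
    moreover have "(from_R2 has_derivative from_R2) (at x within A)"
      by (rule bounded_linear_imp_has_derivative[OF bounded_linear_from_R2])
    ultimately have "((\<lambda>x. mobius g (from_R2 x)) has_derivative (\<lambda>h. m x * from_R2 h)) (at x within A)"
      by (rule has_derivative_compose[rotated])
    from bounded_linear.has_derivative[OF bounded_linear_to_R2 this]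
    show ?thesis unfolding G_def[abs_def] G'_def[abs_def] .
  qed
  have inj: "inj_on G A"
  proof (rule inj_onI)
    fix x y assume xy: "x \<in> A" "y \<in> A" "G x = G y"
    from arg_cong[OF xy(3), of from_R2]
    have eq: "mobius g (from_R2 x) = mobius g (from_R2 y)" by (simp only: G_def from_to_R2)
    have "from_R2 x = mobius (adj2 g) (mobius g (from_R2 x))"
      using Apos[OF xy(1)] by (intro mobius_inverse(1)[OF g, symmetric]) simp
    also have "\<dots> = from_R2 y"
      unfolding eq using Apos[OF xy(2)] by (intro mobius_inverse(1)[OF g]) simp
    finally have "to_R2 (from_R2 x) = to_R2 (from_R2 y)" by (simp only:)
    then show "x = y" by simp
  qed
  have jac: "\<bar>det (matrix (G' x))\<bar> * \<phi> (G x) = \<phi> x" if "x \<in> A" for x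
  proof -
    have "det (matrix (G' x)) = (Re (m x))\<^sup>2 + (Im (m x))\<^sup>2"
      by (simp add: det_2 matrix_def G'_def axis_def power2_eq_square)
    then have 1: "\<bar>det (matrix (G' x))\<bar> = (cmod (m x))\<^sup>2" by (simp add: cmod_power2)
    define J where "J = cmod (automorphy g (from_R2 x))"
    have J: "J > 0" using automorphy_nonzero[OF g] Apos[OF that] by (simp add: J_def)
    have 2: "cmod (m x) = 1 / J\<^sup>2" by (simp add: m_def J_def norm_divide norm_power)
    have 3: "\<phi> (G x) = 1 / (x$2 / J\<^sup>2)\<^sup>2"
      using Im_mobius[OF g, of "from_R2 x"] Apos[OF that] by (simp add: \<phi>_def G_def J_def)
    have "\<bar>det (matrix (G' x))\<bar> * \<phi> (G x) = (1 / J\<^sup>2)\<^sup>2 * (1 / (x$2 / J\<^sup>2)\<^sup>2)"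
      by (simp only: 1 2 3)
    also have "\<dots> = 1 / (x$2)\<^sup>2" using J by (simp add: power_divide)
    finally show ?thesis by (simp only: \<phi>_def)
  qed
  have cong: "integral A (\<lambda>x. \<bar>det (matrix (G' x))\<bar> *\<^sub>R vec (\<phi> (G x)) :: real^1) = integral A (\<lambda>x. vec (\<phi> x))"
    by (intro integral_cong) (simp add: jac[symmetric] vec_eq_iff)
  have "(\<lambda>x. \<bar>det (matrix (G' x))\<bar> *\<^sub>R vec (\<phi> (G x)) :: real^1) absolutely_integrable_on A"
    by (rule set_integrable_cong[THEN iffD1, OF refl refl _ conjunct1[OF vec1]]) (simp_all add: jac[symmetric] vec_eq_iff)
  then have "(\<lambda>x. vec (\<phi> x) :: real^1) absolutely_integrable_on (G ` A) \<and> integral (G ` A) (\<lambda>x. vec (\<phi> x) :: real^1) = vec r"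
    using has_absolute_integral_change_of_variables[of A G G' "\<lambda>x. vec (\<phi> x) :: real^1" "vec r"] der inj cong vec1
    by simp
  then have "\<phi> absolutely_integrable_on (G ` A)" "integral (G ` A) \<phi> = r"
    by (simp_all add: absolutely_integrable_on_1_iff integral_on_1_eq)
  then have "(\<phi> has_integral r) (G ` A)"
    by (metis has_integral_integral set_lebesgue_integral_eq_integral(1))
  then have "(\<integral>\<^sup>+ x. ennreal (\<phi> x) * indicator (G ` A) x \<partial>lborel) = ennreal r"
    by (rule nn_integral_has_integral_lebesgue'[rotated]) (simp add: \<phi>_def)
  moreover have "G ` A = from_R2 -` (mobius g ` S)"
  proof (intro equalityI subsetI)
    fix y assume "y \<in> from_R2 -` (mobius g ` S)"
    then obtain z where "z \<in> S" "from_R2 y = mobius g z" by blast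
    then have "to_R2 z \<in> A" "y = G (to_R2 z)" by (simp_all add: A_def G_def) (metis from_to_R2(2))
    then show "y \<in> G ` A" by blast
  qed (auto simp: G_def A_def)
  ultimately show ?thesis
    unfolding r(2) hyperbolic_area_R2[OF mobius_image_measurable[OF g S]] by (simp add: \<phi>_def)
qed

text \<open>The upper triangular matrix that sends i to x + iy, from the Iwasawa
  decomposition.\<close>

definition up :: "real \<Rightarrow> real \<Rightarrow> real^2^2" where
  "up x y = mat2 (sqrt y) (x / sqrt y) 0 (1 / sqrt y)"

lemma up_SL2 [simp]: "y > 0 \<Longrightarrow> up x y \<in> SL2"
  by (simp add: up_def SL2_iff)

lemma pt_up: "y > 0 \<Longrightarrow> pt (up x y) = Complex x y"
  by (simp add: pt_def mobius_def automorphy_def up_def complex_eq_iff)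

lemma ex_pt: "Im z > 0 \<Longrightarrow> \<exists>u\<in>SL2. pt u = z"
  using up_SL2[of "Im z" "Re z"] pt_up[of "Im z" "Re z"] by auto

lemma same_pt: assumes "g \<in> SL2" "h \<in> SL2" "pt g = pt h" shows "norm (adj2 g ** h) = sqrt 2"
proof -
  have "(norm (adj2 g ** h))\<^sup>2 = 2"
    unfolding norm_rel_pt[OF assms(1,2)] using Im_pt_pos[OF assms(2)] assms(3) by (simp add: power2_eq_square)
  then show ?thesis by (metis norm_ge_zero real_sqrt_unique)
qed

lemma scalar_SL2: assumes "tl2 A = 0" "A \<in> SL2" shows "A = mat 1 \<or> A = - mat 1"
proof -
  have "(hf A)\<^sup>2 = 1" using det_decomp[of A] assms by (simp add: SL2_def det_2)
  then have "hf A = 1 \<or> hf A = -1" by (simp add: power2_eq_1_iff)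
  then show ?thesis using tl2_decomp[of A] assms(1) by auto
qed

section \<open>Counting group elements that make discs around thick points overlap\<close>

lemma separated_card_bound:
  fixes e :: real
  assumes "e > 0"
  shows "\<exists>N::nat. \<forall>S :: (real^2^2) set. (\<forall>p\<in>S. norm p \<le> r) \<and> (\<forall>p\<in>S. \<forall>p'\<in>S. p \<noteq> p' \<longrightarrow> e \<le> norm (p - p'))
     \<longrightarrow> finite S \<and> card S \<le> N"
proof -
  have "compact (cball (0::real^2^2) r)" by simp
  then obtain K where K: "finite K" "cball (0::real^2^2) r \<subseteq> (\<Union>x\<in>K. ball x (e/2))"
    using assms unfolding compact_eq_totally_bounded by (metis half_gt_zero)
  have "finite S \<and> card S \<le> card K" if S: "\<forall>p\<in>S. norm p \<le> r" "\<forall>p\<in>S. \<forall>p'\<in>S. p \<noteq> p' \<longrightarrow> e \<le> norm (p - p')" for S :: "(real^2^2) set"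
  proof -
    have "\<forall>p\<in>S. \<exists>x\<in>K. dist x p < e/2" using S(1) K(2) by (force simp: subset_iff)
    then obtain f where f: "\<And>p. p \<in> S \<Longrightarrow> f p \<in> K" "\<And>p. p \<in> S \<Longrightarrow> dist (f p) p < e/2" by metis
    have "inj_on f S"
    proof (rule inj_onI, rule ccontr)
      fix p p' assume pp: "p \<in> S" "p' \<in> S" "f p = f p'" "p \<noteq> p'"
      have "norm (p - p') \<le> dist (f p) p + dist (f p) p'" by (metis dist_commute dist_norm dist_triangle)
      also have "\<dots> < e" using f(2)[OF pp(1)] f(2)[OF pp(2)] pp(3) by simp
      finally show False using S(2) pp by force
    qed
    moreover have "f ` S \<subseteq> K" using f(1) by blast
    ultimately show ?thesis using K(1) by (meson card_inj_on_le finite_imageD finite_subset)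
  qed
  then show ?thesis by blast
qed

context discrete_SL2
begin

lemma countable_Gamma: "countable \<Gamma>"
proof -
  have "countable (\<Union>n::nat. {A \<in> \<Gamma>. norm A \<le> real n})"
    by (rule countable_UN[OF countableI_type countable_finite[OF fin]])
  moreover have "(\<Union>n::nat. {A \<in> \<Gamma>. norm A \<le> real n}) = \<Gamma>"
  proof (intro equalityI subsetI)
    fix A assume A: "A \<in> \<Gamma>"
    obtain n where "norm A \<le> real n" using real_arch_simple by blast
    then show "A \<in> (\<Union>n::nat. {A \<in> \<Gamma>. norm A \<le> real n})" using A by blast
  qed auto
  ultimately show ?thesis by (simp only:)
qed

text \<open>A point of the disc of radius 1/2 about i is \<open>pt u\<close> with
  \<open>norm u \<le> 3\<close>, by \<open>norm_pt\<close>. If z is carried by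
  \<open>\<sigma>\<close> and \<open>\<tau>\<close> into the discs around \<open>g i\<close> and
  \<open>h i\<close>, the relative matrix is a product of two such matrices and a rotation of norm
  sqrt 2; the bound 13 rounds up 9 sqrt 2.\<close>

lemma overlap_bound:
  assumes "g \<in> SL2" "h \<in> SL2" "a \<in> ball \<i> (1/2)" "b \<in> ball \<i> (1/2)" "\<sigma> \<in> \<Gamma>" "\<tau> \<in> \<Gamma>"
    and "Im z > 0" "mobius \<sigma> z = mobius g a" "mobius \<tau> z = mobius h b"
  shows "norm (adj2 g ** (\<sigma> ** adj2 \<tau>) ** h) \<le> 13"
proof -
  have pos: "Im c > 0" "(Re c)\<^sup>2 + (Im c)\<^sup>2 + 1 \<le> 9 * Im c" if "c \<in> ball \<i> (1/2)" for c
  proof -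
    have n: "norm (c - \<i>) < 1/2" using that by (simp add: dist_norm norm_minus_commute)
    have "\<bar>Re (c - \<i>)\<bar> < 1/2" "\<bar>Im (c - \<i>)\<bar> < 1/2"
      using n abs_Re_le_cmod[of "c - \<i>"] abs_Im_le_cmod[of "c - \<i>"] by linarith+
    then have "\<bar>Re c\<bar> < 1/2" "\<bar>Im c - 1\<bar> < 1/2" by simp_all
    then have *: "\<bar>Re c\<bar> < 1/2" "1/2 < Im c" "Im c < 3/2" by linarith+
    then show "Im c > 0" by simp
    have "\<bar>Re c\<bar> * \<bar>Re c\<bar> \<le> 1/2 * (1/2)" using *(1) by (intro mult_mono) auto
    then have "Re c * Re c \<le> 1/4" by simp
    moreover have "Im c * Im c \<le> Im c * (3/2)" using * by (intro mult_left_mono) auto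
    ultimately show "(Re c)\<^sup>2 + (Im c)\<^sup>2 + 1 \<le> 9 * Im c" using * unfolding power2_eq_square by linarith
  qed
  have n3: "norm u \<le> 3" if "u \<in> SL2" "pt u \<in> ball \<i> (1/2)" for u
  proof (rule power2_le_imp_le)
    show "(norm u)\<^sup>2 \<le> 3\<^sup>2" unfolding norm_pt[OF that(1)] using pos[OF that(2)] by (simp add: divide_le_eq)
  qed simp
  obtain u where u: "u \<in> SL2" "pt u = a" using ex_pt[OF pos(1)[OF assms(3)]] by blast
  obtain v where v: "v \<in> SL2" "pt v = b" using ex_pt[OF pos(1)[OF assms(4)]] by blast
  note S = sub[OF assms(5)] sub[OF assms(6)]
  have "pt (adj2 \<sigma> ** (g ** u)) = mobius (adj2 \<sigma>) (mobius g a)" using S(1) assms(1) u by (simp add: pt_mult)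
  also have "\<dots> = z" unfolding assms(8)[symmetric] by (rule mobius_inverse(1)[OF S(1) assms(7)])
  also have "\<dots> = mobius (adj2 \<tau>) (mobius h b)"
    unfolding assms(9)[symmetric] by (rule mobius_inverse(1)[OF S(2) assms(7), symmetric])
  also have "\<dots> = pt (adj2 \<tau> ** (h ** v))" using S(2) assms(2) v by (simp add: pt_mult)
  finally have e: "pt (adj2 \<sigma> ** (g ** u)) = pt (adj2 \<tau> ** (h ** v))" .
  define X where "X = adj2 g ** (\<sigma> ** adj2 \<tau>) ** h"
  have "norm (adj2 (adj2 \<sigma> ** (g ** u)) ** (adj2 \<tau> ** (h ** v))) = sqrt 2"
    by (rule same_pt[OF _ _ e]) (simp_all add: S assms(1,2) u(1) v(1))
  moreover have "adj2 (adj2 \<sigma> ** (g ** u)) ** (adj2 \<tau> ** (h ** v)) = adj2 u ** X ** v"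
    by (simp only: X_def adj2_mult_distrib adj2_adj2 matrix_mul_assoc)
  ultimately have n: "norm (adj2 u ** X ** v) = sqrt 2" by simp
  have "X = u ** (adj2 u ** X ** v) ** adj2 v"
    using u v by (simp only: matrix_mul_assoc[symmetric] adj2_mult_cancel adj2_mult matrix_mul_rid)
  then have "norm X \<le> norm u * sqrt 2 * norm v"
    using norm_mult_le3[of u "adj2 u ** X ** v" "adj2 v"] n by simp
  also have "\<dots> \<le> 3 * sqrt 2 * 3"
    using n3[OF u(1)] n3[OF v(1)] assms(3,4) unfolding u(2) v(2) by (intro mult_mono) auto
  also have "\<dots> \<le> 13"
  proof -
    have "sqrt 2 \<le> 13/9" by (rule real_le_lsqrt) (auto simp: power2_eq_square)
    then show ?thesis by simp
  qed
  finally show ?thesis by (simp add: X_def)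
qed

text \<open>The element \<open>adj2 \<tau> ** \<sigma>\<close> is not the identity: if it is -1 its
  distance from 1 is 2 sqrt 2, and otherwise thickness puts its conjugate at distance at least 1/10.
  Multiplying back by the conjugate of \<open>\<tau>\<close> costs the factor 13, whence
  1/130.\<close>

lemma thick_separation:
  assumes g: "g \<in> SL2" "thick g" and st: "\<sigma> \<in> \<Gamma>" "\<tau> \<in> \<Gamma>" "\<sigma> \<noteq> \<tau>" and n: "norm (adj2 g ** \<tau> ** g) \<le> 13"
  shows "1/130 \<le> norm (adj2 g ** \<sigma> ** g - adj2 g ** \<tau> ** g)"
proof -
  define f where "f \<sigma> = adj2 g ** \<sigma> ** g" for \<sigma>
  define \<rho> where "\<rho> = adj2 \<tau> ** \<sigma>"
  have \<rho>: "\<rho> \<in> \<Gamma>" unfolding \<rho>_def by (rule mult[OF inv[OF st(2)] st(1)])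
  have T: "\<tau> \<in> SL2" by (rule sub[OF st(2)])
  have \<tau>\<rho>: "\<tau> ** \<rho> = \<sigma>" unfolding \<rho>_def by (rule adj2_mult_cancel(2)[OF T])
  have lower: "1/10 \<le> norm (f \<rho> - mat 1)"
  proof (cases "tl2 \<rho> = 0")
    case True
    from scalar_SL2[OF True sub[OF \<rho>]] have "\<rho> = - mat 1" using \<tau>\<rho> st(3) by auto
    then have "f \<rho> = - mat 1" unfolding f_def by (simp add: matrix_mult_algebra adj2_mult[OF g(1)])
    then have "f \<rho> - mat 1 = (-2) *\<^sub>R mat 1" by (simp add: matrix_eq_2)
    then have "norm (f \<rho> - mat 1) = 2 * sqrt 2" by (simp add: norm_mat1)
    moreover have "sqrt 2 \<ge> 1" by simp
    ultimately show ?thesis by linarith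
  next
    case False
    then show ?thesis using g(2) \<rho> unfolding thick_def f_def by blast
  qed
  have "adj2 (f \<tau>) ** f \<sigma> = f \<rho>" unfolding f_def \<rho>_def
    by (simp only: adj2_mult_distrib adj2_adj2 matrix_mul_assoc[symmetric] adj2_mult_cancel(2)[OF g(1)])
  moreover have "adj2 (f \<tau>) ** f \<tau> = mat 1"
    unfolding f_def by (rule adj2_mult) (simp add: T g(1))
  ultimately have "f \<rho> - mat 1 = adj2 (f \<tau>) ** (f \<sigma> - f \<tau>)" by (simp add: matrix_mult_algebra)
  then have "norm (f \<rho> - mat 1) \<le> norm (f \<tau>) * norm (f \<sigma> - f \<tau>)"
    using norm_matrix_mult_le[of "adj2 (f \<tau>)" "f \<sigma> - f \<tau>"] by simp
  also have "\<dots> \<le> 13 * norm (f \<sigma> - f \<tau>)" using n by (intro mult_right_mono) (simp_all add: f_def)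
  finally show ?thesis using lower unfolding f_def[symmetric] by linarith
qed

text \<open>The point is uniformity in g: N depends only on the radius 13 and the separation 1/130.
  It bounds the number of group elements that can make the disc around a thick point overlap
  itself.\<close>

lemma thick_multiplicity:
  "\<exists>N::nat. \<forall>g S. g \<in> SL2 \<longrightarrow> thick g \<longrightarrow> S \<subseteq> \<Gamma> \<longrightarrow> (\<forall>\<sigma>\<in>S. norm (adj2 g ** \<sigma> ** g) \<le> 13) \<longrightarrow> finite S \<and> card S \<le> N"
proof -
  have pos: "(1/130::real) > 0" by simp
  from separated_card_bound[OF pos, of 13]
  obtain N :: nat where N: "\<forall>S :: (real^2^2) set. (\<forall>p\<in>S. norm p \<le> 13) \<and> (\<forall>p\<in>S. \<forall>p'\<in>S. p \<noteq> p' \<longrightarrow> 1/130 \<le> norm (p - p'))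
     \<longrightarrow> finite S \<and> card S \<le> N" by (rule exE)
  have "finite S \<and> card S \<le> N"
    if g: "g \<in> SL2" "thick g" and S: "S \<subseteq> \<Gamma>" "\<forall>\<sigma>\<in>S. norm (adj2 g ** \<sigma> ** g) \<le> 13" for g S
  proof -
    define f where "f \<sigma> = adj2 g ** \<sigma> ** g" for \<sigma>
    have sep: "1/130 \<le> norm (f \<sigma> - f \<tau>)" if "\<sigma> \<in> S" "\<tau> \<in> S" "\<sigma> \<noteq> \<tau>" for \<sigma> \<tau>
      unfolding f_def by (rule thick_separation[OF g]) (use that S in blast)+
    have inj: "inj_on f S"
    proof (rule inj_onI, rule ccontr)
      fix \<sigma> \<tau> assume "\<sigma> \<in> S" "\<tau> \<in> S" "f \<sigma> = f \<tau>" "\<sigma> \<noteq> \<tau>"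
      with sep[of \<sigma> \<tau>] show False by simp
    qed
    have "\<forall>p\<in>f ` S. \<forall>p'\<in>f ` S. p \<noteq> p' \<longrightarrow> 1/130 \<le> norm (p - p')"
    proof (intro ballI impI)
      fix p p' assume "p \<in> f ` S" "p' \<in> f ` S" "p \<noteq> p'"
      then obtain \<sigma> \<tau> where "\<sigma> \<in> S" "\<tau> \<in> S" "p = f \<sigma>" "p' = f \<tau>" "\<sigma> \<noteq> \<tau>" by blast
      then show "1/130 \<le> norm (p - p')" using sep by simp
    qed
    moreover have "\<forall>p\<in>f ` S. norm p \<le> 13" using S(2) by (simp add: f_def)
    ultimately have "finite (f ` S) \<and> card (f ` S) \<le> N" using N[THEN spec, of "f ` S"] by blast
    then show ?thesis using inj by (simp add: card_image finite_image_iff)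
  qed
  then show ?thesis by (intro exI[of _ N]) blast
qed

end

section \<open>The packing argument\<close>

lemma ball_i_upper: "z \<in> ball \<i> (1/2) \<Longrightarrow> 1/2 < Im z \<and> Im z < 3/2"
proof -
  assume "z \<in> ball \<i> (1/2)"
  then have "norm (z - \<i>) < 1/2" by (simp add: dist_norm norm_minus_commute)
  then have "\<bar>Im (z - \<i>)\<bar> < 1/2" using abs_Im_le_cmod[of "z - \<i>"] by linarith
  then have "\<bar>Im z - 1\<bar> < 1/2" by simp
  then show "1/2 < Im z \<and> Im z < 3/2" by linarith
qed

definition hyp_measure :: "complex measure" where
  "hyp_measure = density lborel (\<lambda>z. ennreal (1 / (Im z)\<^sup>2))"

lemma hyp_measure_sets [simp, measurable_cong]: "sets hyp_measure = sets borel"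
  by (simp add: hyp_measure_def)

lemma hyperbolic_area_eq: "S \<in> sets borel \<Longrightarrow> hyperbolic_area S = emeasure hyp_measure S"
  unfolding hyp_measure_def hyperbolic_area_def
  by (subst emeasure_density) (auto intro!: measurable_compose[OF _ measurable_ennreal])

lemma hyperbolic_area_ball: "0 < hyperbolic_area (ball \<i> (1/2))" "hyperbolic_area (ball \<i> (1/2)) < \<infinity>"
proof -
  let ?B = "ball \<i> (1/2)"
  have fin: "emeasure lborel ?B < \<infinity>" by (intro emeasure_bounded_finite) simp
  have "hyperbolic_area ?B \<le> (\<integral>\<^sup>+ z. 4 * indicator ?B z \<partial>lborel)"
    unfolding hyperbolic_area_def
  proof (intro nn_integral_mono)
    fix z
    show "ennreal (1 / (Im z)\<^sup>2) * indicator ?B z \<le> 4 * indicator ?B z"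
    proof (cases "z \<in> ?B")
      case True
      have "1/2 * (1/2) \<le> Im z * Im z" using ball_i_upper[OF True] by (intro mult_mono) auto
      then have "1 / (Im z)\<^sup>2 \<le> 4" using ball_i_upper[OF True] by (simp add: power2_eq_square divide_le_eq)
      then have "ennreal (1 / (Im z)\<^sup>2) \<le> ennreal 4" by (rule ennreal_leI)
      then show ?thesis using True by simp
    qed simp
  qed
  also have "\<dots> = 4 * emeasure lborel ?B" by (rule nn_integral_cmult_indicator) simp
  also have "\<dots> < \<infinity>" using fin by (simp add: ennreal_mult_less_top)
  finally show "hyperbolic_area ?B < \<infinity>" .
  have "measure lborel ?B > 0" by (rule content_ball_pos) simp
  then have "emeasure lborel ?B \<noteq> 0" by (auto simp: measure_def)
  then have "0 < ennreal (4/9) * emeasure lborel ?B" by (simp add: ennreal_zero_less_mult_iff zero_less_iff_neq_zero)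
  also have "\<dots> = (\<integral>\<^sup>+ z. ennreal (4/9) * indicator ?B z \<partial>lborel)"
    by (rule nn_integral_cmult_indicator[symmetric]) simp
  also have "\<dots> \<le> hyperbolic_area ?B"
    unfolding hyperbolic_area_def
  proof (intro nn_integral_mono)
    fix z
    show "ennreal (4/9) * indicator ?B z \<le> ennreal (1 / (Im z)\<^sup>2) * indicator ?B z"
    proof (cases "z \<in> ?B")
      case True
      have "Im z * Im z \<le> 3/2 * (3/2)" using ball_i_upper[OF True] by (intro mult_mono) auto
      moreover have "Im z * Im z > 0" using ball_i_upper[OF True] by simp
      ultimately have "4/9 \<le> 1 / (Im z)\<^sup>2" by (simp add: power2_eq_square le_divide_eq)
      then have "ennreal (4/9) \<le> ennreal (1 / (Im z)\<^sup>2)" by (rule ennreal_leI)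
      then show ?thesis using True by simp
    qed simp
  qed
  finally show "0 < hyperbolic_area ?B" .
qed

context discrete_SL2
begin

text \<open>Packing: discs around inequivalent thick points have, up to bounded multiplicity, disjoint images
  in a fundamental domain.\<close>

lemma packing_bound:
  assumes F: "F \<in> sets borel" "F \<subseteq> upper_half_plane" "hyperbolic_area F < \<infinity>"
    "\<And>z. Im z > 0 \<Longrightarrow> \<exists>\<sigma>\<in>\<Gamma>. \<exists>w\<in>F. z = mobius \<sigma> w"
  and N: "\<And>g S. g \<in> SL2 \<Longrightarrow> thick g \<Longrightarrow> S \<subseteq> \<Gamma> \<Longrightarrow> (\<forall>\<sigma>\<in>S. norm (adj2 g ** \<sigma> ** g) \<le> 13) \<Longrightarrow> finite S \<and> card S \<le> N"
  and W: "finite W" "\<And>g. g \<in> W \<Longrightarrow> g \<in> SL2" "\<And>g. g \<in> W \<Longrightarrow> thick g"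
    "\<And>g h \<sigma>. g \<in> W \<Longrightarrow> h \<in> W \<Longrightarrow> g \<noteq> h \<Longrightarrow> \<sigma> \<in> \<Gamma> \<Longrightarrow> 13 < norm (adj2 g ** \<sigma> ** h)"
  shows "of_nat (card W) * hyperbolic_area (ball \<i> (1/2)) \<le> of_nat N * hyperbolic_area F"
proof -
  define B where "B = ball \<i> (1/2)"
  have B: "B \<in> sets borel" "B \<subseteq> upper_half_plane" unfolding B_def using ball_i_upper by fastforce+
  \<comment> \<open>The part of F that \<open>\<sigma>\<close> moves into the disc around
    \<open>g i\<close>. For fixed g the moved parts cover the disc, while a point of F lies in few
    of these sets; integrating the count in both orders gives the inequality.\<close>
  define A where "A g \<sigma> = F \<inter> mobius (adj2 \<sigma> ** g) ` B" for g \<sigma>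
  have Ain: "z \<in> F \<and> Im z > 0 \<and> (\<exists>b\<in>B. mobius \<sigma> z = mobius g b)" if zA: "z \<in> A g \<sigma>" and gW: "g \<in> W" and s: "\<sigma> \<in> \<Gamma>" for z g \<sigma>
  proof -
    obtain b where b: "b \<in> B" "z = mobius (adj2 \<sigma> ** g) b" "z \<in> F" using zA by (auto simp: A_def)
    have ib: "Im b > 0" using b(1) B(2) by auto
    have "z = mobius (adj2 \<sigma>) (mobius g b)" unfolding b(2)
      using sub[OF s] W(2)[OF gW] ib by (simp add: mobius_mult)
    then have "mobius \<sigma> z = mobius g b"
      using mobius_inverse(2)[OF sub[OF s], of "mobius g b"] Im_mobius_pos[OF W(2)[OF gW] ib] by simp
    then show ?thesis using b F(2) by auto
  qed
  have Am: "A g \<sigma> \<in> sets borel" if "g \<in> W" "\<sigma> \<in> \<Gamma>" for g \<sigma>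
    unfolding A_def using mobius_image_measurable[OF _ B, of "adj2 \<sigma> ** g"] sub[OF that(2)] W(2)[OF that(1)] F(1) by auto
  have Afin: "hyperbolic_area (A g \<sigma>) < \<infinity>" "A g \<sigma> \<subseteq> upper_half_plane" if "g \<in> W" "\<sigma> \<in> \<Gamma>" for g \<sigma>
  proof -
    have "hyperbolic_area (A g \<sigma>) \<le> hyperbolic_area F"
      unfolding hyperbolic_area_eq[OF Am[OF that]] hyperbolic_area_eq[OF F(1)]
      by (rule emeasure_mono) (use F(1) in \<open>auto simp: A_def\<close>)
    then show "hyperbolic_area (A g \<sigma>) < \<infinity>" using F(3) by (rule le_less_trans)
    show "A g \<sigma> \<subseteq> upper_half_plane" using F(2) by (auto simp: A_def)
  qed
  have one: "hyperbolic_area B \<le> (\<integral>\<^sup>+ \<sigma>. emeasure hyp_measure (A g \<sigma>) \<partial>count_space \<Gamma>)" if g: "g \<in> W" for g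
  proof -
    have img: "mobius \<sigma> ` A g \<sigma> \<in> sets borel" if "\<sigma> \<in> \<Gamma>" for \<sigma>
      by (rule mobius_image_measurable[OF sub[OF that] Am[OF g that] Afin(2)[OF g that]])
    have gB: "mobius g ` B \<in> sets borel" by (rule mobius_image_measurable[OF W(2)[OF g] B])
    have "hyperbolic_area B = hyperbolic_area (mobius g ` B)"
      by (rule hyperbolic_area_mobius[OF W(2)[OF g] B, symmetric]) (use hyperbolic_area_ball(2) in \<open>simp add: B_def\<close>)
    also have "\<dots> = (\<integral>\<^sup>+ z. indicator (mobius g ` B) z \<partial>hyp_measure)"
      unfolding hyperbolic_area_eq[OF gB] using gB by simp
    also have "\<dots> \<le> (\<integral>\<^sup>+ z. (\<integral>\<^sup>+ \<sigma>. indicator (mobius \<sigma> ` A g \<sigma>) z \<partial>count_space \<Gamma>) \<partial>hyp_measure)"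
    proof (intro nn_integral_mono)
      fix z
      show "indicator (mobius g ` B) z \<le> (\<integral>\<^sup>+ \<sigma>. indicator (mobius \<sigma> ` A g \<sigma>) z \<partial>count_space \<Gamma> :: ennreal)"
      proof (cases "z \<in> mobius g ` B")
        case True
        then obtain b where b: "b \<in> B" "z = mobius g b" by blast
        have ib: "Im b > 0" using b(1) B(2) by auto
        have iz: "Im z > 0" unfolding b(2) by (rule Im_mobius_pos[OF W(2)[OF g] ib])
        obtain \<sigma> w where w: "\<sigma> \<in> \<Gamma>" "w \<in> F" "z = mobius \<sigma> w" using F(4)[OF iz] by blast
        have iw: "Im w > 0" using w(2) F(2) by auto
        have "w = mobius (adj2 \<sigma>) z" unfolding w(3) by (rule mobius_inverse(1)[OF sub[OF w(1)] iw, symmetric])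
        also have "\<dots> = mobius (adj2 \<sigma> ** g) b" unfolding b(2)
          using sub[OF w(1)] W(2)[OF g] ib by (simp add: mobius_mult)
        finally have "w \<in> A g \<sigma>" using w(2) b(1) by (auto simp: A_def)
        then have "z \<in> mobius \<sigma> ` A g \<sigma>" using w(3) by blast
        then have "(\<integral>\<^sup>+ \<tau>. indicator {\<sigma>} \<tau> \<partial>count_space \<Gamma>) \<le> (\<integral>\<^sup>+ \<tau>. indicator (mobius \<tau> ` A g \<tau>) z \<partial>count_space \<Gamma> :: ennreal)"
          by (intro nn_integral_mono) (auto split: split_indicator)
        moreover have "(\<integral>\<^sup>+ \<tau>. indicator {\<sigma>} \<tau> \<partial>count_space \<Gamma>) = (1::ennreal)"
          using w(1) by (subst nn_integral_indicator) auto
        ultimately show ?thesis using True by simp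
      qed simp
    qed
    also have "\<dots> = (\<integral>\<^sup>+ \<sigma>. (\<integral>\<^sup>+ z. indicator (mobius \<sigma> ` A g \<sigma>) z \<partial>hyp_measure) \<partial>count_space \<Gamma>)"
      by (rule nn_integral_count_space_nn_integral[OF countable_Gamma]) (use img in auto)
    also have "\<dots> = (\<integral>\<^sup>+ \<sigma>. emeasure hyp_measure (A g \<sigma>) \<partial>count_space \<Gamma>)"
    proof (intro nn_integral_cong)
      fix \<sigma> assume "\<sigma> \<in> space (count_space \<Gamma>)"
      then have s: "\<sigma> \<in> \<Gamma>" by simp
      have "(\<integral>\<^sup>+ z. indicator (mobius \<sigma> ` A g \<sigma>) z \<partial>hyp_measure) = hyperbolic_area (mobius \<sigma> ` A g \<sigma>)"
        unfolding hyperbolic_area_eq[OF img[OF s]] using img[OF s] by simp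
      also have "\<dots> = hyperbolic_area (A g \<sigma>)"
        by (rule hyperbolic_area_mobius[OF sub[OF s] Am[OF g s] Afin(2)[OF g s] Afin(1)[OF g s]])
      finally show "(\<integral>\<^sup>+ z. indicator (mobius \<sigma> ` A g \<sigma>) z \<partial>hyp_measure) = emeasure hyp_measure (A g \<sigma>)"
        unfolding hyperbolic_area_eq[OF Am[OF g s]] .
    qed
    finally show ?thesis .
  qed
  \<comment> \<open>Sets through z with different centres would violate the separation of W, so a
    single centre \<open>g0\<close> occurs, and N bounds the number of \<open>\<sigma>\<close> for
    it.\<close>
  have pointwise: "(\<integral>\<^sup>+ \<sigma>. (\<Sum>g\<in>W. indicator (A g \<sigma>) z) \<partial>count_space \<Gamma>) \<le> (of_nat N * indicator F z :: ennreal)" for z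
  proof (cases "\<exists>g0\<in>W. \<exists>\<sigma>0\<in>\<Gamma>. z \<in> A g0 \<sigma>0")
    case False
    then have "(\<integral>\<^sup>+ \<sigma>. (\<Sum>g\<in>W. indicator (A g \<sigma>) z) \<partial>count_space \<Gamma>) = (\<integral>\<^sup>+ \<sigma>. 0 \<partial>count_space \<Gamma> :: ennreal)"
      by (intro nn_integral_cong sum.neutral ballI) (auto split: split_indicator)
    then show ?thesis by simp
  next
    case True
    then obtain g0 \<sigma>0 where g0: "g0 \<in> W" "\<sigma>0 \<in> \<Gamma>" "z \<in> A g0 \<sigma>0" by blast
    have key: "norm (adj2 g ** (\<sigma> ** adj2 \<sigma>0) ** g0) \<le> 13" if k: "g \<in> W" "\<sigma> \<in> \<Gamma>" "z \<in> A g \<sigma>" for g \<sigma>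
    proof -
      obtain a where a: "a \<in> B" "mobius \<sigma> z = mobius g a" using Ain[OF k(3,1,2)] by blast
      obtain b where b: "b \<in> B" "mobius \<sigma>0 z = mobius g0 b" using Ain[OF g0(3,1,2)] by blast
      have "Im z > 0" using Ain[OF k(3,1,2)] by blast
      then show ?thesis
        using overlap_bound[OF W(2)[OF k(1)] W(2)[OF g0(1)] _ _ k(2) g0(2) _ a(2) b(2)] a(1) b(1)
        unfolding B_def by blast
    qed
    have same: "g = g0" if "g \<in> W" "\<sigma> \<in> \<Gamma>" "z \<in> A g \<sigma>" for g \<sigma>
    proof (rule ccontr)
      assume "g \<noteq> g0"
      from W(4)[OF that(1) g0(1) this mult[OF that(2) inv[OF g0(2)]]] key[OF that] show False by simp
    qed
    define S where "S = {\<sigma> \<in> \<Gamma>. z \<in> A g0 \<sigma>}"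
    define f where "f \<sigma> = \<sigma> ** adj2 \<sigma>0" for \<sigma> :: "real^2^2"
    have finj: "inj_on f S"
    proof (rule inj_onI)
      fix x y assume "f x = f y"
      then have "f x ** \<sigma>0 = f y ** \<sigma>0" by simp
      then show "x = y" unfolding f_def using adj2_mult(1)[OF sub[OF g0(2)]]
        by (simp only: matrix_mul_assoc[symmetric] matrix_mul_rid)
    qed
    have "finite (f ` S) \<and> card (f ` S) \<le> N"
    proof (rule N[OF W(2)[OF g0(1)] W(3)[OF g0(1)]])
      show "f ` S \<subseteq> \<Gamma>" unfolding f_def S_def using mult inv g0(2) by blast
      show "\<forall>\<sigma>\<in>f ` S. norm (adj2 g0 ** \<sigma> ** g0) \<le> 13" unfolding f_def S_def using key[OF g0(1)] by blast
    qed
    then have S: "finite S" "card S \<le> N" using finj by (simp_all add: card_image finite_image_iff)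
    have "(\<integral>\<^sup>+ \<sigma>. (\<Sum>g\<in>W. indicator (A g \<sigma>) z) \<partial>count_space \<Gamma>) \<le> (\<integral>\<^sup>+ \<sigma>. indicator S \<sigma> \<partial>count_space \<Gamma> :: ennreal)"
    proof (intro nn_integral_mono)
      fix \<sigma> assume "\<sigma> \<in> space (count_space \<Gamma>)"
      then have s: "\<sigma> \<in> \<Gamma>" by simp
      have "(\<Sum>g\<in>W. indicator (A g \<sigma>) z) = (\<Sum>g\<in>W. if g = g0 then indicator S \<sigma> else (0::ennreal))"
      proof (rule sum.cong[OF refl])
        fix g assume g: "g \<in> W"
        show "indicator (A g \<sigma>) z = (if g = g0 then indicator S \<sigma> else (0::ennreal))"
        proof (cases "g = g0")
          case True
          then show ?thesis by (simp add: S_def indicator_def s)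
        next
          case False
          then have "z \<notin> A g \<sigma>" using same[OF g s] by blast
          then show ?thesis using False by simp
        qed
      qed
      also have "\<dots> = indicator S \<sigma>" using W(1) g0(1) by simp
      finally show "(\<Sum>g\<in>W. indicator (A g \<sigma>) z) \<le> (indicator S \<sigma> :: ennreal)" by simp
    qed
    also have "\<dots> = of_nat (card S)"
      using S(1) by (subst nn_integral_indicator) (auto simp: S_def emeasure_count_space_finite)
    also have "\<dots> \<le> of_nat N * indicator F z" using S(2) g0(3) by (simp add: A_def)
    finally show ?thesis .
  qed
  have "of_nat (card W) * hyperbolic_area B = (\<Sum>g\<in>W. hyperbolic_area B)" by simp
  also have "\<dots> \<le> (\<Sum>g\<in>W. \<integral>\<^sup>+ \<sigma>. emeasure hyp_measure (A g \<sigma>) \<partial>count_space \<Gamma>)"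
    by (intro sum_mono one)
  also have "\<dots> = (\<integral>\<^sup>+ \<sigma>. (\<Sum>g\<in>W. emeasure hyp_measure (A g \<sigma>)) \<partial>count_space \<Gamma>)"
    by (rule nn_integral_sum[symmetric]) simp
  also have "\<dots> = (\<integral>\<^sup>+ \<sigma>. (\<integral>\<^sup>+ z. (\<Sum>g\<in>W. indicator (A g \<sigma>) z) \<partial>hyp_measure) \<partial>count_space \<Gamma>)"
  proof (intro nn_integral_cong)
    fix \<sigma> assume "\<sigma> \<in> space (count_space \<Gamma>)"
    then have s: "\<sigma> \<in> \<Gamma>" by simp
    have m: "A g \<sigma> \<in> sets hyp_measure" if "g \<in> W" for g using Am[OF that s] by simp
    have "(\<integral>\<^sup>+ z. (\<Sum>g\<in>W. indicator (A g \<sigma>) z) \<partial>hyp_measure) = (\<Sum>g\<in>W. \<integral>\<^sup>+ z. indicator (A g \<sigma>) z \<partial>hyp_measure)"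
      by (rule nn_integral_sum) (use m in auto)
    also have "\<dots> = (\<Sum>g\<in>W. emeasure hyp_measure (A g \<sigma>))"
      by (intro sum.cong refl nn_integral_indicator m)
    finally show "(\<Sum>g\<in>W. emeasure hyp_measure (A g \<sigma>)) = (\<integral>\<^sup>+ z. (\<Sum>g\<in>W. indicator (A g \<sigma>) z) \<partial>hyp_measure)" by simp
  qed
  also have "\<dots> = (\<integral>\<^sup>+ z. (\<integral>\<^sup>+ \<sigma>. (\<Sum>g\<in>W. indicator (A g \<sigma>) z) \<partial>count_space \<Gamma>) \<partial>hyp_measure)"
    by (rule nn_integral_count_space_nn_integral[OF countable_Gamma, symmetric]) (use Am in auto)
  also have "\<dots> \<le> (\<integral>\<^sup>+ z. of_nat N * indicator F z \<partial>hyp_measure)"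
    by (intro nn_integral_mono pointwise)
  also have "\<dots> = of_nat N * hyperbolic_area F"
    using F(1) by (simp add: nn_integral_cmult hyperbolic_area_eq)
  finally show ?thesis unfolding B_def .
qed

text \<open>Take a family W of thick points whose relative matrices, modulo the group, have norm
  above 13, of maximal size; packing bounds the size. By maximality every thick point has a
  translate whose matrix relative to some member of W has norm at most 13.\<close>

lemma thick_compact:
  assumes F: "F \<in> sets borel" "F \<subseteq> upper_half_plane" "hyperbolic_area F < \<infinity>"
    "\<And>z. Im z > 0 \<Longrightarrow> \<exists>\<sigma>\<in>\<Gamma>. \<exists>w\<in>F. z = mobius \<sigma> w"
  shows "\<exists>R>0. \<forall>w\<in>SL2. thick w \<longrightarrow> (\<exists>\<sigma>\<in>\<Gamma>. norm (\<sigma> ** w) \<le> R)"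
proof -
  obtain N where N: "\<And>g S. g \<in> SL2 \<Longrightarrow> thick g \<Longrightarrow> S \<subseteq> \<Gamma> \<Longrightarrow> (\<forall>\<sigma>\<in>S. norm (adj2 g ** \<sigma> ** g) \<le> 13) \<Longrightarrow> finite S \<and> card S \<le> N"
    using thick_multiplicity by blast
  define P where "P W \<longleftrightarrow> finite W \<and> (\<forall>g\<in>W. g \<in> SL2 \<and> thick g) \<and>
    (\<forall>g\<in>W. \<forall>h\<in>W. g \<noteq> h \<longrightarrow> (\<forall>\<sigma>\<in>\<Gamma>. 13 < norm (adj2 g ** \<sigma> ** h)))" for W
  obtain b where b: "hyperbolic_area (ball \<i> (1/2)) = ennreal b" "b > 0"
    using hyperbolic_area_ball by (cases "hyperbolic_area (ball \<i> (1/2))") auto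
  obtain a where a: "hyperbolic_area F = ennreal a" "a \<ge> 0"
    using F(3) by (cases "hyperbolic_area F") auto
  define K where "K = Suc (nat \<lceil>real N * a / b\<rceil>)"
  have "card W < K" if "P W" for W
  proof -
    have "of_nat (card W) * hyperbolic_area (ball \<i> (1/2)) \<le> of_nat N * hyperbolic_area F"
      by (rule packing_bound[OF F N]) (use that in \<open>auto simp: P_def\<close>)
    then have "ennreal (real (card W) * b) \<le> ennreal (real N * a)"
      unfolding a(1) b(1) using a(2) b(2) by (simp add: ennreal_of_nat_eq_real_of_nat ennreal_mult)
    then have "real (card W) * b \<le> real N * a" using a(2) by (simp add: ennreal_le_iff)
    then have "real (card W) \<le> real N * a / b" using b(2) by (simp add: le_divide_eq)
    then show ?thesis unfolding K_def by linarith
  qed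
  moreover have "P {}" by (simp add: P_def)
  ultimately obtain W where W: "P W" "\<And>W'. P W' \<Longrightarrow> card W' \<le> card W"
    using ex_has_greatest_nat[of P "{}" card K] by (metis less_imp_le)
  define R where "R = 13 * (\<Sum>g\<in>W. norm g) + 1"
  have nonneg: "(\<Sum>g\<in>W. norm g) \<ge> 0" by (intro sum_nonneg) simp
  have le: "norm g \<le> (\<Sum>g\<in>W. norm g)" if "g \<in> W" for g
    using W(1) that by (intro member_le_sum) (auto simp: P_def)
  have "\<exists>\<sigma>\<in>\<Gamma>. norm (\<sigma> ** w) \<le> R" if w: "w \<in> SL2" "thick w" for w
  proof (cases "w \<in> W")
    case True
    have "norm (mat 1 ** w) \<le> R" using le[OF True] nonneg by (simp add: R_def)
    then show ?thesis using one by blast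
  next
    case False
    have "\<not> P (insert w W)"
    proof
      assume "P (insert w W)"
      then have "card (insert w W) \<le> card W" by (rule W(2))
      then show False using False W(1) by (simp add: P_def)
    qed
    then obtain g \<sigma> where g: "g \<in> W" "\<sigma> \<in> \<Gamma>"
      "norm (adj2 g ** \<sigma> ** w) \<le> 13 \<or> norm (adj2 w ** \<sigma> ** g) \<le> 13"
      using W(1) w False unfolding P_def by (auto simp: not_less)
    obtain \<tau> where t: "\<tau> \<in> \<Gamma>" "norm (adj2 g ** \<tau> ** w) \<le> 13"
    proof (cases "norm (adj2 g ** \<sigma> ** w) \<le> 13")
      case True
      then show ?thesis using that g(2) by blast
    next
      case False
      have "adj2 (adj2 w ** \<sigma> ** g) = adj2 g ** adj2 \<sigma> ** w"
        by (simp only: adj2_mult_distrib adj2_adj2 matrix_mul_assoc)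
      then have "norm (adj2 (adj2 w ** \<sigma> ** g)) = norm (adj2 g ** adj2 \<sigma> ** w)" by (rule arg_cong)
      then have "norm (adj2 g ** adj2 \<sigma> ** w) = norm (adj2 w ** \<sigma> ** g)" by (simp only: norm_adj2)
      then show ?thesis using that[of "adj2 \<sigma>"] inv[OF g(2)] g(3) False by simp
    qed
    have gS: "g \<in> SL2" using W(1) g(1) by (simp add: P_def)
    have "\<tau> ** w = g ** (adj2 g ** \<tau> ** w)"
      using gS by (simp only: matrix_mul_assoc[symmetric] adj2_mult_cancel)
    then have "norm (\<tau> ** w) = norm (g ** (adj2 g ** \<tau> ** w))" by (rule arg_cong)
    also have "\<dots> \<le> norm g * norm (adj2 g ** \<tau> ** w)" by (rule norm_matrix_mult_le)
    also have "\<dots> \<le> (\<Sum>g\<in>W. norm g) * 13" using le[OF g(1)] t(2) nonneg by (intro mult_mono) auto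
    finally have "norm (\<tau> ** w) \<le> R" by (simp add: R_def)
    then show ?thesis using t(1) by blast
  qed
  moreover have "R > 0" using nonneg by (simp add: R_def)
  ultimately show ?thesis by blast
qed

end

section \<open>Growth of matrix powers\<close>

lemma norm_smult_vec: "norm (c *s v) = norm c * norm v" for c :: complex and v :: "complex^'n"
  by (simp add: norm_vec_def norm_mult L2_set_right_distrib)

lemma norm_smult_vec_le: "norm c \<le> b \<Longrightarrow> norm (c *s v) \<le> b * norm v" for c :: complex and v :: "complex^'n"
  by (simp add: norm_smult_vec mult_right_mono)

definition mpow :: "complex^'m^'m \<Rightarrow> nat \<Rightarrow> complex^'m \<Rightarrow> complex^'m" where
  "mpow T i u = (((*v) T) ^^ i) u"

lemma mpow_0 [simp]: "mpow T 0 u = u" by (simp add: mpow_def)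
lemma mpow_Suc: "mpow T (Suc i) u = T *v mpow T i u" by (simp add: mpow_def)
lemma mpow_Suc2: "mpow T (Suc i) u = mpow T i (T *v u)" by (simp add: mpow_def funpow_swap1)

lemma mpow_diff: "mpow T i (u - w) = mpow T i u - mpow T i w"
  by (induction i) (simp_all add: mpow_Suc matrix_vector_mult_diff_distrib)

lemma mpow_smult: "mpow T i (c *s u) = c *s mpow T i u"
  by (induction i) (simp_all add: mpow_Suc vector_scalar_commute)

lemma mpow_zero [simp]: "mpow T i 0 = 0"
  by (induction i) (simp_all add: mpow_Suc)

lemma mpow_sum: "mpow T i (\<Sum>k\<in>A. f k) = (\<Sum>k\<in>A. mpow T i (f k))"
proof (induction i)
  case (Suc i)
  have "T *v (\<Sum>k\<in>A. g k) = (\<Sum>k\<in>A. T *v g k)" for g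
    by (induction A rule: infinite_finite_induct) (simp_all add: matrix_vector_right_distrib)
  then show ?case using Suc by (simp add: mpow_Suc)
qed simp

text \<open>The vector p(T) u.\<close>

definition poly_act :: "complex^'m^'m \<Rightarrow> complex poly \<Rightarrow> complex^'m \<Rightarrow> complex^'m" where
  "poly_act T p u = (\<Sum>i\<le>degree p. coeff p i *s mpow T i u)"

lemma poly_act_upto: assumes "degree p \<le> N" shows "poly_act T p u = (\<Sum>i\<le>N. coeff p i *s mpow T i u)"
  unfolding poly_act_def using assms
  by (intro sum.mono_neutral_left) (auto simp: coeff_eq_0)

lemma poly_act_diff: "poly_act T p (u - w) = poly_act T p u - poly_act T p w"
  by (simp add: poly_act_def mpow_diff vector_ssub_ldistrib sum_subtractf)

lemma poly_act_smult: "poly_act T p (c *s u) = c *s poly_act T p u"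
  by (simp add: poly_act_def mpow_smult vec.scale_sum_right mult.commute)

lemma poly_act_mult_vec: "poly_act T p (T *v u) = T *v poly_act T p u"
proof -
  have "T *v (\<Sum>k\<in>A. g k) = (\<Sum>k\<in>A. T *v g k)" for g and A :: "nat set"
    by (induction A rule: infinite_finite_induct) (simp_all add: matrix_vector_right_distrib)
  then show ?thesis unfolding poly_act_def
    by (simp only: mpow_Suc2[symmetric] mpow_Suc vector_scalar_commute)
qed

lemma poly_act_linear_factor:
  "poly_act T ([:-\<mu>, 1:] * q) u = poly_act T q (T *v u - \<mu> *s u)"
proof -
  have p: "[:-\<mu>, 1:] * q = pCons 0 q - smult \<mu> q" by simp
  have "degree (pCons 0 q - smult \<mu> q) \<le> Suc (degree q)"
    by (intro degree_diff_le degree_pCons_le) (auto intro: le_trans[OF degree_smult_le])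
  then have "poly_act T ([:-\<mu>, 1:] * q) u = (\<Sum>i\<le>Suc (degree q). coeff (pCons 0 q - smult \<mu> q) i *s mpow T i u)"
    unfolding p by (rule poly_act_upto)
  also have "\<dots> = (\<Sum>i\<le>Suc (degree q). coeff (pCons 0 q) i *s mpow T i u) -
      (\<Sum>i\<le>Suc (degree q). \<mu> *s (coeff q i *s mpow T i u))"
    by (simp only: coeff_diff coeff_smult vector_sub_rdistrib sum_subtractf vector_smult_assoc)
  also have "(\<Sum>i\<le>Suc (degree q). coeff (pCons 0 q) i *s mpow T i u) = poly_act T q (T *v u)"
    unfolding sum.atMost_Suc_shift poly_act_def by (simp add: mpow_Suc2)
  also have "(\<Sum>i\<le>Suc (degree q). \<mu> *s (coeff q i *s mpow T i u)) = poly_act T q (\<mu> *s u)"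
    unfolding poly_act_smult poly_act_upto[of q "Suc (degree q)" T u, OF le_SucI[OF order_refl]]
    by (simp only: vec.scale_sum_right)
  finally show ?thesis by (simp only: poly_act_diff)
qed

lemma of_real_smult: "complex_of_real r *s v = r *\<^sub>R v"
  unfolding vec_eq_iff vector_smult_component vector_scaleR_component by (simp add: scaleR_conv_of_real)

text \<open>The first D + 1 iterates of u are linearly dependent, D being the real dimension. If two
  iterates coincide they do not form a set of D + 1 vectors, and a difference of two monomials
  serves.\<close>

lemma annihilating_poly:
  fixes T :: "complex^'m^'m"
  shows "\<exists>p. p \<noteq> 0 \<and> poly_act T p u = 0"
proof -
  define D where "D = DIM(complex^'m)"
  show ?thesis
  proof (cases "inj_on (\<lambda>i. mpow T i u) {..D}")
    case True
    define S where "S = (\<lambda>i. mpow T i u) ` {..D}"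
    have "card S = Suc D" unfolding S_def using card_image[OF True] by simp
    then have "dependent S" by (intro dependent_biggerset) (simp add: D_def)
    moreover have "finite S" by (simp add: S_def)
    ultimately obtain c where c: "\<exists>v\<in>S. c v \<noteq> 0" "(\<Sum>v\<in>S. c v *\<^sub>R v) = 0"
      using dependent_finite by blast
    define p where "p = (\<Sum>i\<le>D. monom (complex_of_real (c (mpow T i u))) i)"
    have cp: "coeff p k = (if k \<le> D then complex_of_real (c (mpow T k u)) else 0)" for k
      unfolding p_def coeff_sum by (simp add: if_distrib cong: if_cong)
    have "degree p \<le> D" by (rule degree_le) (simp add: cp)
    then have "poly_act T p u = (\<Sum>i\<le>D. coeff p i *s mpow T i u)" by (rule poly_act_upto)
    also have "\<dots> = (\<Sum>i\<le>D. c (mpow T i u) *\<^sub>R mpow T i u)"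
      by (intro sum.cong refl) (simp add: cp of_real_smult)
    also have "\<dots> = (\<Sum>v\<in>S. c v *\<^sub>R v)" unfolding S_def by (rule sum.reindex_cong[OF True, symmetric]) auto
    finally have "poly_act T p u = 0" using c(2) by simp
    moreover have "p \<noteq> 0"
    proof
      assume "p = 0"
      obtain k where "k \<le> D" "c (mpow T k u) \<noteq> 0" using c(1) by (auto simp: S_def)
      then show False using cp[of k] \<open>p = 0\<close> by simp
    qed
    ultimately show ?thesis by blast
  next
    case False
    then obtain i j where ij: "i < j" "mpow T i u = mpow T j u"
      unfolding inj_on_def by (metis linorder_neqE_nat)
    define p where "p = monom (1::complex) j - monom 1 i"
    have cp: "coeff p k = (if k = j then 1 else 0) - (if k = i then 1 else 0)" for k
      by (simp add: p_def)
    have "degree p \<le> j" by (rule degree_le) (use ij in \<open>auto simp: cp\<close>)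
    then have "poly_act T p u = (\<Sum>k\<le>j. coeff p k *s mpow T k u)" by (rule poly_act_upto)
    also have "\<dots> = (\<Sum>k\<le>j. (if k = j then mpow T k u else 0) - (if k = i then mpow T k u else 0))"
      by (intro sum.cong refl) (simp add: cp)
    also have "\<dots> = mpow T j u - mpow T i u" using ij(1) by (simp add: sum_subtractf)
    finally have "poly_act T p u = 0" using ij by simp
    moreover have "coeff p j \<noteq> 0" using ij by (simp add: cp)
    then have "p \<noteq> 0" by auto
    ultimately show ?thesis by blast
  qed
qed

definition poly_growth :: "complex^'m^'m \<Rightarrow> complex^'m \<Rightarrow> bool" where
  "poly_growth T u \<longleftrightarrow> (\<exists>C M. C \<ge> 0 \<and> (\<forall>n. norm (mpow T n u) \<le> C * (1 + real n) ^ M))"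

text \<open>The iterates satisfy x(n+1) = \<mu> x(n) + b(n) with b polynomially bounded; as |\<mu>|
  is at most 1, adding up n terms raises the exponent by one.\<close>

lemma poly_growth_step:
  assumes "poly_growth T (T *v u - \<mu> *s u)" "cmod \<mu> \<le> 1"
  shows "poly_growth T u"
proof -
  obtain C M where C: "C \<ge> 0" "\<And>n. norm (mpow T n (T *v u - \<mu> *s u)) \<le> C * (1 + real n) ^ M"
    using assms(1) by (auto simp: poly_growth_def)
  have bnd: "norm (mpow T n u) \<le> norm u + real n * (C * (1 + real n) ^ M)" for n
  proof (induction n)
    case (Suc n)
    have "mpow T (Suc n) u = mpow T n (T *v u - \<mu> *s u) + \<mu> *s mpow T n u"
      by (simp add: mpow_diff mpow_smult mpow_Suc2)
    then have "norm (mpow T (Suc n) u) \<le> C * (1 + real n) ^ M + 1 * norm (mpow T n u)"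
      using norm_triangle_mono[OF C(2) norm_smult_vec_le[OF assms(2)]] by metis
    also have "\<dots> \<le> norm u + real (Suc n) * (C * (1 + real n) ^ M)" using Suc by (simp add: algebra_simps)
    also have "\<dots> \<le> norm u + real (Suc n) * (C * (1 + real (Suc n)) ^ M)"
      using C(1) by (intro add_left_mono mult_left_mono power_mono) auto
    finally show ?case .
  qed simp
  have "norm (mpow T n u) \<le> (norm u + C) * (1 + real n) ^ Suc M" for n
  proof -
    have "norm u * 1 \<le> norm u * (1 + real n) ^ Suc M"
      by (intro mult_left_mono one_le_power) auto
    moreover have "real n * (C * (1 + real n) ^ M) \<le> (1 + real n) * (C * (1 + real n) ^ M)"
      using C(1) by (intro mult_right_mono) auto
    ultimately show ?thesis using bnd[of n] by (simp add: algebra_simps)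
  qed
  then show ?thesis unfolding poly_growth_def using C(1) by (intro exI[of _ "norm u + C"] exI[of _ "Suc M"]) auto
qed

text \<open>A root of p need not be an eigenvalue of T. The linear factor of an eigenvalue is
  removed by the growth step; for any other root \<mu> the map T - \<mu> is injective and the factor
  can be cancelled.\<close>

lemma poly_act_growth:
  assumes ev: "\<And>l. eigenvalue T l \<Longrightarrow> cmod l \<le> 1"
  shows "p \<noteq> 0 \<Longrightarrow> poly_act T p u = 0 \<Longrightarrow> poly_growth T u"
proof (induction "degree p" arbitrary: p u rule: less_induct)
  case less
  show ?case
  proof (cases "degree p = 0")
    case True
    then have "coeff p 0 *s u = 0" using less.prems(2) by (simp add: poly_act_def)
    moreover have "coeff p 0 \<noteq> 0" using True less.prems(1) leading_coeff_neq_0[of p] by simp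
    ultimately have "u = 0" by simp
    then show ?thesis by (auto simp: poly_growth_def intro!: exI[of _ 0])
  next
    case False
    then obtain \<mu> where "poly p \<mu> = 0"
      using alg_closed_imp_poly_has_root[of p] by blast
    then obtain q where pq: "p = [:-\<mu>, 1:] * q" unfolding poly_eq_0_iff_dvd by (rule dvdE)
    have q: "q \<noteq> 0" using pq less.prems(1) by auto
    then have "degree p = Suc (degree q)" unfolding pq by (subst degree_mult_eq) auto
    then have deg: "degree q < degree p" by simp
    have a: "poly_act T q (T *v u - \<mu> *s u) = 0" using less.prems(2) unfolding pq poly_act_linear_factor .
    show ?thesis
    proof (cases "eigenvalue T \<mu>")
      case True
      then show ?thesis using less.hyps[OF deg q a] ev poly_growth_step by blast
    next
      case False
      have "T *v poly_act T q u = \<mu> *s poly_act T q u"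
        using a by (simp add: poly_act_diff poly_act_smult poly_act_mult_vec)
      then have "poly_act T q u = 0" using False unfolding eigenvalue_def by blast
      then show ?thesis using less.hyps[OF deg q] by blast
    qed
  qed
qed

lemma matrix_power_growth:
  fixes T :: "complex^'m^'m"
  assumes "\<And>l. eigenvalue T l \<Longrightarrow> cmod l \<le> 1"
  shows "\<exists>C M. C \<ge> 0 \<and> (\<forall>n v. norm (mpow T n v) \<le> C * (1 + real n) ^ M * norm v)"
proof -
  have "poly_growth T (axis k 1)" for k
    using annihilating_poly poly_act_growth[OF assms] by blast
  then have "\<forall>k. \<exists>C M. C \<ge> 0 \<and> (\<forall>n. norm (mpow T n (axis k 1)) \<le> C * (1 + real n) ^ M)"
    by (simp add: poly_growth_def)
  then obtain C M where CM: "\<And>k. C k \<ge> 0" "\<And>k n. norm (mpow T n (axis k 1)) \<le> C k * (1 + real n) ^ M k"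
    by metis
  define M' where "M' = (\<Sum>k\<in>UNIV. M k)"
  define C' where "C' = (\<Sum>k\<in>UNIV. C k)"
  have "norm (mpow T n v) \<le> C' * (1 + real n) ^ M' * norm v" for n v
  proof -
    have "mpow T n v = (\<Sum>k\<in>UNIV. v$k *s mpow T n (axis k 1))"
      by (subst basis_expansion[symmetric]) (simp only: mpow_sum mpow_smult)
    also have "norm \<dots> \<le> (\<Sum>k\<in>UNIV. norm v * (C k * (1 + real n) ^ M'))"
    proof (rule sum_norm_le)
      fix k
      have "M k \<le> M'" unfolding M'_def by (rule member_le_sum) auto
      then have "C k * (1 + real n) ^ M k \<le> C k * (1 + real n) ^ M'"
        by (intro mult_left_mono power_increasing CM(1)) auto
      then have "norm (mpow T n (axis k 1)) \<le> C k * (1 + real n) ^ M'" using CM(2) order_trans by blast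
      moreover have "norm (v$k) \<le> norm v" by (rule Finite_Cartesian_Product.norm_nth_le)
      ultimately show "norm (v$k *s mpow T n (axis k 1)) \<le> norm v * (C k * (1 + real n) ^ M')"
        unfolding norm_smult_vec by (intro mult_mono) auto
    qed
    also have "\<dots> = C' * (1 + real n) ^ M' * norm v"
      by (simp add: C'_def sum_distrib_left[symmetric] sum_distrib_right[symmetric] mult.commute)
    finally show ?thesis .
  qed
  moreover have "C' \<ge> 0" unfolding C'_def by (intro sum_nonneg CM)
  ultimately show ?thesis by blast
qed

text \<open>For an eigenvector v with eigenvalue l, the bilinear product of v with the n-th iterate
  of x under the transpose is l^n times its product with x. So a polynomial annihilating the k-th
  basis vector under the transpose has l as a root whenever the k-th component of v is
  nonzero.\<close>

lemma finite_eigenvalues: "finite {l. eigenvalue (T :: complex^'m^'m) l}"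
proof -
  define T' where "T' = transpose T"
  obtain p where p: "\<And>k. p k \<noteq> 0" "\<And>k. poly_act T' (p k) (axis k 1) = 0"
  proof -
    have "\<forall>k. \<exists>p. p \<noteq> 0 \<and> poly_act T' p (axis k 1) = 0" using annihilating_poly by blast
    then show ?thesis using that by metis
  qed
  have dot: "(\<Sum>i\<in>UNIV. v$i * (T' *v x)$i) = (\<Sum>j\<in>UNIV. (T *v v)$j * x$j)" for v x
    unfolding T'_def matrix_vector_mult_def transpose_def
    by (simp add: sum_distrib_left sum_distrib_right mult_ac, subst sum.swap, rule refl)
  have "{l. eigenvalue T l} \<subseteq> (\<Union>k\<in>UNIV. {l. poly (p k) l = 0})"
  proof
    fix l assume "l \<in> {l. eigenvalue T l}"
    then obtain v where v: "v \<noteq> 0" "T *v v = l *s v" by (auto simp: eigenvalue_def)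
    then obtain k where k: "v$k \<noteq> 0" by (auto simp: vec_eq_iff)
    have pow: "(\<Sum>i\<in>UNIV. v$i * (mpow T' n x)$i) = l ^ n * (\<Sum>i\<in>UNIV. v$i * x$i)" for n x
    proof (induction n)
      case (Suc n)
      then show ?case unfolding mpow_Suc dot v(2) by (simp add: sum_distrib_left[symmetric] mult.assoc)
    qed simp
    have ax: "(\<Sum>i\<in>UNIV. v$i * axis k 1 $ i) = v$k" by (simp add: axis_def if_distrib cong: if_cong)
    have "0 = (\<Sum>i\<in>UNIV. v$i * (poly_act T' (p k) (axis k 1))$i)" by (simp add: p(2))
    also have "\<dots> = (\<Sum>n\<le>degree (p k). coeff (p k) n * (\<Sum>i\<in>UNIV. v$i * (mpow T' n (axis k 1))$i))"
      unfolding poly_act_def sum_component vector_smult_component sum_distrib_left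
      by (subst sum.swap) (simp add: mult_ac)
    also have "\<dots> = poly (p k) l * v$k"
      unfolding pow ax poly_altdef by (simp add: sum_distrib_right mult.assoc)
    finally have "poly (p k) l = 0" using k by simp
    then show "l \<in> (\<Union>k\<in>UNIV. {l. poly (p k) l = 0})" by blast
  qed
  moreover have "finite (\<Union>k\<in>UNIV. {l. poly (p k) l = 0})" using p(1) poly_roots_finite by auto
  ultimately show ?thesis by (rule finite_subset)
qed

section \<open>Growth of logarithmic Fourier series\<close>

text \<open>Growth of order at most y^(-s) as y tends to 0, locally uniformly in the real part. All
  widths R are demanded so that the notion is stable under real shifts.\<close>

definition strip_bound :: "real \<Rightarrow> (complex \<Rightarrow> complex^'m) \<Rightarrow> bool" where
  "strip_bound s f \<longleftrightarrow> (\<forall>R. \<exists>B\<ge>0. \<forall>\<tau>. \<bar>Re \<tau>\<bar> \<le> R \<and> 0 < Im \<tau> \<and> Im \<tau> \<le> 1 \<longrightarrow> norm (f \<tau>) \<le> B * Im \<tau> powr (- s))"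

lemma strip_boundI:
  assumes "\<And>R. \<exists>B\<ge>0. \<forall>\<tau>. \<bar>Re \<tau>\<bar> \<le> R \<longrightarrow> 0 < Im \<tau> \<longrightarrow> Im \<tau> \<le> 1 \<longrightarrow> norm (f \<tau>) \<le> B * Im \<tau> powr (- s)"
  shows "strip_bound s f"
  using assms unfolding strip_bound_def by blast

lemma strip_boundD:
  assumes "strip_bound s f"
  shows "\<exists>B\<ge>0. \<forall>\<tau>. \<bar>Re \<tau>\<bar> \<le> R \<longrightarrow> 0 < Im \<tau> \<longrightarrow> Im \<tau> \<le> 1 \<longrightarrow> norm (f \<tau>) \<le> B * Im \<tau> powr (- s)"
  using assms unfolding strip_bound_def by blast

lemma strip_bound_cong:
  assumes "\<And>\<tau>. Im \<tau> > 0 \<Longrightarrow> f \<tau> = g \<tau>" "strip_bound s f" shows "strip_bound s g"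
proof (rule strip_boundI)
  fix R
  obtain B where B: "B \<ge> 0" "\<And>\<tau>. \<bar>Re \<tau>\<bar> \<le> R \<Longrightarrow> 0 < Im \<tau> \<Longrightarrow> Im \<tau> \<le> 1 \<Longrightarrow> norm (f \<tau>) \<le> B * Im \<tau> powr (- s)"
    using strip_boundD[OF assms(2), of R] by blast
  show "\<exists>B\<ge>0. \<forall>\<tau>. \<bar>Re \<tau>\<bar> \<le> R \<longrightarrow> 0 < Im \<tau> \<longrightarrow> Im \<tau> \<le> 1 \<longrightarrow> norm (g \<tau>) \<le> B * Im \<tau> powr (- s)"
    by (intro exI[of _ B] conjI allI impI) (use B assms(1) in auto)
qed

lemma strip_bound_zero: "strip_bound s (\<lambda>\<tau>. 0)"
  by (rule strip_boundI) (auto intro: exI[of _ 0])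

lemma strip_bound_add:
  assumes "strip_bound s f" "strip_bound s g" shows "strip_bound s (\<lambda>\<tau>. f \<tau> + g \<tau>)"
proof (rule strip_boundI)
  fix R
  obtain B where B: "B \<ge> 0" "\<And>\<tau>. \<bar>Re \<tau>\<bar> \<le> R \<Longrightarrow> 0 < Im \<tau> \<Longrightarrow> Im \<tau> \<le> 1 \<Longrightarrow> norm (f \<tau>) \<le> B * Im \<tau> powr (- s)"
    using strip_boundD[OF assms(1), of R] by blast
  obtain B' where B': "B' \<ge> 0" "\<And>\<tau>. \<bar>Re \<tau>\<bar> \<le> R \<Longrightarrow> 0 < Im \<tau> \<Longrightarrow> Im \<tau> \<le> 1 \<Longrightarrow> norm (g \<tau>) \<le> B' * Im \<tau> powr (- s)"
    using strip_boundD[OF assms(2), of R] by blast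
  show "\<exists>B\<ge>0. \<forall>\<tau>. \<bar>Re \<tau>\<bar> \<le> R \<longrightarrow> 0 < Im \<tau> \<longrightarrow> Im \<tau> \<le> 1 \<longrightarrow> norm (f \<tau> + g \<tau>) \<le> B * Im \<tau> powr (- s)"
  proof (intro exI[of _ "B + B'"] conjI allI impI)
    fix \<tau> assume "\<bar>Re \<tau>\<bar> \<le> R" "0 < Im \<tau>" "Im \<tau> \<le> 1"
    then show "norm (f \<tau> + g \<tau>) \<le> (B + B') * Im \<tau> powr (- s)"
      unfolding distrib_right by (intro norm_triangle_mono B B')
  qed (use B B' in simp)
qed

lemma strip_bound_mult:
  assumes "strip_bound s f" and c: "\<And>R. \<exists>K\<ge>0. \<forall>\<tau>. \<bar>Re \<tau>\<bar> \<le> R \<longrightarrow> 0 < Im \<tau> \<longrightarrow> Im \<tau> \<le> 1 \<longrightarrow> cmod (c \<tau>) \<le> K"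
  shows "strip_bound s (\<lambda>\<tau>. c \<tau> *s f \<tau>)"
proof (rule strip_boundI)
  fix R
  obtain B where B: "B \<ge> 0" "\<And>\<tau>. \<bar>Re \<tau>\<bar> \<le> R \<Longrightarrow> 0 < Im \<tau> \<Longrightarrow> Im \<tau> \<le> 1 \<Longrightarrow> norm (f \<tau>) \<le> B * Im \<tau> powr (- s)"
    using strip_boundD[OF assms(1), of R] by blast
  obtain K where K: "K \<ge> 0" "\<And>\<tau>. \<bar>Re \<tau>\<bar> \<le> R \<Longrightarrow> 0 < Im \<tau> \<Longrightarrow> Im \<tau> \<le> 1 \<Longrightarrow> cmod (c \<tau>) \<le> K"
    using c[of R] by blast
  show "\<exists>B\<ge>0. \<forall>\<tau>. \<bar>Re \<tau>\<bar> \<le> R \<longrightarrow> 0 < Im \<tau> \<longrightarrow> Im \<tau> \<le> 1 \<longrightarrow> norm (c \<tau> *s f \<tau>) \<le> B * Im \<tau> powr (- s)"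
  proof (intro exI[of _ "K * B"] conjI allI impI)
    fix \<tau> assume "\<bar>Re \<tau>\<bar> \<le> R" "0 < Im \<tau>" "Im \<tau> \<le> 1"
    then show "norm (c \<tau> *s f \<tau>) \<le> (K * B) * Im \<tau> powr (- s)"
      unfolding norm_smult_vec mult.assoc using K B by (intro mult_mono) auto
  qed (use B K in simp)
qed

lemma strip_bound_smult: "strip_bound s f \<Longrightarrow> strip_bound s (\<lambda>\<tau>. c *s f \<tau>)"
  by (rule strip_bound_mult) (auto intro!: exI[of _ "cmod c"])

lemma strip_bound_diff:
  assumes "strip_bound s f" "strip_bound s g" shows "strip_bound s (\<lambda>\<tau>. f \<tau> - g \<tau>)"
  using strip_bound_add[OF assms(1) strip_bound_smult[OF assms(2), of "-1"]] by simp

lemma strip_bound_sum: "(\<And>i. i \<in> A \<Longrightarrow> strip_bound s (f i)) \<Longrightarrow> strip_bound s (\<lambda>\<tau>. \<Sum>i\<in>A. f i \<tau>)"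
  by (induction A rule: infinite_finite_induct) (auto intro: strip_bound_zero strip_bound_add)

lemma strip_bound_shift:
  assumes "strip_bound s f" shows "strip_bound s (\<lambda>\<tau>. f (\<tau> + of_real h))"
proof (rule strip_boundI)
  fix R
  obtain B where B: "B \<ge> 0" "\<And>\<tau>. \<bar>Re \<tau>\<bar> \<le> R + \<bar>h\<bar> \<Longrightarrow> 0 < Im \<tau> \<Longrightarrow> Im \<tau> \<le> 1 \<Longrightarrow> norm (f \<tau>) \<le> B * Im \<tau> powr (- s)"
    using strip_boundD[OF assms, of "R + \<bar>h\<bar>"] by blast
  show "\<exists>B\<ge>0. \<forall>\<tau>. \<bar>Re \<tau>\<bar> \<le> R \<longrightarrow> 0 < Im \<tau> \<longrightarrow> Im \<tau> \<le> 1 \<longrightarrow> norm (f (\<tau> + of_real h)) \<le> B * Im \<tau> powr (- s)"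
  proof (intro exI[of _ B] conjI allI impI)
    fix \<tau> assume "\<bar>Re \<tau>\<bar> \<le> R" "0 < Im \<tau>" "Im \<tau> \<le> 1"
    then show "norm (f (\<tau> + of_real h)) \<le> B * Im \<tau> powr (- s)"
      using B(2)[of "\<tau> + of_real h"] by simp
  qed (rule B(1))
qed

lemma strip_bound_log_q:
  assumes "strip_bound s f" shows "strip_bound s (\<lambda>\<tau>. log_q h \<tau> ^ j *s f \<tau>)"
proof (rule strip_bound_mult[OF assms])
  fix R
  have "cmod (log_q h \<tau> ^ j) \<le> (2 * pi * (\<bar>R\<bar> + 1) / \<bar>h\<bar>) ^ j" if "\<bar>Re \<tau>\<bar> \<le> R" "0 < Im \<tau>" "Im \<tau> \<le> 1" for \<tau>
  proof -
    have "cmod \<tau> \<le> \<bar>R\<bar> + 1" using cmod_le[of \<tau>] that by linarith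
    then have "cmod (log_q h \<tau>) \<le> 2 * pi * (\<bar>R\<bar> + 1) / \<bar>h\<bar>"
      by (simp add: log_q_def norm_mult norm_divide divide_right_mono)
    then show ?thesis unfolding norm_power by (intro power_mono) auto
  qed
  moreover have "(2 * pi * (\<bar>R\<bar> + 1) / \<bar>h\<bar>) ^ j \<ge> 0" by simp
  ultimately show "\<exists>K\<ge>0. \<forall>\<tau>. \<bar>Re \<tau>\<bar> \<le> R \<longrightarrow> 0 < Im \<tau> \<longrightarrow> Im \<tau> \<le> 1 \<longrightarrow> cmod (log_q h \<tau> ^ j) \<le> K" by blast
qed

text \<open>Back substitution, starting from the unknown of highest index.\<close>

lemma strip_bound_triangular:
  fixes f g :: "nat \<Rightarrow> complex \<Rightarrow> complex^'m"
  assumes "\<And>i. i < n \<Longrightarrow> strip_bound s (g i)"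
    and "\<And>i \<tau>. i < n \<Longrightarrow> Im \<tau> > 0 \<Longrightarrow> g i \<tau> = (\<Sum>j\<in>{i..<n}. a i j *s f j \<tau>)"
    and "\<And>i. i < n \<Longrightarrow> a i i \<noteq> 0"
  shows "i < n \<Longrightarrow> strip_bound s (f i)"
proof (induction "n - i" arbitrary: i rule: less_induct)
  case less
  have "strip_bound s (\<lambda>\<tau>. g i \<tau> - (\<Sum>j\<in>{Suc i..<n}. a i j *s f j \<tau>))"
    by (intro strip_bound_diff strip_bound_sum strip_bound_smult assms(1) less.hyps) (use less.prems in auto)
  then have "strip_bound s (\<lambda>\<tau>. inverse (a i i) *s (g i \<tau> - (\<Sum>j\<in>{Suc i..<n}. a i j *s f j \<tau>)))"
    by (rule strip_bound_smult)
  then show ?case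
  proof (rule strip_bound_cong[rotated])
    fix \<tau> :: complex assume "Im \<tau> > 0"
    then have "g i \<tau> - (\<Sum>j\<in>{Suc i..<n}. a i j *s f j \<tau>) = a i i *s f i \<tau>"
      using assms(2)[OF less.prems] less.prems by (simp add: sum.atLeast_Suc_lessThan)
    then show "inverse (a i i) *s (g i \<tau> - (\<Sum>j\<in>{Suc i..<n}. a i j *s f j \<tau>)) = f i \<tau>"
      using assms(3)[OF less.prems] by simp
  qed
qed

text \<open>The operator \<open>Y(\<tau>) \<mapsto> Y(\<tau> + h) - \<lambda>\<^sub>0 Y(\<tau>)\<close> lowers the degree in \<open>log q\<close> of the \<open>\<lambda>\<^sub>0\<close>-part and keeps
  the degrees of the other parts.\<close>

lemma log_separation:
  fixes f :: "complex \<Rightarrow> nat \<Rightarrow> complex \<Rightarrow> complex^'m" and m :: "complex \<Rightarrow> nat"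
  assumes h: "h > 0" and fin: "finite \<Lambda>" and nz: "\<And>l. l \<in> \<Lambda> \<Longrightarrow> l \<noteq> 0"
  shows "(\<And>l j \<tau>. l \<in> \<Lambda> \<Longrightarrow> j < m l \<Longrightarrow> Im \<tau> > 0 \<Longrightarrow> f l j (\<tau> + of_real h) = l *s f l j \<tau>) \<Longrightarrow>
    strip_bound s (\<lambda>\<tau>. \<Sum>l\<in>\<Lambda>. \<Sum>j<m l. log_q h \<tau> ^ j *s f l j \<tau>) \<Longrightarrow> l \<in> \<Lambda> \<Longrightarrow> j < m l \<Longrightarrow> strip_bound s (f l j)"
proof (induction "sum m \<Lambda>" arbitrary: m f l j rule: less_induct)
  case less
  note per = less.prems(1) and bnd = less.prems(2)
  define w where "w = 2 * of_real pi * \<i>"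
  define l0 where "l0 = l"
  have l0: "l0 \<in> \<Lambda>" "m l0 > 0" using less.prems by (auto simp: l0_def)
  define m' where "m' = m(l0 := m l0 - 1)"
  \<comment> \<open>The coefficient of \<open>log_q ^ i\<close> in
    \<open>l * (log_q + w) ^ j - l0 * log_q ^ j\<close>, where w is the change of
    \<open>log_q\<close> under a shift by h.\<close>
  define a where "a l i j = l * (of_nat (j choose i) * w ^ (j - i)) - (if i = j then l0 else 0)" for l :: complex and i j
  define f' where "f' l i \<tau> = (\<Sum>j\<in>{i..<m l}. a l i j *s f l j \<tau>)" for l i \<tau>
  have logh: "log_q h (\<tau> + of_real h) = log_q h \<tau> + w" for \<tau>
    using h by (simp add: log_q_def w_def add_divide_distrib distrib_left)
  have step_eq: "(\<Sum>j<m l. (log_q h \<tau> + w) ^ j *s (l *s f l j \<tau>)) - l0 *s (\<Sum>j<m l. log_q h \<tau> ^ j *s f l j \<tau>)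
      = (\<Sum>i<m l. log_q h \<tau> ^ i *s f' l i \<tau>)" for l \<tau>
  proof -
    define L where "L = log_q h \<tau>"
    have "(\<Sum>i<m l. L ^ i *s f' l i \<tau>) = (\<Sum>i<m l. \<Sum>j\<in>{i..<m l}. (L ^ i * a l i j) *s f l j \<tau>)"
      by (simp add: f'_def vec.scale_sum_right)
    also have "\<dots> = (\<Sum>j<m l. \<Sum>i\<le>j. (L ^ i * a l i j) *s f l j \<tau>)"
      by (subst sum.Sigma, simp, simp, subst sum.Sigma, simp, simp,
          rule sum.reindex_bij_witness[of _ "\<lambda>(j, i). (i, j)" "\<lambda>(i, j). (j, i)"]) auto
    also have "\<dots> = (\<Sum>j<m l. ((L + w) ^ j * l - l0 * L ^ j) *s f l j \<tau>)"
    proof (intro sum.cong refl)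
      fix j
      have "(\<Sum>i\<le>j. L ^ i * a l i j) = (\<Sum>i\<le>j. l * (of_nat (j choose i) * L ^ i * w ^ (j - i))) - (\<Sum>i\<le>j. if i = j then l0 * L ^ i else 0)"
        unfolding a_def sum_subtractf[symmetric] by (intro sum.cong refl) (simp add: algebra_simps)
      also have "(\<Sum>i\<le>j. l * (of_nat (j choose i) * L ^ i * w ^ (j - i))) = l * (L + w) ^ j"
        unfolding binomial_ring sum_distrib_left ..
      also have "(\<Sum>i\<le>j. if i = j then l0 * L ^ i else 0) = l0 * L ^ j" by simp
      finally show "(\<Sum>i\<le>j. (L ^ i * a l i j) *s f l j \<tau>) = ((L + w) ^ j * l - l0 * L ^ j) *s f l j \<tau>"
        by (simp only: vec.scale_sum_left[symmetric] mult.commute)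
    qed
    also have "\<dots> = (\<Sum>j<m l. (L + w) ^ j *s (l *s f l j \<tau>)) - l0 *s (\<Sum>j<m l. L ^ j *s f l j \<tau>)"
      by (simp add: vector_sub_rdistrib sum_subtractf vec.scale_sum_right)
    finally show ?thesis unfolding L_def ..
  qed
  have f'0: "f' l0 i \<tau> = 0" if "m l0 - 1 \<le> i" for i \<tau>
  proof -
    have "a l0 i j = 0" if "j \<in> {i..<m l0}" for j
    proof -
      have "j = i" using \<open>m l0 - 1 \<le> i\<close> that by auto
      then show ?thesis by (simp add: a_def)
    qed
    then show ?thesis by (simp add: f'_def)
  qed
  have bnd': "strip_bound s (\<lambda>\<tau>. \<Sum>l\<in>\<Lambda>. \<Sum>j<m' l. log_q h \<tau> ^ j *s f' l j \<tau>)"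
  proof -
    define Y where "Y \<tau> = (\<Sum>l\<in>\<Lambda>. \<Sum>j<m l. log_q h \<tau> ^ j *s f l j \<tau>)" for \<tau>
    have "strip_bound s (\<lambda>\<tau>. Y (\<tau> + of_real h) - l0 *s Y \<tau>)"
      using bnd unfolding Y_def[symmetric] by (intro strip_bound_diff strip_bound_smult strip_bound_shift)
    then show ?thesis
    proof (rule strip_bound_cong[rotated])
      fix \<tau> :: complex assume t: "Im \<tau> > 0"
      have "Y (\<tau> + of_real h) = (\<Sum>l\<in>\<Lambda>. \<Sum>j<m l. (log_q h \<tau> + w) ^ j *s (l *s f l j \<tau>))"
        unfolding Y_def logh by (intro sum.cong refl) (use per t in auto)
      then have "Y (\<tau> + of_real h) - l0 *s Y \<tau> = (\<Sum>l\<in>\<Lambda>. \<Sum>i<m l. log_q h \<tau> ^ i *s f' l i \<tau>)"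
        unfolding Y_def by (simp only: vec.scale_sum_right[of _ _ \<Lambda>] sum_subtractf[symmetric] step_eq)
      also have "\<dots> = (\<Sum>l\<in>\<Lambda>. \<Sum>i<m' l. log_q h \<tau> ^ i *s f' l i \<tau>)"
      proof (rule sum.cong[OF refl])
        fix l
        show "(\<Sum>i<m l. log_q h \<tau> ^ i *s f' l i \<tau>) = (\<Sum>i<m' l. log_q h \<tau> ^ i *s f' l i \<tau>)"
          by (rule sum.mono_neutral_right) (auto simp: m'_def f'0 split: if_splits)
      qed
      finally show "Y (\<tau> + of_real h) - l0 *s Y \<tau> = (\<Sum>l\<in>\<Lambda>. \<Sum>j<m' l. log_q h \<tau> ^ j *s f' l j \<tau>)" .
    qed
  qed
  have f'b: "strip_bound s (f' l i)" if "l \<in> \<Lambda>" "i < m' l" for l i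
  proof (rule less.hyps[where m = m' and f = f' and l = l and j = i, OF _ _ bnd' that])
    show "sum m' \<Lambda> < sum m \<Lambda>"
      by (rule sum_strict_mono_ex1[OF fin]) (use l0 in \<open>auto simp: m'_def intro!: bexI[of _ l0]\<close>)
    fix l j \<tau> assume "l \<in> \<Lambda>" "j < m' l" "Im \<tau> > 0"
    then show "f' l j (\<tau> + of_real h) = l *s f' l j \<tau>"
      unfolding f'_def vec.scale_sum_right
      by (intro sum.cong refl) (auto simp: per mult_ac)
  qed
  have w0: "w \<noteq> 0" by (simp add: w_def)
  have other: "strip_bound s (f l j)" if l: "l \<in> \<Lambda>" "l \<noteq> l0" "j < m l" for l j
  proof (rule strip_bound_triangular[where g = "f' l" and n = "m l" and a = "a l"])
    show "strip_bound s (f' l i)" if "i < m l" for i using f'b l that by (simp add: m'_def)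
    show "a l i i \<noteq> 0" for i using l(2) by (simp add: a_def)
  qed (use l in \<open>auto simp: f'_def\<close>)
  \<comment> \<open>For \<open>l0\<close> the diagonal coefficients vanish, but
    \<open>a l0 i (Suc i) = l0 * (i + 1) * w\<close> does not, so the system is triangular in the
    shifted unknowns \<open>f l0 (Suc j)\<close>.\<close>
  have high: "strip_bound s (f l0 (Suc i))" if "i < m l0 - 1" for i
  proof (rule strip_bound_triangular[where g = "f' l0" and n = "m l0 - 1" and a = "\<lambda>i j. a l0 i (Suc j)" and f = "\<lambda>j. f l0 (Suc j)"])
    show "strip_bound s (f' l0 i)" if "i < m l0 - 1" for i using f'b l0 that by (simp add: m'_def)
    show "a l0 i (Suc i) \<noteq> 0" for i
      using nz[OF l0(1)] w0 of_nat_neq_0[where 'a = complex, of i] by (simp add: a_def)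
    fix i and \<tau> :: complex assume i: "i < m l0 - 1"
    have "f' l0 i \<tau> = (\<Sum>j\<in>{Suc i..<m l0}. a l0 i j *s f l0 j \<tau>)"
      unfolding f'_def using i by (subst sum.atLeast_Suc_lessThan) (auto simp: a_def)
    also have "\<dots> = (\<Sum>j\<in>{i..<m l0 - 1}. a l0 i (Suc j) *s f l0 (Suc j) \<tau>)"
      using l0(2) by (subst sum.shift_bounds_Suc_ivl[symmetric]) simp
    finally show "f' l0 i \<tau> = (\<Sum>j\<in>{i..<m l0 - 1}. a l0 i (Suc j) *s f l0 (Suc j) \<tau>)" .
  qed (rule that)
  \<comment> \<open>The shift operator annihilates \<open>f l0 0\<close>, which is therefore
    obtained as what remains of the original sum after all other terms are subtracted.\<close>
  have low: "strip_bound s (f l0 0)"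
  proof -
    have "strip_bound s (\<lambda>\<tau>. (\<Sum>l\<in>\<Lambda>. \<Sum>j<m l. log_q h \<tau> ^ j *s f l j \<tau>) -
        (\<Sum>l\<in>\<Lambda> - {l0}. \<Sum>j<m l. log_q h \<tau> ^ j *s f l j \<tau>) -
        (\<Sum>i<m l0 - 1. log_q h \<tau> ^ Suc i *s f l0 (Suc i) \<tau>))"
      by (intro strip_bound_diff bnd strip_bound_sum strip_bound_log_q) (use other high in auto)
    then show ?thesis
    proof (rule strip_bound_cong[rotated])
      fix \<tau> :: complex
      have "(\<Sum>l\<in>\<Lambda>. \<Sum>j<m l. log_q h \<tau> ^ j *s f l j \<tau>) = (\<Sum>j<m l0. log_q h \<tau> ^ j *s f l0 j \<tau>) +
          (\<Sum>l\<in>\<Lambda> - {l0}. \<Sum>j<m l. log_q h \<tau> ^ j *s f l j \<tau>)"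
        by (rule sum.remove[OF fin l0(1)])
      moreover have "(\<Sum>j<m l0. log_q h \<tau> ^ j *s f l0 j \<tau>) = f l0 0 \<tau> + (\<Sum>i<m l0 - 1. log_q h \<tau> ^ Suc i *s f l0 (Suc i) \<tau>)"
        using sum.lessThan_Suc_shift[of "\<lambda>j. log_q h \<tau> ^ j *s f l0 j \<tau>" "m l0 - 1"] l0(2) by simp
      ultimately show "(\<Sum>l\<in>\<Lambda>. \<Sum>j<m l. log_q h \<tau> ^ j *s f l j \<tau>) -
        (\<Sum>l\<in>\<Lambda> - {l0}. \<Sum>j<m l. log_q h \<tau> ^ j *s f l j \<tau>) -
        (\<Sum>i<m l0 - 1. log_q h \<tau> ^ Suc i *s f l0 (Suc i) \<tau>) = f l0 0 \<tau>" by simp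
    qed
  qed
  show ?case
  proof (cases j)
    case 0
    then show ?thesis using low by (simp add: l0_def)
  next
    case (Suc i)
    then show ?thesis using high[of i] less.prems(4) by (simp add: l0_def)
  qed
qed

section \<open>Cauchy's estimate for the coefficients of a q-series\<close>

lemma q_power_cmod: "h > 0 \<Longrightarrow> cmod (q_power h r \<tau>) = exp (- (2 * pi * r * Im \<tau> / h))"
  by (simp add: q_power_def)

lemma q_power_add: "q_power h (r + t) \<tau> = q_power h r \<tau> * q_power h t \<tau>"
  by (simp add: q_power_def exp_add[symmetric] algebra_simps add_divide_distrib)

lemma q_power_of_nat: "q_power h (real n) \<tau> = q_power h 1 \<tau> ^ n"
  by (simp add: q_power_def exp_of_nat_mult[symmetric] algebra_simps)

lemma q_power_shift: "h > 0 \<Longrightarrow> q_power h r (\<tau> + of_real h) = exp (2 * of_real pi * \<i> * of_real r) * q_power h r \<tau>"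
  by (simp add: q_power_def exp_add[symmetric] algebra_simps add_divide_distrib)

lemma vec_sums_component: "f sums x \<Longrightarrow> (\<lambda>n. f n $ i) sums (x $ i)" for f :: "nat \<Rightarrow> complex^'m"
  by (rule bounded_linear.sums[OF bounded_linear_vec_nth])

text \<open>After division by q^\<mu> each component is a power series in q on the unit disc, and
  the line at height y maps onto the circle |q| = exp(-2 pi y / h), on which Cauchy's estimate is
  applied.\<close>

lemma q_series_coefficient_bound:
  fixes a :: "nat \<Rightarrow> complex^'m"
  assumes h: "h > 0"
    and sm: "\<And>\<tau>. Im \<tau> > 0 \<Longrightarrow> summable (\<lambda>n. q_power h (real n + \<mu>) \<tau> *s a n)"
    and sb: "strip_bound s (q_series h \<mu> a)"
  shows "\<exists>B\<ge>0. \<forall>n y. 0 < y \<longrightarrow> y \<le> 1 \<longrightarrow> norm (a n) \<le> B * y powr (- s) * exp (2 * pi * (real n + \<mu>) * y / h)"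
proof -
  obtain B where B: "B \<ge> 0" "\<And>\<tau>. \<bar>Re \<tau>\<bar> \<le> h \<Longrightarrow> 0 < Im \<tau> \<Longrightarrow> Im \<tau> \<le> 1 \<Longrightarrow> norm (q_series h \<mu> a \<tau>) \<le> B * Im \<tau> powr (- s)"
    using strip_boundD[OF sb, of h] by blast
  have comp: "cmod (a n $ i) \<le> B * y powr (- s) * exp (2 * pi * (real n + \<mu>) * y / h)" if y: "0 < y" "y \<le> 1" for n y i
  proof -
    define F where "F = Abs_fps (\<lambda>n. a n $ i)"
    have sums: "(\<lambda>n. a n $ i * q_power h 1 \<tau> ^ n) sums (q_series h \<mu> a \<tau> $ i / q_power h \<mu> \<tau>)" if "Im \<tau> > 0" for \<tau>
    proof -
      have "(\<lambda>n. q_power h (real n + \<mu>) \<tau> *s a n) sums q_series h \<mu> a \<tau>"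
        unfolding q_series_def using sm[OF that] by (rule summable_sums)
      from sums_divide[OF vec_sums_component[OF this, of i], of "q_power h \<mu> \<tau>"]
      have "(\<lambda>n. (q_power h (real n + \<mu>) \<tau> *s a n) $ i / q_power h \<mu> \<tau>) sums (q_series h \<mu> a \<tau> $ i / q_power h \<mu> \<tau>)" .
      moreover have "(q_power h (real n + \<mu>) \<tau> *s a n) $ i / q_power h \<mu> \<tau> = a n $ i * q_power h 1 \<tau> ^ n" for n
        by (simp add: q_power_add q_power_of_nat) (simp add: q_power_def)
      ultimately show ?thesis by simp
    qed
    \<comment> \<open>The principal logarithm has imaginary part between -pi and pi, so every q has
      a preimage with bounded real part and the strip bound for R = h covers the whole
      circle.\<close>
    have par: "\<exists>\<tau>. q_power h 1 \<tau> = q \<and> Im \<tau> = - (h * ln (cmod q) / (2 * pi)) \<and> \<bar>Re \<tau>\<bar> \<le> h" if "q \<noteq> 0" for q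
    proof (intro exI[of _ "of_real h * Ln q / (2 * of_real pi * \<i>)"] conjI)
      show "q_power h 1 (of_real h * Ln q / (2 * of_real pi * \<i>)) = q"
        using that h by (simp add: q_power_def)
      have eq: "of_real h * Ln q / (2 * of_real pi * \<i>) = of_real (h / (2 * pi)) * (- \<i> * Ln q)"
        by (simp add: field_simps)
      show "Im (of_real h * Ln q / (2 * of_real pi * \<i>)) = - (h * ln (cmod q) / (2 * pi))"
        unfolding eq using that by simp
      have "\<bar>Im (Ln q)\<bar> \<le> pi" using mpi_less_Im_Ln[OF that] Im_Ln_le_pi[OF that] by linarith
      then have "h / (2 * pi) * \<bar>Im (Ln q)\<bar> \<le> h / (2 * pi) * pi" using h by (intro mult_left_mono) auto
      also have "\<dots> \<le> h" using h by simp
      finally show "\<bar>Re (of_real h * Ln q / (2 * of_real pi * \<i>))\<bar> \<le> h"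
        unfolding eq using h by (simp add: abs_mult)
    qed
    have rad: "fps_conv_radius F \<ge> 1"
      unfolding fps_conv_radius_def
    proof (rule conv_radius_geI_ex')
      fix r :: real assume r: "0 < r" "ereal r < 1"
      then have r1: "r < 1" by (metis ereal_less(3) one_ereal_def ereal_less_eq(3) less_ereal.simps(1))
      obtain \<tau> where t: "q_power h 1 \<tau> = of_real r" "Im \<tau> = - (h * ln (cmod (of_real r)) / (2 * pi))"
        using par[of "of_real r"] r by auto
      have "Im \<tau> > 0" unfolding t(2) using r r1 h by (simp add: divide_neg_pos mult_pos_neg)
      from sums[OF this] show "summable (\<lambda>n. fps_nth F n * of_real r ^ n)"
        unfolding t(1) by (simp add: F_def sums_iff)
    qed
    define r where "r = exp (- (2 * pi * y / h))"
    have r: "0 < r" "r < 1" using y h by (simp_all add: r_def)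
    have sub: "ball 0 r \<subseteq> eball (0::complex) (fps_conv_radius F)" "cball 0 r \<subseteq> eball (0::complex) (fps_conv_radius F)"
    proof -
      have "x \<in> eball 0 (fps_conv_radius F)" if "dist 0 x \<le> r" for x :: complex
      proof -
        have "norm x \<le> r" using that by (metis dist_0_norm)
        note that = this
        have "ereal (norm x) < 1" using that r by (metis le_less_trans ereal_less(3) one_ereal_def less_ereal.simps(1))
        from less_le_trans[OF this rad] show ?thesis by (simp add: in_eball_iff)
      qed
      then show "ball 0 r \<subseteq> eball (0::complex) (fps_conv_radius F)" "cball 0 r \<subseteq> eball (0::complex) (fps_conv_radius F)"
        by (simp_all add: subset_iff)
    qed
    have nof: "cmod (eval_fps F x) \<le> B * y powr (- s) * exp (2 * pi * \<mu> * y / h)" if "cmod (0 - x) = r" for x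
    proof -
      have x: "x \<noteq> 0" "cmod x = r" using that r by auto
      obtain \<tau> where t: "q_power h 1 \<tau> = x" "Im \<tau> = - (h * ln (cmod x) / (2 * pi))" "\<bar>Re \<tau>\<bar> \<le> h"
        using par[OF x(1)] by auto
      have Imt: "Im \<tau> = y" unfolding t(2) x(2) r_def using h by simp
      have "eval_fps F x = q_series h \<mu> a \<tau> $ i / q_power h \<mu> \<tau>"
        using sums[of \<tau>] Imt y(1) unfolding t(1) by (simp add: eval_fps_def F_def sums_iff)
      then have "cmod (eval_fps F x) = cmod (q_series h \<mu> a \<tau> $ i) * exp (2 * pi * \<mu> * y / h)"
        using h by (simp add: norm_divide norm_mult norm_inverse q_power_cmod Imt exp_minus divide_inverse)
      also have "\<dots> \<le> (B * y powr (- s)) * exp (2 * pi * \<mu> * y / h)"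
        using B(2)[of \<tau>] t(3) Imt y Finite_Cartesian_Product.norm_nth_le[of "q_series h \<mu> a \<tau>" i]
        by (intro mult_right_mono) auto
      finally show ?thesis .
    qed
    have bd: "cmod ((deriv ^^ n) (eval_fps F) 0) \<le> fact n * (B * y powr (- s) * exp (2 * pi * \<mu> * y / h)) / r ^ n"
      by (rule Cauchy_inequality[OF holomorphic_on_eval_fps[OF sub(1)]
            holomorphic_on_imp_continuous_on[OF holomorphic_on_eval_fps[OF sub(2)]] r(1) nof])
    have an: "a n $ i = (deriv ^^ n) (eval_fps F) 0 / fact n"
    proof -
      have "fps_conv_radius F > 0" by (rule less_le_trans[OF _ rad]) simp
      then have "eval_fps F has_fps_expansion F" by (rule eval_fps_has_fps_expansion)
      from fps_nth_fps_expansion[OF this, of n] show ?thesis by (simp add: F_def)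
    qed
    have "cmod (a n $ i) = cmod ((deriv ^^ n) (eval_fps F) 0) / fact n" by (simp add: an norm_divide)
    also have "\<dots> \<le> fact n * (B * y powr (- s) * exp (2 * pi * \<mu> * y / h)) / r ^ n / fact n"
      by (rule divide_right_mono[OF bd]) simp
    also have "\<dots> = (B * y powr (- s) * exp (2 * pi * \<mu> * y / h)) / r ^ n" by simp
    also have "r ^ n = exp (- (2 * pi * real n * y / h))"
      by (simp add: r_def exp_of_nat_mult[symmetric] algebra_simps)
    also have "(B * y powr (- s) * exp (2 * pi * \<mu> * y / h)) / exp (- (2 * pi * real n * y / h))
      = B * y powr (- s) * exp (2 * pi * (real n + \<mu>) * y / h)"
      by (simp add: exp_minus divide_inverse mult.assoc exp_add[symmetric] add_divide_distrib algebra_simps)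
    finally show ?thesis .
  qed
  show ?thesis
  proof (intro exI[of _ "CARD('m) * B"] conjI allI impI)
    fix n y assume y: "0 < (y::real)" "y \<le> 1"
    have "norm (a n) \<le> (\<Sum>i\<in>UNIV. cmod (a n $ i))"
      unfolding norm_vec_def by (rule L2_set_le_sum) simp
    also have "\<dots> \<le> (\<Sum>i\<in>(UNIV::'m set). B * y powr (- s) * exp (2 * pi * (real n + \<mu>) * y / h))"
      by (intro sum_mono comp y)
    finally show "norm (a n) \<le> CARD('m) * B * y powr (- s) * exp (2 * pi * (real n + \<mu>) * y / h)"
      by (simp add: mult.assoc)
  qed (use B in simp)
qed

lemma coefficient_bigo:
  fixes a :: "nat \<Rightarrow> complex^'m"
  assumes h: "h > 0" and "B \<ge> 0"
    and b: "\<And>n y. 0 < y \<Longrightarrow> y \<le> 1 \<Longrightarrow> norm (a n) \<le> B * y powr (- s) * exp (2 * pi * (real n + \<mu>) * y / h)"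
  shows "(\<lambda>n. norm (a n)) \<in> O(\<lambda>n. real n powr s)"
proof (rule bigoI[of _ "B * exp (2 * pi * (1 + \<bar>\<mu>\<bar>) / h)"], rule eventually_sequentiallyI[of 1])
  fix n :: nat assume n: "n \<ge> 1"
  have "norm (a n) \<le> B * (1 / real n) powr (- s) * exp (2 * pi * (real n + \<mu>) * (1 / real n) / h)"
    using n by (intro b) auto
  also have "(1 / real n) powr (- s) = real n powr s"
    using n by (simp add: powr_divide powr_minus_divide)
  also have "B * real n powr s * exp (2 * pi * (real n + \<mu>) * (1 / real n) / h) \<le> B * real n powr s * exp (2 * pi * (1 + \<bar>\<mu>\<bar>) / h)"
  proof (intro mult_left_mono)
    have "(real n + \<mu>) * (1 / real n) = 1 + \<mu> / real n" using n by (simp add: field_simps)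
    also have "\<mu> / real n \<le> \<bar>\<mu>\<bar> / 1" using n by (intro frac_le) auto
    finally have "(real n + \<mu>) * (1 / real n) \<le> 1 + \<bar>\<mu>\<bar>" by simp
    then have "2 * pi * ((real n + \<mu>) * (1 / real n)) / h \<le> 2 * pi * (1 + \<bar>\<mu>\<bar>) / h"
      using h by (intro divide_right_mono mult_left_mono) auto
    then show "exp (2 * pi * (real n + \<mu>) * (1 / real n) / h) \<le> exp (2 * pi * (1 + \<bar>\<mu>\<bar>) / h)" by simp
  qed (use assms in auto)
  finally show "norm (norm (a n)) \<le> B * exp (2 * pi * (1 + \<bar>\<mu>\<bar>) / h) * norm (real n powr s)"
    by (simp add: mult_ac)
qed

lemma coefficient_zero:
  fixes a :: "nat \<Rightarrow> complex^'m"
  assumes "h > 0" "B \<ge> 0" "s < 0"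
    and b: "\<And>n y. 0 < y \<Longrightarrow> y \<le> 1 \<Longrightarrow> norm (a n) \<le> B * y powr (- s) * exp (2 * pi * (real n + \<mu>) * y / h)"
  shows "a n = 0"
proof -
  have "((\<lambda>y. B * y powr (- s) * exp (2 * pi * (real n + \<mu>) * y / h)) \<longlongrightarrow> B * 0 * exp (2 * pi * (real n + \<mu>) * 0 / h)) (at_right 0)"
  proof (intro tendsto_intros)
    have "eventually (\<lambda>y::real. 0 \<le> y) (at_right 0)"
      using eventually_at_right_less[of "0::real"] by (rule eventually_mono) simp
    then show "((\<lambda>y. y powr - s) \<longlongrightarrow> 0) (at_right (0::real))"
      using assms(3) tendsto_zero_powrI[of "\<lambda>y. y" "at_right (0::real)" "\<lambda>_. - s" "- s"]
      by (auto intro!: tendsto_intros)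
  qed (use assms in auto)
  moreover have "\<forall>\<^sub>F y in at_right 0. norm (a n) \<le> B * y powr (- s) * exp (2 * pi * (real n + \<mu>) * y / h)"
    using b eventually_at_right_real[of 0 1] by (auto elim!: eventually_mono)
  ultimately have "norm (a n) \<le> B * 0 * exp (2 * pi * (real n + \<mu>) * 0 / h)"
    by (intro tendsto_lowerbound[of _ _ "at_right 0"]) auto
  then show ?thesis by simp
qed

section \<open>Cusps\<close>

lemma SL2R_simps [simp]: "carrier SL2R = SL2" "mult SL2R = (**)" "one SL2R = mat 1"
  by (simp_all add: SL2R_def SL2_def)

lemma psl_eq: "psl A = {A, - A}"
  by (auto simp: psl_def r_coset_def matrix_mult_algebra)

lemma carrier_PSL2R: "carrier PSL2R = psl ` SL2"
  by (auto simp: PSL2R_def FactGroup_def RCOSETS_def psl_def)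

lemma one_PSL2R: "one PSL2R = psl (mat 1)"
  by (simp add: PSL2R_def FactGroup_def psl_eq)

lemma mult_PSL2R: "mult PSL2R (psl A) (psl B) = psl (A ** B)"
  by (auto simp: PSL2R_def FactGroup_def psl_eq set_mult_def matrix_mult_algebra)

lemma psl_uminus [simp]: "psl (- A) = psl A"
  by (auto simp: psl_eq)

lemma psl_eq_iff: "psl A = psl B \<longleftrightarrow> A = B \<or> A = - B"
  unfolding psl_eq by (auto simp: doubleton_eq_iff)

lemma group_PSL2R: "group PSL2R"
proof (rule groupI)
  fix x y z assume "x \<in> carrier PSL2R" "y \<in> carrier PSL2R" "z \<in> carrier PSL2R"
  then obtain A B C where ABC: "x = psl A" "y = psl B" "z = psl C" by (auto simp: carrier_PSL2R)
  show "mult PSL2R (mult PSL2R x y) z = mult PSL2R x (mult PSL2R y z)"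
    by (simp add: ABC mult_PSL2R matrix_mul_assoc)
next
  fix x assume "x \<in> carrier PSL2R"
  then obtain A where A: "x = psl A" "A \<in> SL2" by (auto simp: carrier_PSL2R)
  show "mult PSL2R (one PSL2R) x = x" by (simp add: A one_PSL2R mult_PSL2R)
  show "\<exists>y\<in>carrier PSL2R. mult PSL2R y x = one PSL2R"
    using A by (intro bexI[of _ "psl (adj2 A)"]) (auto simp: carrier_PSL2R one_PSL2R mult_PSL2R adj2_mult)
qed (auto simp: carrier_PSL2R one_PSL2R mult_PSL2R)

lemma inv_PSL2R: assumes "A \<in> SL2" shows "m_inv PSL2R (psl A) = psl (adj2 A)"
  by (rule group.inv_equality[OF group_PSL2R])
     (use assms in \<open>auto simp: carrier_PSL2R one_PSL2R mult_PSL2R adj2_mult\<close>)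

text \<open>The elements of G are the cosets {A, -A}, so the union is the full preimage of G in
  \<open>SL2\<close>.\<close>

definition lift :: "(real^2^2) set set \<Rightarrow> (real^2^2) set" where "lift G = \<Union>G"

lemma in_lift_iff: assumes "subgroup G PSL2R" shows "A \<in> lift G \<longleftrightarrow> A \<in> SL2 \<and> psl A \<in> G"
proof -
  have "\<gamma> = psl A \<and> A \<in> SL2" if "\<gamma> \<in> G" "A \<in> \<gamma>" for \<gamma>
  proof -
    have "\<gamma> \<in> carrier PSL2R" using subgroup.subset[OF assms] that(1) by blast
    then obtain B where B: "\<gamma> = psl B" "B \<in> SL2" by (auto simp: carrier_PSL2R)
    then have "A = B \<or> A = - B" using that(2) by (simp add: psl_eq)
    then show ?thesis using B by auto
  qed
  moreover have "A \<in> psl A" by (simp add: psl_eq)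
  ultimately show ?thesis unfolding lift_def by blast
qed

lemma in_group_lift: assumes "subgroup G PSL2R" "\<gamma> \<in> G" "A \<in> \<gamma>" shows "A \<in> lift G" "\<gamma> = psl A"
proof -
  show "A \<in> lift G" using assms by (auto simp: lift_def)
  have "\<gamma> \<in> carrier PSL2R" using subgroup.subset[OF assms(1)] assms(2) by blast
  then obtain B where B: "\<gamma> = psl B" "B \<in> SL2" by (auto simp: carrier_PSL2R)
  then have "A = B \<or> A = - B" using assms(3) by (simp add: psl_eq)
  then show "\<gamma> = psl A" using B by auto
qed

text \<open>The identity class is open in G, and the quotient topology pulls this back to a
  neighbourhood of \<open>mat 1\<close> whose members in the preimage are plus or minus the
  identity; a radius of at most 1 excludes \<open>- mat 1\<close>, which is at distance 2 sqrt
  2.\<close>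

lemma discrete_near_one:
  assumes "discrete_subgroup_PSL2R G"
  shows "\<exists>e>0. \<forall>A\<in>lift G. norm (A - mat 1) < e \<longrightarrow> A = mat 1"
proof -
  have sg: "subgroup G PSL2R" and disc: "subtopology PSL2R_topology G = discrete_topology G"
    using assms by (auto simp: discrete_subgroup_PSL2R_def)
  have 1: "psl (mat 1) \<in> G" using subgroup.one_closed[OF sg] by (simp add: one_PSL2R)
  then have "openin (subtopology PSL2R_topology G) {psl (mat 1)}" unfolding disc by simp
  then obtain U where U: "openin PSL2R_topology U" "{psl (mat 1)} = U \<inter> G"
    unfolding openin_subtopology by blast
  have "openin (top_of_set SL2) {x \<in> SL2. psl x \<in> U}"
    using U(1) unfolding PSL2R_topology_def openin_quotient_topology by simp
  then obtain T where T: "open T" "{x \<in> SL2. psl x \<in> U} = SL2 \<inter> T" unfolding openin_open by blast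
  have "mat 1 \<in> T" using T(2) U(2) SL2_one by blast
  then obtain e where e: "e > 0" "ball (mat 1) e \<subseteq> T" using T(1) open_contains_ball by blast
  have "A = mat 1" if A: "A \<in> lift G" "norm (A - mat 1) < min e 1" for A
  proof -
    have AS: "A \<in> SL2" "psl A \<in> G" using A(1) in_lift_iff[OF sg] by auto
    have "A \<in> ball (mat 1) e" using A(2) by (simp add: dist_norm norm_minus_commute)
    then have "psl A \<in> U" using T(2) e(2) AS(1) by blast
    then have "psl A = psl (mat 1)" using U(2) AS(2) by blast
    then consider "A = mat 1" | "A = - mat 1" unfolding psl_eq_iff by blast
    then show ?thesis
    proof cases
      case 2
      then have "A - mat 1 = (-2) *\<^sub>R mat 1" by (simp add: matrix_eq_2)
      then have "norm (A - mat 1) = 2 * sqrt 2" by (simp add: norm_mat1)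
      moreover have "sqrt 2 \<ge> 1" by simp
      ultimately show ?thesis using A(2) by linarith
    qed
  qed
  then show ?thesis using e(1) by (intro exI[of _ "min e 1"]) auto
qed

lemma discrete_SL2_lift:
  assumes "discrete_subgroup_PSL2R G"
  shows "discrete_SL2 (lift G)"
proof
  have sg: "subgroup G PSL2R" using assms by (simp add: discrete_subgroup_PSL2R_def)
  note iff = in_lift_iff[OF sg]
  show "A \<in> SL2" if "A \<in> lift G" for A using that iff by blast
  show "mat 1 \<in> lift G" using subgroup.one_closed[OF sg] by (simp add: iff one_PSL2R)
  show "- A \<in> lift G" if "A \<in> lift G" for A using that by (simp add: iff)
  show m: "A ** B \<in> lift G" if "A \<in> lift G" "B \<in> lift G" for A B
    using that subgroup.m_closed[OF sg, of "psl A" "psl B"] by (simp add: iff mult_PSL2R)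
  show i: "adj2 A \<in> lift G" if "A \<in> lift G" for A
    using that subgroup.m_inv_closed[OF sg, of "psl A"] inv_PSL2R[of A] by (simp add: iff)
  fix r
  obtain e where e: "e > 0" "\<And>A. A \<in> lift G \<Longrightarrow> norm (A - mat 1) < e \<Longrightarrow> A = mat 1"
    using discrete_near_one[OF assms] by blast
  define S where "S = {A \<in> lift G. norm A \<le> r}"
  \<comment> \<open>Closer elements A and B would bring \<open>adj2 B ** A\<close> into the
    neighbourhood of \<open>mat 1\<close>, since |r| + 1 bounds \<open>norm B\<close>. A bounded
    separated set is finite.\<close>
  have sep: "e / (\<bar>r\<bar> + 1) \<le> norm (A - B)" if AB: "A \<in> S" "B \<in> S" "A \<noteq> B" for A B
  proof (rule ccontr)
    assume "\<not> ?thesis"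
    then have lt: "norm (A - B) < e / (\<bar>r\<bar> + 1)" by simp
    have BS: "B \<in> SL2" using AB(2) iff by (simp add: S_def)
    have "adj2 B ** A - mat 1 = adj2 B ** (A - B)" by (simp add: matrix_mult_algebra adj2_mult[OF BS])
    then have "norm (adj2 B ** A - mat 1) \<le> norm B * norm (A - B)"
      using norm_matrix_mult_le[of "adj2 B" "A - B"] by simp
    also have "\<dots> \<le> (\<bar>r\<bar> + 1) * norm (A - B)" using AB(2) by (intro mult_right_mono) (auto simp: S_def)
    also have "\<dots> < e" using lt by (simp add: field_simps)
    finally have "adj2 B ** A = mat 1"
      by (intro e(2) m i) (use AB in \<open>auto simp: S_def\<close>)
    then have "B ** (adj2 B ** A) = B" by simp
    then show False using AB(3) BS by simp
  qed
  have "e / (\<bar>r\<bar> + 1) > 0" using e(1) by simp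
  from separated_card_bound[OF this, of r] have "finite S" using sep by (auto simp: S_def)
  then show "finite {A \<in> lift G. norm A \<le> r}" by (simp add: S_def)
qed

text \<open>The equation satisfied by a fundamental domain shows it as the intersection of an open
  and a closed set, hence Borel, as the packing argument demands.\<close>

lemma first_kind_thick_compact:
  assumes "fuchsian_first_kind G"
  shows "\<exists>R>0. \<forall>w\<in>SL2. discrete_SL2.thick (lift G) w \<longrightarrow> (\<exists>\<sigma>\<in>lift G. norm (\<sigma> ** w) \<le> R)"
proof -
  have disc: "discrete_subgroup_PSL2R G" using assms by (auto simp: fuchsian_first_kind_def fuchsian_group_def)
  then have sg: "subgroup G PSL2R" by (simp add: discrete_subgroup_PSL2R_def)
  interpret discrete_SL2 "lift G" by (rule discrete_SL2_lift[OF disc])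
  obtain F where F: "fundamental_domain G F" "hyperbolic_area F < \<infinity>"
    using assms by (auto simp: fuchsian_first_kind_def)
  note fd = F(1)[unfolded fundamental_domain_def]
  note FH = fd[THEN conjunct1] and Feq = fd[THEN conjunct2, THEN conjunct1]
    and cov = fd[THEN conjunct2, THEN conjunct2, THEN conjunct1]
  have "open upper_half_plane" unfolding upper_half_plane_def by (rule open_halfspace_Im_gt)
  then have "upper_half_plane \<inter> closure (interior F) \<in> sets borel" by (intro sets.Int) auto
  then have Fb: "F \<in> sets borel" by (simp only: Feq[symmetric])
  show ?thesis
  proof (rule thick_compact[OF Fb FH F(2)])
    fix z :: complex assume "Im z > 0"
    then have "z \<in> (\<Union>\<gamma>\<in>G. \<Union>A\<in>\<gamma>. mobius A ` F)" unfolding cov by simp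
    then obtain \<gamma> A w where "\<gamma> \<in> G" "A \<in> \<gamma>" "w \<in> F" "z = mobius A w" by blast
    then show "\<exists>\<sigma>\<in>lift G. \<exists>w\<in>F. z = mobius \<sigma> w" using in_group_lift(1)[OF sg] by blast
  qed
qed

section \<open>Stabilizers of cusps and cusp widths\<close>

lemma cusp_matrix_SL2 [simp]: "cusp_matrix c \<in> SL2"
  by (cases c) (simp_all add: SL2_iff)

definition cusp_conj :: "boundary_point \<Rightarrow> real^2^2 \<Rightarrow> real^2^2" where
  "cusp_conj c A = adj2 (cusp_matrix c) ** A ** cusp_matrix c"

text \<open>The parabolic matrix that fixes c and acts as z + b in the coordinate where c is at
  infinity.\<close>

definition trans :: "boundary_point \<Rightarrow> real \<Rightarrow> real^2^2" where
  "trans c b = cusp_matrix c ** mat2 1 b 0 1 ** adj2 (cusp_matrix c)"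

lemma cusp_conj_inverse: "A = cusp_matrix c ** cusp_conj c A ** adj2 (cusp_matrix c)"
  unfolding cusp_conj_def by (simp only: matrix_mul_assoc[symmetric] adj2_mult_cancel adj2_mult cusp_matrix_SL2 matrix_mul_rid)

lemma cusp_conj_SL2: "A \<in> SL2 \<Longrightarrow> cusp_conj c A \<in> SL2"
  by (simp add: cusp_conj_def)

lemma cusp_conj_mult: "cusp_conj c (A ** B) = cusp_conj c A ** cusp_conj c B"
  unfolding cusp_conj_def by (simp only: matrix_mul_assoc[symmetric] adj2_mult_cancel cusp_matrix_SL2)

lemma cusp_conj_trans: "cusp_conj c (trans c b) = mat2 1 b 0 1"
  unfolding cusp_conj_def trans_def
  by (simp only: matrix_mul_assoc[symmetric] adj2_mult_cancel adj2_mult cusp_matrix_SL2 matrix_mul_rid)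

lemma cusp_conj_inj: "cusp_conj c A = cusp_conj c B \<Longrightarrow> A = B"
  by (metis cusp_conj_inverse)

lemma cusp_conj_uminus: "cusp_conj c (- A) = - cusp_conj c A"
  by (simp add: cusp_conj_def matrix_mult_algebra)

lemma trans_SL2 [simp]: "trans c b \<in> SL2"
  unfolding trans_def by (intro SL2_mult) (simp_all add: SL2_iff[of "mat2 1 b 0 1"])

lemma trans_add: "trans c a ** trans c b = trans c (a + b)"
  by (rule cusp_conj_inj[of c]) (simp add: cusp_conj_mult cusp_conj_trans matrix_eq_2 matrix_mult_nth_2)

lemma trans_0: "trans c 0 = mat 1"
  by (rule cusp_conj_inj[of c]) (simp only: cusp_conj_trans, simp add: cusp_conj_def adj2_mult matrix_eq_2)

lemma adj2_trans: "adj2 (trans c b) = trans c (- b)"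
proof -
  have "adj2 (mat2 1 b 0 1) = mat2 1 (- b) 0 1" by (simp add: matrix_eq_2)
  then show ?thesis unfolding trans_def by (simp add: adj2_mult_distrib matrix_mul_assoc)
qed

lemma trans_inj: "trans c a = trans c b \<Longrightarrow> a = b"
  using arg_cong[of "trans c a" "trans c b" "cusp_conj c"] by (simp add: cusp_conj_trans matrix_eq_2)

lemma trans_neq_uminus: "trans c a \<noteq> - trans c b"
proof
  assume "trans c a = - trans c b"
  from arg_cong[OF this, of "cusp_conj c"] show False by (simp add: cusp_conj_trans cusp_conj_uminus matrix_eq_2)
qed

lemma psl_trans_inj: "psl (trans c a) = psl (trans c b) \<Longrightarrow> a = b"
  using trans_inj trans_neq_uminus unfolding psl_eq_iff by blast

lemma tl2_trans: "tl2 (trans c b) = cusp_matrix c ** mat2 0 b 0 0 ** adj2 (cusp_matrix c)"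
proof -
  have "tl2 (mat2 1 b 0 1) = mat2 0 b 0 0" by (simp add: matrix_eq_2)
  then show ?thesis using tl2_conj[of "adj2 (cusp_matrix c)" "mat2 1 b 0 1"] by (simp add: trans_def)
qed

lemma tl2_trans_nonzero: "b \<noteq> 0 \<Longrightarrow> tl2 (trans c b) \<noteq> 0"
  using tl2_conj_eq_0[of "adj2 (cusp_matrix c)" "mat2 1 b 0 1"] by (simp add: trans_def matrix_eq_2)

lemma trans_eq: "mat 1 + tl2 (trans c b) = trans c b"
proof -
  have "hf (trans c b) = 1" using hf_conj[of "adj2 (cusp_matrix c)" "mat2 1 b 0 1"]
    by (simp add: trans_def) (simp add: hf_def)
  then show ?thesis using tl2_decomp[of "trans c b"] by simp
qed

lemma trace_conj: "g \<in> SL2 \<Longrightarrow> trace (adj2 g ** A ** g) = trace A"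
  using hf_conj[of g A] by (simp add: hf_def trace_def sum_2)

lemma mobius_boundary_fix_iff:
  assumes "A \<in> SL2" shows "mobius_boundary A c = c \<longleftrightarrow> cusp_conj c A $ 2 $ 1 = 0"
proof (cases c)
  case Infty
  then show ?thesis by (simp add: cusp_conj_def)
next
  case (Fin x)
  have e: "cusp_conj c A $ 2 $ 1 = x * (A$2$1 * x + A$2$2) - (A$1$1 * x + A$1$2)"
    by (simp add: Fin cusp_conj_def matrix_mult_nth_2 algebra_simps)
  have n: "A$1$1 * x + A$1$2 \<noteq> 0 \<or> A$2$1 * x + A$2$2 \<noteq> 0"
  proof (rule ccontr)
    assume "\<not> ?thesis"
    then have "A$1$2 = - A$1$1 * x" "A$2$2 = - A$2$1 * x" by (simp_all add: eq_neg_iff_add_eq_0 add.commute)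
    then show False using assms by (simp add: SL2_iff algebra_simps)
  qed
  show ?thesis
  proof (cases "A$2$1 * x + A$2$2 = 0")
    case True
    then show ?thesis using e n Fin by simp
  next
    case False
    then have "(A$1$1 * x + A$1$2) / (A$2$1 * x + A$2$2) = x \<longleftrightarrow> A$1$1 * x + A$1$2 = x * (A$2$1 * x + A$2$2)"
      by (simp add: divide_eq_eq)
    then show ?thesis using e Fin False by auto
  qed
qed

context discrete_SL2
begin

text \<open>With c moved to infinity, conjugation by A multiplies the nilpotent part of the
  translation by \<open>(M$1$1)\<^sup>2\<close>. Since neither A nor its inverse can contract,
  \<open>M$1$1\<close> is 1 or -1.\<close>

lemma upper_triangular_cusp:
  assumes A: "A \<in> \<Gamma>" "cusp_conj c A $ 2 $ 1 = 0" and t: "trans c h \<in> \<Gamma>" "h \<noteq> 0"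
  shows "\<exists>b. A = trans c b \<or> A = - trans c b"
proof -
  define M where "M = cusp_conj c A"
  have ad: "M$1$1 * M$2$2 = 1" "M$2$1 = 0" using cusp_conj_SL2[OF sub[OF A(1)], of c] A(2) by (simp_all add: M_def SL2_iff)
  define N where "N = tl2 (trans c h)"
  have N: "N \<noteq> 0" "mat 1 + N \<in> \<Gamma>" using tl2_trans_nonzero[OF t(2)] trans_eq t(1) by (simp_all add: N_def)
  have cN: "cusp_conj c N = mat2 0 h 0 0"
    unfolding N_def tl2_trans cusp_conj_def
    by (simp only: matrix_mul_assoc[symmetric] adj2_mult_cancel adj2_mult cusp_matrix_SL2 matrix_mul_rid)
  have scal: "cusp_conj c (q *\<^sub>R X) = q *\<^sub>R cusp_conj c X" for q X by (simp add: cusp_conj_def matrix_mult_algebra)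
  have sq: "(M$1$1)\<^sup>2 * (h * M$2$2) = M$1$1 * h" "(M$2$2)\<^sup>2 * (h * M$1$1) = M$2$2 * h"
  proof -
    have "(M$1$1)\<^sup>2 * (h * M$2$2) = M$1$1 * h * (M$1$1 * M$2$2)" by (simp only: power2_eq_square mult_ac)
    then show "(M$1$1)\<^sup>2 * (h * M$2$2) = M$1$1 * h" by (simp only: ad(1) mult_1_right)
    have "(M$2$2)\<^sup>2 * (h * M$1$1) = M$2$2 * h * (M$1$1 * M$2$2)" by (simp only: power2_eq_square mult_ac)
    then show "(M$2$2)\<^sup>2 * (h * M$1$1) = M$2$2 * h" by (simp only: ad(1) mult_1_right)
  qed
  have "A ** N = (M$1$1)\<^sup>2 *\<^sub>R (N ** A)"
    by (rule cusp_conj_inj[of c])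
       (simp add: cusp_conj_mult scal cN M_def[symmetric] matrix_eq_2 matrix_mult_nth_2 ad(2) sq)
  from no_contraction[OF A(1) N(1) this N(2)] have 1: "(M$1$1)\<^sup>2 \<ge> 1" by simp
  have adjM: "cusp_conj c (adj2 A) = adj2 M"
    unfolding M_def cusp_conj_def by (simp only: adj2_mult_distrib adj2_adj2 matrix_mul_assoc)
  have "adj2 A ** N = (M$2$2)\<^sup>2 *\<^sub>R (N ** adj2 A)"
    by (rule cusp_conj_inj[of c])
       (simp add: cusp_conj_mult scal cN adjM matrix_eq_2 matrix_mult_nth_2 ad(2) sq)
  from no_contraction[OF inv[OF A(1)] N(1) this N(2)] have 2: "(M$2$2)\<^sup>2 \<ge> 1" by simp
  have "(M$1$1)\<^sup>2 * (M$2$2)\<^sup>2 = 1" by (simp only: power_mult_distrib[symmetric] ad(1) power_one)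
  moreover have "(M$1$1)\<^sup>2 * 1 \<le> (M$1$1)\<^sup>2 * (M$2$2)\<^sup>2" using 2 by (intro mult_left_mono) auto
  ultimately have "(M$1$1)\<^sup>2 \<le> 1" by linarith
  then have "(M$1$1)\<^sup>2 = 1" using 1 by simp
  then consider "M$1$1 = 1" | "M$1$1 = -1" unfolding power2_eq_1_iff by blast
  then show ?thesis
  proof cases
    case 1
    then have "A = trans c (M$1$2)"
      using ad by - (rule cusp_conj_inj[of c], simp add: cusp_conj_trans M_def[symmetric] matrix_eq_2)
    then show ?thesis by blast
  next
    case 2
    then have "A = - trans c (- M$1$2)"
      using ad by - (rule cusp_conj_inj[of c], simp add: cusp_conj_trans cusp_conj_uminus M_def[symmetric] matrix_eq_2)
    then show ?thesis by blast
  qed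
qed

lemma trans_of_int: assumes "trans c h \<in> \<Gamma>" shows "trans c (of_int n * h) \<in> \<Gamma>"
proof -
  have nat: "trans c (real k * h) \<in> \<Gamma>" for k
  proof (induction k)
    case (Suc k)
    have "trans c h ** trans c (real k * h) \<in> \<Gamma>" by (rule mult[OF assms Suc])
    then show ?case by (simp add: trans_add algebra_simps)
  qed (simp add: trans_0)
  show ?thesis
  proof (cases "n \<ge> 0")
    case True
    then show ?thesis using nat[of "nat n"] by simp
  next
    case False
    then show ?thesis using inv[OF nat[of "nat (- n)"]] by (simp add: adj2_trans)
  qed
qed

lemma norm_trans_le: "norm (trans c b) \<le> (norm (cusp_matrix c))\<^sup>2 * (2 + \<bar>b\<bar>)"
proof -
  have "norm (mat2 1 b 0 1) \<le> 2 + \<bar>b\<bar>"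
    by (rule norm_matrix_2_le) (simp_all add: power2_eq_square algebra_simps)
  then have "norm (cusp_matrix c) * norm (mat2 1 b 0 1) * norm (cusp_matrix c) \<le> norm (cusp_matrix c) * (2 + \<bar>b\<bar>) * norm (cusp_matrix c)"
    by (intro mult_right_mono mult_left_mono) auto
  moreover have "norm (trans c b) \<le> norm (cusp_matrix c) * norm (mat2 1 b 0 1) * norm (cusp_matrix c)"
    unfolding trans_def using norm_mult_le3[of "cusp_matrix c" "mat2 1 b 0 1" "adj2 (cusp_matrix c)"] by simp
  ultimately show ?thesis by (simp add: power2_eq_square mult_ac)
qed

text \<open>The positive translation lengths up to \<open>\<bar>h0\<bar>\<close> form a finite
  nonempty set; the width is their minimum, and division with remainder shows that all lengths are
  multiples of it.\<close>

lemma cusp_width_exists: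
  assumes t: "trans c h0 \<in> \<Gamma>" "h0 \<noteq> 0"
  shows "\<exists>h>0. \<forall>b. trans c b \<in> \<Gamma> \<longleftrightarrow> (\<exists>n::int. b = of_int n * h)"
proof -
  define B where "B = {b. 0 < b \<and> b \<le> \<bar>h0\<bar> \<and> trans c b \<in> \<Gamma>}"
  have "trans c ` B \<subseteq> {A \<in> \<Gamma>. norm A \<le> (norm (cusp_matrix c))\<^sup>2 * (2 + \<bar>h0\<bar>)}"
  proof
    fix A assume "A \<in> trans c ` B"
    then obtain b where b: "b \<in> B" "A = trans c b" by blast
    have "norm A \<le> (norm (cusp_matrix c))\<^sup>2 * (2 + \<bar>b\<bar>)" unfolding b(2) by (rule norm_trans_le)
    also have "\<dots> \<le> (norm (cusp_matrix c))\<^sup>2 * (2 + \<bar>h0\<bar>)" using b(1) by (intro mult_left_mono) (auto simp: B_def)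
    finally show "A \<in> {A \<in> \<Gamma>. norm A \<le> (norm (cusp_matrix c))\<^sup>2 * (2 + \<bar>h0\<bar>)}" using b by (simp add: B_def)
  qed
  then have "finite (trans c ` B)" using fin finite_subset by blast
  moreover have "inj_on (trans c) B" by (rule inj_onI) (rule trans_inj)
  ultimately have finB: "finite B" by (rule finite_imageD)
  have "\<bar>h0\<bar> \<in> B"
    using t inv[OF t(1)] by (cases "h0 > 0") (auto simp: B_def adj2_trans)
  then have ne: "B \<noteq> {}" by blast
  define h where "h = Min B"
  have hB: "h \<in> B" unfolding h_def by (rule Min_in[OF finB ne])
  have hmin: "h \<le> b" if "b \<in> B" for b unfolding h_def by (rule Min_le[OF finB that])
  have h: "h > 0" "trans c h \<in> \<Gamma>" "h \<le> \<bar>h0\<bar>" using hB by (auto simp: B_def)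
  have "\<exists>n::int. b = of_int n * h" if b: "trans c b \<in> \<Gamma>" for b
  proof -
    define n where "n = \<lfloor>b / h\<rfloor>"
    define r where "r = b - of_int n * h"
    have "of_int n \<le> b / h" "b / h < of_int n + 1" unfolding n_def by linarith+
    then have r: "0 \<le> r" "r < h" using h(1) by (simp_all add: r_def field_simps)
    have "trans c b ** trans c (of_int (- n) * h) \<in> \<Gamma>" by (rule mult[OF b trans_of_int[OF h(2)]])
    then have "trans c r \<in> \<Gamma>" by (simp add: trans_add r_def)
    have "r = 0"
    proof (rule ccontr)
      assume "r \<noteq> 0"
      then have "r \<in> B" using r h(3) \<open>trans c r \<in> \<Gamma>\<close> by (simp add: B_def)
      then show False using hmin r(2) by force
    qed
    then show ?thesis by (auto simp: r_def)
  qed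
  then show ?thesis using h(1) trans_of_int[OF h(2)] by blast
qed

end

text \<open>The lower-left entry vanishes exactly if the conjugated matrix fixes infinity, that is,
  if \<open>\<sigma>\<close> maps c to c'.\<close>

definition cusp_equiv :: "(real^2^2) set \<Rightarrow> boundary_point \<Rightarrow> boundary_point \<Rightarrow> bool" where
  "cusp_equiv \<Gamma> c c' \<longleftrightarrow> (\<exists>\<sigma>\<in>\<Gamma>. (adj2 (cusp_matrix c') ** \<sigma> ** cusp_matrix c) $ 2 $ 1 = 0)"

text \<open>\<open>ht c g\<close> is the height of the point \<open>g i\<close> in the coordinate in which the cusp \<open>c\<close> is \<open>\<infinity>\<close>.\<close>

definition ht :: "boundary_point \<Rightarrow> real^2^2 \<Rightarrow> real" where
  "ht c g = Im (pt (adj2 (cusp_matrix c) ** g))"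

definition xc :: "boundary_point \<Rightarrow> real^2^2 \<Rightarrow> real" where
  "xc c g = Re (pt (adj2 (cusp_matrix c) ** g))"

lemma ht_pos: "g \<in> SL2 \<Longrightarrow> ht c g > 0"
  unfolding ht_def by (rule Im_pt_pos) simp

lemma norm_unipotent_conj:
  assumes "f \<in> SL2" shows "norm (adj2 f ** mat2 0 b 0 0 ** f) = \<bar>b\<bar> / Im (pt f)"
proof -
  have "(norm (adj2 f ** mat2 0 b 0 0 ** f))\<^sup>2 = (b * ((f$2$1)\<^sup>2 + (f$2$2)\<^sup>2))\<^sup>2"
    unfolding norm_matrix_2 by (simp add: matrix_mult_nth_2 power2_eq_square algebra_simps)
  also have "\<dots> = (\<bar>b\<bar> / Im (pt f))\<^sup>2"
    by (simp only: gram_pt(1)[OF assms] times_divide_eq_right mult_1_right power_divide power2_abs)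
  finally show ?thesis
    by (rule power2_eq_imp_eq) (use Im_pt_pos[OF assms] in \<open>simp_all only: norm_ge_zero abs_ge_zero divide_nonneg_pos\<close>)
qed

text \<open>Seen from a point at height y, a translation by b differs from the identity by a
  nilpotent matrix of norm |b|/y. Being high in a cusp thus means being moved little by its
  translations.\<close>

lemma norm_trans_conj:
  assumes "g \<in> SL2"
  shows "norm (adj2 g ** tl2 (trans c b) ** g) = \<bar>b\<bar> / ht c g" "norm (adj2 g ** trans c b ** g - mat 1) = \<bar>b\<bar> / ht c g"
proof -
  define f where "f = adj2 (cusp_matrix c) ** g"
  have f: "f \<in> SL2" using assms by (simp add: f_def)
  have "adj2 g ** tl2 (trans c b) ** g = adj2 f ** mat2 0 b 0 0 ** f"
    unfolding f_def tl2_trans by (simp only: adj2_mult_distrib adj2_adj2 matrix_mul_assoc)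
  then show 1: "norm (adj2 g ** tl2 (trans c b) ** g) = \<bar>b\<bar> / ht c g"
    using norm_unipotent_conj[OF f] by (simp add: ht_def f_def)
  have "adj2 g ** trans c b ** g = adj2 g ** (mat 1 + tl2 (trans c b)) ** g" by (simp only: trans_eq)
  also have "\<dots> = mat 1 + adj2 g ** tl2 (trans c b) ** g" by (simp add: matrix_mult_algebra adj2_mult[OF assms])
  finally show "norm (adj2 g ** trans c b ** g - mat 1) = \<bar>b\<bar> / ht c g" using 1 by simp
qed

lemma parabolic_normal_form:
  fixes N :: "real^2^2"
  assumes "N$2$2 = - N$1$1" "det N = 0" "N \<noteq> 0"
  shows "\<exists>c b. b \<noteq> 0 \<and> N = tl2 (trans c b)"
proof -
  have d: "N$1$1 * N$1$1 + N$1$2 * N$2$1 = 0" using assms by (simp add: det_2)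
  show ?thesis
  proof (cases "N$2$1 = 0")
    case True
    then have "N$1$1 = 0" using d by simp
    then have "N = tl2 (trans Infty (N$1$2))" "N$1$2 \<noteq> 0"
      using True assms by (auto simp: tl2_trans matrix_eq_2 matrix_mult_nth_2)
    then show ?thesis by blast
  next
    case False
    \<comment> \<open>The fixed point of N on the boundary: (x, 1) spans its kernel.\<close>
    define x where "x = N$1$1 / N$2$1"
    have x: "N$1$1 = x * N$2$1" using False by (simp add: x_def)
    have "N$2$1 * (x * x * N$2$1 + N$1$2) = 0" using d unfolding x by (simp add: algebra_simps)
    then have y: "N$1$2 = - (x * x * N$2$1)" using False by (simp add: eq_neg_iff_add_eq_0 add.commute)
    have "N = tl2 (trans (Fin x) (- N$2$1))"
      using assms(1) by (simp add: tl2_trans matrix_eq_2 matrix_mult_nth_2 x y)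
    then show ?thesis using False by (metis neg_equal_0_iff_equal)
  qed
qed

lemma finite_transversal:
  assumes "finite A" "\<And>x. x \<in> A \<Longrightarrow> r x x" "\<And>x y. r x y \<Longrightarrow> r y x"
  shows "\<exists>B\<subseteq>A. (\<forall>x\<in>A. \<exists>y\<in>B. r x y) \<and> (\<forall>x\<in>B. \<forall>y\<in>B. r x y \<longrightarrow> x = y)"
  using assms(1,2)
proof (induction A rule: finite_induct)
  case (insert a A)
  then obtain B where B: "B \<subseteq> A" "\<forall>x\<in>A. \<exists>y\<in>B. r x y" "\<forall>x\<in>B. \<forall>y\<in>B. r x y \<longrightarrow> x = y" by auto
  show ?case
  proof (cases "\<exists>y\<in>B. r a y")
    case True
    then show ?thesis using B by (intro exI[of _ B]) auto
  next
    case False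
    have "\<forall>x\<in>insert a B. \<forall>y\<in>insert a B. r x y \<longrightarrow> x = y" using B(3) False assms(3) by blast
    moreover have "\<forall>x\<in>insert a A. \<exists>y\<in>insert a B. r x y" using B(2) insert.prems by blast
    ultimately show ?thesis using B(1) by (intro exI[of _ "insert a B"]) blast
  qed
qed auto

section \<open>Covering by a compact set and finitely many cusp sectors\<close>

locale fuchsian_first =
  fixes G :: "(real^2^2) set set"
  assumes first_kind: "fuchsian_first_kind G"
begin

lemma discrete: "discrete_subgroup_PSL2R G"
  using first_kind by (simp add: fuchsian_first_kind_def fuchsian_group_def)

lemma subgroup_G: "subgroup G PSL2R"
  using discrete by (simp add: discrete_subgroup_PSL2R_def)

sublocale discrete_SL2 "lift G"
  by (rule discrete_SL2_lift[OF discrete])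

abbreviation \<Gamma> :: "(real^2^2) set" where "\<Gamma> \<equiv> lift G"

lemmas in_Gamma_iff = in_lift_iff[OF subgroup_G]

lemma psl_in_G: "A \<in> \<Gamma> \<Longrightarrow> psl A \<in> G"
  using in_Gamma_iff by blast

lemma trans_parabolic:
  assumes "trans c b \<in> \<Gamma>" "b \<noteq> 0"
  shows "psl (trans c b) \<in> boundary_stabilizer G c" "parabolic (psl (trans c b))"
proof -
  have "trace (mat2 1 b 0 1) = 2" by (simp add: trace_def sum_2)
  then have tr: "trace (trans c b) = 2"
    using trace_conj[of "adj2 (cusp_matrix c)" "mat2 1 b 0 1"] by (simp add: trans_def)
  have tr': "trace (- trans c b) = - 2" using tr by (simp add: trace_def sum_2)
  have "mobius_boundary A c = c" if "A \<in> psl (trans c b)" for A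
  proof -
    have A: "A = trans c b \<or> A = - trans c b" using that by (simp add: psl_eq)
    then have "cusp_conj c A $ 2 $ 1 = 0" by (auto simp: cusp_conj_uminus cusp_conj_trans)
    moreover have "A \<in> SL2" using A by auto
    ultimately show ?thesis using mobius_boundary_fix_iff by blast
  qed
  then show "psl (trans c b) \<in> boundary_stabilizer G c"
    unfolding boundary_stabilizer_def using psl_in_G[OF assms(1)] by blast
  have "psl (trans c b) \<noteq> psl (trans c 0)" using psl_trans_inj assms(2) by blast
  then have "psl (trans c b) \<noteq> psl (mat 1)" unfolding trans_0 .
  moreover have "\<bar>trace A\<bar> = 2" if "A \<in> psl (trans c b)" for A
  proof -
    have "A = trans c b \<or> A = - trans c b" using that by (simp add: psl_eq)
    then show ?thesis by (elim disjE) (simp_all only: tr tr' abs_numeral abs_neg_numeral)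
  qed
  moreover have "psl (trans c b) \<in> psl ` SL2" by (rule imageI[OF trans_SL2])
  ultimately show "parabolic (psl (trans c b))"
    unfolding parabolic_def one_PSL2R carrier_PSL2R by blast
qed

text \<open>With c moved to infinity, determinant 1 and trace 2 or -2 make the diagonal entries of
  an upper triangular matrix equal, so it is plus or minus a translation.\<close>

lemma is_cusp_iff: "is_cusp G c \<longleftrightarrow> (\<exists>b. b \<noteq> 0 \<and> trans c b \<in> \<Gamma>)"
proof
  assume "is_cusp G c"
  then obtain \<gamma> where \<gamma>: "\<gamma> \<in> boundary_stabilizer G c" "parabolic \<gamma>" by (auto simp: is_cusp_def)
  have \<gamma>G: "\<gamma> \<in> G" using \<gamma>(1) by (simp add: boundary_stabilizer_def)
  obtain A where A: "\<gamma> = psl A"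
    using subgroup.subset[OF subgroup_G] \<gamma>G by (auto simp: carrier_PSL2R subset_iff)
  have Ain: "A \<in> \<gamma>" by (simp add: A psl_eq)
  have AG: "A \<in> \<Gamma>" by (rule in_group_lift(1)[OF subgroup_G \<gamma>G Ain])
  define M where "M = cusp_conj c A"
  have "mobius_boundary A c = c" using \<gamma>(1) Ain by (simp add: boundary_stabilizer_def)
  then have M21: "M$2$1 = 0" unfolding M_def using mobius_boundary_fix_iff[OF sub[OF AG]] by simp
  have "M \<in> SL2" unfolding M_def by (rule cusp_conj_SL2[OF sub[OF AG]])
  then have ad: "M$1$1 * M$2$2 = 1" using M21 by (simp add: SL2_iff)
  have "\<bar>trace A\<bar> = 2" using \<gamma>(2) Ain by (simp add: parabolic_def)
  then have "\<bar>trace M\<bar> = 2" unfolding M_def cusp_conj_def using trace_conj[of "cusp_matrix c" A] by simp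
  then have "\<bar>M$1$1 + M$2$2\<bar> = 2" by (simp add: trace_def sum_2)
  then have "(M$1$1 + M$2$2)\<^sup>2 = 2\<^sup>2" by (metis power2_abs)
  then have "(M$1$1 - M$2$2)\<^sup>2 = 0" using ad by (simp add: power2_eq_square algebra_simps)
  then have eq: "M$1$1 = M$2$2" by simp
  have "\<exists>b. A = trans c b \<or> A = - trans c b"
  proof -
    have "M$2$2 = 1 \<or> M$2$2 = -1" using ad unfolding eq by (simp add: square_eq_1_iff)
    then show ?thesis
    proof
      assume "M$2$2 = 1"
      then have "A = trans c (M$1$2)" using eq M21
        by - (rule cusp_conj_inj[of c], simp add: cusp_conj_trans M_def[symmetric] matrix_eq_2)
      then show ?thesis by blast
    next
      assume "M$2$2 = -1"
      then have "A = - trans c (- M$1$2)" using eq M21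
        by - (rule cusp_conj_inj[of c], simp add: cusp_conj_trans cusp_conj_uminus M_def[symmetric] matrix_eq_2)
      then show ?thesis by blast
    qed
  qed
  then obtain b where b: "A = trans c b \<or> A = - trans c b" by blast
  have "b \<noteq> 0"
  proof
    assume "b = 0"
    then have "psl A = psl (mat 1)" using b trans_0[of c] by auto
    then show False using \<gamma>(2) A by (simp add: parabolic_def one_PSL2R)
  qed
  moreover have "trans c b \<in> \<Gamma>" using b AG neg[OF AG] by auto
  ultimately show "\<exists>b. b \<noteq> 0 \<and> trans c b \<in> \<Gamma>" by blast
next
  assume "\<exists>b. b \<noteq> 0 \<and> trans c b \<in> \<Gamma>"
  then show "is_cusp G c" unfolding is_cusp_def using trans_parabolic by blast
qed

lemma psl_trans_pow_nat: "psl (trans c h) [^]\<^bsub>PSL2R\<^esub> (n::nat) = psl (trans c (real n * h))"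
proof (induction n)
  case 0
  then show ?case by (simp add: one_PSL2R trans_0)
next
  case (Suc n)
  then show ?case by (simp add: mult_PSL2R trans_add algebra_simps)
qed

lemma generate_trans: "generate PSL2R {psl (trans c h)} = {psl (trans c (of_int n * h)) | n. True}"
proof -
  have pow: "psl (trans c h) [^]\<^bsub>PSL2R\<^esub> (n::int) = psl (trans c (of_int n * h))" for n
  proof (cases "n < 0")
    case True
    then show ?thesis
      unfolding int_pow_def2 psl_trans_pow_nat by (simp add: inv_PSL2R adj2_trans)
  next
    case False
    then show ?thesis unfolding int_pow_def2 psl_trans_pow_nat by simp
  qed
  have "psl (trans c h) \<in> carrier PSL2R" by (simp add: carrier_PSL2R)
  from group.generate_pow[OF group_PSL2R this] show ?thesis unfolding pow by auto
qed

lemma boundary_stabilizer_eq: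
  assumes "is_cusp G c"
  shows "boundary_stabilizer G c = {psl (trans c b) | b. trans c b \<in> \<Gamma>}"
proof (intro equalityI subsetI)
  obtain h where h: "h \<noteq> 0" "trans c h \<in> \<Gamma>" using assms is_cusp_iff by blast
  fix \<gamma> assume \<gamma>: "\<gamma> \<in> boundary_stabilizer G c"
  then have \<gamma>G: "\<gamma> \<in> G" by (simp add: boundary_stabilizer_def)
  obtain A where A: "\<gamma> = psl A"
    using subgroup.subset[OF subgroup_G] \<gamma>G by (auto simp: carrier_PSL2R subset_iff)
  have Ain: "A \<in> \<gamma>" by (simp add: A psl_eq)
  have AG: "A \<in> \<Gamma>" by (rule in_group_lift(1)[OF subgroup_G \<gamma>G Ain])
  have "mobius_boundary A c = c" using \<gamma> Ain by (simp add: boundary_stabilizer_def)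
  then have "cusp_conj c A $ 2 $ 1 = 0" using mobius_boundary_fix_iff[OF sub[OF AG]] by simp
  from upper_triangular_cusp[OF AG this h(2,1)] obtain b where b: "A = trans c b \<or> A = - trans c b" by blast
  then have "trans c b \<in> \<Gamma>" "\<gamma> = psl (trans c b)" using AG neg[OF AG] A by auto
  then show "\<gamma> \<in> {psl (trans c b) | b. trans c b \<in> \<Gamma>}" by blast
next
  fix \<gamma> assume "\<gamma> \<in> {psl (trans c b) | b. trans c b \<in> \<Gamma>}"
  then obtain b where b: "\<gamma> = psl (trans c b)" "trans c b \<in> \<Gamma>" by blast
  have "mobius_boundary A c = c" if "A \<in> psl (trans c b)" for A
  proof -
    have A: "A = trans c b \<or> A = - trans c b" using that by (simp add: psl_eq)
    then have "cusp_conj c A $ 2 $ 1 = 0" by (auto simp: cusp_conj_uminus cusp_conj_trans)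
    moreover have "A \<in> SL2" using A by auto
    ultimately show ?thesis using mobius_boundary_fix_iff by blast
  qed
  then show "\<gamma> \<in> boundary_stabilizer G c"
    unfolding boundary_stabilizer_def b(1) using psl_in_G[OF b(2)] by blast
qed

lemma cusp_translation_eq: "cusp_translation c h = psl (trans c h)"
  by (simp add: cusp_translation_def trans_def matrix_inv_SL2)

text \<open>The description of \<open>cusp_width\<close> determines it: two positive generators of
  the same group of translations are integer multiples of each other, hence equal.\<close>

lemma cusp_width_props:
  assumes "is_cusp G c"
  shows "cusp_width G c > 0" "trans c b \<in> \<Gamma> \<longleftrightarrow> (\<exists>n::int. b = of_int n * cusp_width G c)"
proof -
  obtain h0 where h0: "h0 \<noteq> 0" "trans c h0 \<in> \<Gamma>" using assms is_cusp_iff by blast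
  obtain h where h: "h > 0" "\<And>b. trans c b \<in> \<Gamma> \<longleftrightarrow> (\<exists>n::int. b = of_int n * h)"
    using cusp_width_exists[OF h0(2,1)] by blast
  have stab: "boundary_stabilizer G c = generate PSL2R {cusp_translation c h}"
    unfolding boundary_stabilizer_eq[OF assms] cusp_translation_eq generate_trans h(2) by blast
  have "cusp_width G c = h"
    unfolding cusp_width_def
  proof (rule the_equality)
    show "h > 0 \<and> boundary_stabilizer G c = generate PSL2R {cusp_translation c h}" using h(1) stab by blast
    fix h' assume h': "h' > 0 \<and> boundary_stabilizer G c = generate PSL2R {cusp_translation c h'}"
    have eq: "{psl (trans c (of_int n * h)) | n. True} = {psl (trans c (of_int n * h')) | n. True}"
      using h' stab unfolding cusp_translation_eq generate_trans by simp
    have "psl (trans c (of_int 1 * h')) \<in> {psl (trans c (of_int n * h)) | n. True}" unfolding eq by blast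
    then obtain n :: int where "psl (trans c (of_int 1 * h')) = psl (trans c (of_int n * h))" by blast
    then have n: "h' = of_int n * h" using psl_trans_inj by (metis mult_1 of_int_1)
    have "psl (trans c (of_int 1 * h)) \<in> {psl (trans c (of_int n * h')) | n. True}" unfolding eq[symmetric] by blast
    then obtain k :: int where "psl (trans c (of_int 1 * h)) = psl (trans c (of_int k * h'))" by blast
    then have k: "h = of_int k * h'" using psl_trans_inj by (metis mult_1 of_int_1)
    have "of_int n > (0::real)" using n h' h(1) by (simp add: zero_less_mult_iff)
    then have n1: "n \<ge> 1" by simp
    have "of_int k > (0::real)" using k h' h(1) by (simp add: zero_less_mult_iff)
    then have k1: "k \<ge> 1" by simp
    have "h \<le> h'" unfolding n using n1 h(1) by simp
    moreover have "h' \<le> h" unfolding k using k1 h' by simp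
    ultimately show "h' = h" by simp
  qed
  then show "cusp_width G c > 0" "trans c b \<in> \<Gamma> \<longleftrightarrow> (\<exists>n::int. b = of_int n * cusp_width G c)"
    using h by auto
qed

lemma trans_width: assumes "is_cusp G c" shows "trans c (of_int n * cusp_width G c) \<in> \<Gamma>"
  using cusp_width_props(2)[OF assms] by blast

lemma cusp_stabilizer_form:
  assumes "is_cusp G c" "A \<in> \<Gamma>" "cusp_conj c A $ 2 $ 1 = 0"
  shows "\<exists>n::int. A = trans c (of_int n * cusp_width G c) \<or> A = - trans c (of_int n * cusp_width G c)"
proof -
  obtain h where h: "h \<noteq> 0" "trans c h \<in> \<Gamma>" using assms(1) is_cusp_iff by blast
  from upper_triangular_cusp[OF assms(2,3) h(2,1)] obtain b where b: "A = trans c b \<or> A = - trans c b" by blast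
  then have "trans c b \<in> \<Gamma>" using assms(2) neg[OF assms(2)] by auto
  then obtain n :: int where "b = of_int n * cusp_width G c"
    using cusp_width_props(2)[OF assms(1), of b] by blast
  then show ?thesis using b by blast
qed

lemma ht_shift: "ht c (trans c b ** g) = ht c g" "xc c (trans c b ** g) = xc c g + b" if g: "g \<in> SL2"
proof -
  define f where "f = adj2 (cusp_matrix c) ** g"
  have f: "f \<in> SL2" using g by (simp add: f_def)
  have "adj2 (cusp_matrix c) ** (trans c b ** g) = mat2 1 b 0 1 ** f"
    unfolding trans_def f_def by (simp only: matrix_mul_assoc[symmetric] adj2_mult_cancel cusp_matrix_SL2)
  moreover have "pt (mat2 1 b 0 1 ** f) = pt f + of_real b"
    by (subst pt_mult) (simp_all add: SL2_iff[of "mat2 1 b 0 1"] f mobius_def automorphy_def)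
  ultimately show "ht c (trans c b ** g) = ht c g" "xc c (trans c b ** g) = xc c g + b"
    by (simp_all add: ht_def xc_def f_def)
qed

text \<open>The finite set E of the thin reduction splits by the sign of
  \<open>det (tl2 \<delta>)\<close>. Elliptic and hyperbolic elements only enlarge the compact part.
  A parabolic one is, up to sign, a translation at some cusp, and a bound on its conjugate is a
  lower bound on the height there.\<close>

lemma cover_raw:
  "\<exists>R Y C. R > 0 \<and> Y > 0 \<and> finite C \<and> (\<forall>c\<in>C. is_cusp G c) \<and>
    (\<forall>g\<in>SL2. \<exists>\<sigma>\<in>\<Gamma>. norm (\<sigma> ** g) \<le> R \<or> (\<exists>c\<in>C. Y \<le> ht c (\<sigma> ** g)))"
proof -
  obtain R where R: "R > 0" "\<forall>w\<in>SL2. thick w \<longrightarrow> (\<exists>\<sigma>\<in>\<Gamma>. norm (\<sigma> ** w) \<le> R)"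
    using first_kind_thick_compact[OF first_kind] by blast
  have "\<exists>E R2. finite E \<and> E \<subseteq> {\<delta> \<in> \<Gamma>. tl2 \<delta> \<noteq> 0} \<and> R2 > 0 \<and>
    (\<forall>g\<in>SL2. \<not> thick g \<longrightarrow> (\<exists>\<sigma>\<in>\<Gamma>. \<exists>\<delta>\<in>E. norm (adj2 (\<sigma> ** g) ** tl2 \<delta> ** (\<sigma> ** g)) \<le> R2))"
    by (rule thin_reduce[OF R(1)]) (use R(2) in blast)
  then obtain E R2 where E: "finite E" "E \<subseteq> {\<delta> \<in> \<Gamma>. tl2 \<delta> \<noteq> 0}" "R2 > 0"
    "\<forall>g\<in>SL2. \<not> thick g \<longrightarrow> (\<exists>\<sigma>\<in>\<Gamma>. \<exists>\<delta>\<in>E. norm (adj2 (\<sigma> ** g) ** tl2 \<delta> ** (\<sigma> ** g)) \<le> R2)" by blast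
  have ex: "\<exists>B. \<exists>c. \<exists>b. (det (tl2 \<delta>) = 0 \<longrightarrow> b > 0 \<and> is_cusp G c) \<and>
      (\<forall>f\<in>SL2. norm (adj2 f ** tl2 \<delta> ** f) \<le> R2 \<longrightarrow>
         (\<exists>\<sigma>\<in>\<Gamma>. norm (\<sigma> ** f) \<le> B) \<or> (det (tl2 \<delta>) = 0 \<and> b \<le> ht c f))" if d: "\<delta> \<in> E" for \<delta>
  proof -
    have \<delta>: "\<delta> \<in> \<Gamma>" "tl2 \<delta> \<noteq> 0" using d E(2) by auto
    have trl: "tl2 \<delta> $ 2 $ 2 = - tl2 \<delta> $ 1 $ 1" by simp
    consider "det (tl2 \<delta>) > 0" | "det (tl2 \<delta>) < 0" | "det (tl2 \<delta>) = 0" by linarith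
    then show ?thesis
    proof cases
      case 1
      define q where "q = 2 * ((\<bar>tl2 \<delta> $ 1 $ 2\<bar> + \<bar>tl2 \<delta> $ 2 $ 1\<bar>) * R2 / det (tl2 \<delta>))"
      have bnd: "\<exists>\<sigma>\<in>\<Gamma>. norm (\<sigma> ** f) \<le> sqrt q" if "norm (adj2 f ** tl2 \<delta> ** f) \<le> R2" for f
      proof (rule bexI[OF _ one])
        have "(norm f)\<^sup>2 \<le> q" unfolding q_def by (rule elliptic_bounded[OF trl 1 that])
        then show "norm (mat 1 ** f) \<le> sqrt q" unfolding matrix_mul_lid by (rule real_le_rsqrt)
      qed
      \<comment> \<open>\<open>Infty\<close> and 0 are placeholders for a cusp and a height; the
        alternative that mentions them is void when the determinant is nonzero.\<close>
      have "det (tl2 \<delta>) = 0 \<longrightarrow> (0::real) > 0 \<and> is_cusp G Infty" using 1 by simp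
      moreover have "\<forall>f\<in>SL2. norm (adj2 f ** tl2 \<delta> ** f) \<le> R2 \<longrightarrow>
         (\<exists>\<sigma>\<in>\<Gamma>. norm (\<sigma> ** f) \<le> sqrt q) \<or> (det (tl2 \<delta>) = 0 \<and> 0 \<le> ht Infty f)"
        using bnd by blast
      ultimately show ?thesis by blast
    next
      case 2
      from hyperbolic_bounded[OF \<delta>(1) 2, of R2] obtain B
        where bnd: "\<forall>f\<in>SL2. norm (adj2 f ** tl2 \<delta> ** f) \<le> R2 \<longrightarrow> (\<exists>\<sigma>\<in>\<Gamma>. norm (\<sigma> ** f) \<le> B)" by (rule exE)
      have "det (tl2 \<delta>) = 0 \<longrightarrow> (0::real) > 0 \<and> is_cusp G Infty" using 2 by simp
      moreover have "\<forall>f\<in>SL2. norm (adj2 f ** tl2 \<delta> ** f) \<le> R2 \<longrightarrow>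
         (\<exists>\<sigma>\<in>\<Gamma>. norm (\<sigma> ** f) \<le> B) \<or> (det (tl2 \<delta>) = 0 \<and> 0 \<le> ht Infty f)"
        using bnd by blast
      ultimately show ?thesis by blast
    next
      case 3
      obtain c b where b: "b \<noteq> 0" "tl2 \<delta> = tl2 (trans c b)"
        using parabolic_normal_form[OF trl 3 \<delta>(2)] by blast
      have "(hf \<delta>)\<^sup>2 = 1" using det_decomp[of \<delta>] sub[OF \<delta>(1)] 3 by (simp add: SL2_def)
      then consider "hf \<delta> = 1" | "hf \<delta> = -1" unfolding power2_eq_1_iff by blast
      then have "is_cusp G c"
      proof cases
        case 1
        have "\<delta> = hf \<delta> *\<^sub>R mat 1 + tl2 \<delta>" by (rule tl2_decomp[symmetric])
        also have "\<dots> = mat 1 + tl2 (trans c b)" unfolding 1 b(2) by simp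
        also have "\<dots> = trans c b" by (rule trans_eq)
        finally have "\<delta> = trans c b" .
        then show ?thesis using is_cusp_iff b(1) \<delta>(1) by blast
      next
        case 2
        have "tl2 (trans c (- b)) = - tl2 (trans c b)"
        proof -
          have "mat2 0 (- b) 0 0 = - mat2 0 b 0 0" by (simp add: matrix_eq_2)
          then show ?thesis unfolding tl2_trans by (simp add: matrix_mult_algebra)
        qed
        then have "mat 1 + tl2 (trans c (- b)) = mat 1 - tl2 \<delta>" unfolding b(2) by simp
        then have "trans c (- b) = mat 1 - tl2 \<delta>" unfolding trans_eq .
        moreover have "- (hf \<delta> *\<^sub>R mat 1 + tl2 \<delta>) = mat 1 - tl2 \<delta>" unfolding 2 by simp
        then have "- \<delta> = mat 1 - tl2 \<delta>" unfolding tl2_decomp .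
        ultimately have "trans c (- b) \<in> \<Gamma>" using neg[OF \<delta>(1)] by simp
        then show ?thesis using is_cusp_iff b(1) by (metis neg_equal_0_iff_equal)
      qed
      moreover have "\<bar>b\<bar> / R2 \<le> ht c f" if f: "f \<in> SL2" "norm (adj2 f ** tl2 \<delta> ** f) \<le> R2" for f
      proof -
        have "\<bar>b\<bar> / ht c f \<le> R2" using f(2) norm_trans_conj(1)[OF f(1), of c b] b(2) by simp
        then show ?thesis using ht_pos[OF f(1), of c] E(3) by (simp add: divide_le_eq mult.commute)
      qed
      moreover have "\<bar>b\<bar> / R2 > 0" using b(1) E(3) by simp
      ultimately have "(det (tl2 \<delta>) = 0 \<longrightarrow> \<bar>b\<bar> / R2 > 0 \<and> is_cusp G c) \<and>
        (\<forall>f\<in>SL2. norm (adj2 f ** tl2 \<delta> ** f) \<le> R2 \<longrightarrow>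
         (\<exists>\<sigma>\<in>\<Gamma>. norm (\<sigma> ** f) \<le> 0) \<or> (det (tl2 \<delta>) = 0 \<and> \<bar>b\<bar> / R2 \<le> ht c f))" using 3 by blast
      then show ?thesis by - (rule exI[of _ 0], rule exI[of _ c], rule exI[of _ "\<bar>b\<bar> / R2"], assumption)
    qed
  qed
  from bchoice[OF ballI[OF ex]] obtain B where "\<forall>\<delta>\<in>E. \<exists>c. \<exists>b. (det (tl2 \<delta>) = 0 \<longrightarrow> b > 0 \<and> is_cusp G c) \<and>
      (\<forall>f\<in>SL2. norm (adj2 f ** tl2 \<delta> ** f) \<le> R2 \<longrightarrow>
         (\<exists>\<sigma>\<in>\<Gamma>. norm (\<sigma> ** f) \<le> B \<delta>) \<or> (det (tl2 \<delta>) = 0 \<and> b \<le> ht c f))" by (rule exE)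
  from bchoice[OF this] obtain c where "\<forall>\<delta>\<in>E. \<exists>b. (det (tl2 \<delta>) = 0 \<longrightarrow> b > 0 \<and> is_cusp G (c \<delta>)) \<and>
      (\<forall>f\<in>SL2. norm (adj2 f ** tl2 \<delta> ** f) \<le> R2 \<longrightarrow>
         (\<exists>\<sigma>\<in>\<Gamma>. norm (\<sigma> ** f) \<le> B \<delta>) \<or> (det (tl2 \<delta>) = 0 \<and> b \<le> ht (c \<delta>) f))" by (rule exE)
  from bchoice[OF this] obtain b where Bcb': "\<forall>\<delta>\<in>E. (det (tl2 \<delta>) = 0 \<longrightarrow> b \<delta> > 0 \<and> is_cusp G (c \<delta>)) \<and>
      (\<forall>f\<in>SL2. norm (adj2 f ** tl2 \<delta> ** f) \<le> R2 \<longrightarrow>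
         (\<exists>\<sigma>\<in>\<Gamma>. norm (\<sigma> ** f) \<le> B \<delta>) \<or> (det (tl2 \<delta>) = 0 \<and> b \<delta> \<le> ht (c \<delta>) f))" by (rule exE)
  have Bcb: "\<And>\<delta>. \<delta> \<in> E \<Longrightarrow> det (tl2 \<delta>) = 0 \<Longrightarrow> b \<delta> > (0::real) \<and> is_cusp G (c \<delta>)"
    "\<And>\<delta> f. \<delta> \<in> E \<Longrightarrow> f \<in> SL2 \<Longrightarrow> norm (adj2 f ** tl2 \<delta> ** f) \<le> R2 \<Longrightarrow>
         (\<exists>\<sigma>\<in>\<Gamma>. norm (\<sigma> ** f) \<le> B \<delta>) \<or> (det (tl2 \<delta>) = 0 \<and> b \<delta> \<le> ht (c \<delta>) f)"
    using Bcb' by blast+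
  define E0 where "E0 = {\<delta> \<in> E. det (tl2 \<delta>) = 0}"
  have finE0: "finite E0" using E(1) by (simp add: E0_def)
  obtain Y where Y: "Y > 0" "\<forall>\<delta>\<in>E0. Y \<le> b \<delta>"
    using finite_positive_lower_bound[OF finE0, of b] Bcb(1) by (auto simp: E0_def)
  define R' where "R' = R + (\<Sum>\<delta>\<in>E. \<bar>B \<delta>\<bar>)"
  have Bs: "\<bar>B \<delta>\<bar> \<le> (\<Sum>\<delta>\<in>E. \<bar>B \<delta>\<bar>)" if "\<delta> \<in> E" for \<delta>
    by (rule member_le_sum[OF that]) (use E(1) in auto)
  have s0: "(\<Sum>\<delta>\<in>E. \<bar>B \<delta>\<bar>) \<ge> 0" by (intro sum_nonneg) simp
  have "\<exists>\<sigma>\<in>\<Gamma>. norm (\<sigma> ** g) \<le> R' \<or> (\<exists>c\<in>c ` E0. Y \<le> ht c (\<sigma> ** g))" if g: "g \<in> SL2" for g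
  proof (cases "thick g")
    case True
    then obtain \<sigma> where "\<sigma> \<in> \<Gamma>" "norm (\<sigma> ** g) \<le> R" using R(2) g by blast
    moreover have "norm (\<sigma> ** g) \<le> R'" unfolding R'_def using \<open>norm (\<sigma> ** g) \<le> R\<close> s0 by linarith
    ultimately show ?thesis by blast
  next
    case False
    then obtain \<sigma> \<delta> where s: "\<sigma> \<in> \<Gamma>" "\<delta> \<in> E" "norm (adj2 (\<sigma> ** g) ** tl2 \<delta> ** (\<sigma> ** g)) \<le> R2"
      using E(4) g by blast
    have "\<sigma> ** g \<in> SL2" using sub[OF s(1)] g by simp
    from Bcb(2)[OF s(2) this s(3)] show ?thesis
    proof
      assume "\<exists>\<tau>\<in>\<Gamma>. norm (\<tau> ** (\<sigma> ** g)) \<le> B \<delta>"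
      then obtain \<tau> where t: "\<tau> \<in> \<Gamma>" "norm (\<tau> ** (\<sigma> ** g)) \<le> B \<delta>" by blast
      then have "norm ((\<tau> ** \<sigma>) ** g) \<le> B \<delta>" by (simp only: matrix_mul_assoc)
      then have "norm ((\<tau> ** \<sigma>) ** g) \<le> R'" unfolding R'_def using Bs[OF s(2)] R(1) by linarith
      then show ?thesis using mult[OF t(1) s(1)] by blast
    next
      assume "det (tl2 \<delta>) = 0 \<and> b \<delta> \<le> ht (c \<delta>) (\<sigma> ** g)"
      then have "\<delta> \<in> E0" "Y \<le> ht (c \<delta>) (\<sigma> ** g)" using s(2) Y(2) by (auto simp: E0_def intro: order_trans)
      then show ?thesis using s(1) by blast
    qed
  qed
  moreover have "R' > 0" unfolding R'_def using R(1) s0 by linarith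
  moreover have "finite (c ` E0)" "\<forall>c\<in>c ` E0. is_cusp G c" using finE0 Bcb(1) by (auto simp: E0_def)
  ultimately show ?thesis using Y(1)
    by - (rule exI[of _ R'], rule exI[of _ Y], rule exI[of _ "c ` E0"], blast)
qed

text \<open>In the coordinates of the two cusps \<open>\<sigma>\<close> is upper triangular, hence
  an affine map that multiplies the height by \<open>(M$1$1)\<^sup>2\<close>.\<close>

lemma cusp_equiv_ht:
  assumes "\<sigma> \<in> \<Gamma>" "(adj2 (cusp_matrix c') ** \<sigma> ** cusp_matrix c) $ 2 $ 1 = 0"
  shows "\<exists>a>0. \<forall>g\<in>SL2. ht c' (\<sigma> ** g) = a * ht c g"
proof -
  define M where "M = adj2 (cusp_matrix c') ** \<sigma> ** cusp_matrix c"
  have M: "M \<in> SL2" using sub[OF assms(1)] by (simp add: M_def)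
  have d: "M$1$1 * M$2$2 = 1" "M$2$1 = 0" using M assms(2) by (simp_all add: SL2_iff M_def)
  have "ht c' (\<sigma> ** g) = (M$1$1)\<^sup>2 * ht c g" if g: "g \<in> SL2" for g
  proof -
    define f where "f = adj2 (cusp_matrix c) ** g"
    have f: "f \<in> SL2" using g by (simp add: f_def)
    have e: "adj2 (cusp_matrix c') ** (\<sigma> ** g) = M ** f"
      unfolding M_def f_def by (simp only: matrix_mul_assoc[symmetric] adj2_mult_cancel cusp_matrix_SL2)
    have "ht c' (\<sigma> ** g) = Im (pt f) / (cmod (automorphy M (pt f)))\<^sup>2"
      unfolding ht_def e pt_mult[OF M f] by (rule Im_mobius[OF M Im_pt_pos[OF f]])
    also have "automorphy M (pt f) = of_real (M$2$2)" using d by (simp add: automorphy_def)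
    also have "Im (pt f) / (cmod (of_real (M$2$2)))\<^sup>2 = (M$1$1)\<^sup>2 * Im (pt f)"
    proof -
      have nz: "M$2$2 \<noteq> 0" using d(1) by auto
      then have "M$1$1 = 1 / M$2$2" using d(1) by (simp add: eq_divide_eq)
      then show ?thesis using nz by (simp add: power_divide)
    qed
    finally show ?thesis by (simp add: ht_def f_def)
  qed
  moreover have "(M$1$1)\<^sup>2 > 0" using d(1) by auto
  ultimately show ?thesis by blast
qed

text \<open>Each sector is carried to the representative of its class of cusps, which multiplies
  heights by finitely many factors bounded below by m, and is reduced horizontally by translations.
  Inequivalence of the representatives will force two points that are high and close modulo the
  group into the same sector.\<close>

lemma cover:
  "\<exists>R Y C. R > 0 \<and> Y > 0 \<and> finite C \<and> (\<forall>c\<in>C. is_cusp G c) \<and>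
    (\<forall>c\<in>C. \<forall>c'\<in>C. cusp_equiv \<Gamma> c c' \<longrightarrow> c = c') \<and>
    (\<forall>g\<in>SL2. \<exists>\<sigma>\<in>\<Gamma>. norm (\<sigma> ** g) \<le> R \<or>
       (\<exists>c\<in>C. Y \<le> ht c (\<sigma> ** g) \<and> 0 \<le> xc c (\<sigma> ** g) \<and> xc c (\<sigma> ** g) \<le> cusp_width G c))"
proof -
  obtain R Y C0 where C0: "R > 0" "Y > 0" "finite C0" "\<forall>c\<in>C0. is_cusp G c"
    "\<forall>g\<in>SL2. \<exists>\<sigma>\<in>\<Gamma>. norm (\<sigma> ** g) \<le> R \<or> (\<exists>c\<in>C0. Y \<le> ht c (\<sigma> ** g))"
    using cover_raw by blast
  have refl: "cusp_equiv \<Gamma> c c" for c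
    unfolding cusp_equiv_def by (intro bexI[of _ "mat 1"]) (simp_all add: adj2_mult)
  have sym: "cusp_equiv \<Gamma> c' c" if cc: "cusp_equiv \<Gamma> c c'" for c c'
  proof -
    obtain \<sigma> where s: "\<sigma> \<in> \<Gamma>" "(adj2 (cusp_matrix c') ** \<sigma> ** cusp_matrix c) $ 2 $ 1 = 0"
      using cc unfolding cusp_equiv_def by (elim bexE)
    have "adj2 (cusp_matrix c) ** adj2 \<sigma> ** cusp_matrix c' = adj2 (adj2 (cusp_matrix c') ** \<sigma> ** cusp_matrix c)"
      by (simp only: adj2_mult_distrib adj2_adj2 matrix_mul_assoc)
    then have "(adj2 (cusp_matrix c) ** adj2 \<sigma> ** cusp_matrix c') $ 2 $ 1 = 0" by (simp only: adj2_nth s(2))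
    then show ?thesis using inv[OF s(1)] by (auto simp: cusp_equiv_def)
  qed
  have "\<exists>C\<subseteq>C0. (\<forall>x\<in>C0. \<exists>y\<in>C. cusp_equiv \<Gamma> x y) \<and> (\<forall>x\<in>C. \<forall>y\<in>C. cusp_equiv \<Gamma> x y \<longrightarrow> x = y)"
    by (rule finite_transversal[OF C0(3)]) (rule refl, erule sym)
  then obtain C where C: "C \<subseteq> C0" "\<forall>x\<in>C0. \<exists>y\<in>C. cusp_equiv \<Gamma> x y" "\<forall>x\<in>C. \<forall>y\<in>C. cusp_equiv \<Gamma> x y \<longrightarrow> x = y"
    by (elim exE conjE)
  have ex: "\<exists>c' \<sigma> a. c' \<in> C \<and> \<sigma> \<in> \<Gamma> \<and> a > (0::real) \<and> (\<forall>g\<in>SL2. ht c' (\<sigma> ** g) = a * ht c g)" if c: "c \<in> C0" for c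
  proof -
    obtain c' where c': "c' \<in> C" "cusp_equiv \<Gamma> c c'" using bspec[OF C(2) c] by (elim bexE)
    from c'(2) obtain \<sigma> where s: "\<sigma> \<in> \<Gamma>" "(adj2 (cusp_matrix c') ** \<sigma> ** cusp_matrix c) $ 2 $ 1 = 0"
      unfolding cusp_equiv_def by (elim bexE)
    from cusp_equiv_ht[OF s] obtain a where a: "a > 0" "\<forall>g\<in>SL2. ht c' (\<sigma> ** g) = a * ht c g" by (elim exE conjE)
    show ?thesis by (rule exI[of _ c'], rule exI[of _ \<sigma>], rule exI[of _ a]) (rule conjI[OF c'(1) conjI[OF s(1) conjI[OF a]]])
  qed
  from bchoice[OF ballI[OF ex]] obtain c' where
    "\<forall>c\<in>C0. \<exists>\<sigma> a. c' c \<in> C \<and> \<sigma> \<in> \<Gamma> \<and> a > (0::real) \<and> (\<forall>g\<in>SL2. ht (c' c) (\<sigma> ** g) = a * ht c g)" by (rule exE)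
  from bchoice[OF this] obtain s where
    "\<forall>c\<in>C0. \<exists>a. c' c \<in> C \<and> s c \<in> \<Gamma> \<and> a > (0::real) \<and> (\<forall>g\<in>SL2. ht (c' c) (s c ** g) = a * ht c g)" by (rule exE)
  from bchoice[OF this] obtain a where
    tr': "\<forall>c\<in>C0. c' c \<in> C \<and> s c \<in> \<Gamma> \<and> a c > (0::real) \<and> (\<forall>g\<in>SL2. ht (c' c) (s c ** g) = a c * ht c g)" by (rule exE)
  have tr: "\<And>c. c \<in> C0 \<Longrightarrow> c' c \<in> C" "\<And>c. c \<in> C0 \<Longrightarrow> s c \<in> \<Gamma>" "\<And>c. c \<in> C0 \<Longrightarrow> a c > (0::real)"
    "\<And>c g. c \<in> C0 \<Longrightarrow> g \<in> SL2 \<Longrightarrow> ht (c' c) (s c ** g) = a c * ht c g" using tr' by blast+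
  obtain m where m: "m > 0" "\<forall>c\<in>C0. m \<le> a c" using finite_positive_lower_bound[OF C0(3), of a] tr(3) by blast
  have main: "\<exists>\<sigma>\<in>\<Gamma>. norm (\<sigma> ** g) \<le> R \<or>
       (\<exists>c\<in>C. m * Y \<le> ht c (\<sigma> ** g) \<and> 0 \<le> xc c (\<sigma> ** g) \<and> xc c (\<sigma> ** g) \<le> cusp_width G c)" if g: "g \<in> SL2" for g
  proof -
    obtain \<sigma> where \<sigma>: "\<sigma> \<in> \<Gamma>" "norm (\<sigma> ** g) \<le> R \<or> (\<exists>c\<in>C0. Y \<le> ht c (\<sigma> ** g))" using C0(5) g by blast
    show ?thesis
    proof (cases "norm (\<sigma> ** g) \<le> R")
      case True
      then show ?thesis using \<sigma>(1) by blast
    next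
      case False
      then obtain c where c: "c \<in> C0" "Y \<le> ht c (\<sigma> ** g)" using \<sigma>(2) by blast
      define k where "k = c' c"
      have kC: "k \<in> C" "is_cusp G k" using tr(1)[OF c(1)] C(1) C0(4) by (auto simp: k_def)
      define f where "f = s c ** (\<sigma> ** g)"
      have f: "f \<in> SL2" unfolding f_def using sub[OF tr(2)[OF c(1)]] sub[OF \<sigma>(1)] g by simp
      have "ht k f = a c * ht c (\<sigma> ** g)" unfolding k_def f_def using tr(4)[OF c(1)] sub[OF \<sigma>(1)] g by simp
      moreover have "m * Y \<le> a c * ht c (\<sigma> ** g)" using m c C0(2) by (intro mult_mono) auto
      ultimately have hk: "m * Y \<le> ht k f" by simp
      define h where "h = cusp_width G k"
      have h: "h > 0" unfolding h_def by (rule cusp_width_props(1)[OF kC(2)])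
      define n where "n = \<lfloor>xc k f / h\<rfloor>"
      have "of_int n \<le> xc k f / h" "xc k f / h < of_int n + 1" unfolding n_def by linarith+
      then have nn: "of_int n * h \<le> xc k f" "xc k f \<le> of_int n * h + h" using h by (simp_all add: field_simps)
      define t where "t = trans k (of_int (- n) * h)"
      have t: "t \<in> \<Gamma>" unfolding t_def h_def by (rule trans_width[OF kC(2)])
      have "ht k (t ** f) = ht k f" "xc k (t ** f) = xc k f + of_int (- n) * h"
        unfolding t_def by (rule ht_shift[OF f])+
      then have "m * Y \<le> ht k (t ** f) \<and> 0 \<le> xc k (t ** f) \<and> xc k (t ** f) \<le> cusp_width G k"
        using hk nn unfolding h_def by simp
      moreover have "t ** f = (t ** (s c ** \<sigma>)) ** g" by (simp only: f_def matrix_mul_assoc)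
      moreover have "t ** (s c ** \<sigma>) \<in> \<Gamma>" by (rule mult[OF t mult[OF tr(2)[OF c(1)] \<sigma>(1)]])
      ultimately show ?thesis using kC(1) by (intro bexI[of _ "t ** (s c ** \<sigma>)"]) auto
    qed
  qed
  have A: "finite C" "\<forall>c\<in>C. is_cusp G c" "m * Y > 0"
    using C(1) C0(3) finite_subset apply blast
    using C(1) C0(4) apply blast
    using m(1) C0(2) by simp
  show ?thesis
    by (rule exI[of _ R], rule exI[of _ "m * Y"], rule exI[of _ C])
       (rule conjI[OF C0(1) conjI[OF A(3) conjI[OF A(1) conjI[OF A(2) conjI[OF C(3) ballI[OF main]]]]]])
qed

end

section \<open>Norms adapted to the cusps\<close>

lemma bounded_of_ht:
  assumes g: "g \<in> SL2" and y: "0 < Y" "Y \<le> ht c g" "ht c g \<le> H" and x: "0 \<le> xc c g" "xc c g \<le> h"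
  shows "norm g \<le> norm (cusp_matrix c) * sqrt ((h\<^sup>2 + H\<^sup>2 + 1) / Y)"
proof -
  define f where "f = adj2 (cusp_matrix c) ** g"
  have f: "f \<in> SL2" using g by (simp add: f_def)
  have "(norm f)\<^sup>2 = ((xc c g)\<^sup>2 + (ht c g)\<^sup>2 + 1) / ht c g"
    unfolding norm_pt[OF f] by (simp add: xc_def ht_def f_def)
  also have "\<dots> \<le> (h\<^sup>2 + H\<^sup>2 + 1) / Y"
    using x y by (intro frac_le add_mono power_mono) auto
  finally have "norm f \<le> sqrt ((h\<^sup>2 + H\<^sup>2 + 1) / Y)" by (rule real_le_rsqrt)
  then have "norm (cusp_matrix c) * norm f \<le> norm (cusp_matrix c) * sqrt ((h\<^sup>2 + H\<^sup>2 + 1) / Y)"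
    by (intro mult_left_mono) auto
  moreover have "g = cusp_matrix c ** f" unfolding f_def by (simp only: adj2_mult_cancel cusp_matrix_SL2)
  then have "norm g = norm (cusp_matrix c ** f)" by (rule arg_cong)
  ultimately show ?thesis using norm_matrix_mult_le[of "cusp_matrix c" f] by linarith
qed

lemma dyadic_scale:
  fixes y :: real assumes "0 < y" "y \<le> 1"
  shows "\<exists>j::nat. 1/2 \<le> 2 ^ j * y \<and> 2 ^ j * y \<le> 1"
proof -
  obtain n :: nat where "1 / y < 2 ^ n" using real_arch_pow[of 2 "1 / y"] by auto
  then have ex: "1 < 2 ^ n * y" using assms(1) by (simp add: divide_less_eq)
  define j where "j = (LEAST n. 1 < 2 ^ n * y)"
  have j: "1 < 2 ^ j * y" unfolding j_def using ex by (rule LeastI)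
  have "j \<noteq> 0" using j assms(2) by (intro notI) simp
  then obtain i where i: "j = Suc i" using not0_implies_Suc by blast
  have "\<not> 1 < 2 ^ i * y" using not_less_Least[of i "\<lambda>n. 1 < 2 ^ n * y"] i by (simp add: j_def)
  moreover have "1/2 \<le> 2 ^ i * y" using j unfolding i power_Suc by simp
  ultimately show ?thesis by (intro exI[of _ i]) simp
qed

lemma norm_bounded_matrices:
  fixes S :: "'a set" and T :: "'a \<Rightarrow> complex^'m^'m"
  assumes "finite S"
  shows "\<exists>B\<ge>1. \<forall>s\<in>S. \<forall>v. norm (T s *v v) \<le> B * norm v"
proof -
  have one: "\<exists>B\<ge>0. \<forall>v. norm (A *v v) \<le> B * norm v" for A :: "complex^'m^'m"
  proof -
    have "linear ((*v) A)" by (intro linearI) (simp add: matrix_vector_right_distrib, simp add: vec_eq_iff matrix_vector_mult_def scaleR_sum_right)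
    then have "bounded_linear ((*v) A)" by (simp add: linear_conv_bounded_linear)
    then obtain K where "K > 0" "\<forall>v. norm (A *v v) \<le> norm v * K" using bounded_linear.pos_bounded by blast
    then show ?thesis by (intro exI[of _ K]) (auto simp: mult.commute)
  qed
  have "\<forall>s\<in>S. \<exists>B. B \<ge> 0 \<and> (\<forall>v. norm (T s *v v) \<le> B * norm v)" using one by blast
  from bchoice[OF this] obtain B where B: "\<forall>s\<in>S. B s \<ge> 0 \<and> (\<forall>v. norm (T s *v v) \<le> B s * norm v)" by (rule exE)
  have "norm (T s *v v) \<le> (1 + (\<Sum>s\<in>S. B s)) * norm v" if s: "s \<in> S" for s v
  proof -
    have "B s \<le> (\<Sum>s\<in>S. B s)" by (rule member_le_sum[OF s]) (use B assms in auto)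
    then have "B s * norm v \<le> (1 + (\<Sum>s\<in>S. B s)) * norm v" by (intro mult_right_mono) auto
    moreover have "norm (T s *v v) \<le> B s * norm v" using B s by blast
    ultimately show ?thesis by (rule order_trans[rotated])
  qed
  moreover have "(\<Sum>s\<in>S. B s) \<ge> 0" by (rule sum_nonneg) (use B in blast)
  ultimately show ?thesis by (intro exI[of _ "1 + (\<Sum>s\<in>S. B s)"]) auto
qed

locale fuchsian_rep = fuchsian_first G for G +
  fixes \<rho> :: "(real^2^2) set \<Rightarrow> complex^'m^'m"
  assumes rep: "group_representation G \<rho>"
    and unitary: "\<gamma> \<in> G \<Longrightarrow> parabolic \<gamma> \<Longrightarrow> eigenvalue (\<rho> \<gamma>) l \<Longrightarrow> cmod l = 1"
begin

definition rv :: "real^2^2 \<Rightarrow> complex^'m \<Rightarrow> complex^'m" where "rv A v = \<rho> (psl A) *v v"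

lemma rv_mult: assumes "A \<in> \<Gamma>" "B \<in> \<Gamma>" shows "rv (A ** B) v = rv A (rv B v)"
proof -
  have "\<rho> (psl A \<otimes>\<^bsub>PSL2R\<^esub> psl B) = \<rho> (psl A) ** \<rho> (psl B)"
    using rep psl_in_G[OF assms(1)] psl_in_G[OF assms(2)]
    unfolding group_representation_def hom_def GL_complex_def by simp
  then show ?thesis by (simp add: rv_def mult_PSL2R matrix_vector_mul_assoc)
qed

text \<open>A homomorphism into \<open>GL_complex\<close> sends the identity to an invertible
  idempotent.\<close>

lemma rv_one: "rv (mat 1) v = v"
proof -
  have i: "invertible (\<rho> (psl (mat 1)))"
    using rep psl_in_G[OF one] unfolding group_representation_def hom_def GL_complex_def by auto
  then obtain E where E: "E ** \<rho> (psl (mat 1)) = mat 1" unfolding invertible_def by blast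
  have "\<rho> (psl (mat 1)) *v (\<rho> (psl (mat 1)) *v v) = \<rho> (psl (mat 1)) *v v"
    using rv_mult[OF one one, of v] by (simp add: rv_def)
  then have "E *v (\<rho> (psl (mat 1)) *v (\<rho> (psl (mat 1)) *v v)) = E *v (\<rho> (psl (mat 1)) *v v)" by (rule arg_cong)
  then show ?thesis unfolding rv_def by (simp only: matrix_vector_mul_assoc E matrix_vector_mul_lid matrix_mul_assoc matrix_mul_lid)
qed

lemma rv_inv: "A \<in> \<Gamma> \<Longrightarrow> rv (adj2 A) (rv A v) = v" "A \<in> \<Gamma> \<Longrightarrow> rv A (rv (adj2 A) v) = v"
  using rv_mult[of "adj2 A" A v] rv_mult[of A "adj2 A" v] inv[of A] adj2_mult[OF sub, of A] rv_one by simp_all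

lemma rv_uminus: "rv (- A) v = rv A v"
  by (simp add: rv_def)

lemma rv_trans_nat:
  assumes "trans c h \<in> \<Gamma>"
  shows "rv (trans c (real k * h)) v = mpow (\<rho> (psl (trans c h))) k v"
proof (induction k arbitrary: v)
  case 0
  then show ?case by (simp add: trans_0 rv_one)
next
  case (Suc k)
  have "trans c (real (Suc k) * h) = trans c h ** trans c (of_int (int k) * h)"
    by (simp add: trans_add algebra_simps)
  then show ?case using rv_mult[OF assms trans_of_int[OF assms, of "int k"], of v] Suc
    by (simp add: mpow_Suc) (simp add: rv_def)
qed

text \<open>Negative n go through the inverse generator, which is parabolic as well; its eigenvalues
  also have modulus one, so its powers grow polynomially too.\<close>

lemma rv_trans_growth:
  assumes c: "is_cusp G c"
  shows "\<exists>K M. K \<ge> 0 \<and> (\<forall>n::int. \<forall>v. norm (rv (trans c (of_int n * cusp_width G c)) v) \<le> K * (1 + \<bar>of_int n\<bar>) ^ M * norm v)"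
proof -
  define h where "h = cusp_width G c"
  have h: "h > 0" "trans c h \<in> \<Gamma>" "trans c (- h) \<in> \<Gamma>"
    using cusp_width_props(1)[OF c] trans_width[OF c, of 1] trans_width[OF c, of "-1"] by (simp_all add: h_def)
  have ev: "eigenvalue (\<rho> (psl (trans c b))) l \<Longrightarrow> cmod l \<le> 1" if "trans c b \<in> \<Gamma>" "b \<noteq> 0" for b l
    using unitary[OF psl_in_G[OF that(1)] trans_parabolic(2)[OF that]] by simp
  obtain K1 M1 where 1: "K1 \<ge> 0" "\<And>n v. norm (mpow (\<rho> (psl (trans c h))) n v) \<le> K1 * (1 + real n) ^ M1 * norm v"
    using matrix_power_growth[OF ev[OF h(2)]] h(1) by blast
  obtain K2 M2 where 2: "K2 \<ge> 0" "\<And>n v. norm (mpow (\<rho> (psl (trans c (- h)))) n v) \<le> K2 * (1 + real n) ^ M2 * norm v"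
    using matrix_power_growth[OF ev[OF h(3)]] h(1) by fastforce
  have pow: "K1 * (1 + real k) ^ M1 \<le> (K1 + K2) * (1 + real k) ^ (M1 + M2)" "K2 * (1 + real k) ^ M2 \<le> (K1 + K2) * (1 + real k) ^ (M1 + M2)" for k
    using 1(1) 2(1) by (intro mult_mono power_increasing; simp)+
  have "norm (rv (trans c (of_int n * h)) v) \<le> (K1 + K2) * (1 + \<bar>of_int n\<bar>) ^ (M1 + M2) * norm v" for n :: int and v
  proof (cases "n \<ge> 0")
    case True
    define k where "k = nat n"
    have k: "of_int n = real k" using True by (simp add: k_def)
    have "norm (rv (trans c (real k * h)) v) \<le> K1 * (1 + real k) ^ M1 * norm v"
      unfolding rv_trans_nat[OF h(2)] by (rule 1(2))
    also have "\<dots> \<le> (K1 + K2) * (1 + real k) ^ (M1 + M2) * norm v" by (rule mult_right_mono[OF pow(1)]) simp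
    finally show ?thesis unfolding k by simp
  next
    case False
    define k where "k = nat (- n)"
    have k: "of_int n = - real k" using False by (simp add: k_def)
    have "norm (rv (trans c (real k * (- h))) v) \<le> K2 * (1 + real k) ^ M2 * norm v"
      unfolding rv_trans_nat[OF h(3)] by (rule 2(2))
    also have "\<dots> \<le> (K1 + K2) * (1 + real k) ^ (M1 + M2) * norm v" by (rule mult_right_mono[OF pow(2)]) simp
    finally show ?thesis unfolding k by simp
  qed
  then show ?thesis unfolding h_def using 1(1) 2(1) by (intro exI[of _ "K1 + K2"] exI[of _ "M1 + M2"]) auto
qed

text \<open>If \<open>\<delta>\<close> moves g high into the cusp, the translation by one width,
  conjugated by \<open>\<delta>\<close>, is close to the identity at g, and so has small trace-free
  part when \<open>norm g\<close> is bounded. The lower bound on trace-free parts limits the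
  height.\<close>

lemma ht_translate_bounded:
  assumes c: "is_cusp G c"
  shows "\<exists>H>0. \<forall>g\<in>SL2. \<forall>\<delta>\<in>\<Gamma>. ht c (\<delta> ** g) \<le> H * (norm g)\<^sup>2"
proof -
  obtain m where m: "m > 0" "\<forall>\<delta>\<in>\<Gamma>. tl2 \<delta> \<noteq> 0 \<longrightarrow> m \<le> norm (tl2 \<delta>)" using norm_tl2_lower_bound by (elim exE conjE)
  define h where "h = cusp_width G c"
  have h: "h > 0" "trans c h \<in> \<Gamma>"
    using cusp_width_props(1)[OF c] trans_width[OF c, of 1] by (simp_all add: h_def)
  have "ht c (\<delta> ** g) \<le> h / m * (norm g)\<^sup>2" if g: "g \<in> SL2" and d: "\<delta> \<in> \<Gamma>" for g \<delta>
  proof -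
    define f where "f = \<delta> ** g"
    have D: "\<delta> \<in> SL2" by (rule sub[OF d])
    have f: "f \<in> SL2" unfolding f_def using D g by simp
    define \<gamma> where "\<gamma> = adj2 \<delta> ** trans c h ** \<delta>"
    have \<gamma>: "\<gamma> \<in> \<Gamma>" unfolding \<gamma>_def by (rule mult[OF mult[OF inv[OF d] h(2)] d])
    have "tl2 \<gamma> \<noteq> 0" unfolding \<gamma>_def tl2_conj_eq_0[OF D] using tl2_trans_nonzero h(1) by simp
    then have mt: "m \<le> norm (tl2 \<gamma>)" using m(2) \<gamma> by blast
    have e: "adj2 g ** tl2 \<gamma> ** g = adj2 f ** tl2 (trans c h) ** f"
      unfolding \<gamma>_def tl2_conj[OF D] f_def by (rule conj_mult[symmetric])
    have "tl2 \<gamma> = g ** (adj2 g ** tl2 \<gamma> ** g) ** adj2 g"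
      using g by (simp only: matrix_mul_assoc[symmetric] adj2_mult_cancel adj2_mult matrix_mul_rid)
    then have "norm (tl2 \<gamma>) = norm (g ** (adj2 g ** tl2 \<gamma> ** g) ** adj2 g)" by (rule arg_cong)
    also have "\<dots> \<le> norm g * norm (adj2 g ** tl2 \<gamma> ** g) * norm g"
      using norm_mult_le3[of g "adj2 g ** tl2 \<gamma> ** g" "adj2 g"] by simp
    also have "norm (adj2 g ** tl2 \<gamma> ** g) = h / ht c f"
      unfolding e using norm_trans_conj(1)[OF f, of c h] h(1) by simp
    finally have "norm (tl2 \<gamma>) \<le> norm g * (h / ht c f) * norm g" .
    with mt have "m \<le> norm g * (h / ht c f) * norm g" by (rule order_trans)
    then have "m * ht c f \<le> h * (norm g)\<^sup>2" using ht_pos[OF f, of c] by (simp add: field_simps power2_eq_square)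
    then show ?thesis using m(1) by (simp add: f_def field_simps)
  qed
  moreover have "h / m > 0" using h(1) m(1) by simp
  ultimately show ?thesis by blast
qed

end

text \<open>Holds the data of the covering, with one constant K0 and one exponent M for the powers
  of the cusp generators at all cusps of C. The same M is the exponent of the damping in the adapted
  norms.\<close>

locale cusp_system = fuchsian_rep G \<rho> for G and \<rho> :: "(real^2^2) set \<Rightarrow> complex^'m^'m" +
  fixes R0 Y0 K0 :: real and M :: nat and C :: "boundary_point set"
  assumes R0: "R0 > 0" and Y0: "Y0 > 0" and finC: "finite C" and cusps: "c \<in> C \<Longrightarrow> is_cusp G c"
    and inequiv: "c \<in> C \<Longrightarrow> c' \<in> C \<Longrightarrow> cusp_equiv \<Gamma> c c' \<Longrightarrow> c = c'"
    and cov: "g \<in> SL2 \<Longrightarrow> \<exists>\<sigma>\<in>\<Gamma>. norm (\<sigma> ** g) \<le> R0 \<or>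
       (\<exists>c\<in>C. Y0 \<le> ht c (\<sigma> ** g) \<and> 0 \<le> xc c (\<sigma> ** g) \<and> xc c (\<sigma> ** g) \<le> cusp_width G c)"
    and K0: "K0 \<ge> 0"
    and pow: "c \<in> C \<Longrightarrow> norm (rv (trans c (of_int n * cusp_width G c)) v) \<le> K0 * (1 + \<bar>of_int n\<bar>) ^ M * norm v"
begin

abbreviation wd :: "boundary_point \<Rightarrow> real" where "wd \<equiv> cusp_width G"

lemma wd_pos: "c \<in> C \<Longrightarrow> wd c > 0"
  using cusp_width_props(1)[OF cusps] .

text \<open>A norm on the fibre over a point of height \<open>y\<close> in the cusp \<open>c\<close> which, in contrast to the fixed norm,
  is distorted by a bounded factor only when moving by a bounded hyperbolic distance.\<close>

definition W :: "boundary_point \<Rightarrow> real \<Rightarrow> complex^'m \<Rightarrow> real" where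
  "W c y v = (SUP n::int. norm (rv (trans c (of_int n * wd c)) v) / (1 + \<bar>of_int n\<bar> / y) ^ M)"

text \<open>Rests on \<open>1 + |n| \<le> (1 + y) * (1 + |n| / y)\<close>. It makes the supremum in
  \<open>W\<close> finite and bounds \<open>W\<close> by a power of the height.\<close>

lemma W_term_le:
  assumes "c \<in> C" "y > 0"
  shows "norm (rv (trans c (of_int n * wd c)) v) / (1 + \<bar>of_int n\<bar> / y) ^ M \<le> K0 * (1 + y) ^ M * norm v"
proof -
  define t where "t = 1 + \<bar>of_int n\<bar> / y"
  have t: "t \<ge> 1" using assms(2) by (simp add: t_def)
  have "(1 + y) * t = 1 + y + \<bar>of_int n\<bar> / y + \<bar>of_int n\<bar>" using assms(2) by (simp add: t_def field_simps)
  moreover have "\<bar>of_int n\<bar> / y \<ge> 0" using assms(2) by simp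
  ultimately have "1 + \<bar>of_int n\<bar> \<le> (1 + y) * t" using assms(2) by linarith
  then have "(1 + \<bar>of_int n\<bar>) ^ M \<le> ((1 + y) * t) ^ M" by (intro power_mono) auto
  then have "K0 * (1 + \<bar>of_int n\<bar>) ^ M * norm v \<le> K0 * ((1 + y) * t) ^ M * norm v"
    using K0 by (intro mult_right_mono mult_left_mono) auto
  then have "norm (rv (trans c (of_int n * wd c)) v) \<le> (K0 * (1 + y) ^ M * norm v) * t ^ M"
    using pow[OF assms(1), of n v] by (simp add: power_mult_distrib mult_ac)
  then show ?thesis unfolding t_def[symmetric] using t by (simp add: divide_le_eq)
qed

lemma W_upper: assumes "c \<in> C" "y > 0"
  shows "norm (rv (trans c (of_int n * wd c)) v) / (1 + \<bar>of_int n\<bar> / y) ^ M \<le> W c y v"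
  unfolding W_def
  by (rule cSUP_upper) (auto intro!: bdd_aboveI2 W_term_le[OF assms])

lemma W_le: assumes "\<And>n. norm (rv (trans c (of_int n * wd c)) v) / (1 + \<bar>of_int n\<bar> / y) ^ M \<le> b"
  shows "W c y v \<le> b"
  unfolding W_def by (rule cSUP_least) (use assms in auto)

lemma W_bounds: assumes "c \<in> C" "y > 0" shows "norm v \<le> W c y v" "W c y v \<le> K0 * (1 + y) ^ M * norm v"
proof -
  show "norm v \<le> W c y v" using W_upper[OF assms, of 0 v] by (simp add: trans_0 rv_one)
  show "W c y v \<le> K0 * (1 + y) ^ M * norm v" by (rule W_le) (rule W_term_le[OF assms])
qed

text \<open>Re-index the supremum by n - k; the damping factors compare by
  \<open>1 + |n - k| / y' \<le> (4 + 4 * |k| / y) * (1 + |n| / y)\<close>. The constant stays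
  bounded while |k| / y does, which is the drift that a bounded hyperbolic move allows.\<close>

lemma W_change:
  assumes c: "c \<in> C" and y: "y > 0" "y' > 0" "y \<le> 4 * y'"
  shows "W c y v \<le> (4 + 4 * \<bar>of_int k\<bar> / y) ^ M * W c y' (rv (trans c (of_int k * wd c)) v)"
proof (rule W_le)
  fix n :: int
  define w where "w = rv (trans c (of_int k * wd c)) v"
  have "trans c (of_int n * wd c) = trans c (of_int (n - k) * wd c) ** trans c (of_int k * wd c)"
    by (simp add: trans_add algebra_simps)
  then have e: "rv (trans c (of_int n * wd c)) v = rv (trans c (of_int (n - k) * wd c)) w"
    unfolding w_def using rv_mult[OF trans_width[OF cusps[OF c], of "n - k"] trans_width[OF cusps[OF c], of k]] by simp
  define s where "s = 1 + \<bar>of_int (n - k)\<bar> / y'"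
  define t where "t = 1 + \<bar>of_int n\<bar> / y"
  define q where "q = 4 + 4 * \<bar>of_int k\<bar> / y"
  have pos: "s > 0" "t > 0" "q > 0" using y by (simp_all add: s_def t_def q_def add_pos_nonneg)
  have "\<bar>of_int (n - k)\<bar> / y' \<le> (\<bar>of_int n\<bar> + \<bar>of_int k\<bar>) / (y / 4)"
    using y by (intro frac_le) auto
  also have "\<dots> = 4 * \<bar>of_int n\<bar> / y + 4 * \<bar>of_int k\<bar> / y" using y(1) by (simp add: field_simps)
  finally have "s \<le> 1 + (4 * \<bar>of_int n\<bar> / y + 4 * \<bar>of_int k\<bar> / y)" by (simp add: s_def)
  also have "\<dots> \<le> q * t"
  proof -
    have ring: "(4 + 4 * b) * (1 + a) = 4 + 4 * a + 4 * b + (4 * b) * a" for a b :: real by (simp add: algebra_simps)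
    have "q * t = 4 + 4 * \<bar>of_int n\<bar> / y + 4 * \<bar>of_int k\<bar> / y + (4 * \<bar>of_int k\<bar> / y) * (\<bar>of_int n\<bar> / y)"
      using ring[of "\<bar>of_int k\<bar> / y" "\<bar>of_int n\<bar> / y"] by (simp add: q_def t_def)
    moreover have "(4 * \<bar>of_int k\<bar> / y) * (\<bar>of_int n\<bar> / y) \<ge> 0" using y(1) by simp
    ultimately show ?thesis by linarith
  qed
  finally have "s ^ M \<le> (q * t) ^ M" using pos by (intro power_mono) auto
  then have st: "s ^ M \<le> q ^ M * t ^ M" by (simp only: power_mult_distrib)
  have up: "norm (rv (trans c (of_int (n - k) * wd c)) w) / s ^ M \<le> W c y' w"
    unfolding s_def by (rule W_upper[OF c y(2)])
  then have "norm (rv (trans c (of_int (n - k) * wd c)) w) \<le> W c y' w * s ^ M" using pos by (simp add: divide_le_eq)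
  also have "\<dots> \<le> W c y' w * (q ^ M * t ^ M)"
    using W_bounds(1)[OF c y(2), of w] st norm_ge_zero[of w] by (intro mult_left_mono) linarith+
  finally have "norm (rv (trans c (of_int n * wd c)) v) / t ^ M \<le> q ^ M * W c y' w"
    unfolding e using pos by (simp add: divide_le_eq mult_ac)
  then show "norm (rv (trans c (of_int n * wd c)) v) / (1 + \<bar>of_int n\<bar> / y) ^ M
      \<le> (4 + 4 * \<bar>of_int k\<bar> / y) ^ M * W c y' (rv (trans c (of_int k * wd c)) v)"
    unfolding q_def t_def w_def .
qed

text \<open>The pieces of a fundamental set: \<open>None\<close> for the compact part, \<open>Some c\<close> for the cusp sectors.\<close>

definition I :: "boundary_point option set" where "I = insert None (Some ` C)"

fun piece :: "boundary_point option \<Rightarrow> (real^2^2) set" where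
  "piece None = {g \<in> SL2. norm g \<le> R0}"
| "piece (Some c) = {g \<in> SL2. Y0 \<le> ht c g \<and> 0 \<le> xc c g \<and> xc c g \<le> wd c}"

fun wt :: "boundary_point option \<Rightarrow> real^2^2 \<Rightarrow> complex^'m \<Rightarrow> real" where
  "wt None g v = norm v"
| "wt (Some c) g v = W c (ht c g) v"

lemma I_cases: "i \<in> I \<Longrightarrow> (i = None \<Longrightarrow> P) \<Longrightarrow> (\<And>c. i = Some c \<Longrightarrow> c \<in> C \<Longrightarrow> P) \<Longrightarrow> P"
  by (auto simp: I_def)

lemma piece_SL2: "g \<in> piece i \<Longrightarrow> g \<in> SL2"
  by (cases i) auto

lemma piece_cover: assumes "g \<in> SL2" shows "\<exists>\<sigma>\<in>\<Gamma>. \<exists>i\<in>I. \<sigma> ** g \<in> piece i"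
proof -
  obtain \<sigma> where s: "\<sigma> \<in> \<Gamma>" "norm (\<sigma> ** g) \<le> R0 \<or>
       (\<exists>c\<in>C. Y0 \<le> ht c (\<sigma> ** g) \<and> 0 \<le> xc c (\<sigma> ** g) \<and> xc c (\<sigma> ** g) \<le> wd c)" using cov[OF assms] by blast
  have S: "\<sigma> ** g \<in> SL2" using sub[OF s(1)] assms by simp
  from s(2) show ?thesis
  proof
    assume "norm (\<sigma> ** g) \<le> R0"
    then have "\<sigma> ** g \<in> piece None" using S by simp
    moreover have "None \<in> I" by (simp add: I_def)
    ultimately show ?thesis using s(1) by blast
  next
    assume "\<exists>c\<in>C. Y0 \<le> ht c (\<sigma> ** g) \<and> 0 \<le> xc c (\<sigma> ** g) \<and> xc c (\<sigma> ** g) \<le> wd c"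
    then obtain c where c: "c \<in> C" "Y0 \<le> ht c (\<sigma> ** g) \<and> 0 \<le> xc c (\<sigma> ** g) \<and> xc c (\<sigma> ** g) \<le> wd c" by blast
    then have "\<sigma> ** g \<in> piece (Some c)" using S by simp
    moreover have "Some c \<in> I" using c(1) by (simp add: I_def)
    ultimately show ?thesis using s(1) by blast
  qed
qed

lemma wt_ge: assumes "i \<in> I" "g \<in> piece i" shows "norm v \<le> wt i g v"
  using assms(1)
proof (rule I_cases)
  fix c assume c: "i = Some c" "c \<in> C"
  have "ht c g > 0" using assms(2) Y0 c(1) by auto
  then show ?thesis using W_bounds(1)[OF c(2)] c(1) by simp
qed simp

lemma uniform_ht: "\<exists>H>0. \<forall>c\<in>C. \<forall>g\<in>SL2. \<forall>\<delta>\<in>\<Gamma>. ht c (\<delta> ** g) \<le> H * (norm g)\<^sup>2"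
proof -
  have "\<forall>c\<in>C. \<exists>H. H > 0 \<and> (\<forall>g\<in>SL2. \<forall>\<delta>\<in>\<Gamma>. ht c (\<delta> ** g) \<le> H * (norm g)\<^sup>2)"
    using ht_translate_bounded cusps by blast
  from bchoice[OF this] obtain H where H: "\<forall>c\<in>C. H c > 0 \<and> (\<forall>g\<in>SL2. \<forall>\<delta>\<in>\<Gamma>. ht c (\<delta> ** g) \<le> H c * (norm g)\<^sup>2)" by (rule exE)
  have "ht c (\<delta> ** g) \<le> (1 + (\<Sum>c\<in>C. H c)) * (norm g)\<^sup>2" if "c \<in> C" "g \<in> SL2" "\<delta> \<in> \<Gamma>" for c g \<delta>
  proof -
    have "H c \<le> (\<Sum>c\<in>C. H c)" by (rule member_le_sum[OF that(1)]) (use H finC in \<open>auto intro: less_imp_le\<close>)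
    then have "H c * (norm g)\<^sup>2 \<le> (1 + (\<Sum>c\<in>C. H c)) * (norm g)\<^sup>2" by (intro mult_right_mono) auto
    moreover have "ht c (\<delta> ** g) \<le> H c * (norm g)\<^sup>2" using H that by blast
    ultimately show ?thesis by linarith
  qed
  moreover have "(\<Sum>c\<in>C. H c) \<ge> 0" by (rule sum_nonneg) (use H in \<open>auto intro: less_imp_le\<close>)
  ultimately show ?thesis by (intro exI[of _ "1 + (\<Sum>c\<in>C. H c)"]) auto
qed

lemma low_piece_bounded: "\<exists>R\<ge>R0. \<forall>i\<in>I. \<forall>g\<in>piece i. (\<forall>c. i = Some c \<longrightarrow> ht c g \<le> H) \<longrightarrow> norm g \<le> R"
proof -
  define b where "b c = norm (cusp_matrix c) * sqrt (((wd c)\<^sup>2 + H\<^sup>2 + 1) / Y0)" for c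
  have b0: "b c \<ge> 0" for c unfolding b_def using Y0 by (intro mult_nonneg_nonneg real_sqrt_ge_zero divide_nonneg_pos) auto
  have "norm g \<le> R0 + (\<Sum>c\<in>C. b c)" if i: "i \<in> I" and g: "g \<in> piece i" "\<forall>c. i = Some c \<longrightarrow> ht c g \<le> H" for i g
    using i
  proof (rule I_cases)
    assume "i = None"
    then show ?thesis using g(1) sum_nonneg[of C b] b0 by auto
  next
    fix c assume c: "i = Some c" "c \<in> C"
    have "norm g \<le> b c" unfolding b_def
      by (rule bounded_of_ht) (use g c Y0 in auto)
    also have "\<dots> \<le> (\<Sum>c\<in>C. b c)" by (rule member_le_sum[OF c(2)]) (use b0 finC in auto)
    finally show ?thesis using R0 by linarith
  qed
  moreover have "(\<Sum>c\<in>C. b c) \<ge> 0" by (rule sum_nonneg) (rule b0)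
  ultimately show ?thesis by (intro exI[of _ "R0 + (\<Sum>c\<in>C. b c)"]) auto
qed

text \<open>An element taking a point of norm at most R1 into the fundamental set lands at bounded
  height, hence in a compact part, so only finitely many \<open>\<delta>\<close> occur. Their
  matrices and the inverses are bounded together, and at bounded height \<open>wt\<close> is
  comparable with the norm.\<close>

lemma low_comparison:
  "\<exists>K\<ge>1. \<forall>i\<in>I. \<forall>g\<in>SL2. \<forall>\<delta>\<in>\<Gamma>. norm g \<le> R1 \<longrightarrow> \<delta> ** g \<in> piece i \<longrightarrow>
     (\<forall>v. norm v \<le> K * wt i (\<delta> ** g) (rv \<delta> v) \<and> wt i (\<delta> ** g) (rv \<delta> v) \<le> K * norm v)"
proof -
  obtain H where H: "H > 0" "\<forall>c\<in>C. \<forall>g\<in>SL2. \<forall>\<delta>\<in>\<Gamma>. ht c (\<delta> ** g) \<le> H * (norm g)\<^sup>2" using uniform_ht by blast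
  define H1 where "H1 = H * R1\<^sup>2"
  obtain R2 where R2: "R2 \<ge> R0" "\<forall>i\<in>I. \<forall>g\<in>piece i. (\<forall>c. i = Some c \<longrightarrow> ht c g \<le> H1) \<longrightarrow> norm g \<le> R2"
    using low_piece_bounded by blast
  define S where "S = {\<delta> \<in> \<Gamma>. norm \<delta> \<le> R2 * R1}"
  have finS: "finite S" unfolding S_def by (rule fin)
  obtain B1 where B1: "B1 \<ge> 1" "\<forall>s\<in>S. \<forall>v. norm (\<rho> (psl s) *v v) \<le> B1 * norm v" using norm_bounded_matrices[OF finS, of "\<lambda>s. \<rho> (psl s)"] by blast
  obtain B2 where B2: "B2 \<ge> 1" "\<forall>s\<in>S. \<forall>v. norm (\<rho> (psl (adj2 s)) *v v) \<le> B2 * norm v" using norm_bounded_matrices[OF finS, of "\<lambda>s. \<rho> (psl (adj2 s))"] by blast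
  define P where "P = 1 + K0 * (1 + H1) ^ M"
  have H10: "H1 \<ge> 0" using H(1) by (simp add: H1_def)
  have P: "P \<ge> 1" using K0 H10 by (simp add: P_def)
  define K where "K = B2 + P * B1"
  have "P * B1 \<ge> 0" using B1(1) P by simp
  then have K1: "K \<ge> 1" using B2(1) by (simp add: K_def)
  have "norm v \<le> K * wt i (\<delta> ** g) (rv \<delta> v) \<and> wt i (\<delta> ** g) (rv \<delta> v) \<le> K * norm v"
    if i: "i \<in> I" and g: "g \<in> SL2" and d: "\<delta> \<in> \<Gamma>" and gR: "norm g \<le> R1" and p: "\<delta> ** g \<in> piece i" for i g \<delta> v
  proof -
    have htH: "ht c (\<delta> ** g) \<le> H1" if "c \<in> C" for c
    proof -
      have "ht c (\<delta> ** g) \<le> H * (norm g)\<^sup>2" using H(2) that g d by blast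
      also have "\<dots> \<le> H1" unfolding H1_def using H(1) gR by (intro mult_left_mono power_mono) auto
      finally show ?thesis .
    qed
    have "\<forall>c. i = Some c \<longrightarrow> ht c (\<delta> ** g) \<le> H1" using htH i by (auto simp: I_def)
    then have n2: "norm (\<delta> ** g) \<le> R2" using R2(2) i p by blast
    have "\<delta> = (\<delta> ** g) ** adj2 g" using g by (simp only: matrix_mul_assoc[symmetric] adj2_mult matrix_mul_rid)
    then have "norm \<delta> = norm ((\<delta> ** g) ** adj2 g)" by (rule arg_cong)
    also have "\<dots> \<le> norm (\<delta> ** g) * norm g" using norm_matrix_mult_le[of "\<delta> ** g" "adj2 g"] by simp
    also have "\<dots> \<le> R2 * R1" using n2 gR R2(1) R0 by (intro mult_mono) auto
    finally have dS: "\<delta> \<in> S" using d by (simp add: S_def)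
    have 1: "norm (rv \<delta> v) \<le> B1 * norm v" unfolding rv_def using B1(2) dS by blast
    have "norm (rv (adj2 \<delta>) (rv \<delta> v)) \<le> B2 * norm (rv \<delta> v)" unfolding rv_def[of "adj2 \<delta>"] using B2(2) dS by blast
    then have 2: "norm v \<le> B2 * norm (rv \<delta> v)" unfolding rv_inv(1)[OF d] .
    have 3: "norm (rv \<delta> v) \<le> wt i (\<delta> ** g) (rv \<delta> v)" by (rule wt_ge[OF i p])
    have 4: "wt i (\<delta> ** g) (rv \<delta> v) \<le> P * norm (rv \<delta> v)"
      using i
    proof (rule I_cases)
      assume "i = None"
      then show ?thesis using P mult_right_mono[OF P norm_ge_zero[of "rv \<delta> v"]] by simp
    next
      fix c assume c: "i = Some c" "c \<in> C"
      have pos: "ht c (\<delta> ** g) > 0" using p Y0 c(1) by auto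
      have "W c (ht c (\<delta> ** g)) (rv \<delta> v) \<le> K0 * (1 + ht c (\<delta> ** g)) ^ M * norm (rv \<delta> v)" by (rule W_bounds(2)[OF c(2) pos])
      also have "\<dots> \<le> K0 * (1 + H1) ^ M * norm (rv \<delta> v)"
        using K0 htH[OF c(2)] pos by (intro mult_right_mono mult_left_mono power_mono) auto
      also have "\<dots> \<le> P * norm (rv \<delta> v)" unfolding P_def by (intro mult_right_mono) auto
      finally show ?thesis using c(1) by simp
    qed
    have w0: "0 \<le> wt i (\<delta> ** g) (rv \<delta> v)" using 3 norm_ge_zero[of "rv \<delta> v"] by linarith
    have "norm v \<le> B2 * wt i (\<delta> ** g) (rv \<delta> v)" using 2 mult_left_mono[OF 3, of B2] B2(1) by linarith
    also have "\<dots> \<le> K * wt i (\<delta> ** g) (rv \<delta> v)"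
      by (rule mult_right_mono[OF _ w0]) (use P B1(1) in \<open>simp add: K_def\<close>)
    finally have a: "norm v \<le> K * wt i (\<delta> ** g) (rv \<delta> v)" .
    have "wt i (\<delta> ** g) (rv \<delta> v) \<le> P * (B1 * norm v)" using 4 mult_left_mono[OF 1, of P] P by linarith
    also have "\<dots> \<le> K * norm v" unfolding K_def mult.assoc[symmetric] by (rule mult_right_mono) (use B2(1) in auto)
    finally show ?thesis using a by blast
  qed
  then show ?thesis using K1 by blast
qed

end

section \<open>Comparison of adapted norms at nearby points\<close>

lemma conj_near:
  assumes "u \<in> SL2"
  shows "norm (adj2 u ** A ** u - mat 1) \<le> norm u * norm (A - mat 1) * norm u"
proof -
  have "adj2 u ** A ** u - mat 1 = adj2 u ** (A - mat 1) ** u"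
    by (simp add: matrix_mult_algebra adj2_mult[OF assms])
  then show ?thesis using norm_mult_le3[of "adj2 u" "A - mat 1" u] by simp
qed

lemma adj2_mult_left: assumes "A \<in> SL2" shows "adj2 (A ** g) ** (A ** h) = adj2 g ** h"
  by (simp only: adj2_mult_distrib matrix_mul_assoc[symmetric] adj2_mult_cancel assms)

lemma norm_up: assumes "y > 0" shows "(norm (up x y))\<^sup>2 = (x\<^sup>2 + y\<^sup>2 + 1) / y"
  using norm_pt[OF up_SL2[OF assms], of x] by (simp add: pt_up[OF assms])

lemma norm_up_step: assumes "y > 0" shows "norm (adj2 (up x (2 * y)) ** up x y) \<le> 2"
proof -
  have "(norm (adj2 (up x (2 * y)) ** up x y))\<^sup>2 = ((2 * y)\<^sup>2 + y\<^sup>2) / (2 * y * y)"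
    using norm_rel_pt[OF up_SL2[of "2 * y" x] up_SL2[OF assms, of x]] assms by (simp add: pt_up)
  also have "\<dots> = 5 / 2" using assms by (simp add: field_simps power2_eq_square)
  finally have "(norm (adj2 (up x (2 * y)) ** up x y))\<^sup>2 \<le> 2\<^sup>2" by simp
  then show ?thesis by (rule power2_le_imp_le) simp
qed

text \<open>The hypothesis says that 2 cosh of the hyperbolic distance is at most 4; it bounds the
  ratio of the heights and the horizontal displacement in units of the height.\<close>

lemma close_points:
  fixes y y' d :: real
  assumes "y > 0" "y' > 0" "(d\<^sup>2 + y\<^sup>2 + y'\<^sup>2) / (y * y') \<le> 4"
  shows "y \<le> 4 * y'" "y' \<le> 4 * y" "\<bar>d\<bar> \<le> 4 * y"
proof -
  have yy: "y * y' > 0" using assms by simp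
  have e: "d\<^sup>2 + y\<^sup>2 + y'\<^sup>2 \<le> 4 * (y * y')" using assms(3) yy by (simp add: divide_le_eq)
  have "y * y \<le> (4 * y') * y" using e zero_le_power2[of d] zero_le_power2[of y'] by (simp only: power2_eq_square mult_ac)
  then show "y \<le> 4 * y'" using assms(1) by (rule mult_right_le_imp_le)
  have "y' * y' \<le> (4 * y) * y'" using e zero_le_power2[of d] zero_le_power2[of y] by (simp only: power2_eq_square mult_ac)
  then show 2: "y' \<le> 4 * y" using assms(2) by (rule mult_right_le_imp_le)
  have "y * y' \<le> y * (4 * y)" using 2 assms(1) by (intro mult_left_mono) auto
  then have "4 * (y * y') \<le> 16 * (y * y)" by simp
  moreover have "y * y \<ge> 0" "y' * y' \<ge> 0" by simp_all
  ultimately have "d * d \<le> 16 * (y * y)" using e unfolding power2_eq_square by linarith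
  then have "d\<^sup>2 \<le> (4 * y)\<^sup>2" by (simp add: power2_eq_square)
  then have "\<bar>d\<bar>\<^sup>2 \<le> (4 * y)\<^sup>2" by simp
  then show "\<bar>d\<bar> \<le> 4 * y" by (rule power2_le_imp_le) (use assms(1) in simp)
qed

context fuchsian_first begin

text \<open>Two points high in cusp sectors and close to each other modulo \<open>\<Gamma>\<close> lie in equivalent
  sectors: both parabolic generators are near the identity there, hence commute.\<close>

lemma high_close_cusp_equiv:
  assumes "is_cusp G c" "is_cusp G c'" and g: "g \<in> SL2" "g' \<in> SL2" and d: "\<delta> \<in> \<Gamma>"
    and hi: "40 * cusp_width G c \<le> ht c g" "40 * cusp_width G c' \<le> ht c' g'"
    and cl: "norm (adj2 (\<delta> ** g) ** g') \<le> 2"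
  shows "(adj2 (cusp_matrix c') ** \<delta> ** cusp_matrix c) $ 2 $ 1 = 0"
proof -
  define h where "h = cusp_width G c"
  define h' where "h' = cusp_width G c'"
  have h: "h > 0" "trans c h \<in> \<Gamma>" using cusp_width_props(1)[OF assms(1)] trans_width[OF assms(1), of 1] by (simp_all add: h_def)
  have h': "h' > 0" "trans c' h' \<in> \<Gamma>" using cusp_width_props(1)[OF assms(2)] trans_width[OF assms(2), of 1] by (simp_all add: h'_def)
  have D: "\<delta> \<in> SL2" by (rule sub[OF d])
  define a where "a = adj2 (adj2 \<delta>) ** trans c h ** adj2 \<delta>"
  have a: "a \<in> \<Gamma>" unfolding a_def by (rule mult[OF mult[OF inv[OF inv[OF d]] h(2)] inv[OF d]])
  define u where "u = adj2 (\<delta> ** g) ** g'"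
  have u: "u \<in> SL2" unfolding u_def using D g by simp
  have g'u: "g' = (\<delta> ** g) ** u" unfolding u_def using D g by (simp only: adj2_mult_cancel SL2_mult)
  have e: "adj2 (\<delta> ** g) ** a ** (\<delta> ** g) = adj2 g ** trans c h ** g"
    unfolding a_def conj_mult[of \<delta> g]
    by (simp only: adj2_adj2 matrix_mul_assoc[symmetric] adj2_mult_cancel D adj2_mult matrix_mul_rid)
  have "adj2 g' ** a ** g' = adj2 u ** (adj2 g ** trans c h ** g) ** u"
    unfolding e[symmetric] by (subst g'u, subst g'u) (rule conj_mult)
  then have "norm (adj2 g' ** a ** g' - mat 1) \<le> norm u * norm (adj2 g ** trans c h ** g - mat 1) * norm u"
    using conj_near[OF u] by simp
  also have "\<dots> = (norm u)\<^sup>2 * (h / ht c g)"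
    unfolding norm_trans_conj(2)[OF g(1)] using h(1) by (simp add: power2_eq_square)
  \<comment> \<open>The origin of the factor 40 in the hypotheses: 4/40 is the constant 1/10 below
    which elements commute.\<close>
  also have "\<dots> \<le> 2\<^sup>2 * (1 / 40)"
    using cl hi(1) h(1) ht_pos[OF g(1), of c] by (intro mult_mono power_mono) (auto simp: u_def h_def divide_le_eq)
  finally have na: "norm (adj2 g' ** a ** g' - mat 1) \<le> 1/10" by simp
  have nb: "norm (adj2 g' ** trans c' h' ** g' - mat 1) \<le> 1/10"
    unfolding norm_trans_conj(2)[OF g(2)] using hi(2) h'(1) ht_pos[OF g(2), of c'] by (simp add: h'_def divide_le_eq)
  have com: "a ** trans c' h' = trans c' h' ** a" by (rule small_commute[OF a h'(2) g(2) na nb])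
  have ta: "tl2 a = \<delta> ** tl2 (trans c h) ** adj2 \<delta>" unfolding a_def using tl2_conj[of "adj2 \<delta>" "trans c h"] D by simp
  have "tl2 a \<noteq> 0" unfolding a_def using tl2_conj_eq_0[of "adj2 \<delta>" "trans c h"] D tl2_trans_nonzero h(1) by simp
  from commute_imp_parallel[OF com this] obtain q where q: "tl2 (trans c' h') = q *\<^sub>R tl2 a" by (rule exE)
  have q0: "q \<noteq> 0"
  proof
    assume "q = 0"
    then have "tl2 (trans c' h') = 0" using q by simp
    then show False using tl2_trans_nonzero h'(1) by simp
  qed
  define M where "M = adj2 (cusp_matrix c') ** \<delta> ** cusp_matrix c"
  have f1: "adj2 (cusp_matrix c') ** tl2 (trans c' h') ** cusp_matrix c' = mat2 0 h' 0 0"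
    unfolding tl2_trans by (simp only: matrix_mul_assoc[symmetric] adj2_mult_cancel adj2_mult cusp_matrix_SL2 matrix_mul_rid)
  have f2: "adj2 (cusp_matrix c') ** tl2 (trans c' h') ** cusp_matrix c' = q *\<^sub>R (M ** mat2 0 h 0 0 ** adj2 M)"
    unfolding q unfolding ta unfolding tl2_trans M_def by (simp only: matrix_mult_algebra adj2_mult_distrib adj2_adj2 matrix_mul_assoc)
  \<comment> \<open>The lower-left entry of \<open>M ** mat2 0 h 0 0 ** adj2 M\<close> is
    \<open>- h * (M$2$1)\<^sup>2\<close>, so parallel nilpotent parts force M to fix
    infinity.\<close>
  have "mat2 0 h' 0 0 = q *\<^sub>R (M ** mat2 0 h 0 0 ** adj2 M)" by (subst f1[symmetric]) (rule f2)
  then have "mat2 0 h' 0 0 $ 2 $ 1 = (q *\<^sub>R (M ** mat2 0 h 0 0 ** adj2 M)) $ 2 $ 1" by (rule arg_cong)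
  then have "q * (M $ 2 $ 1 * h * M $ 2 $ 1) = 0" by (simp add: matrix_mult_nth_2)
  then show ?thesis using q0 h(1) by (simp add: M_def)
qed

end

context cusp_system begin

text \<open>\<open>\<delta>\<close> is plus or minus a translation by n widths. Closeness forces
  \<open>|n| * wd c \<le> 4 * y + wd c\<close>; as y is at least Y0, the quotient |n| / y is bounded
  and \<open>W_change\<close> applies with a constant independent of the points.\<close>

lemma cusp_sector_comparison:
  assumes c: "c \<in> C" and g: "g \<in> piece (Some c)" "g' \<in> piece (Some c)" and d: "\<delta> \<in> \<Gamma>"
    and low: "(adj2 (cusp_matrix c) ** \<delta> ** cusp_matrix c) $ 2 $ 1 = 0"
    and cl: "norm (adj2 (\<delta> ** g) ** g') \<le> 2"
  shows "wt (Some c) g v \<le> (4 + 4 * (4 / wd c + 1 / Y0)) ^ M * wt (Some c) g' (rv \<delta> v)"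
proof -
  have G: "g \<in> SL2" "g' \<in> SL2" using g by auto
  obtain n :: int where n: "\<delta> = trans c (of_int n * wd c) \<or> \<delta> = - trans c (of_int n * wd c)"
    using cusp_stabilizer_form[OF cusps[OF c] d] low unfolding cusp_conj_def by blast
  define t where "t = trans c (of_int n * wd c)"
  have t: "t \<in> \<Gamma>" unfolding t_def by (rule trans_width[OF cusps[OF c]])
  have T: "t \<in> SL2" by (rule sub[OF t])
  have rt: "rv \<delta> v = rv t v" using n rv_uminus[of t v] by (auto simp: t_def)
  have "norm (adj2 (\<delta> ** g) ** g') = norm (adj2 (t ** g) ** g')"
    using n by (auto simp: t_def matrix_mult_algebra)
  with cl have cl': "norm (adj2 (t ** g) ** g') \<le> 2" by simp
  define A where "A = adj2 (cusp_matrix c)"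
  have A: "A \<in> SL2" by (simp add: A_def)
  define y where "y = ht c g"
  define y' where "y' = ht c g'"
  have yy: "y > 0" "y' > 0" unfolding y_def y'_def by (rule ht_pos[OF G(1)], rule ht_pos[OF G(2)])
  have s: "Im (pt (A ** (t ** g))) = y" "Re (pt (A ** (t ** g))) = xc c g + of_int n * wd c"
    "Im (pt (A ** g')) = y'" "Re (pt (A ** g')) = xc c g'"
    using ht_shift[OF G(1), of c "of_int n * wd c"] by (simp_all add: A_def y_def y'_def t_def ht_def xc_def)
  define d' where "d' = xc c g + of_int n * wd c - xc c g'"
  have "(norm (adj2 (t ** g) ** g'))\<^sup>2 = (d'\<^sup>2 + y\<^sup>2 + y'\<^sup>2) / (y * y')"
    using norm_rel_pt[of "A ** (t ** g)" "A ** g'"] A T G unfolding adj2_mult_left[OF A] s d'_def by simp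
  moreover have "(norm (adj2 (t ** g) ** g'))\<^sup>2 \<le> 2\<^sup>2" using cl' by (intro power_mono) auto
  ultimately have "(d'\<^sup>2 + y\<^sup>2 + y'\<^sup>2) / (y * y') \<le> 4" by simp
  note cp = close_points[OF yy this]
  have w: "wd c > 0" by (rule wd_pos[OF c])
  have x: "0 \<le> xc c g" "xc c g \<le> wd c" "0 \<le> xc c g'" "xc c g' \<le> wd c" using g by auto
  have "\<bar>of_int n\<bar> * wd c = \<bar>of_int n * wd c\<bar>" using w by (simp add: abs_mult)
  also have "\<dots> \<le> 4 * y + wd c" using cp(3) x unfolding d'_def by linarith
  finally have nb: "\<bar>of_int n\<bar> * wd c \<le> 4 * y + wd c" .
  have "\<bar>of_int n\<bar> / y \<le> 4 / wd c + 1 / y" using nb w yy(1) by (simp add: field_simps)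
  moreover have "1 / y \<le> 1 / Y0" using g(1) Y0 by (intro divide_left_mono) (auto simp: y_def)
  ultimately have b: "4 + 4 * \<bar>of_int n\<bar> / y \<le> 4 + 4 * (4 / wd c + 1 / Y0)" by simp
  have w0: "0 \<le> W c y' (rv t v)" using W_bounds(1)[OF c yy(2), of "rv t v"] norm_ge_zero[of "rv t v"] by linarith
  have "W c y v \<le> (4 + 4 * \<bar>of_int n\<bar> / y) ^ M * W c y' (rv t v)"
    unfolding t_def by (rule W_change[OF c yy cp(1)])
  also have "\<dots> \<le> (4 + 4 * (4 / wd c + 1 / Y0)) ^ M * W c y' (rv t v)"
    using b yy(1) w0 by (intro mult_right_mono power_mono) auto
  finally show ?thesis by (simp add: y_def y'_def rt)
qed

text \<open>If one of the two points is in the compact part, the other is, up to the group, in one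
  of twice the radius, and both weighted norms are compared with the fixed norm. If both are high,
  inequivalence of the chosen cusps puts them into the same sector.\<close>

lemma local_comparison:
  "\<exists>K\<ge>1. \<forall>i\<in>I. \<forall>i'\<in>I. \<forall>g\<in>piece i. \<forall>g'\<in>piece i'. \<forall>\<delta>\<in>\<Gamma>.
     norm (adj2 (\<delta> ** g) ** g') \<le> 2 \<longrightarrow> (\<forall>v. wt i g v \<le> K * wt i' g' (rv \<delta> v))"
proof -
  \<comment> \<open>Above this height every sector meets the threshold of 40 widths for equivalence
    of cusps; below it the pieces are bounded, by R1.\<close>
  define Y1 where "Y1 = 40 * (\<Sum>c\<in>C. wd c)"
  have wY: "40 * wd c \<le> Y1" if "c \<in> C" for c
    unfolding Y1_def using member_le_sum[OF that, of wd] finC wd_pos by (auto intro: less_imp_le)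
  obtain R1 where R1: "R1 \<ge> R0" "\<forall>i\<in>I. \<forall>g\<in>piece i. (\<forall>c. i = Some c \<longrightarrow> ht c g \<le> Y1) \<longrightarrow> norm g \<le> R1"
    using low_piece_bounded by blast
  have R1': "R1 > 0" using R0 R1(1) by linarith
  obtain K where K: "K \<ge> 1" and lc: "\<forall>i\<in>I. \<forall>g\<in>SL2. \<forall>\<delta>\<in>\<Gamma>. norm g \<le> 2 * R1 \<longrightarrow> \<delta> ** g \<in> piece i \<longrightarrow>
     (\<forall>v. norm v \<le> K * wt i (\<delta> ** g) (rv \<delta> v) \<and> wt i (\<delta> ** g) (rv \<delta> v) \<le> K * norm v)"
    using low_comparison[of "2 * R1"] by (elim exE conjE)
  define q where "q c = (4 + 4 * (4 / wd c + 1 / Y0)) ^ M" for c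
  have q0: "q c \<ge> 0" if "c \<in> C" for c unfolding q_def using wd_pos[OF that] Y0 by simp
  have qs: "(\<Sum>c\<in>C. q c) \<ge> 0" by (rule sum_nonneg) (rule q0)
  have KK: "K * K \<ge> 1" using K mult_mono[of 1 K 1 K] by simp
  define B where "B = K * K + (\<Sum>c\<in>C. q c)"
  have "wt i g v \<le> B * wt i' g' (rv \<delta> v)"
    if i: "i \<in> I" "i' \<in> I" and g: "g \<in> piece i" "g' \<in> piece i'" and d: "\<delta> \<in> \<Gamma>" and cl: "norm (adj2 (\<delta> ** g) ** g') \<le> 2"
    for i i' g g' \<delta> v
  proof -
    have G: "g \<in> SL2" "g' \<in> SL2" and D: "\<delta> \<in> SL2" using g piece_SL2 sub[OF d] by blast+
    define u where "u = adj2 (\<delta> ** g) ** g'"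
    have nw: "norm (rv \<delta> v) \<le> wt i' g' (rv \<delta> v)" by (rule wt_ge[OF i(2) g(2)])
    have w0: "0 \<le> wt i' g' (rv \<delta> v)" using nw norm_ge_zero[of "rv \<delta> v"] by linarith
    have KB: "K * K * wt i' g' (rv \<delta> v) \<le> B * wt i' g' (rv \<delta> v)"
      using w0 qs by (intro mult_right_mono) (auto simp: B_def)
    consider "norm g \<le> R1" | "norm g' \<le> R1" | "norm g > R1" "norm g' > R1" by linarith
    then show ?thesis
    proof cases
      case 1
      have "\<delta> ** g \<in> SL2" using D G by simp
      then have e: "adj2 \<delta> ** g' = g ** u"
        unfolding u_def adj2_mult_distrib using G by (simp only: matrix_mul_assoc[symmetric] adj2_mult_cancel)
      have "norm (g ** u) \<le> R1 * 2"
        using norm_matrix_mult_le[of g u] mult_mono[OF 1 cl] R1' unfolding u_def by simp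
      then have n: "norm (adj2 \<delta> ** g') \<le> 2 * R1" unfolding e by simp
      have gg: "adj2 \<delta> ** g' \<in> SL2" using D G by simp
      have "\<delta> ** (adj2 \<delta> ** g') \<in> piece i'" using g(2) D by (simp only: adj2_mult_cancel)
      then have "norm v \<le> K * wt i' (\<delta> ** (adj2 \<delta> ** g')) (rv \<delta> v)" using lc[rule_format, OF i(2) gg d n] by blast
      then have a: "norm v \<le> K * wt i' g' (rv \<delta> v)" using D by (simp only: adj2_mult_cancel)
      have "norm g \<le> 2 * R1" using 1 R1' by simp
      moreover have "mat 1 ** g \<in> piece i" using g(1) by simp
      ultimately have "wt i (mat 1 ** g) (rv (mat 1) v) \<le> K * norm v" using lc[rule_format, OF i(1) G(1) one] by blast
      then have "wt i g v \<le> K * norm v" by (simp add: rv_one)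
      also have "\<dots> \<le> K * (K * wt i' g' (rv \<delta> v))" using a K by (intro mult_left_mono) auto
      finally show ?thesis using KB by simp
    next
      case 2
      have dg: "\<delta> ** g \<in> SL2" using D G by simp
      have e: "\<delta> ** g = g' ** adj2 u"
        unfolding u_def adj2_mult_distrib adj2_adj2 using G(2) by (simp only: adj2_mult_cancel)
      have "norm (g' ** adj2 u) \<le> R1 * 2"
        using norm_matrix_mult_le[of g' "adj2 u"] mult_mono[OF 2 cl] R1' unfolding u_def[symmetric] by simp
      then have n: "norm (\<delta> ** g) \<le> 2 * R1" unfolding e by simp
      have "adj2 \<delta> ** (\<delta> ** g) \<in> piece i" using g(1) D by (simp only: adj2_mult_cancel)
      then have "wt i (adj2 \<delta> ** (\<delta> ** g)) (rv (adj2 \<delta>) (rv \<delta> v)) \<le> K * norm (rv \<delta> v)"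
        using lc[rule_format, OF i(1) dg inv[OF d] n] by blast
      then have "wt i g v \<le> K * norm (rv \<delta> v)" unfolding rv_inv(1)[OF d] using D by (simp only: adj2_mult_cancel)
      also have "\<dots> \<le> K * wt i' g' (rv \<delta> v)" using nw K by (intro mult_left_mono) auto
      also have "\<dots> \<le> K * K * wt i' g' (rv \<delta> v)" using K w0 by (intro mult_right_mono) auto
      finally show ?thesis using KB by simp
    next
      case 3
      have "\<exists>c. i = Some c \<and> ht c g > Y1" using R1(2) i(1) g(1) 3(1) by (meson not_le)
      then obtain c where c: "i = Some c" "ht c g > Y1" by (elim exE conjE)
      have "\<exists>c. i' = Some c \<and> ht c g' > Y1" using R1(2) i(2) g(2) 3(2) by (meson not_le)
      then obtain c' where c': "i' = Some c'" "ht c' g' > Y1" by (elim exE conjE)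
      have cC: "c \<in> C" "c' \<in> C" using i c(1) c'(1) by (auto simp: I_def)
      have low: "(adj2 (cusp_matrix c') ** \<delta> ** cusp_matrix c) $ 2 $ 1 = 0"
        by (rule high_close_cusp_equiv[OF cusps[OF cC(1)] cusps[OF cC(2)] G d _ _ cl])
           (use wY[OF cC(1)] wY[OF cC(2)] c(2) c'(2) in linarith)+
      then have "cusp_equiv \<Gamma> c c'" unfolding cusp_equiv_def using d by (intro bexI[of _ \<delta>])
      then have cc: "c' = c" using inequiv[OF cC] by simp
      have "wt i g v \<le> q c * wt i' g' (rv \<delta> v)"
        unfolding q_def c(1) c'(1) cc
        by (rule cusp_sector_comparison[OF cC(1)]) (use g c(1) c'(1) cc d cl low in auto)
      also have "\<dots> \<le> B * wt i' g' (rv \<delta> v)"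
      proof (rule mult_right_mono[OF _ w0])
        have "q c \<le> (\<Sum>c\<in>C. q c)" by (rule member_le_sum[OF cC(1)]) (use q0 finC in auto)
        then show "q c \<le> B" using KK by (simp add: B_def)
      qed
      finally show ?thesis .
    qed
  qed
  moreover have "B \<ge> 1" using KK qs by (simp add: B_def)
  ultimately show ?thesis by (intro exI[of _ B]) auto
qed

lemma strip_base_norm:
  assumes "\<bar>x\<bar> \<le> Rx" "0 < y" "y \<le> 1"
  shows "(norm (cusp_matrix c ** up x y))\<^sup>2 \<le> ((norm (cusp_matrix c))\<^sup>2 * (Rx\<^sup>2 + 2)) / y"
proof -
  have "(norm (up x y))\<^sup>2 \<le> (Rx\<^sup>2 + 2) / y"
  proof -
    have "\<bar>x\<bar>\<^sup>2 \<le> Rx\<^sup>2" using assms(1) by (rule power_mono) simp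
    moreover have "y\<^sup>2 \<le> 1\<^sup>2" using assms(3) by (rule power_mono) (use assms(2) in simp)
    ultimately have "x\<^sup>2 + y\<^sup>2 + 1 \<le> Rx\<^sup>2 + 2" by simp
    then show ?thesis unfolding norm_up[OF assms(2)] using assms(2) by (intro divide_right_mono) auto
  qed
  then have "(norm (cusp_matrix c))\<^sup>2 * (norm (up x y))\<^sup>2 \<le> (norm (cusp_matrix c))\<^sup>2 * ((Rx\<^sup>2 + 2) / y)"
    by (intro mult_left_mono) auto
  moreover have "(norm (cusp_matrix c ** up x y))\<^sup>2 \<le> (norm (cusp_matrix c) * norm (up x y))\<^sup>2"
    using norm_matrix_mult_le by (intro power_mono) auto
  ultimately show ?thesis by (simp add: power_mult_distrib)
qed

text \<open>Limits the height of the reduced point in terms of 1/y, which later turns powers of that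
  height into powers of 1/y.\<close>

lemma strip_height:
  "\<exists>H>0. \<forall>x y. \<forall>\<gamma>\<in>\<Gamma>. \<forall>c\<in>C. \<bar>x\<bar> \<le> Rx \<longrightarrow> 0 < y \<longrightarrow> y \<le> 1 \<longrightarrow> ht c (\<gamma> ** (cusp_matrix c0 ** up x y)) \<le> H / y"
proof -
  obtain H where H: "H > 0" "\<forall>c\<in>C. \<forall>g\<in>SL2. \<forall>\<delta>\<in>\<Gamma>. ht c (\<delta> ** g) \<le> H * (norm g)\<^sup>2" using uniform_ht by blast
  define B where "B = (norm (cusp_matrix c0))\<^sup>2 * (Rx\<^sup>2 + 2)"
  have B: "B \<ge> 0" unfolding B_def by simp
  have "ht c (\<gamma> ** (cusp_matrix c0 ** up x y)) \<le> (H * (B + 1)) / y"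
    if x: "\<bar>x\<bar> \<le> Rx" "0 < y" "y \<le> 1" and g: "\<gamma> \<in> \<Gamma>" and c: "c \<in> C" for x y \<gamma> c
  proof -
    have "ht c (\<gamma> ** (cusp_matrix c0 ** up x y)) \<le> H * (norm (cusp_matrix c0 ** up x y))\<^sup>2"
      using H(2) c g x(2) by simp
    also have "\<dots> \<le> H * ((B + 1) / y)"
    proof (rule mult_left_mono)
      have "(norm (cusp_matrix c0 ** up x y))\<^sup>2 \<le> B / y" unfolding B_def by (rule strip_base_norm[OF x])
      also have "\<dots> \<le> (B + 1) / y" using x(2) by (intro divide_right_mono) auto
      finally show "(norm (cusp_matrix c0 ** up x y))\<^sup>2 \<le> (B + 1) / y" .
    qed (use H in simp)
    finally show ?thesis by simp
  qed
  moreover have "H * (B + 1) > 0" using H(1) B by simp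
  ultimately show ?thesis by blast
qed

text \<open>Moving from height of order one down to height \<open>y\<close> takes \<open>log 2 (1/y)\<close> steps of bounded
  hyperbolic length, each of which costs a constant factor \<open>K = 2\<^sup>\<beta>\<close>.\<close>

lemma strip_comparison:
  "\<exists>\<beta>\<ge>0. \<forall>c0 Rx. \<exists>K\<ge>0. \<forall>x y \<gamma> i v. \<bar>x\<bar> \<le> Rx \<longrightarrow> 0 < y \<longrightarrow> y \<le> 1 \<longrightarrow> \<gamma> \<in> \<Gamma> \<longrightarrow> i \<in> I \<longrightarrow>
     \<gamma> ** (cusp_matrix c0 ** up x y) \<in> piece i \<longrightarrow>
     norm v \<le> K * y powr (- \<beta>) * wt i (\<gamma> ** (cusp_matrix c0 ** up x y)) (rv \<gamma> v)"
proof -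
  obtain K where K: "K \<ge> 1" and lc: "\<forall>i\<in>I. \<forall>i'\<in>I. \<forall>g\<in>piece i. \<forall>g'\<in>piece i'. \<forall>\<delta>\<in>\<Gamma>.
     norm (adj2 (\<delta> ** g) ** g') \<le> 2 \<longrightarrow> (\<forall>v. wt i g v \<le> K * wt i' g' (rv \<delta> v))"
    using local_comparison by (elim exE conjE)
  define \<beta> where "\<beta> = log 2 K"
  have b0: "\<beta> \<ge> 0" using K by (simp add: \<beta>_def)
  have bK: "2 powr \<beta> = K" using K by (simp add: \<beta>_def)
  have "\<exists>K1\<ge>0. \<forall>x y \<gamma> i v. \<bar>x\<bar> \<le> Rx \<longrightarrow> 0 < y \<longrightarrow> y \<le> 1 \<longrightarrow> \<gamma> \<in> \<Gamma> \<longrightarrow> i \<in> I \<longrightarrow>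
     \<gamma> ** (cusp_matrix c0 ** up x y) \<in> piece i \<longrightarrow>
     norm v \<le> K1 * y powr (- \<beta>) * wt i (\<gamma> ** (cusp_matrix c0 ** up x y)) (rv \<gamma> v)" for c0 Rx
  proof -
    define P where "P x y = cusp_matrix c0 ** up x y" for x y
    have P: "P x y \<in> SL2" if "y > 0" for x y using that by (simp add: P_def)
    define R1 where "R1 = sqrt ((norm (cusp_matrix c0))\<^sup>2 * (Rx\<^sup>2 + 2) * 2)"
    obtain K1 where K1: "K1 \<ge> 1" and lo: "\<forall>i\<in>I. \<forall>g\<in>SL2. \<forall>\<delta>\<in>\<Gamma>. norm g \<le> R1 \<longrightarrow> \<delta> ** g \<in> piece i \<longrightarrow>
     (\<forall>v. norm v \<le> K1 * wt i (\<delta> ** g) (rv \<delta> v) \<and> wt i (\<delta> ** g) (rv \<delta> v) \<le> K1 * norm v)"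
      using low_comparison[of R1] by (elim exE conjE)
    \<comment> \<open>Induction on the number j of doublings that bring y into [1/2, 1], where the
      comparison on compact sets starts the chain. The reducing group element may change at every
      step.\<close>
    have ind: "norm v \<le> K1 * K ^ j * wt i (\<gamma> ** P x y) (rv \<gamma> v)"
      if x: "\<bar>x\<bar> \<le> Rx" and "1/2 \<le> 2 ^ j * y" "2 ^ j * y \<le> 1" "\<gamma> \<in> \<Gamma>" "i \<in> I" "\<gamma> ** P x y \<in> piece i" for j x y \<gamma> i v
      using that(2-)
    proof (induction j arbitrary: y \<gamma> i)
      case 0
      have y: "0 < y" "1/2 \<le> y" "y \<le> 1" using 0 by simp_all
      have "(norm (P x y))\<^sup>2 \<le> ((norm (cusp_matrix c0))\<^sup>2 * (Rx\<^sup>2 + 2)) / y"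
        unfolding P_def by (rule strip_base_norm[OF x y(1,3)])
      also have "\<dots> \<le> ((norm (cusp_matrix c0))\<^sup>2 * (Rx\<^sup>2 + 2)) / (1/2)"
        using y by (intro divide_left_mono) auto
      finally have "norm (P x y) \<le> R1" unfolding R1_def by (intro real_le_rsqrt) simp
      then show ?case using lo[rule_format, OF 0(4) P[OF y(1)] 0(3) _ 0(5)] by simp
    next
      case (Suc j)
      have "(2::real) ^ Suc j * y > 0" using Suc.prems(1) by linarith
      then have y: "y > 0" by (simp add: zero_less_mult_iff)
      have y2: "1/2 \<le> 2 ^ j * (2 * y)" "2 ^ j * (2 * y) \<le> 1" using Suc.prems(1,2) by (simp_all add: mult_ac)
      obtain \<sigma> i2 where s: "\<sigma> \<in> \<Gamma>" "i2 \<in> I" "\<sigma> ** P x (2 * y) \<in> piece i2"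
        using piece_cover[OF P[of "2 * y" x]] y by auto
      have IH: "norm v \<le> K1 * K ^ j * wt i2 (\<sigma> ** P x (2 * y)) (rv \<sigma> v)" by (rule Suc.IH[OF y2 s])
      \<comment> \<open>Passes from the reduction by \<open>\<sigma>\<close> of the point at height
        2y to the reduction by \<open>\<gamma>\<close> of the point at height y, so that closeness
        modulo the group is that of the unreduced points.\<close>
      define \<delta> where "\<delta> = \<gamma> ** adj2 \<sigma>"
      have d: "\<delta> \<in> \<Gamma>" unfolding \<delta>_def by (rule mult[OF Suc.prems(3) inv[OF s(1)]])
      have S: "\<sigma> \<in> SL2" "\<gamma> \<in> SL2" using sub s(1) Suc.prems(3) by blast+
      have "\<delta> ** (\<sigma> ** P x (2 * y)) = \<gamma> ** P x (2 * y)"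
        unfolding \<delta>_def using S by (simp only: matrix_mul_assoc[symmetric] adj2_mult_cancel)
      then have "adj2 (\<delta> ** (\<sigma> ** P x (2 * y))) ** (\<gamma> ** P x y) = adj2 (up x (2 * y)) ** up x y"
        unfolding P_def using S by (simp only: adj2_mult_left cusp_matrix_SL2)
      then have cl: "norm (adj2 (\<delta> ** (\<sigma> ** P x (2 * y))) ** (\<gamma> ** P x y)) \<le> 2" using norm_up_step[OF y] by simp
      have rvd: "rv \<delta> (rv \<sigma> v) = rv \<gamma> v"
        unfolding \<delta>_def rv_mult[OF Suc.prems(3) inv[OF s(1)]] rv_inv(1)[OF s(1)] ..
      have "wt i2 (\<sigma> ** P x (2 * y)) (rv \<sigma> v) \<le> K * wt i (\<gamma> ** P x y) (rv \<delta> (rv \<sigma> v))"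
        using lc[rule_format, OF s(2) Suc.prems(4) s(3) Suc.prems(5) d cl] .
      then have "K1 * K ^ j * wt i2 (\<sigma> ** P x (2 * y)) (rv \<sigma> v) \<le> K1 * K ^ j * (K * wt i (\<gamma> ** P x y) (rv \<gamma> v))"
        unfolding rvd using K K1 by (intro mult_left_mono) auto
      with IH show ?case by (simp add: mult_ac)
    qed
    have "norm v \<le> K1 * y powr (- \<beta>) * wt i (\<gamma> ** (cusp_matrix c0 ** up x y)) (rv \<gamma> v)"
      if x: "\<bar>x\<bar> \<le> Rx" "0 < y" "y \<le> 1" and g: "\<gamma> \<in> \<Gamma>" and i: "i \<in> I" and p: "\<gamma> ** (cusp_matrix c0 ** up x y) \<in> piece i" for x y \<gamma> i v
    proof -
      obtain j :: nat where j: "1/2 \<le> 2 ^ j * y" "2 ^ j * y \<le> 1" using dyadic_scale[OF x(2,3)] by blast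
      have "norm v \<le> K1 * K ^ j * wt i (\<gamma> ** (cusp_matrix c0 ** up x y)) (rv \<gamma> v)"
        using ind[OF x(1) j g i] p unfolding P_def by simp
      also have "\<dots> \<le> K1 * y powr (- \<beta>) * wt i (\<gamma> ** (cusp_matrix c0 ** up x y)) (rv \<gamma> v)"
      proof (intro mult_right_mono mult_left_mono)
        have "K ^ j = (2 powr \<beta>) powr real j" unfolding bK using K by (simp add: powr_realpow)
        also have "\<dots> = (2 ^ j) powr \<beta>" by (simp add: powr_powr powr_realpow[symmetric] mult.commute)
        also have "\<dots> \<le> (1 / y) powr \<beta>" using j(2) x(2) b0 by (intro powr_mono2) (auto simp: le_divide_eq)
        also have "\<dots> = y powr (- \<beta>)" using x(2) by (simp add: powr_minus_divide powr_divide)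
        finally show "K ^ j \<le> y powr (- \<beta>)" .
        show "0 \<le> wt i (\<gamma> ** (cusp_matrix c0 ** up x y)) (rv \<gamma> v)"
          using wt_ge[OF i p, of "rv \<gamma> v"] norm_ge_zero[of "rv \<gamma> v"] by linarith
      qed (use K1 in simp)
      finally show ?thesis .
    qed
    then show ?thesis using K1 by (intro exI[of _ K1]) auto
  qed
  then show ?thesis using b0 by blast
qed

end

section \<open>Growth of automorphic forms\<close>

text \<open>Since Im (A \<tau>) = Im \<tau> / |c \<tau> + d|^2, moduli of automorphy factors become
  powers of quotients of heights.\<close>

lemma automorphy_powi_cmod:
  assumes "A \<in> SL2" "Im \<tau> > 0"
  shows "cmod (automorphy A \<tau> powi m) = (Im (mobius A \<tau>) / Im \<tau>) powr (- of_int m / 2)"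
proof -
  define a where "a = cmod (automorphy A \<tau>)"
  have a: "a > 0" using automorphy_nonzero[OF assms] by (simp add: a_def)
  have "Im (mobius A \<tau>) / Im \<tau> = 1 / a\<^sup>2" unfolding Im_mobius[OF assms] a_def using assms(2) by simp
  also have "\<dots> = a powr (- 2)" using powr_neg_numeral[OF a, of "num.Bit0 num.One"] by simp
  finally have "(Im (mobius A \<tau>) / Im \<tau>) powr (- of_int m / 2) = a powr of_int m" by (simp add: powr_powr)
  moreover have "cmod (automorphy A \<tau> powi m) = a powi m" by (simp add: norm_power_int a_def)
  moreover have "a powr of_int m = a powi m" using a by (intro powr_real_of_int') auto
  ultimately show ?thesis by simp
qed

lemma powr_exp_bounded:
  fixes e \<epsilon> Y :: real
  assumes "\<epsilon> > 0" "Y > 0"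
  shows "\<exists>B\<ge>0. \<forall>y\<ge>Y. y powr e * exp (- \<epsilon> * y) \<le> B"
proof (cases "e \<le> 0")
  case True
  have "y powr e * exp (- \<epsilon> * y) \<le> Y powr e * 1" if "y \<ge> Y" for y
    using that assms True by (intro mult_mono powr_mono2') auto
  then show ?thesis by (intro exI[of _ "Y powr e"]) auto
next
  case False
  then have e: "e > 0" by simp
  define \<delta> where "\<delta> = \<epsilon> / e"
  have d: "\<delta> > 0" "e * \<delta> = \<epsilon>" using e assms(1) by (simp_all add: \<delta>_def)
  have "y powr e * exp (- \<epsilon> * y) \<le> exp (- e * ln \<delta>)" if "y \<ge> Y" for y
  proof -
    have y: "y > 0" using that assms(2) by linarith
    have "ln (\<delta> * y) \<le> \<delta> * y - 1" using d(1) y by (intro ln_le_minus_one) simp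
    then have "ln \<delta> + ln y \<le> \<delta> * y" using d(1) y by (simp add: ln_mult)
    then have "e * (ln \<delta> + ln y) \<le> e * (\<delta> * y)" using e by (intro mult_left_mono) auto
    then have "e * ln y + - \<epsilon> * y \<le> - e * ln \<delta>" using d(2) by (simp add: distrib_left mult.assoc[symmetric])
    then have "exp (e * ln y + - \<epsilon> * y) \<le> exp (- e * ln \<delta>)" by simp
    moreover have "y powr e * exp (- \<epsilon> * y) = exp (e * ln y + - \<epsilon> * y)" using y by (simp add: powr_def exp_add[symmetric])
    ultimately show ?thesis by simp
  qed
  then show ?thesis by (intro exI[of _ "exp (- e * ln \<delta>)"]) auto
qed

lemma strip_bound_mono:
  assumes "strip_bound s f" "s \<le> s'" shows "strip_bound s' f"
proof (rule strip_boundI)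
  fix R
  obtain B where B: "B \<ge> 0" "\<forall>\<tau>. \<bar>Re \<tau>\<bar> \<le> R \<longrightarrow> 0 < Im \<tau> \<longrightarrow> Im \<tau> \<le> 1 \<longrightarrow> norm (f \<tau>) \<le> B * Im \<tau> powr (- s)"
    using strip_boundD[OF assms(1), of R] by (elim exE conjE)
  have "norm (f \<tau>) \<le> B * Im \<tau> powr (- s')" if "\<bar>Re \<tau>\<bar> \<le> R" "0 < Im \<tau>" "Im \<tau> \<le> 1" for \<tau>
  proof -
    have "Im \<tau> powr (- s) \<le> Im \<tau> powr (- s')" using assms(2) that by (intro powr_mono') auto
    then have "B * Im \<tau> powr (- s) \<le> B * Im \<tau> powr (- s')" using B(1) by (rule mult_left_mono)
    then show ?thesis using B(2) that by (meson order_trans)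
  qed
  then show "\<exists>B\<ge>0. \<forall>\<tau>. \<bar>Re \<tau>\<bar> \<le> R \<longrightarrow> 0 < Im \<tau> \<longrightarrow> Im \<tau> \<le> 1 \<longrightarrow> norm (f \<tau>) \<le> B * Im \<tau> powr (- s')"
    using B(1) by blast
qed

lemma eigenvalue_exponent:
  assumes "cmod l = 1"
  shows "0 \<le> eigenvalue_exponent l" "l = exp (2 * of_real pi * \<i> * of_real (eigenvalue_exponent l))"
proof -
  define \<mu> where "\<mu> = Arg2pi l / (2 * pi)"
  have "l = exp (\<i> * of_real (Arg2pi l))" using Arg2pi_eq[of l] assms by simp
  also have "\<i> * of_real (Arg2pi l) = 2 * of_real pi * \<i> * of_real \<mu>" by (simp add: \<mu>_def)
  finally have l: "l = exp (2 * of_real pi * \<i> * of_real \<mu>)" .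
  have ex: "0 \<le> \<mu> \<and> \<mu> < 1 \<and> l = exp (2 * of_real pi * \<i> * of_real \<mu>)"
    using l Arg2pi[of l] by (auto simp: \<mu>_def divide_less_eq)
  have un: "\<nu> = \<mu>" if n: "0 \<le> \<nu> \<and> \<nu> < 1 \<and> l = exp (2 * of_real pi * \<i> * of_real \<nu>)" for \<nu>
  proof -
    have "\<bar>\<nu> - \<mu>\<bar> < 1" using n ex by linarith
    then have "2 * pi * \<bar>\<nu> - \<mu>\<bar> < 2 * pi * 1" by (intro mult_strict_left_mono) auto
    then have lt: "\<bar>2 * pi * \<nu> - 2 * pi * \<mu>\<bar> < 2 * pi" by (simp add: right_diff_distrib[symmetric] abs_mult)
    have ln: "exp (2 * of_real pi * \<i> * of_real \<nu>) = l" using n by (elim conjE) (rule sym)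
    have "exp (2 * of_real pi * \<i> * of_real \<nu>) = exp (2 * of_real pi * \<i> * of_real \<mu>)" unfolding ln by (rule l)
    then have "2 * of_real pi * \<i> * of_real \<nu> = 2 * of_real pi * \<i> * of_real \<mu>"
      by (rule exp_complex_eqI[rotated]) (use lt in simp)
    then show ?thesis by simp
  qed
  have "0 \<le> eigenvalue_exponent l \<and> eigenvalue_exponent l < 1 \<and> l = exp (2 * of_real pi * \<i> * of_real (eigenvalue_exponent l))"
    unfolding eigenvalue_exponent_def by (rule theI[of "\<lambda>\<nu>. 0 \<le> \<nu> \<and> \<nu> < 1 \<and> l = exp (2 * of_real pi * \<i> * of_real \<nu>)" \<mu>]) (rule ex, rule un)
  then show "0 \<le> eigenvalue_exponent l" "l = exp (2 * of_real pi * \<i> * of_real (eigenvalue_exponent l))" by blast+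
qed

lemma bounded_linear_smult_vec: "bounded_linear (\<lambda>v::complex^'m. c *s v)"
proof -
  have "linear (\<lambda>v::complex^'m. c *s v)"
    by (intro linearI) (simp_all add: vec_eq_iff algebra_simps)
  then show ?thesis by (simp add: linear_conv_bounded_linear)
qed

lemma smult_vec_assoc: "a *s (b *s v) = (a * b) *s v" for v :: "complex^'m"
  by (simp add: vec_eq_iff)

lemma q_series_shift:
  fixes a :: "nat \<Rightarrow> complex^'m"
  assumes h: "h > 0" and sm: "summable (\<lambda>n. q_power h (real n + \<mu>) \<tau> *s a n)"
  shows "q_series h \<mu> a (\<tau> + of_real h) = exp (2 * of_real pi * \<i> * of_real \<mu>) *s q_series h \<mu> a \<tau>"
proof -
  have "exp (2 * of_real pi * \<i> * of_real (real n + \<mu>)) = exp (2 * of_real pi * \<i> * of_real \<mu>)" for n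
  proof -
    have "exp (2 * of_real pi * \<i> * of_real (real n + \<mu>)) = exp (2 * of_real pi * \<i> * of_real (real n)) * exp (2 * of_real pi * \<i> * of_real \<mu>)"
      by (simp add: distrib_left exp_add)
    also have "2 * of_real pi * \<i> * of_real (real n) = complex_of_real (2 * real n * pi) * \<i>" by simp
    also have "exp (complex_of_real (2 * real n * pi) * \<i>) = 1" by (rule exp_integer_2pi) simp
    finally show ?thesis by simp
  qed
  then have "(\<lambda>n. q_power h (real n + \<mu>) (\<tau> + of_real h) *s a n) = (\<lambda>n. exp (2 * of_real pi * \<i> * of_real \<mu>) *s (q_power h (real n + \<mu>) \<tau> *s a n))"
    by (simp add: q_power_shift[OF h] smult_vec_assoc)
  then show ?thesis unfolding q_series_def using bounded_linear.suminf[OF bounded_linear_smult_vec sm] by simp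
qed

text \<open>Summability at height Y/2 bounds the terms there by B; from height Y upwards the n-th
  term gains at least the factor exp(-pi Y / h)^n, so a geometric series dominates.\<close>

lemma q_series_bounded:
  fixes a :: "nat \<Rightarrow> complex^'m"
  assumes h: "h > 0" and \<mu>: "\<mu> \<ge> 0" and Y: "Y > 0"
    and sm: "summable (\<lambda>n. q_power h (real n + \<mu>) (Complex 0 (Y/2)) *s a n)"
  shows "\<exists>B\<ge>0. \<forall>\<tau>. Y \<le> Im \<tau> \<longrightarrow> norm (q_series h \<mu> a \<tau>) \<le> B"
proof -
  have "Bseq (\<lambda>n. q_power h (real n + \<mu>) (Complex 0 (Y/2)) *s a n)"
    by (rule convergent_imp_Bseq) (use summable_LIMSEQ_zero[OF sm] in \<open>auto simp: convergent_def\<close>)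
  then obtain B where B: "B > 0" "\<forall>n. norm (q_power h (real n + \<mu>) (Complex 0 (Y/2)) *s a n) \<le> B" by (rule BseqE)
  define r where "r = exp (- (pi * Y / h))"
  have r: "0 \<le> r" "r < 1" using h Y by (simp_all add: r_def)
  have sr: "summable (\<lambda>n. B * r ^ n)" using r by (intro summable_mult summable_geometric) simp
  have "norm (q_series h \<mu> a \<tau>) \<le> (\<Sum>n. B * r ^ n)" if t: "Y \<le> Im \<tau>" for \<tau>
    unfolding q_series_def
  proof (rule norm_suminf_le[OF _ sr])
    fix n
    have "(real n + \<mu>) * (Y / 2) + real n * (Y / 2) \<le> (real n + \<mu>) * Im \<tau>"
    proof -
      have "(real n + \<mu>) * Y \<le> (real n + \<mu>) * Im \<tau>" using t \<mu> by (intro mult_left_mono) auto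
      moreover have "\<mu> * Y \<ge> 0" using \<mu> Y by simp
      moreover have "(real n + \<mu>) * (Y / 2) + real n * (Y / 2) = real n * Y + \<mu> * Y / 2" by (simp add: field_simps)
      moreover have "(real n + \<mu>) * Y = real n * Y + \<mu> * Y" by (simp add: distrib_right)
      ultimately show ?thesis by linarith
    qed
    then have I: "(2 * pi / h) * ((real n + \<mu>) * (Y / 2) + real n * (Y / 2)) \<le> (2 * pi / h) * ((real n + \<mu>) * Im \<tau>)"
      using h by (intro mult_left_mono) auto
    have e1: "2 * pi * x * y / h = (2 * pi / h) * (x * y)" for x y by simp
    have e2: "real n * (- (pi * Y / h)) = - ((2 * pi / h) * (real n * (Y / 2)))" by simp
    have "- (2 * pi * (real n + \<mu>) * Im \<tau> / h) \<le> - (2 * pi * (real n + \<mu>) * (Y / 2) / h) + real n * (- (pi * Y / h))"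
      unfolding e1 e2 using I unfolding distrib_left[of "2 * pi / h"] by linarith
    then have "exp (- (2 * pi * (real n + \<mu>) * Im \<tau> / h)) \<le> exp (- (2 * pi * (real n + \<mu>) * (Y / 2) / h) + real n * (- (pi * Y / h)))"
      by (simp only: exp_le_cancel_iff)
    also have "\<dots> = exp (- (2 * pi * (real n + \<mu>) * (Y / 2) / h)) * r ^ n"
      unfolding r_def exp_add exp_of_nat_mult ..
    finally have "exp (- (2 * pi * (real n + \<mu>) * Im \<tau> / h)) * norm (a n) \<le> exp (- (2 * pi * (real n + \<mu>) * (Y / 2) / h)) * r ^ n * norm (a n)"
      by (rule mult_right_mono) simp
    then have "norm (q_power h (real n + \<mu>) \<tau> *s a n) \<le> norm (q_power h (real n + \<mu>) (Complex 0 (Y/2)) *s a n) * r ^ n"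
      by (simp add: norm_smult_vec q_power_cmod[OF h] mult_ac)
    also have "\<dots> \<le> B * r ^ n" using B(2) r(1) by (intro mult_right_mono) auto
    finally show "norm (q_power h (real n + \<mu>) \<tau> *s a n) \<le> B * r ^ n" .
  qed
  moreover have "(\<Sum>n. B * r ^ n) \<ge> 0" by (rule suminf_nonneg[OF sr]) (use B(1) r(1) in simp)
  ultimately show ?thesis by blast
qed

text \<open>Decay is given only above some height Y'; between Y and Y' boundedness supplies it after
  enlarging the constant.\<close>

lemma exponential_decay_uniform:
  fixes f :: "complex \<Rightarrow> complex^'m"
  assumes "exponential_decay f" "B \<ge> 0" "\<forall>\<tau>. Y \<le> Im \<tau> \<longrightarrow> norm (f \<tau>) \<le> B"
  shows "\<exists>\<epsilon>>0. \<exists>K\<ge>0. \<forall>\<tau>. Y \<le> Im \<tau> \<longrightarrow> norm (f \<tau>) \<le> K * exp (- \<epsilon> * Im \<tau>)"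
proof -
  obtain \<epsilon> K Y' where e: "\<epsilon> > 0" "\<forall>\<tau>. Im \<tau> > Y' \<longrightarrow> norm (f \<tau>) \<le> K * exp (- \<epsilon> * Im \<tau>)"
    using assms(1) unfolding exponential_decay_def by (elim exE conjE)
  have "norm (f \<tau>) \<le> (\<bar>K\<bar> + B * exp (\<epsilon> * Y')) * exp (- \<epsilon> * Im \<tau>)" if t: "Y \<le> Im \<tau>" for \<tau>
  proof (cases "Im \<tau> > Y'")
    case True
    then have "norm (f \<tau>) \<le> K * exp (- \<epsilon> * Im \<tau>)" using e(2) by blast
    also have "\<dots> \<le> (\<bar>K\<bar> + B * exp (\<epsilon> * Y')) * exp (- \<epsilon> * Im \<tau>)"
      using assms(2) by (intro mult_right_mono add_increasing2) auto
    finally show ?thesis .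
  next
    case False
    then have "\<epsilon> * Im \<tau> \<le> \<epsilon> * Y'" using e(1) by simp
    then have "1 \<le> exp (\<epsilon> * Y' + - \<epsilon> * Im \<tau>)" by simp
    then have "B * 1 \<le> B * (exp (\<epsilon> * Y') * exp (- \<epsilon> * Im \<tau>))" unfolding exp_add[symmetric] using assms(2) by (intro mult_left_mono) auto
    moreover have "norm (f \<tau>) \<le> B" using assms(3) t by blast
    moreover have "0 \<le> \<bar>K\<bar> * exp (- \<epsilon> * Im \<tau>)" by simp
    moreover have "(\<bar>K\<bar> + B * exp (\<epsilon> * Y')) * exp (- \<epsilon> * Im \<tau>) = \<bar>K\<bar> * exp (- \<epsilon> * Im \<tau>) + B * (exp (\<epsilon> * Y') * exp (- \<epsilon> * Im \<tau>))"
      by (simp only: distrib_right mult.assoc)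
    ultimately show ?thesis by linarith
  qed
  moreover have "\<bar>K\<bar> + B * exp (\<epsilon> * Y') \<ge> 0" using assms(2) by simp
  ultimately show ?thesis using e(1) by blast
qed

section \<open>From a strip bound to the Fourier coefficients\<close>

context fuchsian_rep begin

lemma rv_smult: "rv A (c *s v) = c *s rv A v"
  unfolding rv_def by (rule vector_scalar_commute)

lemma slash_rv:
  assumes "weakly_automorphic G \<rho> k X" "\<gamma> \<in> \<Gamma>" "Im \<tau> > 0"
  shows "rv \<gamma> (X \<tau>) = automorphy \<gamma> \<tau> powi (- k) *s X (mobius \<gamma> \<tau>)"
proof -
  have "\<gamma> \<in> psl \<gamma>" by (simp add: psl_eq)
  then have "slash k \<gamma> X \<tau> = \<rho> (psl \<gamma>) *v X \<tau>"
    using assms psl_in_G[OF assms(2)] unfolding weakly_automorphic_def by auto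
  then show ?thesis by (simp add: slash_def rv_def)
qed

lemma cusp_generator_eq: "cusp_generator G c = psl (trans c (cusp_width G c))"
  by (simp add: cusp_generator_def cusp_translation_eq)

lemma cusp_eigenvalue:
  assumes "is_cusp G c" "eigenvalue (\<rho> (cusp_generator G c)) l" shows "cmod l = 1"
proof -
  have t: "trans c (cusp_width G c) \<in> \<Gamma>" using trans_width[OF assms(1), of 1] by simp
  have "cusp_width G c \<noteq> 0" using cusp_width_props(1)[OF assms(1)] by simp
  from unitary[OF psl_in_G[OF t] trans_parabolic(2)[OF t this]] show ?thesis
    using assms(2) by (simp add: cusp_generator_eq)
qed

text \<open>A shift by h multiplies each q-series by its eigenvalue l, because exp(2 pi i \<mu>(l))
  = l. So the separation of logarithms applies to the expansion, and Cauchy's estimate to each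
  q-series in it.\<close>

lemma fourier_coefficient_bound:
  assumes c: "is_cusp G c" and sb: "strip_bound s (slash k (cusp_matrix c) X)"
    and fe: "fourier_expansion G \<rho> k c X a"
    and l: "eigenvalue (\<rho> (cusp_generator G c)) l" "j < eigenvalue_multiplicity (\<rho> (cusp_generator G c)) l"
  shows "\<exists>B\<ge>0. \<forall>n y. 0 < y \<longrightarrow> y \<le> 1 \<longrightarrow>
     norm (a l j n) \<le> B * y powr (- s) * exp (2 * pi * (real n + eigenvalue_exponent l) * y / cusp_width G c)"
proof -
  define h where "h = cusp_width G c"
  define T where "T = \<rho> (cusp_generator G c)"
  define \<Lambda> where "\<Lambda> = {l. eigenvalue T l}"
  define m where "m = eigenvalue_multiplicity T"
  define f where "f l j = q_series h (eigenvalue_exponent l) (a l j)" for l j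
  have h: "h > 0" unfolding h_def by (rule cusp_width_props(1)[OF c])
  have sm: "summable (\<lambda>n. q_power h (real n + eigenvalue_exponent l) \<tau> *s a l j n)"
    if "l \<in> \<Lambda>" "j < m l" "Im \<tau> > 0" for l j \<tau>
    using fe that unfolding fourier_expansion_def Let_def h_def[symmetric] T_def[symmetric] \<Lambda>_def m_def by auto
  have ex: "slash k (cusp_matrix c) X \<tau> = (\<Sum>l\<in>\<Lambda>. \<Sum>j<m l. log_q h \<tau> ^ j *s f l j \<tau>)" if "Im \<tau> > 0" for \<tau>
    using fe that unfolding fourier_expansion_def Let_def h_def[symmetric] T_def[symmetric] \<Lambda>_def m_def f_def by auto
  have ev: "cmod l = 1" if "l \<in> \<Lambda>" for l using cusp_eigenvalue[OF c] that by (simp add: \<Lambda>_def T_def)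
  have sh: "f l j (\<tau> + of_real h) = l *s f l j \<tau>" if "l \<in> \<Lambda>" "j < m l" "Im \<tau> > 0" for l j \<tau>
    unfolding f_def q_series_shift[OF h sm[OF that]] by (simp only: eigenvalue_exponent(2)[OF ev[OF that(1)], symmetric])
  have nz: "l \<noteq> 0" if "l \<in> \<Lambda>" for l using ev[OF that] by auto
  have "strip_bound s (\<lambda>\<tau>. \<Sum>l\<in>\<Lambda>. \<Sum>j<m l. log_q h \<tau> ^ j *s f l j \<tau>)"
    by (rule strip_bound_cong[OF _ sb]) (rule ex)
  then have sf: "strip_bound s (f l j)"
  proof (rule log_separation[where m = m and f = f and \<Lambda> = \<Lambda> and h = h and s = s, rotated 4])
    show "finite \<Lambda>" unfolding \<Lambda>_def by (rule finite_eigenvalues)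
    show "l \<in> \<Lambda>" "j < m l" using l by (simp_all add: \<Lambda>_def m_def T_def)
  qed (fact h, erule nz, erule (2) sh)
  have "summable (\<lambda>n. q_power h (real n + eigenvalue_exponent l) \<tau> *s a l j n)" if "Im \<tau> > 0" for \<tau>
    using sm[of l j \<tau>] l that by (simp add: \<Lambda>_def m_def T_def)
  then show ?thesis unfolding h_def[symmetric] by (rule q_series_coefficient_bound[OF h _ sf[unfolded f_def]])
qed

text \<open>The series is recovered by inverting the factor P diag(q^\<mu>) P^(-1); the inverse is
  bounded for 0 < Im \<tau> \<le> 1, so the strip bound passes to the series, to which Cauchy's
  estimate applies with exponent shift 0.\<close>

lemma admissible_coefficient_bound:
  assumes c: "is_cusp G c" and sb: "strip_bound s (slash k (cusp_matrix c) X)"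
    and fe: "admissible_fourier_expansion G \<rho> k c X P l D"
  shows "(\<lambda>n. norm (D n)) \<in> O(\<lambda>n. real n powr s)"
proof -
  define h where "h = cusp_width G c"
  define \<mu> where "\<mu> i = eigenvalue_exponent (l i)" for i
  have h: "h > 0" unfolding h_def by (rule cusp_width_props(1)[OF c])
  have sm: "summable (\<lambda>n. q_power h (real n + 0) \<tau> *s D n)" if "Im \<tau> > 0" for \<tau>
    using fe that unfolding admissible_fourier_expansion_def Let_def h_def[symmetric] by auto
  have ex: "slash k (cusp_matrix c) X \<tau> = (P ** diag_matrix (\<lambda>i. q_power h (\<mu> i) \<tau>) ** matrix_inv P) *v q_series h 0 D \<tau>" if "Im \<tau> > 0" for \<tau>
    using fe that unfolding admissible_fourier_expansion_def Let_def h_def[symmetric] \<mu>_def by auto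
  have inv: "invertible P" using fe unfolding admissible_fourier_expansion_def diagonalized_by_def by blast
  define Q where "Q = matrix_inv P"
  have "P ** Q = mat 1 \<and> Q ** P = mat 1"
    unfolding Q_def matrix_inv_def by (rule someI_ex) (use inv in \<open>simp add: invertible_def\<close>)
  then have PQ: "P ** Q = mat 1" "Q ** P = mat 1" by blast+
  define d where "d \<tau> = diag_matrix (\<lambda>i. q_power h (\<mu> i) \<tau>)" for \<tau>
  define e where "e \<tau> = diag_matrix (\<lambda>i. q_power h (- \<mu> i) \<tau>)" for \<tau>
  have diag: "diag_matrix u *v v = (\<chi> i. u i * v $ i)" for u :: "'m \<Rightarrow> complex" and v
    by (simp add: vec_eq_iff diag_matrix_def matrix_vector_mult_def if_distrib[of "\<lambda>x. x * _"] cong: if_cong)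
  have ed: "e \<tau> *v (d \<tau> *v v) = v" for \<tau> v
  proof -
    have "q_power h (- \<mu> i) \<tau> * q_power h (\<mu> i) \<tau> = 1" for i
      unfolding q_power_add[symmetric] by (simp add: q_power_def)
    then have "q_power h (- \<mu> i) \<tau> * (q_power h (\<mu> i) \<tau> * x) = x" for i x by (simp add: mult.assoc[symmetric])
    then show ?thesis unfolding d_def e_def diag by (simp add: vec_eq_iff)
  qed
  have sol: "q_series h 0 D \<tau> = P *v (e \<tau> *v (Q *v slash k (cusp_matrix c) X \<tau>))" if "Im \<tau> > 0" for \<tau>
  proof -
    have "slash k (cusp_matrix c) X \<tau> = P *v (d \<tau> *v (Q *v q_series h 0 D \<tau>))"
      unfolding ex[OF that] Q_def d_def by (simp only: matrix_vector_mul_assoc matrix_mul_assoc)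
    then have "P *v (e \<tau> *v (Q *v slash k (cusp_matrix c) X \<tau>)) = P *v (e \<tau> *v (Q *v (P *v (d \<tau> *v (Q *v q_series h 0 D \<tau>)))))" by simp
    also have "Q *v (P *v (d \<tau> *v (Q *v q_series h 0 D \<tau>))) = d \<tau> *v (Q *v q_series h 0 D \<tau>)"
      by (simp only: matrix_vector_mul_assoc[of Q P] PQ matrix_vector_mul_lid)
    also have "P *v (e \<tau> *v (d \<tau> *v (Q *v q_series h 0 D \<tau>))) = q_series h 0 D \<tau>"
      unfolding ed by (simp only: matrix_vector_mul_assoc PQ matrix_vector_mul_lid)
    finally show ?thesis ..
  qed
  obtain B1 where B1: "B1 \<ge> 1" "\<forall>s\<in>{()}. \<forall>v. norm (P *v v) \<le> B1 * norm v" using norm_bounded_matrices[of "{()}" "\<lambda>s. P"] by auto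
  obtain B2 where B2: "B2 \<ge> 1" "\<forall>s\<in>{()}. \<forall>v. norm (Q *v v) \<le> B2 * norm v" using norm_bounded_matrices[of "{()}" "\<lambda>s. Q"] by auto
  define E where "E = (\<Sum>i\<in>UNIV. exp (2 * pi * \<bar>\<mu> i\<bar> / h))"
  have E0: "E \<ge> 0" unfolding E_def by (rule sum_nonneg) simp
  have eb: "norm (e \<tau> *v v) \<le> E * norm v" if t: "0 < Im \<tau>" "Im \<tau> \<le> 1" for \<tau> v
  proof -
    have "norm (q_power h (- \<mu> i) \<tau> * v $ i) \<le> norm (E *\<^sub>R v $ i)" for i
    proof -
      have "\<mu> i * Im \<tau> \<le> \<bar>\<mu> i\<bar> * 1" using t by (intro mult_mono) auto
      then have "(2 * pi / h) * (\<mu> i * Im \<tau>) \<le> (2 * pi / h) * (\<bar>\<mu> i\<bar> * 1)" using h by (intro mult_left_mono) auto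
      then have "cmod (q_power h (- \<mu> i) \<tau>) \<le> exp (2 * pi * \<bar>\<mu> i\<bar> / h)"
        unfolding q_power_cmod[OF h] by (simp add: mult_ac)
      also have "\<dots> \<le> E" unfolding E_def by (rule member_le_sum) auto
      finally have "cmod (q_power h (- \<mu> i) \<tau>) * cmod (v $ i) \<le> E * cmod (v $ i)" by (rule mult_right_mono) simp
      then show ?thesis using E0 by (simp add: norm_mult)
    qed
    then have "norm (e \<tau> *v v) \<le> norm (E *\<^sub>R v)"
      unfolding e_def diag norm_vec_def by (intro L2_set_mono) auto
    then show ?thesis using E0 by simp
  qed
  have "strip_bound s (q_series h 0 D)"
  proof (rule strip_boundI)
    fix R
    obtain B where B: "B \<ge> 0" "\<forall>\<tau>. \<bar>Re \<tau>\<bar> \<le> R \<longrightarrow> 0 < Im \<tau> \<longrightarrow> Im \<tau> \<le> 1 \<longrightarrow> norm (slash k (cusp_matrix c) X \<tau>) \<le> B * Im \<tau> powr (- s)"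
      using strip_boundD[OF sb, of R] by (elim exE conjE)
    have "norm (q_series h 0 D \<tau>) \<le> (B1 * (E * (B2 * B))) * Im \<tau> powr (- s)" if t: "\<bar>Re \<tau>\<bar> \<le> R" "0 < Im \<tau>" "Im \<tau> \<le> 1" for \<tau>
    proof -
      define x where "x = slash k (cusp_matrix c) X \<tau>"
      have x: "norm x \<le> B * Im \<tau> powr (- s)" unfolding x_def using B(2) t by blast
      have "norm (q_series h 0 D \<tau>) \<le> B1 * norm (e \<tau> *v (Q *v x))" unfolding sol[OF t(2)] x_def using B1(2) by blast
      also have "\<dots> \<le> B1 * (E * norm (Q *v x))" using eb[OF t(2,3)] B1(1) by (intro mult_left_mono) auto
      also have "\<dots> \<le> B1 * (E * (B2 * norm x))" using B2(2) B1(1) E0 by (intro mult_left_mono) auto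
      also have "\<dots> \<le> B1 * (E * (B2 * (B * Im \<tau> powr (- s))))" using x B2(1) B1(1) E0 by (intro mult_left_mono) auto
      finally show ?thesis by (simp add: mult_ac)
    qed
    moreover have "B1 * (E * (B2 * B)) \<ge> 0" using B1(1) B2(1) B(1) E0 by simp
    ultimately show "\<exists>B\<ge>0. \<forall>\<tau>. \<bar>Re \<tau>\<bar> \<le> R \<longrightarrow> 0 < Im \<tau> \<longrightarrow> Im \<tau> \<le> 1 \<longrightarrow> norm (q_series h 0 D \<tau>) \<le> B * Im \<tau> powr (- s)"
      by blast
  qed
  then have "\<exists>B\<ge>0. \<forall>n y. 0 < y \<longrightarrow> y \<le> 1 \<longrightarrow> norm (D n) \<le> B * y powr (- s) * exp (2 * pi * (real n + 0) * y / h)"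
    by (rule q_series_coefficient_bound[OF h, rotated]) (rule sm)
  then obtain B where B: "B \<ge> 0" "\<forall>n y. 0 < y \<longrightarrow> y \<le> 1 \<longrightarrow> norm (D n) \<le> B * y powr (- s) * exp (2 * pi * (real n + 0) * y / h)"
    by (elim exE conjE)
  show ?thesis by (rule coefficient_bigo[where \<mu> = 0, OF h B(1)]) (rule B(2)[rule_format])
qed

lemma strip_bound_imp_bigo:
  assumes c: "is_cusp G c" and sb: "strip_bound s (slash k (cusp_matrix c) X)"
  shows "fourier_coefficients_bigo G \<rho> k c X s"
  unfolding fourier_coefficients_bigo_def Let_def
proof (intro conjI allI impI)
  fix a l j assume fe: "fourier_expansion G \<rho> k c X a"
    and l: "eigenvalue (\<rho> (cusp_generator G c)) l \<and> j < eigenvalue_multiplicity (\<rho> (cusp_generator G c)) l"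
  obtain B where B: "B \<ge> 0" "\<forall>n y. 0 < y \<longrightarrow> y \<le> 1 \<longrightarrow>
     norm (a l j n) \<le> B * y powr (- s) * exp (2 * pi * (real n + eigenvalue_exponent l) * y / cusp_width G c)"
    using fourier_coefficient_bound[OF c sb fe conjunct1[OF l] conjunct2[OF l]] by (elim exE conjE)
  show "(\<lambda>n. norm (a l j n)) \<in> O(\<lambda>n. real n powr s)"
    by (rule coefficient_bigo[OF cusp_width_props(1)[OF c] B(1)]) (rule B(2)[rule_format])
next
  fix P l D assume "admissible_fourier_expansion G \<rho> k c X P l D"
  then show "(\<lambda>n. norm (D n)) \<in> O(\<lambda>n. real n powr s)"
    by (rule admissible_coefficient_bound[OF c sb])
qed

lemma strip_bound_imp_zero:
  assumes c: "is_cusp G c" and sb: "strip_bound s (slash k (cusp_matrix c) X)" and s: "s < 0"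
    and fe: "fourier_expansion G \<rho> k c X a" and \<tau>: "Im \<tau> > 0"
  shows "X \<tau> = 0"
proof -
  define T where "T = \<rho> (cusp_generator G c)"
  have z: "a l j n = 0" if l: "eigenvalue T l" "j < eigenvalue_multiplicity T l" for l j n
  proof -
    obtain B where B: "B \<ge> 0" "\<forall>n y. 0 < y \<longrightarrow> y \<le> 1 \<longrightarrow>
       norm (a l j n) \<le> B * y powr (- s) * exp (2 * pi * (real n + eigenvalue_exponent l) * y / cusp_width G c)"
      using fourier_coefficient_bound[OF c sb fe l[unfolded T_def]] by (elim exE conjE)
    show ?thesis by (rule coefficient_zero[OF cusp_width_props(1)[OF c] B(1) s]) (rule B(2)[rule_format])
  qed
  have sl: "slash k (cusp_matrix c) X \<tau> = 0" if "Im \<tau> > 0" for \<tau>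
  proof -
    have "slash k (cusp_matrix c) X \<tau> = (\<Sum>l | eigenvalue T l. \<Sum>j<eigenvalue_multiplicity T l.
             log_q (cusp_width G c) \<tau> ^ j *s q_series (cusp_width G c) (eigenvalue_exponent l) (a l j) \<tau>)"
      using fe that unfolding fourier_expansion_def Let_def T_def by auto
    also have "\<dots> = 0"
    proof (intro sum.neutral ballI)
      fix l j assume "l \<in> {l. eigenvalue T l}" "j \<in> {..<eigenvalue_multiplicity T l}"
      then have "q_series (cusp_width G c) (eigenvalue_exponent l) (a l j) \<tau> = 0" unfolding q_series_def by (simp add: z)
      then show "log_q (cusp_width G c) \<tau> ^ j *s q_series (cusp_width G c) (eigenvalue_exponent l) (a l j) \<tau> = 0" by simp
    qed
    finally show ?thesis .
  qed
  define w where "w = mobius (adj2 (cusp_matrix c)) \<tau>"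
  have w: "Im w > 0" unfolding w_def by (rule Im_mobius_pos) (use \<tau> in simp_all)
  have "mobius (cusp_matrix c) w = \<tau>" unfolding w_def by (rule mobius_inverse(2)[OF cusp_matrix_SL2 \<tau>])
  then have "automorphy (cusp_matrix c) w powi (- k) *s X \<tau> = 0" using sl[OF w] by (simp add: slash_def)
  moreover have "automorphy (cusp_matrix c) w powi (- k) \<noteq> 0"
    using automorphy_nonzero[OF cusp_matrix_SL2[of c] w] by simp
  ultimately show ?thesis by (simp only: vector_mul_eq_0) blast
qed

end

section \<open>From the comparison of norms to a strip bound\<close>

context cusp_system begin

text \<open>The analogue of the Petersson norm y^(k/2) |X|: the power of the height absorbs the
  automorphy factor, so that moving by the group acts on the vector through \<open>rv\<close>
  alone.\<close>

definition weighted :: "int \<Rightarrow> (complex \<Rightarrow> complex^'m) \<Rightarrow> boundary_point option \<Rightarrow> real^2^2 \<Rightarrow> real" where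
  "weighted k X i g = Im (pt g) powr (of_int k / 2) * wt i g (X (pt g))"

lemma W_smult:
  assumes "c \<in> C" "y > 0" shows "W c y (a *s v) \<le> cmod a * W c y v"
proof (rule W_le)
  fix n :: int
  have "cmod a * (norm (rv (trans c (of_int n * wd c)) v) / (1 + \<bar>of_int n\<bar> / y) ^ M) \<le> cmod a * W c y v"
    by (intro mult_left_mono W_upper assms) simp
  then show "norm (rv (trans c (of_int n * wd c)) (a *s v)) / (1 + \<bar>of_int n\<bar> / y) ^ M \<le> cmod a * W c y v"
    by (simp add: rv_smult norm_smult_vec)
qed

lemma wt_smult: assumes "i \<in> I" "g \<in> piece i" shows "wt i g (a *s v) \<le> cmod a * wt i g v"
  using assms(1)
proof (rule I_cases)
  fix c assume c: "i = Some c" "c \<in> C"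
  have "ht c g > 0" using assms(2) Y0 c(1) by auto
  then show ?thesis using W_smult[OF c(2)] c(1) by simp
qed (simp add: norm_smult_vec)

lemma weighted_compact_bounded:
  assumes "weakly_automorphic G \<rho> k X"
  shows "\<exists>B. \<forall>g\<in>piece None. weighted k X None g \<le> B"
proof -
  \<comment> \<open>By \<open>norm_pt\<close> these are the points \<open>pt g\<close> with
    \<open>norm g \<le> R0\<close>; they form a compact subset of the upper half plane.\<close>
  define D where "D = {z. (Re z)\<^sup>2 + (Im z)\<^sup>2 + 1 \<le> R0\<^sup>2 * Im z}"
  have pos: "Im z > 0" if "z \<in> D" for z
  proof -
    have "0 < R0\<^sup>2 * Im z" using that zero_le_power2[of "Re z"] zero_le_power2[of "Im z"] unfolding D_def mem_Collect_eq by linarith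
    then show ?thesis using R0 by (simp add: zero_less_mult_iff)
  qed
  have "closed D" unfolding D_def by (intro closed_Collect_le continuous_intros)
  moreover have "bounded D"
  proof (rule boundedI)
    fix z assume z: "z \<in> D"
    have "(cmod z)\<^sup>2 \<le> R0\<^sup>2 * Im z" using z by (simp add: D_def cmod_power2)
    also have "\<dots> \<le> R0\<^sup>2 * cmod z" using abs_Im_le_cmod[of z] by (intro mult_left_mono) auto
    finally have "cmod z * cmod z \<le> R0\<^sup>2 * cmod z" by (simp add: power2_eq_square)
    moreover have "cmod z > 0" using pos[OF z] by auto
    ultimately show "norm z \<le> R0\<^sup>2" by (rule mult_right_le_imp_le)
  qed
  ultimately have "compact D" by (simp add: compact_eq_bounded_closed)
  have DH: "D \<subseteq> upper_half_plane" using pos by auto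
  have "continuous_on D (\<lambda>z. X z $ i)" for i
    using assms DH unfolding weakly_automorphic_def
    by (intro holomorphic_on_imp_continuous_on) (blast intro: holomorphic_on_subset)
  then have "continuous_on D (\<lambda>z. \<chi> i. X z $ i)" by (intro continuous_on_vec_lambda)
  then have cX: "continuous_on D X" by simp
  have "continuous_on D (\<lambda>z. Im z powr (of_int k / 2) * norm (X z))"
    using pos by (intro continuous_intros cX) (auto simp: less_le)
  then have "compact ((\<lambda>z. Im z powr (of_int k / 2) * norm (X z)) ` D)"
    using \<open>compact D\<close> by (rule compact_continuous_image)
  then have "bounded ((\<lambda>z. Im z powr (of_int k / 2) * norm (X z)) ` D)" by (rule compact_imp_bounded)
  then obtain B where B: "\<forall>x\<in>(\<lambda>z. Im z powr (of_int k / 2) * norm (X z)) ` D. norm x \<le> B" unfolding bounded_iff by (rule exE)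
  have "weighted k X None g \<le> B" if g: "g \<in> piece None" for g
  proof -
    have G: "g \<in> SL2" and n: "norm g \<le> R0" using g by auto
    have "((Re (pt g))\<^sup>2 + (Im (pt g))\<^sup>2 + 1) / Im (pt g) \<le> R0\<^sup>2"
      unfolding norm_pt[OF G, symmetric] using n by (intro power_mono) auto
    then have "pt g \<in> D" using Im_pt_pos[OF G] by (simp add: D_def divide_le_eq)
    then have "norm (Im (pt g) powr (of_int k / 2) * norm (X (pt g))) \<le> B" using B by blast
    then show ?thesis by (simp add: weighted_def)
  qed
  then show ?thesis by blast
qed

text \<open>In the coordinate of c the form X becomes its slash, and the automorphy factor trades
  the height of \<open>pt g\<close> for the height in the cusp.\<close>

lemma weighted_slash:
  assumes c: "c \<in> C" and g: "g \<in> piece (Some c)" and \<tau>: "\<tau> = pt (adj2 (cusp_matrix c) ** g)"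
  shows "Y0 \<le> Im \<tau>" "0 \<le> Re \<tau>" "Re \<tau> \<le> wd c" "Im \<tau> = ht c g"
    "weighted k X (Some c) g \<le> Im \<tau> powr (of_int k / 2) * (K0 * (1 + Im \<tau>) ^ M * norm (slash k (cusp_matrix c) X \<tau>))"
proof -
  have G: "g \<in> SL2" using g by auto
  define A where "A = cusp_matrix c"
  have A: "A \<in> SL2" by (simp add: A_def)
  show y: "Im \<tau> = ht c g" by (simp add: \<tau> ht_def)
  then show "Y0 \<le> Im \<tau>" using g by simp
  show "0 \<le> Re \<tau>" "Re \<tau> \<le> wd c" using g by (simp_all add: \<tau> xc_def)
  have pos: "Im \<tau> > 0" using y ht_pos[OF G] by simp
  have "pt g = pt (A ** (adj2 A ** g))" using A by (simp only: adj2_mult_cancel)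
  also have "\<dots> = mobius A \<tau>" unfolding \<tau> A_def[symmetric] using A G by (intro pt_mult) simp_all
  finally have p: "pt g = mobius A \<tau>" .
  define j where "j = automorphy A \<tau>"
  have j: "j \<noteq> 0" unfolding j_def by (rule automorphy_nonzero[OF A pos])
  have "X (pt g) = j powi k *s slash k A X \<tau>"
    unfolding p slash_def j_def[symmetric] smult_vec_assoc using j by (simp add: power_int_minus)
  then have "W c (Im \<tau>) (X (pt g)) \<le> cmod (j powi k) * W c (Im \<tau>) (slash k A X \<tau>)" using W_smult[OF c pos] by simp
  also have "\<dots> \<le> cmod (j powi k) * (K0 * (1 + Im \<tau>) ^ M * norm (slash k A X \<tau>))"
    by (intro mult_left_mono W_bounds(2)[OF c pos]) simp
  also have "cmod (j powi k) = (Im (pt g) / Im \<tau>) powr (- of_int k / 2)"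
    unfolding j_def p by (rule automorphy_powi_cmod[OF A pos])
  finally have w: "W c (Im \<tau>) (X (pt g)) \<le> (Im (pt g) / Im \<tau>) powr (- of_int k / 2) * (K0 * (1 + Im \<tau>) ^ M * norm (slash k A X \<tau>))" .
  have pg: "Im (pt g) > 0" by (rule Im_pt_pos[OF G])
  have e: "Im (pt g) powr (of_int k / 2) * (Im (pt g) / Im \<tau>) powr (- of_int k / 2) = Im \<tau> powr (of_int k / 2)"
    using pg pos by (simp add: powr_divide powr_minus_divide)
  have "weighted k X (Some c) g = Im (pt g) powr (of_int k / 2) * W c (Im \<tau>) (X (pt g))" by (simp add: weighted_def y)
  also have "\<dots> \<le> Im (pt g) powr (of_int k / 2) * ((Im (pt g) / Im \<tau>) powr (- of_int k / 2) * (K0 * (1 + Im \<tau>) ^ M * norm (slash k A X \<tau>)))"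
    by (rule mult_left_mono[OF w]) simp
  also have "\<dots> = Im \<tau> powr (of_int k / 2) * (K0 * (1 + Im \<tau>) ^ M * norm (slash k A X \<tau>))"
    unfolding mult.assoc[symmetric] e ..
  finally show "weighted k X (Some c) g \<le> Im \<tau> powr (of_int k / 2) * (K0 * (1 + Im \<tau>) ^ M * norm (slash k (cusp_matrix c) X \<tau>))"
    unfolding A_def .
qed

lemma log_q_bound:
  assumes c: "c \<in> C" and t: "Y0 \<le> Im \<tau>" "0 \<le> Re \<tau>" "Re \<tau> \<le> wd c" and j: "j \<le> L"
  shows "cmod (log_q (wd c) \<tau> ^ j) \<le> ((2 * pi * (1 / wd c + 1 / Y0) + 1 / Y0) * Im \<tau>) ^ L"
proof -
  \<comment> \<open>The last summand makes \<open>D * Im \<tau> \<ge> 1\<close>, so that the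
    exponent j may be raised to L.\<close>
  define D where "D = 2 * pi * (1 / wd c + 1 / Y0) + 1 / Y0"
  have w: "wd c > 0" by (rule wd_pos[OF c])
  have y: "Im \<tau> > 0" using t(1) Y0 by linarith
  have one: "1 \<le> Im \<tau> / Y0" using t(1) Y0 by simp
  have "cmod \<tau> \<le> wd c + Im \<tau>" using cmod_le[of \<tau>] t y by linarith
  then have "cmod \<tau> / wd c \<le> (wd c + Im \<tau>) / wd c" using w by (intro divide_right_mono) auto
  also have "\<dots> = 1 + Im \<tau> / wd c" using w by (simp add: add_divide_distrib)
  also have "\<dots> \<le> (1 / wd c + 1 / Y0) * Im \<tau>" using one by (simp add: distrib_right)
  finally have "2 * pi * (cmod \<tau> / wd c) \<le> 2 * pi * ((1 / wd c + 1 / Y0) * Im \<tau>)" by (intro mult_left_mono) auto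
  also have "\<dots> \<le> D * Im \<tau>" using one by (simp add: D_def distrib_right mult.assoc)
  finally have "cmod (log_q (wd c) \<tau>) \<le> D * Im \<tau>"
    using w unfolding log_q_def by (simp add: norm_mult norm_divide)
  then have "cmod (log_q (wd c) \<tau>) ^ j \<le> (D * Im \<tau>) ^ j" by (intro power_mono) auto
  also have "\<dots> \<le> (D * Im \<tau>) ^ L"
  proof (rule power_increasing[OF j])
    have "0 \<le> 2 * pi * (1 / wd c + 1 / Y0) * Im \<tau>" using w Y0 y by simp
    moreover have "D * Im \<tau> = 2 * pi * (1 / wd c + 1 / Y0) * Im \<tau> + Im \<tau> / Y0"
      unfolding D_def by (simp add: distrib_right[of _ "1 / Y0"])
    ultimately show "1 \<le> D * Im \<tau>" using one by linarith
  qed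
  finally show ?thesis by (simp add: norm_power D_def)
qed

text \<open>The exponent in the hypothesis on the q-series collects k/2 from the weight, M from the
  bound of \<open>W\<close> by the fixed norm, and L from the powers of the logarithm.\<close>

lemma weighted_cusp_bound:
  assumes c: "c \<in> C" and fe: "fourier_expansion G \<rho> k c X a"
    and L: "\<And>l. eigenvalue (\<rho> (cusp_generator G c)) l \<Longrightarrow> eigenvalue_multiplicity (\<rho> (cusp_generator G c)) l \<le> L"
    and q: "\<And>l j. eigenvalue (\<rho> (cusp_generator G c)) l \<Longrightarrow> j < eigenvalue_multiplicity (\<rho> (cusp_generator G c)) l \<Longrightarrow>
      \<exists>B\<ge>0. \<forall>\<tau>. Y0 \<le> Im \<tau> \<longrightarrow>
        Im \<tau> powr (of_int k / 2 + real (M + L)) * norm (q_series (wd c) (eigenvalue_exponent l) (a l j) \<tau>) \<le> B * Im \<tau> powr e"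
  shows "\<exists>B. \<forall>g\<in>piece (Some c). weighted k X (Some c) g \<le> B * ht c g powr e"
proof -
  define T where "T = \<rho> (cusp_generator G c)"
  define S where "S = Sigma {l. eigenvalue T l} (\<lambda>l. {..<eigenvalue_multiplicity T l})"
  have fS: "finite S" unfolding S_def using finite_eigenvalues by (intro finite_SigmaI) auto
  define f where "f p = q_series (wd c) (eigenvalue_exponent (fst p)) (a (fst p) (snd p))" for p
  have "\<forall>p\<in>S. \<exists>B. B \<ge> 0 \<and> (\<forall>\<tau>. Y0 \<le> Im \<tau> \<longrightarrow> Im \<tau> powr (of_int k / 2 + real (M + L)) * norm (f p \<tau>) \<le> B * Im \<tau> powr e)"
  proof
    fix p assume "p \<in> S"
    then show "\<exists>B. B \<ge> 0 \<and> (\<forall>\<tau>. Y0 \<le> Im \<tau> \<longrightarrow> Im \<tau> powr (of_int k / 2 + real (M + L)) * norm (f p \<tau>) \<le> B * Im \<tau> powr e)"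
      unfolding f_def by (intro q) (auto simp: S_def T_def)
  qed
  from bchoice[OF this] obtain B where B: "\<forall>p\<in>S. B p \<ge> 0 \<and> (\<forall>\<tau>. Y0 \<le> Im \<tau> \<longrightarrow> Im \<tau> powr (of_int k / 2 + real (M + L)) * norm (f p \<tau>) \<le> B p * Im \<tau> powr e)" by (rule exE)
  define D where "D = 2 * pi * (1 / wd c + 1 / Y0) + 1 / Y0"
  have w: "wd c > 0" by (rule wd_pos[OF c])
  have D0: "D \<ge> 0" unfolding D_def using w Y0 by simp
  define Z where "Z = K0 * (1 + 1 / Y0) ^ M * D ^ L"
  have Z0: "Z \<ge> 0" unfolding Z_def using K0 Y0 D0 by simp
  have "weighted k X (Some c) g \<le> (Z * (\<Sum>p\<in>S. B p)) * ht c g powr e" if g: "g \<in> piece (Some c)" for g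
  proof -
    define \<tau> where "\<tau> = pt (adj2 (cusp_matrix c) ** g)"
    note ws = weighted_slash[OF c g \<tau>_def]
    define y where "y = Im \<tau>"
    have y: "y > 0" "Y0 \<le> y" using ws(1) Y0 by (simp_all add: y_def)
    have "slash k (cusp_matrix c) X \<tau> = (\<Sum>l | eigenvalue T l. \<Sum>j<eigenvalue_multiplicity T l.
             log_q (wd c) \<tau> ^ j *s f (l, j) \<tau>)"
      using fe y unfolding fourier_expansion_def Let_def T_def f_def y_def by simp
    also have "\<dots> = (\<Sum>(l,j)\<in>S. log_q (wd c) \<tau> ^ j *s f (l, j) \<tau>)"
      unfolding S_def by (rule sum.Sigma) (use finite_eigenvalues in auto)
    finally have sl: "slash k (cusp_matrix c) X \<tau> = (\<Sum>p\<in>S. log_q (wd c) \<tau> ^ snd p *s f p \<tau>)"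
      by (simp add: case_prod_unfold)
    have "norm (slash k (cusp_matrix c) X \<tau>) \<le> (\<Sum>p\<in>S. (D * y) ^ L * norm (f p \<tau>))"
      unfolding sl
    proof (rule sum_norm_le)
      fix p assume "p \<in> S"
      then have "snd p < eigenvalue_multiplicity T (fst p)" "eigenvalue T (fst p)" by (auto simp: S_def)
      then have "snd p \<le> L" using L[of "fst p"] by (simp add: T_def)
      from log_q_bound[OF c ws(1-3) this] show "norm (log_q (wd c) \<tau> ^ snd p *s f p \<tau>) \<le> (D * y) ^ L * norm (f p \<tau>)"
        unfolding norm_smult_vec D_def y_def by (rule mult_right_mono) simp
    qed
    also have "\<dots> = D ^ L * (y ^ L * (\<Sum>p\<in>S. norm (f p \<tau>)))"
      by (simp add: power_mult_distrib sum_distrib_left mult.assoc)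
    finally have n: "norm (slash k (cusp_matrix c) X \<tau>) \<le> D ^ L * (y ^ L * (\<Sum>p\<in>S. norm (f p \<tau>)))" .
    have "1 + y \<le> (1 + 1 / Y0) * y" using y Y0 by (simp add: distrib_right)
    then have "(1 + y) ^ M \<le> ((1 + 1 / Y0) * y) ^ M" using y by (intro power_mono) auto
    then have m: "(1 + y) ^ M \<le> (1 + 1 / Y0) ^ M * y ^ M" by (simp only: power_mult_distrib)
    have S0: "0 \<le> (\<Sum>p\<in>S. norm (f p \<tau>))" by (rule sum_nonneg) simp
    have "weighted k X (Some c) g \<le> y powr (of_int k / 2) * (K0 * (1 + y) ^ M * norm (slash k (cusp_matrix c) X \<tau>))"
      unfolding y_def by (rule ws(5))
    also have "\<dots> \<le> y powr (of_int k / 2) * (K0 * ((1 + 1 / Y0) ^ M * y ^ M) * (D ^ L * (y ^ L * (\<Sum>p\<in>S. norm (f p \<tau>)))))"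
      using K0 Y0 y m n by (intro mult_left_mono mult_mono) auto
    also have "\<dots> = Z * ((y powr (of_int k / 2) * (y ^ M * y ^ L)) * (\<Sum>p\<in>S. norm (f p \<tau>)))"
      by (simp add: Z_def mult_ac)
    also have "y ^ M * y ^ L = y powr real (M + L)" using y by (simp add: powr_realpow[symmetric] powr_add)
    also have "y powr (of_int k / 2) * y powr real (M + L) = y powr (of_int k / 2 + real (M + L))" by (simp only: powr_add)
    also have "y powr (of_int k / 2 + real (M + L)) * (\<Sum>p\<in>S. norm (f p \<tau>)) = (\<Sum>p\<in>S. y powr (of_int k / 2 + real (M + L)) * norm (f p \<tau>))"
      by (rule sum_distrib_left)
    also have "Z * \<dots> \<le> Z * (\<Sum>p\<in>S. B p * y powr e)"
      by (intro mult_left_mono sum_mono Z0) (use B y(2) in \<open>auto simp: y_def\<close>)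
    also have "\<dots> = (Z * (\<Sum>p\<in>S. B p)) * y powr e" by (simp add: sum_distrib_right)
    finally show ?thesis unfolding y_def ws(4) .
  qed
  then show ?thesis by blast
qed

text \<open>The q-series are merely bounded above height Y0, so the whole collected exponent
  remains.\<close>

lemma weighted_automorphic:
  assumes X: "automorphic_form G \<rho> k X" and c: "c \<in> C"
    and L: "\<And>l. eigenvalue (\<rho> (cusp_generator G c)) l \<Longrightarrow> eigenvalue_multiplicity (\<rho> (cusp_generator G c)) l \<le> L"
  shows "\<exists>B. \<forall>g\<in>piece (Some c). weighted k X (Some c) g \<le> B * ht c g powr (of_int k / 2 + real (M + L))"
proof -
  obtain a where a: "fourier_expansion G \<rho> k c X a" using X cusps[OF c] unfolding automorphic_form_def by blast
  show ?thesis
  proof (rule weighted_cusp_bound[OF c a L])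
    fix l j assume l: "eigenvalue (\<rho> (cusp_generator G c)) l" "j < eigenvalue_multiplicity (\<rho> (cusp_generator G c)) l"
    have "summable (\<lambda>n. q_power (wd c) (real n + eigenvalue_exponent l) (Complex 0 (Y0/2)) *s a l j n)"
      using a l Y0 unfolding fourier_expansion_def Let_def by simp
    from q_series_bounded[OF wd_pos[OF c] eigenvalue_exponent(1)[OF cusp_eigenvalue[OF cusps[OF c] l(1)]] Y0 this]
    obtain B where B: "B \<ge> 0" "\<forall>\<tau>. Y0 \<le> Im \<tau> \<longrightarrow> norm (q_series (wd c) (eigenvalue_exponent l) (a l j) \<tau>) \<le> B" by (elim exE conjE)
    have "Im \<tau> powr (of_int k / 2 + real (M + L)) * norm (q_series (wd c) (eigenvalue_exponent l) (a l j) \<tau>) \<le> B * Im \<tau> powr (of_int k / 2 + real (M + L))"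
      if "Y0 \<le> Im \<tau>" for \<tau>
      unfolding mult.commute[of B] using B(2) that by (intro mult_left_mono) auto
    then show "\<exists>B\<ge>0. \<forall>\<tau>. Y0 \<le> Im \<tau> \<longrightarrow>
        Im \<tau> powr (of_int k / 2 + real (M + L)) * norm (q_series (wd c) (eigenvalue_exponent l) (a l j) \<tau>) \<le> B * Im \<tau> powr (of_int k / 2 + real (M + L))"
      using B(1) by blast
  qed
qed

text \<open>Exponential decay absorbs every power of the height, which leaves exponent 0.\<close>

lemma weighted_cuspidal:
  assumes X: "cusp_form G \<rho> k X" and c: "c \<in> C"
    and L: "\<And>l. eigenvalue (\<rho> (cusp_generator G c)) l \<Longrightarrow> eigenvalue_multiplicity (\<rho> (cusp_generator G c)) l \<le> L"
  shows "\<exists>B. \<forall>g\<in>piece (Some c). weighted k X (Some c) g \<le> B * ht c g powr 0"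
proof -
  obtain a where a: "fourier_expansion G \<rho> k c X a" "cuspidal_expansion G \<rho> c a" using X cusps[OF c] unfolding cusp_form_def by blast
  show ?thesis
  proof (rule weighted_cusp_bound[OF c a(1) L])
    fix l j assume l: "eigenvalue (\<rho> (cusp_generator G c)) l" "j < eigenvalue_multiplicity (\<rho> (cusp_generator G c)) l"
    define f where "f = q_series (wd c) (eigenvalue_exponent l) (a l j)"
    define r where "r = of_int k / 2 + real (M + L)"
    have "summable (\<lambda>n. q_power (wd c) (real n + eigenvalue_exponent l) (Complex 0 (Y0/2)) *s a l j n)"
      using a(1) l Y0 unfolding fourier_expansion_def Let_def by simp
    from q_series_bounded[OF wd_pos[OF c] eigenvalue_exponent(1)[OF cusp_eigenvalue[OF cusps[OF c] l(1)]] Y0 this]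
    obtain B where B: "B \<ge> 0" "\<forall>\<tau>. Y0 \<le> Im \<tau> \<longrightarrow> norm (f \<tau>) \<le> B" unfolding f_def by (elim exE conjE)
    have "exponential_decay f" using a(2) l unfolding cuspidal_expansion_def Let_def f_def by blast
    from exponential_decay_uniform[OF this B] obtain \<epsilon> K where K: "\<epsilon> > 0" "K \<ge> 0" "\<forall>\<tau>. Y0 \<le> Im \<tau> \<longrightarrow> norm (f \<tau>) \<le> K * exp (- \<epsilon> * Im \<tau>)"
      by (elim exE conjE)
    obtain B' where B': "B' \<ge> 0" "\<forall>y\<ge>Y0. y powr r * exp (- \<epsilon> * y) \<le> B'" using powr_exp_bounded[OF K(1) Y0, of r] by (elim exE conjE)
    have "Im \<tau> powr r * norm (f \<tau>) \<le> (K * B') * Im \<tau> powr 0" if t: "Y0 \<le> Im \<tau>" for \<tau>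
    proof -
      have "Im \<tau> powr r * norm (f \<tau>) \<le> Im \<tau> powr r * (K * exp (- \<epsilon> * Im \<tau>))" using K(3) t by (intro mult_left_mono) auto
      also have "\<dots> = K * (Im \<tau> powr r * exp (- \<epsilon> * Im \<tau>))" by (simp only: mult_ac)
      also have "\<dots> \<le> K * B'" using B'(2) t K(2) by (intro mult_left_mono) auto
      finally show ?thesis using t Y0 by simp
    qed
    moreover have "K * B' \<ge> 0" using K(2) B'(1) by simp
    ultimately show "\<exists>B\<ge>0. \<forall>\<tau>. Y0 \<le> Im \<tau> \<longrightarrow>
        Im \<tau> powr (of_int k / 2 + real (M + L)) * norm (q_series (wd c) (eigenvalue_exponent l) (a l j) \<tau>) \<le> B * Im \<tau> powr 0"
      unfolding f_def r_def by blast
  qed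
qed

lemma multiplicity_bounded:
  "\<exists>L. \<forall>c\<in>C. \<forall>l. eigenvalue (\<rho> (cusp_generator G c)) l \<longrightarrow> eigenvalue_multiplicity (\<rho> (cusp_generator G c)) l \<le> L"
proof -
  have "finite (\<Union>c\<in>C. eigenvalue_multiplicity (\<rho> (cusp_generator G c)) ` {l. eigenvalue (\<rho> (cusp_generator G c)) l})"
    using finC finite_eigenvalues by (intro finite_UN_I finite_imageI)
  then obtain L where "\<forall>n\<in>(\<Union>c\<in>C. eigenvalue_multiplicity (\<rho> (cusp_generator G c)) ` {l. eigenvalue (\<rho> (cusp_generator G c)) l}). n \<le> L"
    unfolding finite_nat_set_iff_bounded_le by (rule exE)
  then show ?thesis by (intro exI[of _ L]) auto
qed

text \<open>The term k/2 comes from returning to the slashed form at height y, and \<beta> from the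
  comparison of norms. The reduced height lies between Y0 and H/y, so its power e contributes y^(-e)
  for positive e and a constant otherwise, hence the maximum.\<close>

lemma weighted_strip_bound:
  assumes wk: "weakly_automorphic G \<rho> k X"
    and b: "\<forall>c0 Rx. \<exists>K\<ge>0. \<forall>x y \<gamma> i v. \<bar>x\<bar> \<le> Rx \<longrightarrow> 0 < y \<longrightarrow> y \<le> 1 \<longrightarrow> \<gamma> \<in> \<Gamma> \<longrightarrow> i \<in> I \<longrightarrow>
       \<gamma> ** (cusp_matrix c0 ** up x y) \<in> piece i \<longrightarrow>
       norm v \<le> K * y powr (- \<beta>) * wt i (\<gamma> ** (cusp_matrix c0 ** up x y)) (rv \<gamma> v)"
    and e: "\<forall>c\<in>C. \<exists>B. \<forall>g\<in>piece (Some c). weighted k X (Some c) g \<le> B * ht c g powr e"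
  shows "strip_bound (of_int k / 2 + \<beta> + max 0 e) (slash k (cusp_matrix c0) X)"
proof (rule strip_boundI)
  fix Rx :: real
  define A where "A = cusp_matrix c0"
  have A: "A \<in> SL2" by (simp add: A_def)
  obtain K where K: "K \<ge> 0" "\<forall>x y \<gamma> i v. \<bar>x\<bar> \<le> Rx \<longrightarrow> 0 < y \<longrightarrow> y \<le> 1 \<longrightarrow> \<gamma> \<in> \<Gamma> \<longrightarrow> i \<in> I \<longrightarrow>
       \<gamma> ** (A ** up x y) \<in> piece i \<longrightarrow> norm v \<le> K * y powr (- \<beta>) * wt i (\<gamma> ** (A ** up x y)) (rv \<gamma> v)"
    using b[rule_format, of Rx c0] unfolding A_def by (elim exE conjE)
  obtain H where H: "H > 0" "\<forall>x y. \<forall>\<gamma>\<in>\<Gamma>. \<forall>c\<in>C. \<bar>x\<bar> \<le> Rx \<longrightarrow> 0 < y \<longrightarrow> y \<le> 1 \<longrightarrow> ht c (\<gamma> ** (A ** up x y)) \<le> H / y"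
    using strip_height[of Rx c0] unfolding A_def by (elim exE conjE)
  obtain B0 where B0: "\<forall>g\<in>piece None. weighted k X None g \<le> B0" using weighted_compact_bounded[OF wk] by (rule exE)
  from bchoice[OF e] obtain B where B: "\<forall>c\<in>C. \<forall>g\<in>piece (Some c). weighted k X (Some c) g \<le> B c * ht c g powr e" by (rule exE)
  define Q where "Q = 1 + H powr e + Y0 powr e"
  have Q1: "Q \<ge> 1" by (simp add: Q_def)
  define B1 where "B1 = (\<bar>B0\<bar> + (\<Sum>c\<in>C. \<bar>B c\<bar>)) * Q"
  have sB: "(\<Sum>c\<in>C. \<bar>B c\<bar>) \<ge> 0" by (rule sum_nonneg) simp
  have B1: "B1 \<ge> 0" unfolding B1_def using sB Q1 by simp
  define e' where "e' = max 0 e"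
  have W1: "weighted k X i (\<gamma> ** (A ** up x y)) \<le> B1 * y powr (- e')"
    if x: "\<bar>x\<bar> \<le> Rx" "0 < y" "y \<le> 1" and g: "\<gamma> \<in> \<Gamma>" and i: "i \<in> I" and p: "\<gamma> ** (A ** up x y) \<in> piece i" for x y \<gamma> i
  proof -
    have y1: "1 \<le> y powr (- e')"
      using powr_mono'[of "- e'" 0 y] x by (simp add: e'_def)
    show ?thesis using i
    proof (rule I_cases)
      assume n: "i = None"
      have "weighted k X None (\<gamma> ** (A ** up x y)) \<le> \<bar>B0\<bar> * 1" using B0 p n by force
      also have "\<dots> \<le> B1 * y powr (- e')"
      proof (rule mult_mono[OF _ y1])
        have "\<bar>B0\<bar> * 1 \<le> (\<bar>B0\<bar> + (\<Sum>c\<in>C. \<bar>B c\<bar>)) * Q" using sB Q1 by (intro mult_mono) auto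
        then show "\<bar>B0\<bar> \<le> B1" by (simp add: B1_def)
      qed (use B1 in auto)
      finally show ?thesis by (simp add: n)
    next
      fix c assume c: "i = Some c" "c \<in> C"
      define t where "t = ht c (\<gamma> ** (A ** up x y))"
      have t: "t > 0" "Y0 \<le> t" "t \<le> H / y" using p c Y0 H(2) g x by (auto simp: t_def)
      have te: "t powr e \<le> Q * y powr (- e')"
      proof (cases "e \<ge> 0")
        case True
        have "t powr e \<le> (H / y) powr e" using t True by (intro powr_mono2) auto
        also have "\<dots> = H powr e * y powr (- e)" using H(1) x by (simp add: powr_divide powr_minus_divide)
        also have "\<dots> \<le> Q * y powr (- e)" by (intro mult_right_mono) (auto simp: Q_def)
        finally show ?thesis using True by (simp add: e'_def max_def)
      next
        case False
        have "t powr e \<le> Y0 powr e" using t Y0 False by (intro powr_mono2') auto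
        also have "\<dots> \<le> Q * 1" by (simp add: Q_def)
        also have "\<dots> \<le> Q * y powr (- e')" using y1 Q1 by (intro mult_left_mono) auto
        finally show ?thesis .
      qed
      have "weighted k X (Some c) (\<gamma> ** (A ** up x y)) \<le> B c * t powr e" unfolding t_def using B c p by blast
      also have "\<dots> \<le> \<bar>B c\<bar> * t powr e" by (intro mult_right_mono) auto
      also have "\<dots> \<le> \<bar>B c\<bar> * (Q * y powr (- e'))" using te by (intro mult_left_mono) auto
      also have "\<dots> \<le> (\<bar>B0\<bar> + (\<Sum>c\<in>C. \<bar>B c\<bar>)) * (Q * y powr (- e'))"
      proof (rule mult_right_mono)
        have "\<bar>B c\<bar> \<le> (\<Sum>c\<in>C. \<bar>B c\<bar>)" by (rule member_le_sum[OF c(2)]) (use finC in auto)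
        then show "\<bar>B c\<bar> \<le> \<bar>B0\<bar> + (\<Sum>c\<in>C. \<bar>B c\<bar>)" by simp
      qed (use Q1 in simp)
      finally show ?thesis by (simp add: c(1) B1_def mult.assoc)
    qed
  qed
  have "norm (slash k A X \<tau>) \<le> (K * B1) * Im \<tau> powr (- (of_int k / 2 + \<beta> + e'))"
    if t: "\<bar>Re \<tau>\<bar> \<le> Rx" "0 < Im \<tau>" "Im \<tau> \<le> 1" for \<tau>
  proof -
    define x where "x = Re \<tau>"
    define y where "y = Im \<tau>"
    have y: "0 < y" "y \<le> 1" "\<bar>x\<bar> \<le> Rx" using t by (simp_all add: x_def y_def)
    define P where "P = A ** up x y"
    have P: "P \<in> SL2" unfolding P_def using A y by simp
    have ptP: "pt P = mobius A \<tau>" unfolding P_def using A y by (simp add: pt_mult pt_up) (simp add: x_def y_def)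
    obtain \<gamma> i where g: "\<gamma> \<in> \<Gamma>" "i \<in> I" "\<gamma> ** P \<in> piece i" using piece_cover[OF P] by blast
    have S: "\<gamma> \<in> SL2" by (rule sub[OF g(1)])
    have p0: "Im (pt P) > 0" by (rule Im_pt_pos[OF P])
    have ptg: "pt (\<gamma> ** P) = mobius \<gamma> (pt P)" by (rule pt_mult[OF S P])
    have g0: "Im (pt (\<gamma> ** P)) > 0" by (rule Im_pt_pos) (use S P in simp)
    have "norm (X (pt P)) \<le> K * y powr (- \<beta>) * wt i (\<gamma> ** P) (rv \<gamma> (X (pt P)))"
      unfolding P_def using K(2) y g unfolding P_def by blast
    also have "\<dots> \<le> K * y powr (- \<beta>) * ((Im (pt (\<gamma> ** P)) / Im (pt P)) powr (of_int k / 2) * wt i (\<gamma> ** P) (X (pt (\<gamma> ** P))))"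
    proof (rule mult_left_mono)
      have "wt i (\<gamma> ** P) (rv \<gamma> (X (pt P))) \<le> cmod (automorphy \<gamma> (pt P) powi (- k)) * wt i (\<gamma> ** P) (X (pt (\<gamma> ** P)))"
        unfolding slash_rv[OF wk g(1) p0] ptg[symmetric] by (rule wt_smult[OF g(2,3)])
      also have "cmod (automorphy \<gamma> (pt P) powi (- k)) = (Im (pt (\<gamma> ** P)) / Im (pt P)) powr (of_int k / 2)"
        unfolding automorphy_powi_cmod[OF S p0] ptg by simp
      finally show "wt i (\<gamma> ** P) (rv \<gamma> (X (pt P))) \<le> (Im (pt (\<gamma> ** P)) / Im (pt P)) powr (of_int k / 2) * wt i (\<gamma> ** P) (X (pt (\<gamma> ** P)))" .
    qed (use K(1) in simp)
    also have "\<dots> = K * y powr (- \<beta>) * (weighted k X i (\<gamma> ** P) / Im (pt P) powr (of_int k / 2))"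
      using p0 g0 by (simp add: weighted_def powr_divide)
    also have "\<dots> \<le> K * y powr (- \<beta>) * ((B1 * y powr (- e')) / Im (pt P) powr (of_int k / 2))"
      using W1[OF y(3,1,2) g(1,2)] g(3) K(1) unfolding P_def by (intro mult_left_mono divide_right_mono) auto
    finally have n: "norm (X (pt P)) \<le> K * y powr (- \<beta>) * ((B1 * y powr (- e')) / Im (pt P) powr (of_int k / 2))" .
    have "norm (slash k A X \<tau>) = cmod (automorphy A \<tau> powi (- k)) * norm (X (pt P))"
      unfolding slash_def norm_smult_vec ptP ..
    also have "cmod (automorphy A \<tau> powi (- k)) = (Im (pt P) / y) powr (of_int k / 2)"
      unfolding automorphy_powi_cmod[OF A t(2)] ptP y_def by simp
    also have "(Im (pt P) / y) powr (of_int k / 2) * norm (X (pt P)) \<le>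
        (Im (pt P) / y) powr (of_int k / 2) * (K * y powr (- \<beta>) * ((B1 * y powr (- e')) / Im (pt P) powr (of_int k / 2)))"
      by (rule mult_left_mono[OF n]) simp
    also have "\<dots> = (K * B1) * (y powr (- (of_int k / 2)) * y powr (- \<beta>) * y powr (- e'))"
      using p0 y(1) by (simp add: powr_divide powr_minus_divide field_simps)
    also have "y powr (- (of_int k / 2)) * y powr (- \<beta>) * y powr (- e') = y powr (- (of_int k / 2 + \<beta> + e'))"
      by (simp add: powr_add[symmetric])
    finally show ?thesis unfolding y_def .
  qed
  then have "\<forall>\<tau>. \<bar>Re \<tau>\<bar> \<le> Rx \<longrightarrow> 0 < Im \<tau> \<longrightarrow> Im \<tau> \<le> 1 \<longrightarrow> norm (slash k A X \<tau>) \<le> (K * B1) * Im \<tau> powr (- (of_int k / 2 + \<beta> + e'))" by blast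
  moreover have "K * B1 \<ge> 0" using K(1) B1 by simp
  ultimately show "\<exists>B\<ge>0. \<forall>\<tau>. \<bar>Re \<tau>\<bar> \<le> Rx \<longrightarrow> 0 < Im \<tau> \<longrightarrow> Im \<tau> \<le> 1 \<longrightarrow>
      norm (slash k (cusp_matrix c0) X \<tau>) \<le> B * Im \<tau> powr (- (of_int k / 2 + \<beta> + max 0 e))"
    unfolding A_def e'_def by blast
qed

lemma coefficient_growth:
  "\<exists>\<alpha>::real. \<forall>c. is_cusp G c \<longrightarrow>
    (\<forall>(k::int) (X :: complex \<Rightarrow> complex^'m). even k \<and> automorphic_form G \<rho> k X \<longrightarrow>
       fourier_coefficients_bigo G \<rho> k c X (of_int k + 2 * \<alpha>)) \<and>
    (\<forall>(k::int) (X :: complex \<Rightarrow> complex^'m). even k \<and> cusp_form G \<rho> k X \<longrightarrow>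
       fourier_coefficients_bigo G \<rho> k c X (of_int k / 2 + \<alpha>)) \<and>
    (\<forall>(k::int) (X :: complex \<Rightarrow> complex^'m). even k \<and> automorphic_form G \<rho> k X \<and>
       of_int k + 2 * \<alpha> < 0 \<longrightarrow> (\<forall>\<tau>\<in>upper_half_plane. X \<tau> = 0))"
proof -
  obtain \<beta> where b0: "\<beta> \<ge> 0" and b: "\<forall>c0 Rx. \<exists>K\<ge>0. \<forall>x y \<gamma> i v. \<bar>x\<bar> \<le> Rx \<longrightarrow> 0 < y \<longrightarrow> y \<le> 1 \<longrightarrow> \<gamma> \<in> \<Gamma> \<longrightarrow> i \<in> I \<longrightarrow>
       \<gamma> ** (cusp_matrix c0 ** up x y) \<in> piece i \<longrightarrow>
       norm v \<le> K * y powr (- \<beta>) * wt i (\<gamma> ** (cusp_matrix c0 ** up x y)) (rv \<gamma> v)"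
    using strip_comparison by (elim exE conjE)
  obtain L where L: "\<forall>c\<in>C. \<forall>l. eigenvalue (\<rho> (cusp_generator G c)) l \<longrightarrow> eigenvalue_multiplicity (\<rho> (cusp_generator G c)) l \<le> L"
    using multiplicity_bounded by (rule exE)
  define N where "N = real (M + L)"
  have N0: "N \<ge> 0" by (simp add: N_def)
  define s where "s k = of_int k / 2 + \<beta> + max 0 (of_int k / 2 + N)" for k
  have au: "strip_bound (s k) (slash k (cusp_matrix c) X)" if X: "automorphic_form G \<rho> k X" for c k X
    unfolding s_def
  proof (rule weighted_strip_bound[OF _ b])
    show "weakly_automorphic G \<rho> k X" using X by (simp add: automorphic_form_def)
    show "\<forall>c\<in>C. \<exists>B. \<forall>g\<in>piece (Some c). weighted k X (Some c) g \<le> B * ht c g powr (of_int k / 2 + N)"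
      unfolding N_def using weighted_automorphic[OF X] L by blast
  qed
  have zero: "X \<tau> = 0" if X: "automorphic_form G \<rho> k X" and s: "s k < 0" and c: "is_cusp G c" and t: "Im \<tau> > 0" for X k c \<tau>
  proof -
    obtain a where a: "fourier_expansion G \<rho> k c X a" using X c unfolding automorphic_form_def by blast
    show ?thesis by (rule strip_bound_imp_zero[OF c au[OF X] s a t])
  qed
  have cu: "strip_bound (of_int k / 2 + (\<beta> + N)) (slash k (cusp_matrix c) X)" if X: "cusp_form G \<rho> k X" for c k X
  proof -
    have "strip_bound (of_int k / 2 + \<beta> + max 0 0) (slash k (cusp_matrix c) X)"
    proof (rule weighted_strip_bound[OF _ b])
      show "weakly_automorphic G \<rho> k X" using X by (simp add: automorphic_form_def cusp_form_def)
      show "\<forall>c\<in>C. \<exists>B. \<forall>g\<in>piece (Some c). weighted k X (Some c) g \<le> B * ht c g powr 0"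
        using weighted_cuspidal[OF X] L by blast
    qed
    then show ?thesis by (rule strip_bound_mono) (use N0 in simp)
  qed
  \<comment> \<open>If \<open>s k\<close> is negative the form vanishes. Otherwise the exponent is k
    + \<beta> + N when k/2 + N is nonnegative, and else it is k/2 + \<beta>, which is nonnegative
    and so at most its double.\<close>
  have au2: "strip_bound (of_int k + 2 * (\<beta> + N)) (slash k (cusp_matrix c) X)" if X: "automorphic_form G \<rho> k X" and c: "is_cusp G c" for c k X
  proof (cases "s k < 0")
    case True
    have "slash k (cusp_matrix c) X \<tau> = 0" if "Im \<tau> > 0" for \<tau>
      unfolding slash_def using zero[OF X True c Im_mobius_pos[OF cusp_matrix_SL2 that]] by simp
    then show ?thesis by (intro strip_bound_cong[OF _ strip_bound_zero]) simp
  next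
    case False
    have "s k \<le> of_int k + 2 * (\<beta> + N)"
      using False b0 N0 unfolding s_def by (auto simp: max_def split: if_splits)
    then show ?thesis using au[OF X] by (rule strip_bound_mono[rotated])
  qed
  \<comment> \<open>Here k/2 + \<beta> + N < 0, so the maximum in \<open>s k\<close> is 0 and
    \<open>s k\<close> is k/2 + \<beta> < 0.\<close>
  have neg: "s k < 0" if "of_int k + 2 * (\<beta> + N) < 0" for k
    using that b0 N0 unfolding s_def by (auto simp: max_def)
  show ?thesis
  proof (rule exI[of _ "\<beta> + N"], intro allI impI conjI ballI)
    fix c k X assume c: "is_cusp G c"
    show "fourier_coefficients_bigo G \<rho> k c X (of_int k + 2 * (\<beta> + N))" if "even k \<and> automorphic_form G \<rho> k X"
      using that by (intro strip_bound_imp_bigo[OF c] au2 c) simp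
    show "fourier_coefficients_bigo G \<rho> k c X (of_int k / 2 + (\<beta> + N))" if "even k \<and> cusp_form G \<rho> k X"
      using that by (intro strip_bound_imp_bigo[OF c] cu) simp
    show "X \<tau> = 0" if "even k \<and> automorphic_form G \<rho> k X \<and> of_int k + 2 * (\<beta> + N) < 0" "\<tau> \<in> upper_half_plane" for \<tau>
      using zero[OF _ neg c, of k X \<tau>] that by simp
  qed
qed

end

lemma (in fuchsian_rep) cusp_system_exists: "\<exists>R0 Y0 K0 M C. cusp_system G \<rho> R0 Y0 K0 M C"
proof -
  from cover obtain R Y C where C: "R > 0" "Y > 0" "finite C" "\<forall>c\<in>C. is_cusp G c"
    "\<forall>c\<in>C. \<forall>c'\<in>C. cusp_equiv \<Gamma> c c' \<longrightarrow> c = c'"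
    "\<forall>g\<in>SL2. \<exists>\<sigma>\<in>\<Gamma>. norm (\<sigma> ** g) \<le> R \<or>
       (\<exists>c\<in>C. Y \<le> ht c (\<sigma> ** g) \<and> 0 \<le> xc c (\<sigma> ** g) \<and> xc c (\<sigma> ** g) \<le> cusp_width G c)"
    by (elim exE conjE)
  have "\<forall>c\<in>C. \<exists>K M. K \<ge> 0 \<and> (\<forall>n::int. \<forall>v. norm (rv (trans c (of_int n * cusp_width G c)) v) \<le> K * (1 + \<bar>of_int n\<bar>) ^ M * norm v)"
    using C(4) rv_trans_growth by blast
  from bchoice[OF this] obtain K where
    "\<forall>c\<in>C. \<exists>M. K c \<ge> 0 \<and> (\<forall>n::int. \<forall>v. norm (rv (trans c (of_int n * cusp_width G c)) v) \<le> K c * (1 + \<bar>of_int n\<bar>) ^ M * norm v)" by (rule exE)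
  from bchoice[OF this] obtain M where
    KM: "\<forall>c\<in>C. K c \<ge> 0 \<and> (\<forall>n::int. \<forall>v. norm (rv (trans c (of_int n * cusp_width G c)) v) \<le> K c * (1 + \<bar>of_int n\<bar>) ^ M c * norm v)" by (rule exE)
  have K0: "(\<Sum>c\<in>C. K c) \<ge> 0" by (rule sum_nonneg) (use KM in blast)
  have pw: "norm (rv (trans c (of_int n * cusp_width G c)) v) \<le> (\<Sum>c\<in>C. K c) * (1 + \<bar>of_int n\<bar>) ^ (\<Sum>c\<in>C. M c) * norm v"
    if c: "c \<in> C" for c n v
  proof -
    have "K c \<le> (\<Sum>c\<in>C. K c)" by (rule member_le_sum[OF c]) (use KM C(3) in auto)
    moreover have "M c \<le> (\<Sum>c\<in>C. M c)" by (rule member_le_sum[OF c]) (use C(3) in auto)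
    ultimately have "K c * (1 + \<bar>of_int n\<bar>) ^ M c * norm v \<le> (\<Sum>c\<in>C. K c) * (1 + \<bar>of_int n\<bar>) ^ (\<Sum>c\<in>C. M c) * norm v"
      using K0 by (intro mult_right_mono mult_mono power_increasing) auto
    moreover have "norm (rv (trans c (of_int n * cusp_width G c)) v) \<le> K c * (1 + \<bar>of_int n\<bar>) ^ M c * norm v" using KM c by blast
    ultimately show ?thesis by (rule order_trans[rotated])
  qed
  have "cusp_system G \<rho> R Y (\<Sum>c\<in>C. K c) (\<Sum>c\<in>C. M c) C"
    by unfold_locales (use C K0 pw in \<open>blast+\<close>)
  then show ?thesis by (intro exI)
qed

theorem theorem1p1:
  fixes G :: "(real^2^2) set set"
    and \<rho> :: "(real^2^2) set \<Rightarrow> complex^'m^'m"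
  assumes "fuchsian_first_kind G"
    and "group_representation G \<rho>"
    and "\<And>\<gamma> l. \<gamma> \<in> G \<Longrightarrow> parabolic \<gamma> \<Longrightarrow> eigenvalue (\<rho> \<gamma>) l \<Longrightarrow> cmod l = 1"
  shows "\<exists>\<alpha>::real. \<forall>c. is_cusp G c \<longrightarrow>
    (\<forall>(k::int) (X :: complex \<Rightarrow> complex^'m). even k \<and> automorphic_form G \<rho> k X \<longrightarrow>
       fourier_coefficients_bigo G \<rho> k c X (of_int k + 2 * \<alpha>)) \<and>
    (\<forall>(k::int) (X :: complex \<Rightarrow> complex^'m). even k \<and> cusp_form G \<rho> k X \<longrightarrow>
       fourier_coefficients_bigo G \<rho> k c X (of_int k / 2 + \<alpha>)) \<and>
    (\<forall>(k::int) (X :: complex \<Rightarrow> complex^'m). even k \<and> automorphic_form G \<rho> k X \<and>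
       of_int k + 2 * \<alpha> < 0 \<longrightarrow> (\<forall>\<tau>\<in>upper_half_plane. X \<tau> = 0))"
proof -
  interpret fuchsian_rep G \<rho> by unfold_locales (fact assms)+
  from cusp_system_exists obtain R0 Y0 K0 M C where "cusp_system G \<rho> R0 Y0 K0 M C" by (elim exE)
  then show ?thesis by (rule cusp_system.coefficient_growth)
qed

end
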